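(* Let $d\ge 1$, let $X=(X_k)_{k\in\mathbb{Z}}$ be a $d$-dimensional centered stationary Gaussian process with $X_1\sim N_d(0,I_d)$, let $f:\mathbb{R}^d\to\mathbb{R}$ be measurable with $\mathbb{E}[f(X_1)]=0$, $\mathbb{E}[f^2(X_1)]<\infty$ and Hermite rank $q\ge 1$, and suppose that $\sum_{j\in\mathbb{Z}}|r^{(i,l)}(j)|^q<\infty$ for all $i,l\in\{1,\dots,d\}$. Let $S_n=n^{-1/2}\sum_{k=1}^n f(X_k)$ for $n\ge1$, and let $S\sim N(0,\sigma^2)$ with $\sigma^2=\mathrm{Var}[f(X_1)]+2\sum_{k=1}^\infty\mathrm{Cov}[f(X_1),f(X_{1+k})]\in[0,\infty)$. Then the convergence of $S_n$ to $S$ takes place with respect to the three distances $d_{Kol}$, $d_W$ and $d_C$ (for all $C>0$), namely $$\lim_{n\to\infty}d_{Kol}(S_n,S)=\lim_{n\to\infty}d_W(S_n,S)=\lim_{n\to\infty}d_C(S_n,S)=0.$$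
   Context: Write $X_k=(X_k^{(1)},\dots,X_k^{(d)})$ and $r^{(i,l)}(j)=\mathbb{E}[X_1^{(i)}X_{1+j}^{(l)}]$. Hermite polynomials: $H_0=1$, $H_j(x)=xH_{j-1}(x)-H_{j-1}'(x)$ for $j\ge1$. For a multi-index $\alpha=(\alpha_1,\dots,\alpha_d)$ of nonnegative integers, $|\alpha|=\sum_i\alpha_i$, $\alpha!=\prod_i\alpha_i!$, $a_\alpha=(\alpha!)^{-1}\mathbb{E}[f(X_1)\prod_{i=1}^dH_{\alpha_i}(X_1^{(i)})]$. The function $f$ (with $\mathbb{E}[f(X_1)]=0$) has Hermite rank $q\ge1$ if $a_\alpha=0$ for all $|\alpha|<q$ and $a_\alpha\neq0$ for some $|\alpha|=q$. Distances between laws of real random variables $U,V$: $d_{Kol}(U,V)=\sup_{z\in\mathbb{R}}|\mathbb{P}(U\le z)-\mathbb{P}(V\le z)|$; $d_W(U,V)=\sup|\mathbb{E}[g(U)]-\mathbb{E}[g(V)]|$ over all Lipschitz $g:\mathbb{R}\to\mathbb{R}$ with Lipschitz constant $\le1$ (for integrable $U,V$); $d_C(U,V)=\sup|\mathbb{E}[g(U)]-\mathbb{E}[g(V)]|$ over all twice continuously differentiable $g:\mathbb{R}\to\mathbb{R}$ with second derivative bounded by $C$ (for $U,V$ with finite second moments).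
   Formalization: The limit of d_Kol(S_n,S) is proved only when σ²>0, since it can fail when σ²=0 (e.g. X_k=(Z_{k+1}−Z_k)/√2 with Z i.i.d. N(0,1), f(x)=x); the d_W and d_C limits cover every σ²≥0. *)

theory Defs
  imports "HOL-Probability.Probability" "HOL-Computational_Algebra.Polynomial"
begin

section \<open>Gaussian laws and processes\<close>

text \<open>The law $N(m, v)$ for $v \ge 0$. It is given as an image measure rather than by a density, so
  that $N(m, 0)$ is the point mass at $m$.\<close>

definition normal_law :: "real \<Rightarrow> real \<Rightarrow> real measure" where
  "normal_law m v = distr std_normal_distribution borel (\<lambda>x. m + sqrt v * x)"

definition std_normal_law_vec :: "(real ^ 'd::finite) measure" where
  "std_normal_law_vec = density lborel (\<lambda>x. \<Prod>i\<in>UNIV. ennreal (std_normal_density (x $ i)))"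

text \<open>All finite linear combinations of the real variables $X_k^{(i)}$ are normal, possibly
  degenerate.\<close>

definition gaussian_process :: "'a measure \<Rightarrow> (int \<Rightarrow> 'a \<Rightarrow> real ^ 'd::finite) \<Rightarrow> bool" where
  "gaussian_process M X \<longleftrightarrow>
     (\<forall>k. X k \<in> borel_measurable M) \<and>
     (\<forall>J c. finite J \<longrightarrow>
        (\<exists>m v. v \<ge> 0 \<and> distr M borel (\<lambda>\<omega>. \<Sum>k\<in>J. c k \<bullet> X k \<omega>) = normal_law m v))"

definition centered_process :: "'a measure \<Rightarrow> (int \<Rightarrow> 'a \<Rightarrow> real ^ 'd::finite) \<Rightarrow> bool" where
  "centered_process M X \<longleftrightarrow>
     (\<forall>k i. integrable M (\<lambda>\<omega>. X k \<omega> $ i) \<and> (\<integral>\<omega>. X k \<omega> $ i \<partial>M) = 0)"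

definition stationary_process :: "'a measure \<Rightarrow> (int \<Rightarrow> 'a \<Rightarrow> real ^ 'd::finite) \<Rightarrow> bool" where
  "stationary_process M X \<longleftrightarrow>
     (\<forall>J h. finite J \<longrightarrow>
        distr M (Pi\<^sub>M J (\<lambda>_. borel)) (\<lambda>\<omega>. \<lambda>j\<in>J. X (j + h) \<omega>) =
        distr M (Pi\<^sub>M J (\<lambda>_. borel)) (\<lambda>\<omega>. \<lambda>j\<in>J. X j \<omega>))"

definition cross_cov ::
  "'a measure \<Rightarrow> (int \<Rightarrow> 'a \<Rightarrow> real ^ 'd::finite) \<Rightarrow> 'd \<Rightarrow> 'd \<Rightarrow> int \<Rightarrow> real" where
  "cross_cov M X i l j = (\<integral>\<omega>. X 1 \<omega> $ i * X (1 + j) \<omega> $ l \<partial>M)"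


section \<open>Hermite polynomials and Hermite rank\<close>

fun hermite :: "nat \<Rightarrow> real poly" where
  "hermite 0 = 1"
| "hermite (Suc j) = [:0, 1:] * hermite j - pderiv (hermite j)"

text \<open>Multi-indices are functions from the finite type that indexes the coordinates.\<close>

definition hermite_coeff ::
  "'a measure \<Rightarrow> (real ^ 'd::finite \<Rightarrow> real) \<Rightarrow> ('a \<Rightarrow> real ^ 'd) \<Rightarrow> ('d \<Rightarrow> nat) \<Rightarrow> real" where
  "hermite_coeff M f Y \<alpha> =
     (\<integral>\<omega>. f (Y \<omega>) * (\<Prod>i\<in>UNIV. poly (hermite (\<alpha> i)) (Y \<omega> $ i)) \<partial>M) / (\<Prod>i\<in>UNIV. fact (\<alpha> i))"

definition has_hermite_rank ::
  "'a measure \<Rightarrow> (real ^ 'd::finite \<Rightarrow> real) \<Rightarrow> ('a \<Rightarrow> real ^ 'd) \<Rightarrow> nat \<Rightarrow> bool" where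
  "has_hermite_rank M f Y q \<longleftrightarrow>
     q \<ge> 1 \<and>
     (\<forall>\<alpha>. (\<Sum>i\<in>UNIV. \<alpha> i) < q \<longrightarrow> hermite_coeff M f Y \<alpha> = 0) \<and>
     (\<exists>\<alpha>. (\<Sum>i\<in>UNIV. \<alpha> i) = q \<and> hermite_coeff M f Y \<alpha> \<noteq> 0)"


section \<open>Normalized sums and the limiting variance\<close>

definition covar :: "'a measure \<Rightarrow> ('a \<Rightarrow> real) \<Rightarrow> ('a \<Rightarrow> real) \<Rightarrow> real" where
  "covar M U V =
     (\<integral>\<omega>. (U \<omega> - (\<integral>\<omega>'. U \<omega>' \<partial>M)) * (V \<omega> - (\<integral>\<omega>'. V \<omega>' \<partial>M)) \<partial>M)"

definition normalized_sum ::
  "(real ^ 'd::finite \<Rightarrow> real) \<Rightarrow> (int \<Rightarrow> 'a \<Rightarrow> real ^ 'd) \<Rightarrow> nat \<Rightarrow> 'a \<Rightarrow> real" where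
  "normalized_sum f X n \<omega> = (\<Sum>k=1..n. f (X (int k) \<omega>)) / sqrt (real n)"

definition lag_covar ::
  "'a measure \<Rightarrow> (real ^ 'd::finite \<Rightarrow> real) \<Rightarrow> (int \<Rightarrow> 'a \<Rightarrow> real ^ 'd) \<Rightarrow> nat \<Rightarrow> real" where
  "lag_covar M f X k = covar M (\<lambda>\<omega>. f (X 1 \<omega>)) (\<lambda>\<omega>. f (X (1 + int k) \<omega>))"

text \<open>The lag-zero term is the variance of $f(X_1)$; the infinite sum runs over the lags
  $1, 2, \ldots$.\<close>

definition limit_variance ::
  "'a measure \<Rightarrow> (real ^ 'd::finite \<Rightarrow> real) \<Rightarrow> (int \<Rightarrow> 'a \<Rightarrow> real ^ 'd) \<Rightarrow> real" where
  "limit_variance M f X = lag_covar M f X 0 + 2 * (\<Sum>k. lag_covar M f X (Suc k))"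


section \<open>Distances between laws of real random variables\<close>

text \<open>The two random variables may live on different probability spaces. The suprema are taken in
  the extended nonnegative reals, so that no boundedness is presupposed.\<close>

definition d_Kol :: "'a measure \<Rightarrow> ('a \<Rightarrow> real) \<Rightarrow> 'b measure \<Rightarrow> ('b \<Rightarrow> real) \<Rightarrow> ennreal" where
  "d_Kol M U N V =
     (SUP z. ennreal \<bar>measure M {\<omega> \<in> space M. U \<omega> \<le> z} - measure N {\<omega> \<in> space N. V \<omega> \<le> z}\<bar>)"

definition d_W :: "'a measure \<Rightarrow> ('a \<Rightarrow> real) \<Rightarrow> 'b measure \<Rightarrow> ('b \<Rightarrow> real) \<Rightarrow> ennreal" where
  "d_W M U N V =
     (SUP g\<in>{g :: real \<Rightarrow> real. 1-lipschitz_on UNIV g}.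
        ennreal \<bar>(\<integral>\<omega>. g (U \<omega>) \<partial>M) - (\<integral>\<omega>. g (V \<omega>) \<partial>N)\<bar>)"

definition C2_bounded :: "real \<Rightarrow> (real \<Rightarrow> real) set" where
  "C2_bounded C =
     {g. \<exists>g' g''. (\<forall>x. (g has_real_derivative g' x) (at x)) \<and>
                  (\<forall>x. (g' has_real_derivative g'' x) (at x)) \<and>
                  continuous_on UNIV g'' \<and> (\<forall>x. \<bar>g'' x\<bar> \<le> C)}"

definition d_C :: "real \<Rightarrow> 'a measure \<Rightarrow> ('a \<Rightarrow> real) \<Rightarrow> 'b measure \<Rightarrow> ('b \<Rightarrow> real) \<Rightarrow> ennreal" where
  "d_C C M U N V =
     (SUP g\<in>C2_bounded C. ennreal \<bar>(\<integral>\<omega>. g (U \<omega>) \<partial>M) - (\<integral>\<omega>. g (V \<omega>) \<partial>N)\<bar>)"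

end

theory Submission
  imports Defs
begin

text \<open>By Hermite expansion, the covariances of functions of Hermite rank at least $q$ at lag $j$ are
  bounded by a multiple of $\max_{i,l} |r^{(i,l)}(j)|^q$ times the squared $L^2$ norm. So $f$ may be
  replaced by a finite Hermite expansion at a cost that is uniform in $n$. For such an expansion,
  Gaussian integration by parts gives $E[F e^{iuF}] = iu\, E[\Gamma e^{iuF}]$ with $E[\Gamma] = E[F^2]$, where
  $F = S_n$ and $\Gamma$ is a quadratic form in Hermite products. The variance of $\Gamma$ is a sum over
  four times of covariances which, by Wick's formula, are dominated by monomials in the correlations;
  it tends to $0$, so the characteristic function of $F$ nearly solves the differential equation of the
  Gaussian one. Weak convergence together with convergence of the second moments yields an $L^2$
  coupling by Skorohod's theorem, and this controls all three distances.\<close>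

text \<open>The vector of all variables involved may have a singular covariance matrix, so there is
  no joint density to integrate against; the joint law is accessible only through the characteristic
  functions of linear combinations. Integration by parts is therefore obtained for exponentials of
  linear forms and has to be carried over to a polynomial times e^{iuq} with q a polynomial.
  Expanding e^{iuq} in its Taylor series fails directly, because exp |uq| is in general not
  integrable once q has degree above two. So each variable y is first replaced by sin(sy)/s:
  everything except one linear factor is then bounded, the expansion is harmless, and s tends to 0
  at the end. The other delicate point is the variance of \<Gamma>. Its Hermite factors are only
  known to have degree at least q - 1, one short of what the summability of |r|^q requires; the
  missing powers come from the covariances that appear as coefficients of the quadratic
  form.\<close>

section \<open>The distances through a Skorohod coupling\<close>

lemma (in prob_space) abs_expectation_le_sqrt:
  fixes U :: "'a \<Rightarrow> real"
  assumes "U \<in> borel_measurable M" "integrable M (\<lambda>x. (U x)\<^sup>2)"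
  shows "integrable M U" "expectation (\<lambda>x. \<bar>U x\<bar>) \<le> sqrt (expectation (\<lambda>x. (U x)\<^sup>2))"
proof -
  show "integrable M U" by (rule square_integrable_imp_integrable) (use assms in auto)
  then have i: "integrable M (\<lambda>x. \<bar>U x\<bar>)" by auto
  have "0 \<le> variance (\<lambda>x. \<bar>U x\<bar>)" by simp
  also have "\<dots> = expectation (\<lambda>x. (U x)\<^sup>2) - (expectation (\<lambda>x. \<bar>U x\<bar>))\<^sup>2"
    using assms i by (subst variance_eq) auto
  finally show "expectation (\<lambda>x. \<bar>U x\<bar>) \<le> sqrt (expectation (\<lambda>x. (U x)\<^sup>2))"
    by (intro real_le_rsqrt) simp
qed

lemma integrable_mult_square:
  fixes U V :: "'a \<Rightarrow> real"
  assumes [measurable]: "U \<in> borel_measurable M" "V \<in> borel_measurable M"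
    and "integrable M (\<lambda>x. (U x)\<^sup>2)" "integrable M (\<lambda>x. (V x)\<^sup>2)"
  shows "integrable M (\<lambda>x. U x * V x)"
proof (rule Bochner_Integration.integrable_bound)
  show "integrable M (\<lambda>x. (U x)\<^sup>2 + (V x)\<^sup>2)" using assms by auto
  have "norm (U x * V x) \<le> norm ((U x)\<^sup>2 + (V x)\<^sup>2)" for x
  proof -
    have "2 * (\<bar>U x\<bar> * \<bar>V x\<bar>) \<le> (U x)\<^sup>2 + (V x)\<^sup>2" "0 \<le> \<bar>U x\<bar> * \<bar>V x\<bar>"
      using sum_squares_bound[of "\<bar>U x\<bar>" "\<bar>V x\<bar>"] by auto
    moreover have "\<bar>(U x)\<^sup>2 + (V x)\<^sup>2\<bar> = (U x)\<^sup>2 + (V x)\<^sup>2" by simp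
    ultimately show ?thesis unfolding real_norm_def abs_mult by linarith
  qed
  then show "AE x in M. norm (U x * V x) \<le> norm ((U x)\<^sup>2 + (V x)\<^sup>2)" by simp
qed simp

lemma Cauchy_Schwarz_integral:
  fixes U V :: "'a \<Rightarrow> real"
  assumes [measurable]: "U \<in> borel_measurable M" "V \<in> borel_measurable M"
    and i: "integrable M (\<lambda>x. (U x)\<^sup>2)" "integrable M (\<lambda>x. (V x)\<^sup>2)"
  shows "(\<integral>x. \<bar>U x * V x\<bar> \<partial>M) \<le> sqrt (\<integral>x. (U x)\<^sup>2 \<partial>M) * sqrt (\<integral>x. (V x)\<^sup>2 \<partial>M)"
proof -
  have "(\<integral>\<^sup>+x. ennreal \<bar>U x\<bar> * ennreal \<bar>V x\<bar> \<partial>M)\<^sup>2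
      \<le> (\<integral>\<^sup>+x. (ennreal \<bar>U x\<bar>)\<^sup>2 \<partial>M) * (\<integral>\<^sup>+x. (ennreal \<bar>V x\<bar>)\<^sup>2 \<partial>M)"
    by (rule Cauchy_Schwarz_nn_integral) auto
  also have "(\<integral>\<^sup>+x. ennreal \<bar>U x\<bar> * ennreal \<bar>V x\<bar> \<partial>M) = ennreal (\<integral>x. \<bar>U x * V x\<bar> \<partial>M)"
    using integrable_norm[OF integrable_mult_square[OF assms]]
    by (subst nn_integral_eq_integral[symmetric]) (simp_all add: abs_mult ennreal_mult)
  also have "(\<integral>\<^sup>+x. (ennreal \<bar>U x\<bar>)\<^sup>2 \<partial>M) = ennreal (\<integral>x. (U x)\<^sup>2 \<partial>M)"
    using i by (subst nn_integral_eq_integral[symmetric]) (auto simp: ennreal_power)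
  also have "(\<integral>\<^sup>+x. (ennreal \<bar>V x\<bar>)\<^sup>2 \<partial>M) = ennreal (\<integral>x. (V x)\<^sup>2 \<partial>M)"
    using i by (subst nn_integral_eq_integral[symmetric]) (auto simp: ennreal_power)
  finally have "(\<integral>x. \<bar>U x * V x\<bar> \<partial>M)\<^sup>2 \<le> (\<integral>x. (U x)\<^sup>2 \<partial>M) * (\<integral>x. (V x)\<^sup>2 \<partial>M)"
    by (simp add: ennreal_power ennreal_mult[symmetric])
  then show ?thesis
    unfolding real_sqrt_mult[symmetric] by (rule real_le_rsqrt)
qed

text \<open>Minkowski's inequality in L^2, with the Cauchy-Schwarz inequality applied to the mixed
  term.\<close>

lemma sqrt_integral_add_le:
  fixes U V :: "'a \<Rightarrow> real"
  assumes [measurable]: "U \<in> borel_measurable M" "V \<in> borel_measurable M"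
    and i: "integrable M (\<lambda>x. (U x)\<^sup>2)" "integrable M (\<lambda>x. (V x)\<^sup>2)"
  shows "integrable M (\<lambda>x. (U x + V x)\<^sup>2)"
    "sqrt (\<integral>x. (U x + V x)\<^sup>2 \<partial>M) \<le> sqrt (\<integral>x. (U x)\<^sup>2 \<partial>M) + sqrt (\<integral>x. (V x)\<^sup>2 \<partial>M)"
proof -
  have UV: "integrable M (\<lambda>x. U x * V x)" by (rule integrable_mult_square) (use assms in auto)
  have eq: "(\<lambda>x. (U x + V x)\<^sup>2) = (\<lambda>x. (U x)\<^sup>2 + 2 * (U x * V x) + (V x)\<^sup>2)"
    by (auto simp: power2_eq_square algebra_simps)
  show "integrable M (\<lambda>x. (U x + V x)\<^sup>2)" unfolding eq using i UV by auto
  have "(\<integral>x. U x * V x \<partial>M) \<le> (\<integral>x. \<bar>U x * V x\<bar> \<partial>M)"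
    using UV by (intro integral_mono) auto
  also note Cauchy_Schwarz_integral[OF assms]
  finally have "(\<integral>x. (U x + V x)\<^sup>2 \<partial>M) \<le> (sqrt (\<integral>x. (U x)\<^sup>2 \<partial>M) + sqrt (\<integral>x. (V x)\<^sup>2 \<partial>M))\<^sup>2"
    unfolding eq using i UV by (simp add: power2_sum)
  then show "sqrt (\<integral>x. (U x + V x)\<^sup>2 \<partial>M) \<le> sqrt (\<integral>x. (U x)\<^sup>2 \<partial>M) + sqrt (\<integral>x. (V x)\<^sup>2 \<partial>M)"
    by (intro real_le_lsqrt) auto
qed

text \<open>Fatou's lemma for $2U_n^2 + 2U^2 - (U_n - U)^2 \ge 0$.\<close>

lemma L2_convergence_of_ae_and_moments:
  fixes U :: "nat \<Rightarrow> 'a \<Rightarrow> real" and V :: "'a \<Rightarrow> real"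
  assumes [measurable]: "\<And>n. U n \<in> borel_measurable M" "V \<in> borel_measurable M"
    and iU: "\<And>n. integrable M (\<lambda>x. (U n x)\<^sup>2)" and iV: "integrable M (\<lambda>x. (V x)\<^sup>2)"
    and ae: "AE x in M. (\<lambda>n. U n x) \<longlonglongrightarrow> V x"
    and mom: "(\<lambda>n. \<integral>x. (U n x)\<^sup>2 \<partial>M) \<longlonglongrightarrow> (\<integral>x. (V x)\<^sup>2 \<partial>M)"
  shows "(\<lambda>n. \<integral>x. (U n x - V x)\<^sup>2 \<partial>M) \<longlonglongrightarrow> 0"
proof -
  define s where "s = (\<integral>x. (V x)\<^sup>2 \<partial>M)"
  define d where "d n = (\<integral>x. (U n x - V x)\<^sup>2 \<partial>M)" for n
  have id: "integrable M (\<lambda>x. (U n x - V x)\<^sup>2)" for n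
    using sqrt_integral_add_le(1)[of "U n" M "\<lambda>x. - V x"] iU iV by simp
  define g where "g n x = 2 * (U n x)\<^sup>2 + 2 * (V x)\<^sup>2 - (U n x - V x)\<^sup>2" for n x
  have g0: "g n x \<ge> 0" for n x
  proof -
    have "g n x = (U n x + V x)\<^sup>2" by (simp add: g_def power2_eq_square algebra_simps)
    then show ?thesis by simp
  qed
  have ig: "integrable M (g n)" for n unfolding g_def using iU iV id by auto
  have [measurable]: "g n \<in> borel_measurable M" for n using ig by auto
  have gI: "(\<integral>\<^sup>+x. ennreal (g n x) \<partial>M) = ennreal (2 * (\<integral>x. (U n x)\<^sup>2 \<partial>M) + 2 * s - d n)" for n
  proof -
    have "(\<integral>x. g n x \<partial>M) = 2 * (\<integral>x. (U n x)\<^sup>2 \<partial>M) + 2 * s - d n"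
      using iU[of n] iV id[of n] unfolding g_def s_def d_def by simp
    then show ?thesis using g0 ig[of n] by (subst nn_integral_eq_integral) simp_all
  qed
  have "ennreal (4 * s) = (\<integral>\<^sup>+x. ennreal (4 * (V x)\<^sup>2) \<partial>M)"
    using iV by (subst nn_integral_eq_integral) (auto simp: s_def)
  also have "\<dots> = (\<integral>\<^sup>+x. liminf (\<lambda>n. ennreal (g n x)) \<partial>M)"
  proof (rule nn_integral_cong_AE, use ae in eventually_elim)
    case (elim x)
    have "(\<lambda>n. g n x) \<longlonglongrightarrow> 2 * (V x)\<^sup>2 + 2 * (V x)\<^sup>2 - (V x - V x)\<^sup>2"
      unfolding g_def by (intro tendsto_intros elim)
    then have "(\<lambda>n. ennreal (g n x)) \<longlonglongrightarrow> ennreal (4 * (V x)\<^sup>2)"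
      by (intro tendsto_ennrealI) simp
    then show ?case by (simp add: lim_imp_Liminf)
  qed
  also have "\<dots> \<le> liminf (\<lambda>n. \<integral>\<^sup>+x. ennreal (g n x) \<partial>M)"
    by (rule nn_integral_liminf) simp
  finally have F: "ennreal (4 * s) \<le> liminf (\<lambda>n. ennreal (2 * (\<integral>x. (U n x)\<^sup>2 \<partial>M) + 2 * s - d n))"
    by (simp add: gI)
  have s0: "s \<ge> 0" and d0: "d n \<ge> 0" for n by (auto simp: s_def d_def)
  show ?thesis
  proof (rule LIMSEQ_I, goal_cases)
    case (1 e)
    have ev1: "\<forall>\<^sub>F n in sequentially. (\<integral>x. (U n x)\<^sup>2 \<partial>M) < s + e/4"
      using order_tendstoD(2)[OF mom, of "s + e/4"] 1 by (simp add: s_def)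
    \<comment> \<open>\<open>ennreal\<close> sends every negative number to 0, so the strict
      comparison with the limit inferior can be read back in the reals only for a nonnegative
      threshold. For a negative one it is enough that the integral of \<open>g n\<close> is
      nonnegative.\<close>
    have ev2: "\<forall>\<^sub>F n in sequentially. 2 * (\<integral>x. (U n x)\<^sup>2 \<partial>M) + 2 * s - d n > 4 * s - e / 2"
    proof (cases "4 * s - e/2 < 0")
      case True
      have "2 * (\<integral>x. (U n x)\<^sup>2 \<partial>M) + 2 * s - d n \<ge> 0" for n
      proof -
        have "(\<integral>x. g n x \<partial>M) \<ge> 0" using g0 by simp
        then show ?thesis using iU iV id unfolding g_def by (simp add: s_def d_def)
      qed
      then show ?thesis using True by (intro always_eventually allI) (meson less_le_trans)
    next
      case False
      then have "ennreal (4 * s - e/2) < ennreal (4 * s)" using 1 by (intro ennreal_lessI) auto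
      then have "ennreal (4 * s - e/2) < liminf (\<lambda>n. ennreal (2 * (\<integral>x. (U n x)\<^sup>2 \<partial>M) + 2 * s - d n))"
        using F by simp
      from less_LiminfD[OF this] show ?thesis
        by eventually_elim (use False in \<open>auto simp: ennreal_less_iff\<close>)
    qed
    from ev1 ev2 have "\<forall>\<^sub>F n in sequentially. norm (d n - 0) < e"
      by eventually_elim (use d0 in auto)
    then show ?case by (simp add: eventually_sequentially d_def)
  qed
qed

text \<open>The test functions of \<open>d_W\<close> and \<open>d_C\<close> are unbounded, so weak
  convergence alone does not suffice. Skorohod's representation gives pointwise convergence on one
  space; second moments depend only on the laws, so their convergence survives the transfer and
  improves pointwise to L^2 convergence.\<close>

lemma Skorohod_L2_coupling:
  fixes U :: "nat \<Rightarrow> 'a \<Rightarrow> real" and S :: "'b \<Rightarrow> real"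
  assumes "prob_space M" "prob_space N"
    and U[measurable]: "\<And>n. U n \<in> borel_measurable M" and S[measurable]: "S \<in> borel_measurable N"
    and iU: "\<And>n. integrable M (\<lambda>x. (U n x)\<^sup>2)" and iS: "integrable N (\<lambda>x. (S x)\<^sup>2)"
    and mom: "(\<lambda>n. \<integral>x. (U n x)\<^sup>2 \<partial>M) \<longlonglongrightarrow> (\<integral>x. (S x)\<^sup>2 \<partial>N)"
    and char: "\<And>t. (\<lambda>n. char (distr M borel (U n)) t) \<longlonglongrightarrow> char (distr N borel S) t"
  obtains \<Omega> :: "real measure" and Z :: "nat \<Rightarrow> real \<Rightarrow> real" and Y :: "real \<Rightarrow> real"
  where "prob_space \<Omega>" "\<And>n. Z n \<in> borel_measurable \<Omega>" "Y \<in> borel_measurable \<Omega>"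
    "\<And>n. distr \<Omega> borel (Z n) = distr M borel (U n)" "distr \<Omega> borel Y = distr N borel S"
    "\<And>n. integrable \<Omega> (\<lambda>x. (Z n x)\<^sup>2)" "integrable \<Omega> (\<lambda>x. (Y x)\<^sup>2)"
    "(\<lambda>n. \<integral>x. (Z n x - Y x)\<^sup>2 \<partial>\<Omega>) \<longlonglongrightarrow> 0"
proof -
  interpret M: prob_space M by fact
  interpret N: prob_space N by fact
  have rM: "real_distribution (distr M borel (U n))" for n by (rule M.real_distribution_distr) simp
  have rN: "real_distribution (distr N borel S)" by (rule N.real_distribution_distr) simp
  have "weak_conv_m (\<lambda>n. distr M borel (U n)) (distr N borel S)"
    by (rule levy_continuity[OF rM rN char])
  from Skorohod[OF rM rN this] obtain \<Omega> :: "real measure" and Z Y where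
    \<Omega>: "prob_space \<Omega>" and Z[measurable]: "\<And>n. Z n \<in> borel_measurable \<Omega>"
    and dZ: "\<And>n. distr \<Omega> borel (Z n) = distr M borel (U n)"
    and Y: "Y \<in> measurable \<Omega> lborel" and dY: "distr \<Omega> borel Y = distr N borel S"
    and lim: "\<And>x. x \<in> space \<Omega> \<Longrightarrow> (\<lambda>n. Z n x) \<longlonglongrightarrow> Y x" by blast
  have Y[measurable]: "Y \<in> borel_measurable \<Omega>" using Y by simp
  have sq: "integrable \<Omega> (\<lambda>x. (Z n x)\<^sup>2) \<longleftrightarrow> integrable M (\<lambda>x. (U n x)\<^sup>2)"
    "(\<integral>x. (Z n x)\<^sup>2 \<partial>\<Omega>) = (\<integral>x. (U n x)\<^sup>2 \<partial>M)" for n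
    using integrable_distr_eq[of "Z n" \<Omega> borel "\<lambda>x. x\<^sup>2"] integrable_distr_eq[of "U n" M borel "\<lambda>x. x\<^sup>2"]
      integral_distr[of "Z n" \<Omega> borel "\<lambda>x. x\<^sup>2"] integral_distr[of "U n" M borel "\<lambda>x. x\<^sup>2"]
    by (simp_all add: dZ)
  have sqY: "integrable \<Omega> (\<lambda>x. (Y x)\<^sup>2) \<longleftrightarrow> integrable N (\<lambda>x. (S x)\<^sup>2)"
    "(\<integral>x. (Y x)\<^sup>2 \<partial>\<Omega>) = (\<integral>x. (S x)\<^sup>2 \<partial>N)"
    using integrable_distr_eq[of "Y" \<Omega> borel "\<lambda>x. x\<^sup>2"] integrable_distr_eq[of S N borel "\<lambda>x. x\<^sup>2"]
      integral_distr[of "Y" \<Omega> borel "\<lambda>x. x\<^sup>2"] integral_distr[of S N borel "\<lambda>x. x\<^sup>2"]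
    by (simp_all add: dY)
  have "(\<lambda>n. \<integral>x. (Z n x - Y x)\<^sup>2 \<partial>\<Omega>) \<longlonglongrightarrow> 0"
    by (rule L2_convergence_of_ae_and_moments) (use lim sq sqY iU iS mom in auto)
  then show ?thesis by (intro that[OF \<Omega> Z Y dZ dY]) (simp_all add: sq sqY iU iS)
qed

text \<open>A bound on the second derivative does not bound g' itself, so the linear part g'(0) x is
  removed; it has no effect later because the coupled variables have mean zero. The remaining
  derivative g'(z) - g'(0) has modulus at most C |z|, hence at most C (|x| + |y|) on the segment
  between x and y.\<close>

lemma C2_bounded_increment:
  assumes g: "\<And>x. (g has_real_derivative g' x) (at x)"
    and g': "\<And>x. (g' has_real_derivative g'' x) (at x)" and C: "\<And>x. \<bar>g'' x\<bar> \<le> C"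
  shows "\<bar>(g x - g' 0 * x) - (g y - g' 0 * y)\<bar> \<le> C * ((\<bar>x\<bar> + \<bar>y\<bar>) * \<bar>x - y\<bar>)"
proof -
  have C0: "C \<ge> 0" using C[of 0] by linarith
  have d: "\<bar>g' z - g' 0\<bar> \<le> C * \<bar>z\<bar>" for z
    using field_differentiable_bound[of UNIV g' g'' C z 0] g' C by auto
  have "norm ((g x - g' 0 * x) - (g y - g' 0 * y)) \<le> (C * (\<bar>x\<bar> + \<bar>y\<bar>)) * norm (x - y)"
  proof (rule field_differentiable_bound[of "closed_segment y x" _ "\<lambda>z. g' z - g' 0"])
    fix z assume z: "z \<in> closed_segment y x"
    show "((\<lambda>x. g x - g' 0 * x) has_field_derivative g' z - g' 0) (at z within closed_segment y x)"
      by (rule DERIV_subset[of _ _ _ UNIV]) (auto intro!: derivative_eq_intros g)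
    have "\<bar>z\<bar> \<le> \<bar>x\<bar> + \<bar>y\<bar>" using z by (auto simp: closed_segment_eq_real_ivl split: if_splits)
    with d[of z] C0 show "norm (g' z - g' 0) \<le> C * (\<bar>x\<bar> + \<bar>y\<bar>)"
      by (smt (verit) mult_left_mono real_norm_def)
  qed auto
  then show ?thesis by (simp add: mult.assoc)
qed

lemma tendsto_ennreal_0_of_bound:
  assumes "\<And>n. d n \<le> ennreal (b n)" "b \<longlonglongrightarrow> (0::real)"
  shows "d \<longlonglongrightarrow> (0::ennreal)"
proof (rule tendsto_sandwich[of "\<lambda>_. 0"])
  show "(\<lambda>n. ennreal (b n)) \<longlonglongrightarrow> 0" using tendsto_ennrealI[OF assms(2)] by simp
qed (use assms in auto)

text \<open>All three estimates are in terms of the L^2 distance \<open>r n\<close> of the coupled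
  variables. It bounds \<open>d_W\<close> itself, it bounds \<open>d_C\<close> up to a factor that
  converges, by Cauchy-Schwarz, and it bounds \<open>d_Kol\<close> through Chebyshev's inequality as
  soon as the limiting distribution function is Lipschitz, which is the premise of the third
  claim.\<close>

lemma distances_tendsto_0:
  fixes U :: "nat \<Rightarrow> 'a \<Rightarrow> real" and S :: "'b \<Rightarrow> real"
  assumes "prob_space M" "prob_space N"
    and U[measurable]: "\<And>n. U n \<in> borel_measurable M" and S[measurable]: "S \<in> borel_measurable N"
    and iU: "\<And>n. integrable M (\<lambda>x. (U n x)\<^sup>2)" and iS: "integrable N (\<lambda>x. (S x)\<^sup>2)"
    and mU: "\<And>n. (\<integral>x. U n x \<partial>M) = 0" and mS: "(\<integral>x. S x \<partial>N) = 0"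
    and mom: "(\<lambda>n. \<integral>x. (U n x)\<^sup>2 \<partial>M) \<longlonglongrightarrow> (\<integral>x. (S x)\<^sup>2 \<partial>N)"
    and char: "\<And>t. (\<lambda>n. char (distr M borel (U n)) t) \<longlonglongrightarrow> char (distr N borel S) t"
  shows "(\<lambda>n. d_W M (U n) N S) \<longlonglongrightarrow> 0"
    and "C > 0 \<Longrightarrow> (\<lambda>n. d_C C M (U n) N S) \<longlonglongrightarrow> 0"
    and "(\<And>z h. h > 0 \<Longrightarrow> measure N {\<omega> \<in> space N. S \<omega> \<le> z + h} \<le> measure N {\<omega> \<in> space N. S \<omega> \<le> z} + L * h)
      \<Longrightarrow> (\<lambda>n. d_Kol M (U n) N S) \<longlonglongrightarrow> 0"
proof -
  obtain \<Omega> :: "real measure" and Z Y where \<Omega>: "prob_space \<Omega>"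
    and Z[measurable]: "\<And>n. Z n \<in> borel_measurable \<Omega>" and Y[measurable]: "Y \<in> borel_measurable \<Omega>"
    and dZ: "\<And>n. distr \<Omega> borel (Z n) = distr M borel (U n)" and dY: "distr \<Omega> borel Y = distr N borel S"
    and iZ: "\<And>n. integrable \<Omega> (\<lambda>x. (Z n x)\<^sup>2)" and iY: "integrable \<Omega> (\<lambda>x. (Y x)\<^sup>2)"
    and L2: "(\<lambda>n. \<integral>x. (Z n x - Y x)\<^sup>2 \<partial>\<Omega>) \<longlonglongrightarrow> 0"
    apply (rule Skorohod_L2_coupling[OF assms(1-6) mom char])
    subgoal premises prems for \<Omega> Z Y by (rule prems(1)) (fact prems)+
    done
  interpret \<Omega>: prob_space \<Omega> by fact
  interpret M: prob_space M by fact
  interpret N: prob_space N by fact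
  have EU: "(\<integral>x. g (U n x) \<partial>M) = (\<integral>x. g (Z n x) \<partial>\<Omega>)" if [measurable]: "g \<in> borel_measurable borel"
    for g :: "real \<Rightarrow> real" and n
    using integral_distr[of "Z n" \<Omega> borel g] integral_distr[of "U n" M borel g] by (simp add: dZ)
  have ES: "(\<integral>x. g (S x) \<partial>N) = (\<integral>x. g (Y x) \<partial>\<Omega>)" if [measurable]: "g \<in> borel_measurable borel"
    for g :: "real \<Rightarrow> real"
    using integral_distr[of Y \<Omega> borel g] integral_distr[of S N borel g] by (simp add: dY)
  have mZ: "(\<integral>x. Z n x \<partial>\<Omega>) = 0" and mY: "(\<integral>x. Y x \<partial>\<Omega>) = 0" for n
    using EU[of "\<lambda>x. x" n] ES[of "\<lambda>x. x"] mU mS by simp_all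
  have iZ1: "integrable \<Omega> (Z n)" and iY1: "integrable \<Omega> Y" for n
    by (rule \<Omega>.abs_expectation_le_sqrt(1)[OF Z iZ], rule \<Omega>.abs_expectation_le_sqrt(1)[OF Y iY])
  have id: "integrable \<Omega> (\<lambda>x. (Z n x - Y x)\<^sup>2)" for n
    using sqrt_integral_add_le(1)[of "Z n" \<Omega> "\<lambda>x. - Y x"] iZ iY by simp
  define r where "r n = sqrt (\<integral>x. (Z n x - Y x)\<^sup>2 \<partial>\<Omega>)" for n
  have r: "r \<longlonglongrightarrow> 0" using tendsto_real_sqrt[OF L2] by (simp add: r_def[abs_def])
  have r0: "r n \<ge> 0" for n by (simp add: r_def)
  show "(\<lambda>n. d_W M (U n) N S) \<longlonglongrightarrow> 0"
  proof (rule tendsto_ennreal_0_of_bound[OF _ r])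
    fix n
    have "\<bar>(\<integral>x. g (U n x) \<partial>M) - (\<integral>x. g (S x) \<partial>N)\<bar> \<le> r n" if g: "1-lipschitz_on UNIV g" for g :: "real \<Rightarrow> real"
    proof -
      have gl: "\<bar>g x - g y\<bar> \<le> \<bar>x - y\<bar>" for x y
        using lipschitz_onD[OF g, of x y] by (simp add: dist_real_def)
      have [measurable]: "g \<in> borel_measurable borel"
        using lipschitz_on_continuous_on[OF g] by (rule borel_measurable_continuous_onI)
      have ig: "integrable \<Omega> (\<lambda>x. g (V x))" if "integrable \<Omega> V" for V
      proof (rule Bochner_Integration.integrable_bound)
        show "integrable \<Omega> (\<lambda>x. \<bar>V x\<bar> + \<bar>g 0\<bar>)" using that by auto
        have "norm (g (V x)) \<le> norm (\<bar>V x\<bar> + \<bar>g 0\<bar>)" for x using gl[of "V x" 0] by simp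
        then show "AE x in \<Omega>. norm (g (V x)) \<le> norm (\<bar>V x\<bar> + \<bar>g 0\<bar>)" by simp
        show "(\<lambda>x. g (V x)) \<in> borel_measurable \<Omega>" using that by measurable
      qed
      have "\<bar>(\<integral>x. g (Z n x) \<partial>\<Omega>) - (\<integral>x. g (Y x) \<partial>\<Omega>)\<bar> = \<bar>\<integral>x. g (Z n x) - g (Y x) \<partial>\<Omega>\<bar>"
        using ig[OF iZ1] ig[OF iY1] by simp
      also have "\<dots> \<le> (\<integral>x. \<bar>g (Z n x) - g (Y x)\<bar> \<partial>\<Omega>)" by (rule integral_abs_bound)
      also have "\<dots> \<le> (\<integral>x. \<bar>Z n x - Y x\<bar> \<partial>\<Omega>)"
        using ig[OF iZ1] ig[OF iY1] iZ1 iY1 gl by (intro integral_mono) auto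
      also have "\<dots> \<le> r n" unfolding r_def by (rule \<Omega>.abs_expectation_le_sqrt) (use id in auto)
      finally show ?thesis by (simp add: EU ES)
    qed
    then show "d_W M (U n) N S \<le> ennreal (r n)"
      unfolding d_W_def by (intro SUP_least ennreal_leI) auto
  qed
  define w where "w n = sqrt (\<integral>x. (Z n x)\<^sup>2 \<partial>\<Omega>) + sqrt (\<integral>x. (Y x)\<^sup>2 \<partial>\<Omega>)" for n
  have w: "w \<longlonglongrightarrow> sqrt (\<integral>x. (S x)\<^sup>2 \<partial>N) + sqrt (\<integral>x. (Y x)\<^sup>2 \<partial>\<Omega>)"
    unfolding w_def using mom EU[of "\<lambda>x. x\<^sup>2"] by (intro tendsto_intros) simp
  show "(\<lambda>n. d_C C M (U n) N S) \<longlonglongrightarrow> 0" if "C > 0"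
  proof (rule tendsto_ennreal_0_of_bound)
    show "(\<lambda>n. C * (w n * r n)) \<longlonglongrightarrow> 0" using tendsto_mult[OF w r] tendsto_mult_right_zero by auto
    fix n
    have "\<bar>(\<integral>x. g (U n x) \<partial>M) - (\<integral>x. g (S x) \<partial>N)\<bar> \<le> C * (w n * r n)" if "g \<in> C2_bounded C" for g
    proof -
      from that obtain g' g'' where g: "\<And>x. (g has_real_derivative g' x) (at x)"
        and g': "\<And>x. (g' has_real_derivative g'' x) (at x)" and gC: "\<And>x. \<bar>g'' x\<bar> \<le> C"
        unfolding C2_bounded_def by blast
      note inc = C2_bounded_increment[OF g g' gC]
      define k where "k x = g x - g' 0 * x" for x
      have inck: "\<bar>k x - k y\<bar> \<le> C * ((\<bar>x\<bar> + \<bar>y\<bar>) * \<bar>x - y\<bar>)" for x y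
        using inc[of x y] by (simp add: k_def)
      have "continuous_on UNIV g" using g by (meson DERIV_isCont continuous_at_imp_continuous_on)
      then have [measurable]: "g \<in> borel_measurable borel" by (rule borel_measurable_continuous_onI)
      have [measurable]: "k \<in> borel_measurable borel" unfolding k_def by measurable
      have ik: "integrable \<Omega> (\<lambda>x. k (V x))"
        if [measurable]: "V \<in> borel_measurable \<Omega>" and "integrable \<Omega> (\<lambda>x. (V x)\<^sup>2)" for V
      proof (rule Bochner_Integration.integrable_bound)
        show "integrable \<Omega> (\<lambda>x. C * (V x)\<^sup>2 + \<bar>k 0\<bar>)" using that by auto
        have "norm (k (V x)) \<le> norm (C * (V x)\<^sup>2 + \<bar>k 0\<bar>)" for x
          using inck[of "V x" 0] by (simp add: power2_eq_square)
        then show "AE x in \<Omega>. norm (k (V x)) \<le> norm (C * (V x)\<^sup>2 + \<bar>k 0\<bar>)" by simp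
      qed simp
      note ikZ = ik[OF Z iZ] and ikY = ik[OF Y iY]
      \<comment> \<open>The linear function by which \<open>g\<close> and \<open>k\<close> differ
        integrates to 0 against both coupled variables.\<close>
      have gk: "g = (\<lambda>x. k x + g' 0 * x)" by (simp add: k_def)
      have iN: "integrable \<Omega> (\<lambda>x. \<bar>(\<bar>Z n x\<bar> + \<bar>Y x\<bar>) * (Z n x - Y x)\<bar>)"
        by (intro integrable_abs integrable_mult_square sqrt_integral_add_le) (use iZ iY id in auto)
      have "\<bar>(\<integral>x. g (Z n x) \<partial>\<Omega>) - (\<integral>x. g (Y x) \<partial>\<Omega>)\<bar> = \<bar>\<integral>x. k (Z n x) - k (Y x) \<partial>\<Omega>\<bar>"
        unfolding gk using ikZ ikY iZ1 iY1 mZ mY by simp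
      also have "\<dots> \<le> (\<integral>x. \<bar>k (Z n x) - k (Y x)\<bar> \<partial>\<Omega>)" by (rule integral_abs_bound)
      also have "\<dots> \<le> (\<integral>x. C * \<bar>(\<bar>Z n x\<bar> + \<bar>Y x\<bar>) * (Z n x - Y x)\<bar> \<partial>\<Omega>)"
        using ikZ ikY iN inck by (intro integral_mono) (auto simp: abs_mult)
      also have "\<dots> = C * (\<integral>x. \<bar>(\<bar>Z n x\<bar> + \<bar>Y x\<bar>) * (Z n x - Y x)\<bar> \<partial>\<Omega>)" by simp
      also have "\<dots> \<le> C * (sqrt (\<integral>x. (\<bar>Z n x\<bar> + \<bar>Y x\<bar>)\<^sup>2 \<partial>\<Omega>) * r n)"
        unfolding r_def using \<open>C > 0\<close> iZ iY id
        by (intro mult_left_mono Cauchy_Schwarz_integral sqrt_integral_add_le) auto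
      also have "\<dots> \<le> C * (w n * r n)"
        using sqrt_integral_add_le(2)[of "\<lambda>x. \<bar>Z n x\<bar>" \<Omega> "\<lambda>x. \<bar>Y x\<bar>"] iZ iY \<open>C > 0\<close> r0
        by (intro mult_left_mono mult_right_mono) (auto simp: w_def)
      finally show ?thesis by (simp add: EU ES)
    qed
    then show "d_C C M (U n) N S \<le> ennreal (C * (w n * r n))"
      unfolding d_C_def by (intro SUP_least ennreal_leI) auto
  qed
  assume L: "measure N {\<omega> \<in> space N. S \<omega> \<le> z + h} \<le> measure N {\<omega> \<in> space N. S \<omega> \<le> z} + L * h"
    if "h > 0" for z h
  have PU: "measure M {\<omega> \<in> space M. U n \<omega> \<le> z} = measure \<Omega> {\<omega> \<in> space \<Omega>. Z n \<omega> \<le> z}" for n z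
    using measure_distr[of "U n" M borel "{..z}"] measure_distr[of "Z n" \<Omega> borel "{..z}"]
    by (simp add: dZ vimage_def Int_def conj_commute)
  have PS: "measure N {\<omega> \<in> space N. S \<omega> \<le> z} = measure \<Omega> {\<omega> \<in> space \<Omega>. Y \<omega> \<le> z}" for z
    using measure_distr[of S N borel "{..z}"] measure_distr[of Y \<Omega> borel "{..z}"]
    by (simp add: dY vimage_def Int_def conj_commute)
  \<comment> \<open>Monotonicity of a distribution function forces the sign of \<open>L\<close>,
    which the choice of \<open>h\<close> below relies on.\<close>
  have L0: "L \<ge> 0"
  proof -
    have "measure N {\<omega> \<in> space N. S \<omega> \<le> 0} \<le> measure N {\<omega> \<in> space N. S \<omega> \<le> 0 + 1}"
      by (intro N.finite_measure_mono) auto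
    with L[of 1 0] show ?thesis by simp
  qed
  \<comment> \<open>If Z n \<le> z, then Y \<le> z + h or |Z n - Y| \<ge> h; if Y \<le> z - h, then
    Z n \<le> z or |Z n - Y| \<ge> h. The exceptional set does not depend on z.\<close>
  have K: "\<bar>measure M {\<omega> \<in> space M. U n \<omega> \<le> z} - measure N {\<omega> \<in> space N. S \<omega> \<le> z}\<bar>
      \<le> L * h + (r n)\<^sup>2 / h\<^sup>2" if "h > 0" for n z h
  proof -
    let ?D = "{\<omega> \<in> space \<Omega>. h \<le> \<bar>Z n \<omega> - Y \<omega>\<bar>}"
    have D: "measure \<Omega> ?D \<le> (r n)\<^sup>2 / h\<^sup>2"
    proof -
      have "?D = {\<omega> \<in> space \<Omega>. h\<^sup>2 \<le> (Z n \<omega> - Y \<omega>)\<^sup>2}"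
        using that by (auto simp: abs_le_square_iff[symmetric])
      also have "measure \<Omega> \<dots> \<le> (\<integral>\<omega>. (Z n \<omega> - Y \<omega>)\<^sup>2 \<partial>\<Omega>) / h\<^sup>2"
        using that id by (intro integral_Markov_inequality_measure[where A="{}"]) auto
      finally show ?thesis by (simp add: r_def)
    qed
    have "measure \<Omega> {\<omega> \<in> space \<Omega>. Z n \<omega> \<le> z} \<le> measure \<Omega> ({\<omega> \<in> space \<Omega>. Y \<omega> \<le> z + h} \<union> ?D)"
      by (intro \<Omega>.finite_measure_mono) auto
    also have "\<dots> \<le> measure \<Omega> {\<omega> \<in> space \<Omega>. Y \<omega> \<le> z + h} + measure \<Omega> ?D"
      by (intro measure_Un_le) auto
    finally have 1: "measure \<Omega> {\<omega> \<in> space \<Omega>. Z n \<omega> \<le> z} \<le> measure \<Omega> {\<omega> \<in> space \<Omega>. Y \<omega> \<le> z} + L * h + (r n)\<^sup>2 / h\<^sup>2"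
      using D L[OF that, of z] unfolding PS by linarith
    have "measure \<Omega> {\<omega> \<in> space \<Omega>. Y \<omega> \<le> z - h} \<le> measure \<Omega> ({\<omega> \<in> space \<Omega>. Z n \<omega> \<le> z} \<union> ?D)"
      by (intro \<Omega>.finite_measure_mono) auto
    also have "\<dots> \<le> measure \<Omega> {\<omega> \<in> space \<Omega>. Z n \<omega> \<le> z} + measure \<Omega> ?D"
      by (intro measure_Un_le) auto
    finally have 2: "measure \<Omega> {\<omega> \<in> space \<Omega>. Y \<omega> \<le> z} \<le> measure \<Omega> {\<omega> \<in> space \<Omega>. Z n \<omega> \<le> z} + L * h + (r n)\<^sup>2 / h\<^sup>2"
      using D L[OF that, of "z - h"] unfolding PS by simp
    show ?thesis using 1 2 unfolding PU PS by linarith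
  qed
  show "(\<lambda>n. d_Kol M (U n) N S) \<longlonglongrightarrow> 0"
  proof (rule tendsto_ennreal_0_of_bound)
    define b where "b n = (SUP z. \<bar>measure M {\<omega> \<in> space M. U n \<omega> \<le> z} - measure N {\<omega> \<in> space N. S \<omega> \<le> z}\<bar>)" for n
    have bd: "bdd_above (range (\<lambda>z. \<bar>measure M {\<omega> \<in> space M. U n \<omega> \<le> z} - measure N {\<omega> \<in> space N. S \<omega> \<le> z}\<bar>))" for n
      using K[of 1 n] by (intro bdd_aboveI) auto
    show "d_Kol M (U n) N S \<le> ennreal (b n)" for n
      unfolding d_Kol_def b_def by (intro SUP_least ennreal_leI cSUP_upper bd) auto
    have b0: "b n \<ge> 0" for n
      unfolding b_def by (rule order_trans[OF abs_ge_zero cSUP_upper[OF UNIV_I bd]])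
    have bK: "b n \<le> L * h + (r n)\<^sup>2 / h\<^sup>2" if "h > 0" for n h
      unfolding b_def using K[OF that] by (intro cSUP_least) auto
    show "b \<longlonglongrightarrow> 0"
    proof (rule LIMSEQ_I, goal_cases)
      case (1 e)
      \<comment> \<open>The summand 1 keeps the denominator positive when \<open>L\<close> is
        0.\<close>
      define h where "h = e / (2 * (L + 1))"
      have h: "h > 0" "L * h \<le> e / 2" using 1 L0 by (auto simp: h_def field_simps)
      have "(\<lambda>n. (r n)\<^sup>2 / h\<^sup>2) \<longlonglongrightarrow> 0\<^sup>2 / h\<^sup>2" using h by (intro tendsto_intros r) auto
      then have "\<forall>\<^sub>F n in sequentially. (r n)\<^sup>2 / h\<^sup>2 < e / 2"
        by (rule order_tendstoD(2)) (use 1 in simp)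
      then have "\<forall>\<^sub>F n in sequentially. norm (b n - 0) < e"
      proof eventually_elim
        case (elim n)
        then show ?case using bK[OF h(1), of n] h(2) b0[of n] unfolding real_norm_def by linarith
      qed
      then show ?case by (simp add: eventually_sequentially)
    qed
  qed
qed

text \<open>The standard normal density is at most 1 because sqrt (2 pi) \<ge> 1, and dividing an
  interval of length h by sqrt v produces the Lipschitz constant 1 / sqrt v. This is where
  positivity of the variance enters.\<close>

lemma normal_law_cdf_lipschitz:
  assumes "distr N borel S = normal_law 0 v" "S \<in> borel_measurable N" "prob_space N" "v > 0" "h > 0"
  shows "measure N {\<omega> \<in> space N. S \<omega> \<le> z + h} \<le> measure N {\<omega> \<in> space N. S \<omega> \<le> z} + 1 / sqrt v * h"
proof -
  interpret N: prob_space N by fact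
  note [measurable] = assms(2)
  let ?m = "std_normal_distribution"
  interpret G: real_distribution ?m by (rule real_dist_normal_dist)
  have meas: "measure N {\<omega> \<in> space N. S \<omega> \<le> y} = measure ?m {..y / sqrt v}" for y
  proof -
    have "measure N {\<omega> \<in> space N. S \<omega> \<le> y} = measure (distr N borel S) {..y}"
      by (subst measure_distr) (auto simp: vimage_def Int_def conj_commute)
    also have "\<dots> = measure ?m ((\<lambda>x. 0 + sqrt v * x) -` {..y} \<inter> space ?m)"
      unfolding assms normal_law_def by (subst measure_distr) auto
    also have "(\<lambda>x. 0 + sqrt v * x) -` {..y} \<inter> space ?m = {..y / sqrt v}"
      using \<open>v > 0\<close> by (auto simp: field_simps)
    finally show ?thesis .
  qed
  have sd: "std_normal_density x \<le> 1" for x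
  proof -
    have "sqrt (2 * pi) \<ge> 1" using pi_gt3 by (intro real_le_rsqrt) simp
    then have "1 / sqrt (2 * pi) \<le> 1" by simp
    then show ?thesis unfolding std_normal_density_def by (intro mult_le_one) auto
  qed
  let ?a = "z / sqrt v" and ?b = "(z + h) / sqrt v"
  have ab: "?a \<le> ?b" using assms by (simp add: divide_right_mono)
  have "emeasure ?m {?a<..?b} = (\<integral>\<^sup>+x. ennreal (std_normal_density x) * indicator {?a<..?b} x \<partial>lborel)"
    by (simp add: emeasure_density)
  also have "\<dots> \<le> (\<integral>\<^sup>+x. indicator {?a<..?b} x \<partial>lborel)"
    using sd by (intro nn_integral_mono) (auto simp: indicator_def)
  also have "\<dots> = ennreal (?b - ?a)" using ab by simp
  finally have "measure ?m {?a<..?b} \<le> ?b - ?a"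
    using ab by (simp add: G.emeasure_eq_measure)
  moreover have "measure ?m {..?b} \<le> measure ?m {..?a} + measure ?m {?a<..?b}"
    by (rule order_trans[OF G.finite_measure_mono measure_Un_le]) auto
  moreover have "?b - ?a = 1 / sqrt v * h" by (simp add: diff_divide_distrib[symmetric])
  ultimately show ?thesis unfolding meas by linarith
qed

section \<open>Integration by parts for jointly Gaussian variables\<close>

lemma has_vector_derivative_quadratic_bound:
  fixes \<phi> :: "real \<Rightarrow> 'b::real_normed_vector"
  assumes "\<And>h. norm (\<phi> (x + h) - \<phi> x - h *\<^sub>R D) \<le> K * h\<^sup>2"
  shows "(\<phi> has_vector_derivative D) (at x)"
  unfolding has_vector_derivative_def has_derivative_at
proof (intro conjI bounded_linear_scaleR_left)
  show "(\<lambda>h. norm (\<phi> (x + h) - \<phi> x - h *\<^sub>R D) / norm h) \<midarrow>0\<rightarrow> 0"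
  proof (rule real_tendsto_sandwich[where f="\<lambda>_. 0"])
    show "((\<lambda>h. K * \<bar>h\<bar>) \<longlongrightarrow> 0) (at 0)" by (intro tendsto_eq_intros) auto
    show "\<forall>\<^sub>F h in at 0. norm (\<phi> (x + h) - \<phi> x - h *\<^sub>R D) / norm h \<le> K * \<bar>h\<bar>"
      using assms by (intro always_eventually allI) (auto simp: divide_le_eq power2_eq_square abs_mult_self_eq mult.assoc)
  qed auto
qed

lemma norm_iexp_quadratic: "norm (iexp x - 1 - \<i> * complex_of_real x) \<le> x\<^sup>2 / 2"
  using iexp_approx1[of x 1] by (simp add: numeral_2_eq_2 algebra_simps)

text \<open>Taking expectations in |e^{ix} - 1 - ix| \<le> x^2 / 2 leaves a remainder of at most h^2
  E[U^2] / 2, so a finite second moment is enough to differentiate under the expectation.\<close>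

lemma (in prob_space) has_vector_derivative_expectation_iexp:
  assumes [measurable]: "L \<in> borel_measurable M" "U \<in> borel_measurable M"
    and iU: "integrable M (\<lambda>\<omega>. (U \<omega>)\<^sup>2)"
  shows "((\<lambda>h. expectation (\<lambda>\<omega>. iexp (L \<omega> + h * U \<omega>))) has_vector_derivative
      expectation (\<lambda>\<omega>. \<i> * complex_of_real (U \<omega>) * iexp (L \<omega> + x * U \<omega>))) (at x)"
proof (rule has_vector_derivative_quadratic_bound[where K="expectation (\<lambda>\<omega>. (U \<omega>)\<^sup>2) / 2"])
  fix h
  have i1: "integrable M (\<lambda>\<omega>. iexp (L \<omega> + t * U \<omega>))" for t by (rule integrable_const_bound[of _ 1]) auto
  have i2: "integrable M (\<lambda>\<omega>. \<i> * complex_of_real (U \<omega>) * iexp (L \<omega> + x * U \<omega>))"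
  proof (rule Bochner_Integration.integrable_bound)
    show "integrable M U" by (rule square_integrable_imp_integrable) (use iU in auto)
  qed (auto simp: norm_mult)
  have "expectation A - expectation B - h *\<^sub>R expectation D = expectation (\<lambda>\<omega>. A \<omega> - B \<omega> - h *\<^sub>R D \<omega>)"
    if "integrable M A" "integrable M B" "integrable M D" for A B D :: "'a \<Rightarrow> complex"
    using that by simp
  note eq = this[OF i1[of "x + h"] i1[of x] i2]
  have pt: "norm (iexp (L \<omega> + (x + h) * U \<omega>) - iexp (L \<omega> + x * U \<omega>)
       - h *\<^sub>R (\<i> * complex_of_real (U \<omega>) * iexp (L \<omega> + x * U \<omega>))) \<le> (U \<omega>)\<^sup>2 * (h\<^sup>2 / 2)" for \<omega>
  proof -
    have "iexp (L \<omega> + (x + h) * U \<omega>) - iexp (L \<omega> + x * U \<omega>)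
       - h *\<^sub>R (\<i> * complex_of_real (U \<omega>) * iexp (L \<omega> + x * U \<omega>)) =
       iexp (L \<omega> + x * U \<omega>) * (iexp (h * U \<omega>) - 1 - \<i> * complex_of_real (h * U \<omega>))"
      by (simp add: scaleR_conv_of_real algebra_simps flip: exp_add)
    also have "norm \<dots> \<le> (h * U \<omega>)\<^sup>2 / 2"
      using norm_iexp_quadratic[of "h * U \<omega>"] by (simp only: norm_mult norm_exp_i_times mult_1)
    finally show ?thesis by (simp add: power_mult_distrib mult.commute)
  qed
  have "norm (expectation (\<lambda>\<omega>. iexp (L \<omega> + (x + h) * U \<omega>) - iexp (L \<omega> + x * U \<omega>)
       - h *\<^sub>R (\<i> * complex_of_real (U \<omega>) * iexp (L \<omega> + x * U \<omega>)))) \<le> expectation (\<lambda>\<omega>. (U \<omega>)\<^sup>2 * (h\<^sup>2 / 2))"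
  proof (rule order_trans[OF integral_norm_bound integral_mono])
    show "integrable M (\<lambda>\<omega>. norm (iexp (L \<omega> + (x + h) * U \<omega>) - iexp (L \<omega> + x * U \<omega>)
       - h *\<^sub>R (\<i> * complex_of_real (U \<omega>) * iexp (L \<omega> + x * U \<omega>))))"
      by (intro integrable_norm Bochner_Integration.integrable_diff integrable_scaleR_right i1 i2)
    show "integrable M (\<lambda>\<omega>. (U \<omega>)\<^sup>2 * (h\<^sup>2 / 2))" using iU by simp
  qed (rule pt)
  then show "norm (expectation (\<lambda>\<omega>. iexp (L \<omega> + (x + h) * U \<omega>)) - expectation (\<lambda>\<omega>. iexp (L \<omega> + x * U \<omega>))
      - h *\<^sub>R expectation (\<lambda>\<omega>. \<i> * complex_of_real (U \<omega>) * iexp (L \<omega> + x * U \<omega>))) \<le> expectation (\<lambda>\<omega>. (U \<omega>)\<^sup>2) / 2 * h\<^sup>2"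
    unfolding eq by simp
qed

section \<open>Polynomials and trigonometric polynomials with formal partial derivatives\<close>

text \<open>A polynomial function in the variables indexed by \<open>J\<close>, paired with its
  family of partial derivatives. Generating the pair syntactically lets growth bounds, limits,
  measurability and the substitution of sines all be proved by one induction, without any derivative
  calculus in several variables.\<close>

inductive pdiff :: "'i set \<Rightarrow> (('i \<Rightarrow> real) \<Rightarrow> real) \<Rightarrow> ('i \<Rightarrow> ('i \<Rightarrow> real) \<Rightarrow> real) \<Rightarrow> bool"
  for J :: "'i set" where
  const: "pdiff J (\<lambda>y. c) (\<lambda>b y. 0)"
| var: "a \<in> J \<Longrightarrow> pdiff J (\<lambda>y. y a) (\<lambda>b y. of_bool (b = a))"
| add: "pdiff J p dp \<Longrightarrow> pdiff J q dq \<Longrightarrow> pdiff J (\<lambda>y. p y + q y) (\<lambda>b y. dp b y + dq b y)"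
| mult: "pdiff J p dp \<Longrightarrow> pdiff J q dq \<Longrightarrow> pdiff J (\<lambda>y. p y * q y) (\<lambda>b y. dp b y * q y + p y * dq b y)"

lemma pdiff_cong:
  assumes "pdiff J p dp" "\<And>y. p y = p' y" "\<And>b y. dp b y = dp' b y" shows "pdiff J p' dp'"
proof -
  have "p = p'" "dp = dp'" by (intro ext assms(2,3))+
  with assms(1) show ?thesis by simp
qed

lemma pdiff_sum:
  assumes "finite A" "\<And>a. a \<in> A \<Longrightarrow> pdiff J (p a) (dp a)"
  shows "pdiff J (\<lambda>y. \<Sum>a\<in>A. p a y) (\<lambda>b y. \<Sum>a\<in>A. dp a b y)"
  using assms by (induction A rule: finite_induct) (auto intro: pdiff.intros)

lemma pdiff_cmult: "pdiff J p dp \<Longrightarrow> pdiff J (\<lambda>y. c * p y) (\<lambda>b y. c * dp b y)"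
  by (rule pdiff_cong[OF pdiff.mult[OF pdiff.const]]) auto

lemma pdiff_power:
  assumes "pdiff J p dp" shows "pdiff J (\<lambda>y. p y ^ k) (\<lambda>b y. real k * p y ^ (k - 1) * dp b y)"
proof (induction k)
  case 0 then show ?case by (rule pdiff_cong[OF pdiff.const[of _ 1]]) auto
next
  case (Suc k)
  show ?case by (rule pdiff_cong[OF pdiff.mult[OF assms Suc]]) (cases k; simp add: algebra_simps)+
qed

text \<open>Derivatives end up under expectations; this gives them the integrability and the limit
  theorems of polynomials.\<close>

lemma pdiff_deriv: "pdiff J p dp \<Longrightarrow> \<exists>dq. pdiff J (dp b) dq"
proof (induction rule: pdiff.induct)
  case (mult p dp q dq)
  then obtain r r' where "pdiff J (dp b) r" "pdiff J (dq b) r'" by blast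
  from pdiff.add[OF pdiff.mult[OF this(1) mult.hyps(2)] pdiff.mult[OF mult.hyps(1) this(2)]]
  show ?case by blast
qed (auto intro: pdiff.intros)

text \<open>Supplies the dominating functions of all later limits. The base is at least 1, so adding
  the two exponents works for sums as well as for products.\<close>

lemma pdiff_bound:
  assumes "finite J" "pdiff J p dp"
  shows "\<exists>K N. 0 \<le> K \<and> (\<forall>y. \<bar>p y\<bar> \<le> K * (1 + (\<Sum>b\<in>J. \<bar>y b\<bar>)) ^ N)"
  using assms(2)
proof (induction rule: pdiff.induct)
  case (const c)
  show ?case by (rule exI[of _ "\<bar>c\<bar>"], rule exI[of _ 0]) auto
next
  case (var a)
  have "\<bar>y a\<bar> \<le> 1 * (1 + (\<Sum>b\<in>J. \<bar>y b\<bar>)) ^ 1" for y :: "'a \<Rightarrow> real"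
    using member_le_sum[of a J "\<lambda>b. \<bar>y b\<bar>"] var assms(1) by simp
  then show ?case by (intro exI[of _ 1]) auto
next
  case (add p dp q dq)
  then obtain K N K' N' where 0: "0 \<le> K" "0 \<le> K'"
    and b: "\<And>y. \<bar>p y\<bar> \<le> K * (1 + (\<Sum>b\<in>J. \<bar>y b\<bar>)) ^ N" "\<And>y. \<bar>q y\<bar> \<le> K' * (1 + (\<Sum>b\<in>J. \<bar>y b\<bar>)) ^ N'" by auto
  have "\<bar>p y + q y\<bar> \<le> (K + K') * (1 + (\<Sum>b\<in>J. \<bar>y b\<bar>)) ^ (N + N')" for y
  proof -
    let ?R = "1 + (\<Sum>b\<in>J. \<bar>y b\<bar>)"
    have R: "1 \<le> ?R" by (simp add: sum_nonneg)
    have "K * ?R ^ N \<le> K * ?R ^ (N + N')" "K' * ?R ^ N' \<le> K' * ?R ^ (N + N')"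
      using 0 R by (auto intro!: mult_left_mono power_increasing)
    then show ?thesis using b[of y] by (simp only: distrib_right)
  qed
  with 0 show ?case by (intro exI[of _ "K + K'"] exI[of _ "N + N'"]) auto
next
  case (mult p dp q dq)
  then obtain K N K' N' where 0: "0 \<le> K" "0 \<le> K'"
    and b: "\<And>y. \<bar>p y\<bar> \<le> K * (1 + (\<Sum>b\<in>J. \<bar>y b\<bar>)) ^ N" "\<And>y. \<bar>q y\<bar> \<le> K' * (1 + (\<Sum>b\<in>J. \<bar>y b\<bar>)) ^ N'" by auto
  have "\<bar>p y * q y\<bar> \<le> (K * K') * (1 + (\<Sum>b\<in>J. \<bar>y b\<bar>)) ^ (N + N')" for y
  proof -
    have "\<bar>p y * q y\<bar> \<le> (K * (1 + (\<Sum>b\<in>J. \<bar>y b\<bar>)) ^ N) * (K' * (1 + (\<Sum>b\<in>J. \<bar>y b\<bar>)) ^ N')"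
      unfolding abs_mult by (rule mult_mono'[OF b]) auto
    then show ?thesis by (simp add: power_add mult_ac)
  qed
  with 0 show ?case by (intro exI[of _ "K * K'"] exI[of _ "N + N'"]) auto
qed

lemma pdiff_tendsto:
  assumes "pdiff J p dp" "\<And>b. b \<in> J \<Longrightarrow> ((\<lambda>n. z n b) \<longlongrightarrow> y b) F"
  shows "((\<lambda>n. p (z n)) \<longlongrightarrow> p y) F"
  using assms(1) by (induction rule: pdiff.induct) (auto intro!: tendsto_intros assms(2))

lemma pdiff_measurable:
  assumes "pdiff J p dp" "\<And>b. b \<in> J \<Longrightarrow> Z b \<in> borel_measurable M"
  shows "(\<lambda>\<omega>. p (\<lambda>b. Z b \<omega>)) \<in> borel_measurable M"
  using assms(1) by (induction rule: pdiff.induct) (auto intro!: assms(2) borel_measurable_add borel_measurable_times)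

text \<open>Complex trigonometric polynomials with their partial derivatives: the class on which
  integration by parts can be read off from the characteristic function. Its members are bounded, so
  integrability is automatic.\<close>

inductive trig :: "'i set \<Rightarrow> (('i \<Rightarrow> real) \<Rightarrow> complex) \<Rightarrow> ('i \<Rightarrow> ('i \<Rightarrow> real) \<Rightarrow> complex) \<Rightarrow> bool"
  for J :: "'i set" where
  exp: "trig J (\<lambda>y. iexp (\<Sum>b\<in>J. t b * y b)) (\<lambda>b y. \<i> * complex_of_real (t b) * iexp (\<Sum>b\<in>J. t b * y b))"
| add: "trig J G D \<Longrightarrow> trig J G' D' \<Longrightarrow> trig J (\<lambda>y. G y + G' y) (\<lambda>b y. D b y + D' b y)"
| cmult: "trig J G D \<Longrightarrow> trig J (\<lambda>y. z * G y) (\<lambda>b y. z * D b y)"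

lemma trig_cong:
  assumes "trig J G D" "\<And>y. G y = G' y" "\<And>b y. D b y = D' b y" shows "trig J G' D'"
proof -
  have "G = G'" "D = D'" by (intro ext assms(2,3))+
  with assms(1) show ?thesis by simp
qed

lemma trig_iexp_mult:
  assumes "trig J G D"
  shows "trig J (\<lambda>y. iexp (\<Sum>b\<in>J. s b * y b) * G y)
    (\<lambda>b y. \<i> * complex_of_real (s b) * iexp (\<Sum>b\<in>J. s b * y b) * G y + iexp (\<Sum>b\<in>J. s b * y b) * D b y)"
  using assms
proof (induction rule: trig.induct)
  case (exp t)
  show ?case
    by (rule trig_cong[OF trig.exp[of J "\<lambda>b. s b + t b"]])
      (simp_all add: distrib_right sum.distrib distrib_left exp_add)
next
  case (add G D G' D')
  show ?case by (rule trig_cong[OF trig.add[OF add.IH]]) (simp_all add: algebra_simps)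
next
  case (cmult G D z)
  show ?case by (rule trig_cong[OF trig.cmult[OF cmult.IH, of z]]) (simp_all add: algebra_simps)
qed

text \<open>Euler's formula writes the sine as a combination of the exponentials with frequencies s
  and -s in the variable a, and \<open>trig_iexp_mult\<close> handles each of them.\<close>

lemma trig_sin_mult:
  assumes G: "trig J G D" and a: "a \<in> J" and s: "s \<noteq> 0" and J: "finite J"
  shows "trig J (\<lambda>y. complex_of_real (sin (s * y a) / s) * G y)
    (\<lambda>b y. complex_of_real (of_bool (b = a) * cos (s * y b)) * G y + complex_of_real (sin (s * y a) / s) * D b y)"
proof -
  have S: "(\<Sum>b\<in>J. (if b = a then x else 0) * y b) = x * y a" for x :: real and y
    using a J by (simp add: if_distrib[of "\<lambda>x. x * _"] cong: if_cong)
  have sn: "complex_of_real (sin x) = (iexp x - iexp (- x)) * (- \<i> / 2)" for x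
    by (simp add: complex_eq_iff Re_exp Im_exp)
  have cs: "complex_of_real (cos x) = (iexp x + iexp (- x)) / 2" for x
    by (simp add: complex_eq_iff Re_exp Im_exp)
  have T: "trig J (\<lambda>y. iexp (x * y a) * G y)
    (\<lambda>b y. \<i> * complex_of_real (if b = a then x else 0) * iexp (x * y a) * G y + iexp (x * y a) * D b y)" for x
    using trig_iexp_mult[OF G, of "\<lambda>b. if b = a then x else 0"] unfolding S .
  show ?thesis
    by (rule trig_cong[OF trig.add[OF trig.cmult[OF T[of s], of "- \<i> / (2 * s)"] trig.cmult[OF T[of "- s"], of "\<i> / (2 * s)"]]])
      (use s in \<open>auto simp: sn cs field_simps\<close>)
qed

text \<open>Substituting sin(s y_b) / s for y_b turns a polynomial into a trigonometric polynomial;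
  the cosine is the inner derivative of the chain rule. As s tends to 0 the substitution becomes the
  identity.\<close>

lemma trig_pdiff_mult:
  assumes J: "finite J" and p: "pdiff J p dp" and G: "trig J G D" and s: "s \<noteq> 0"
  shows "trig J (\<lambda>y. complex_of_real (p (\<lambda>b. sin (s * y b) / s)) * G y)
    (\<lambda>b y. complex_of_real (dp b (\<lambda>b. sin (s * y b) / s) * cos (s * y b)) * G y
        + complex_of_real (p (\<lambda>b. sin (s * y b) / s)) * D b y)"
  using p G
proof (induction arbitrary: G D rule: pdiff.induct)
  case (const c)
  show ?case by (rule trig_cong[OF trig.cmult[OF const]]) auto
next
  case (var a)
  show ?case by (rule trig_cong[OF trig_sin_mult[OF var(2,1) s J]]) auto
next
  case (add p dp q dq)
  show ?case by (rule trig_cong[OF trig.add[OF add.IH(1)[OF add.prems] add.IH(2)[OF add.prems]]]) (simp_all add: algebra_simps)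
next
  case (mult p dp q dq)
  show ?case by (rule trig_cong[OF mult.IH(1)[OF mult.IH(2)[OF mult.prems]]]) (simp_all add: algebra_simps)
qed

lemma trig_bounded: "trig J G D \<Longrightarrow> \<exists>K. \<forall>y. norm (G y) \<le> K"
proof (induction rule: trig.induct)
  case (exp t)
  show ?case by (rule exI[of _ 1]) simp
next
  case (add G D G' D')
  then obtain K K' where "\<And>y. norm (G y) \<le> K" "\<And>y. norm (G' y) \<le> K'" by auto
  then show ?case by (intro exI[of _ "K + K'"]) (auto intro!: norm_triangle_le add_mono)
next
  case (cmult G D z)
  then obtain K where "\<And>y. norm (G y) \<le> K" by auto
  then show ?case by (intro exI[of _ "norm z * K"]) (auto simp: norm_mult intro!: mult_left_mono)
qed

lemma trig_deriv: "trig J G D \<Longrightarrow> \<exists>D'. trig J (D b) D'"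
proof (induction rule: trig.induct)
  case (exp t)
  show ?case using trig.cmult[OF trig.exp, of J "\<i> * complex_of_real (t b)" t] by blast
qed (auto intro: trig.intros)

lemma trig_measurable:
  assumes "trig J G D" "\<And>b. b \<in> J \<Longrightarrow> Z b \<in> borel_measurable M"
  shows "(\<lambda>\<omega>. G (\<lambda>b. Z b \<omega>)) \<in> borel_measurable M"
  using assms(1)
proof (induction rule: trig.induct)
  case (exp t)
  have [measurable]: "(\<lambda>\<omega>. \<Sum>b\<in>J. t b * Z b \<omega>) \<in> borel_measurable M"
    by (intro borel_measurable_sum borel_measurable_times assms(2) borel_measurable_const)
  show ?case by measurable
qed auto

text \<open>Joint Gaussianity is encoded by characteristic functions with the quadratic form of
  \<open>c\<close>, so that degenerate covariances are included. The marginal law is recorded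
  separately because it yields all moments at once.\<close>

locale gaussian_family = prob_space M for M :: "'a measure" +
  fixes Y :: "'i \<Rightarrow> 'a \<Rightarrow> real" and c :: "'i \<Rightarrow> 'i \<Rightarrow> real"
  assumes Y_measurable [measurable]: "Y b \<in> borel_measurable M"
    and Y_std_normal: "distr M borel (Y b) = std_normal_distribution"
    and Y_char: "finite J \<Longrightarrow> expectation (\<lambda>\<omega>. iexp (\<Sum>b\<in>J. t b * Y b \<omega>)) =
      complex_of_real (exp (- (\<Sum>a\<in>J. \<Sum>b\<in>J. t a * t b * c a b) / 2))"
    and c_sym: "c a b = c b a"
begin

definition vec :: "'a \<Rightarrow> 'i \<Rightarrow> real" where "vec \<omega> = (\<lambda>b. Y b \<omega>)"

lemma integrable_Y_power: "integrable M (\<lambda>\<omega>. \<bar>Y b \<omega>\<bar> ^ k)"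
proof -
  have "integrable std_normal_distribution (\<lambda>x. \<bar>x ^ k\<bar>)"
    using integrable_std_normal_distribution_moment by (rule integrable_abs)
  then have "integrable (distr M borel (Y b)) (\<lambda>x. \<bar>x\<bar> ^ k)" by (simp add: Y_std_normal power_abs)
  then show ?thesis by (subst (asm) integrable_distr_eq) auto
qed

lemma integrable_dominating:
  assumes "finite J" shows "integrable M (\<lambda>\<omega>. (1 + (\<Sum>b\<in>J. \<bar>Y b \<omega>\<bar>)) ^ N)"
  using assms
proof (induction J rule: finite_induct)
  case (insert a J)
  show ?case
  proof (rule Bochner_Integration.integrable_bound)
    show "integrable M (\<lambda>\<omega>. 2 ^ N * ((1 + (\<Sum>b\<in>J. \<bar>Y b \<omega>\<bar>)) ^ N + \<bar>Y a \<omega>\<bar> ^ N))"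
      using insert.IH integrable_Y_power by auto
    have "norm ((1 + (\<Sum>b\<in>insert a J. \<bar>Y b \<omega>\<bar>)) ^ N) \<le> norm (2 ^ N * ((1 + (\<Sum>b\<in>J. \<bar>Y b \<omega>\<bar>)) ^ N + \<bar>Y a \<omega>\<bar> ^ N))" for \<omega>
    proof -
      define R A where "R = 1 + (\<Sum>b\<in>J. \<bar>Y b \<omega>\<bar>)" and "A = \<bar>Y a \<omega>\<bar>"
      have 0: "0 \<le> R" "0 \<le> A" by (auto simp: R_def A_def sum_nonneg add_nonneg_nonneg)
      have "(R + A) ^ N \<le> (2 * max R A) ^ N" using 0 by (intro power_mono) auto
      also have "\<dots> = 2 ^ N * max R A ^ N" by (simp add: power_mult_distrib)
      also have "\<dots> \<le> 2 ^ N * (R ^ N + A ^ N)" using 0 by (intro mult_left_mono) (auto simp: max_def)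
      finally have le: "(R + A) ^ N \<le> 2 ^ N * (R ^ N + A ^ N)" .
      have "1 + (\<Sum>b\<in>insert a J. \<bar>Y b \<omega>\<bar>) = R + A" using insert.hyps by (simp add: R_def A_def)
      then show ?thesis using le 0 unfolding R_def[symmetric] A_def[symmetric] by simp
    qed
    then show "AE \<omega> in M. norm ((1 + (\<Sum>b\<in>insert a J. \<bar>Y b \<omega>\<bar>)) ^ N) \<le> norm (2 ^ N * ((1 + (\<Sum>b\<in>J. \<bar>Y b \<omega>\<bar>)) ^ N + \<bar>Y a \<omega>\<bar> ^ N))"
      by simp
  qed simp
qed simp

lemma pdiff_vec_measurable: "pdiff J p dp \<Longrightarrow> (\<lambda>\<omega>. p (vec \<omega>)) \<in> borel_measurable M"
  unfolding vec_def by (rule pdiff_measurable) auto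

lemma integrable_pdiff:
  assumes "finite J" "pdiff J p dp" shows "integrable M (\<lambda>\<omega>. p (vec \<omega>))"
proof -
  obtain K N where "\<And>y. \<bar>p y\<bar> \<le> K * (1 + (\<Sum>b\<in>J. \<bar>y b\<bar>)) ^ N" using pdiff_bound[OF assms] by auto
  then have "norm (p (vec \<omega>)) \<le> norm (K * (1 + (\<Sum>b\<in>J. \<bar>Y b \<omega>\<bar>)) ^ N)" for \<omega>
    unfolding vec_def real_norm_def by (meson abs_ge_self order_trans)
  then show ?thesis
    using assms pdiff_vec_measurable
    by (intro Bochner_Integration.integrable_bound[OF integrable_mult_right[OF integrable_dominating[OF assms(1)]]]) auto
qed

lemma integrable_pdiff_mult_bounded:
  fixes g :: "'a \<Rightarrow> complex"
  assumes "finite J" "pdiff J p dp" "g \<in> borel_measurable M" "\<And>\<omega>. norm (g \<omega>) \<le> 1"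
  shows "integrable M (\<lambda>\<omega>. complex_of_real (p (vec \<omega>)) * g \<omega>)"
proof (rule Bochner_Integration.integrable_bound[OF integrable_pdiff[OF assms(1,2)]])
  show "(\<lambda>\<omega>. complex_of_real (p (vec \<omega>)) * g \<omega>) \<in> borel_measurable M"
    using assms(3) pdiff_vec_measurable[OF assms(2)] by measurable
  have "norm (complex_of_real (p (vec \<omega>)) * g \<omega>) \<le> norm (p (vec \<omega>))" for \<omega>
    using assms(4)[of \<omega>] by (simp add: norm_mult mult_left_le)
  then show "AE \<omega> in M. norm (complex_of_real (p (vec \<omega>)) * g \<omega>) \<le> norm (p (vec \<omega>))" by simp
qed

text \<open>For an exponential e^{iL}, the function h \<mapsto> E[e^{i(L + h Y_a)}] is
  differentiated at 0 in two ways. Under the expectation this gives i E[Y_a e^{iL}]; from the closed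
  form it gives -B e^{-Q/2}, where B is the covariance of Y_a with L. Linearity does the
  rest.\<close>

lemma ibp_trig:
  assumes J: "finite J" and "trig J G D" and a: "a \<in> J"
  shows "expectation (\<lambda>\<omega>. complex_of_real (Y a \<omega>) * G (vec \<omega>)) =
    (\<Sum>b\<in>J. complex_of_real (c a b) * expectation (\<lambda>\<omega>. D b (vec \<omega>)))"
proof -
  have iY: "integrable M (Y a)" using integrable_Y_power[of a 1] by (simp add: integrable_abs_iff)
  have meas: "(\<lambda>\<omega>. G (vec \<omega>)) \<in> borel_measurable M" if "trig J G D" for G D
    using trig_measurable[OF that, of Y M] by (simp add: vec_def)
  have i1: "integrable M (\<lambda>\<omega>. G (vec \<omega>))" if t: "trig J G D" for G D
  proof -
    obtain K where "\<And>y. norm (G y) \<le> K" using trig_bounded[OF t] by auto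
    then show ?thesis using meas[OF t] by (intro integrable_const_bound[of _ K]) auto
  qed
  have i2: "integrable M (\<lambda>\<omega>. complex_of_real (Y a \<omega>) * G (vec \<omega>))" if t: "trig J G D" for G D
  proof -
    obtain K where K: "\<And>y. norm (G y) \<le> K" using trig_bounded[OF t] by auto
    show ?thesis
    proof (rule Bochner_Integration.integrable_bound[where f="\<lambda>\<omega>. K * Y a \<omega>"])
      show "(\<lambda>\<omega>. complex_of_real (Y a \<omega>) * G (vec \<omega>)) \<in> borel_measurable M" using meas[OF t] by measurable
      have "norm (complex_of_real (Y a \<omega>) * G (vec \<omega>)) \<le> norm (K * Y a \<omega>)" for \<omega>
        using mult_right_mono[OF order_trans[OF K[of "vec \<omega>"] abs_ge_self[of K]] abs_ge_zero[of "Y a \<omega>"]]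
        by (simp add: norm_mult abs_mult mult.commute)
      then show "AE \<omega> in M. norm (complex_of_real (Y a \<omega>) * G (vec \<omega>)) \<le> norm (K * Y a \<omega>)" by simp
    qed (use iY in simp)
  qed
  show ?thesis using assms(2)
  proof (induction rule: trig.induct)
    case (exp t)
    define L where "L \<omega> = (\<Sum>b\<in>J. t b * Y b \<omega>)" for \<omega>
    have [measurable]: "L \<in> borel_measurable M" unfolding L_def by measurable
    define Q B where "Q = (\<Sum>a\<in>J. \<Sum>b\<in>J. t a * t b * c a b)" and "B = (\<Sum>b\<in>J. c a b * t b)"
    \<comment> \<open>Moving the coefficient vector by h in direction a expands the quadratic form;
      the two mixed sums are equal because \<open>c\<close> is symmetric.\<close>
    have ch: "expectation (\<lambda>\<omega>. iexp (L \<omega> + h * Y a \<omega>)) = complex_of_real (exp (- (Q + 2 * h * B + h\<^sup>2 * c a a) / 2))" for h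
    proof -
      let ?e = "\<lambda>b. if b = a then h else 0"
      have e: "(\<Sum>b\<in>J. ?e b * g b) = h * g a" for g :: "'i \<Rightarrow> real"
        using a J by (simp add: if_distrib[of "\<lambda>x. x * _"] cong: if_cong)
      have "(\<Sum>b\<in>J. (t b + ?e b) * Y b \<omega>) = L \<omega> + h * Y a \<omega>" for \<omega>
        by (simp add: distrib_right sum.distrib e L_def)
      then have "expectation (\<lambda>\<omega>. iexp (L \<omega> + h * Y a \<omega>)) =
          complex_of_real (exp (- (\<Sum>a\<in>J. \<Sum>b\<in>J. (t a + ?e a) * (t b + ?e b) * c a b) / 2))"
        using Y_char[OF J, of "\<lambda>b. t b + ?e b"] by simp
      also have "(\<Sum>a\<in>J. \<Sum>b\<in>J. (t a + ?e a) * (t b + ?e b) * c a b) = Q + 2 * h * B + h\<^sup>2 * c a a"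
      proof -
        have "(\<Sum>x\<in>J. \<Sum>b\<in>J. (t x + ?e x) * (t b + ?e b) * c x b) =
          (\<Sum>x\<in>J. \<Sum>b\<in>J. t x * t b * c x b) + (\<Sum>x\<in>J. \<Sum>b\<in>J. ?e b * (t x * c x b)) +
          ((\<Sum>x\<in>J. ?e x * (\<Sum>b\<in>J. t b * c x b)) + (\<Sum>x\<in>J. ?e x * (\<Sum>b\<in>J. ?e b * c x b)))"
          unfolding sum_distrib_left sum.distrib[symmetric]
          by (intro sum.cong refl) (simp only: algebra_simps)
        also have "\<dots> = Q + h * (\<Sum>x\<in>J. t x * c x a) + (h * (\<Sum>b\<in>J. t b * c a b) + h * (h * c a a))"
          unfolding e by (simp add: Q_def sum_distrib_left)
        moreover have "(\<Sum>x\<in>J. t x * c x a) = B" "(\<Sum>b\<in>J. t b * c a b) = B"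
          unfolding B_def by (rule sum.cong[OF refl], metis c_sym mult.commute)+
        ultimately show ?thesis by (simp add: power2_eq_square)
      qed
      finally show ?thesis .
    qed
    have d1: "((\<lambda>h. expectation (\<lambda>\<omega>. iexp (L \<omega> + h * Y a \<omega>))) has_vector_derivative
      expectation (\<lambda>\<omega>. \<i> * complex_of_real (Y a \<omega>) * iexp (L \<omega> + 0 * Y a \<omega>))) (at 0)"
      using integrable_Y_power[of a 2] by (intro has_vector_derivative_expectation_iexp) auto
    have "((\<lambda>h. exp (- (Q + 2 * h * B + h\<^sup>2 * c a a) / 2)) has_real_derivative - B * exp (- Q / 2)) (at 0)"
      by (auto intro!: derivative_eq_intros)
    then have d2: "((\<lambda>h. complex_of_real (exp (- (Q + 2 * h * B + h\<^sup>2 * c a a) / 2))) has_vector_derivative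
        complex_of_real (- B * exp (- Q / 2))) (at 0)"
      by (intro has_vector_derivative_of_real) (simp add: has_real_derivative_iff_has_vector_derivative)
    from vector_derivative_unique_at[OF d1[unfolded ch] d2]
    have "\<i> * expectation (\<lambda>\<omega>. complex_of_real (Y a \<omega>) * iexp (L \<omega>)) = complex_of_real (- B * exp (- Q / 2))"
      by (simp add: mult.assoc)
    then have 1: "expectation (\<lambda>\<omega>. complex_of_real (Y a \<omega>) * iexp (L \<omega>)) = \<i> * complex_of_real (B * exp (- Q / 2))"
      by (simp add: complex_eq_iff)
    have 2: "expectation (\<lambda>\<omega>. iexp (L \<omega>)) = complex_of_real (exp (- Q / 2))" using ch[of 0] by simp
    have "(\<Sum>b\<in>J. complex_of_real (c a b) * expectation (\<lambda>\<omega>. \<i> * complex_of_real (t b) * iexp (L \<omega>))) =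
        \<i> * complex_of_real (B * exp (- Q / 2))"
      by (simp add: 2 B_def sum_distrib_left sum_distrib_right mult_ac)
    with 1 show ?case by (simp add: L_def vec_def)
  next
    case (add G D G' D')
    have "expectation (\<lambda>\<omega>. complex_of_real (Y a \<omega>) * (G (vec \<omega>) + G' (vec \<omega>))) =
      expectation (\<lambda>\<omega>. complex_of_real (Y a \<omega>) * G (vec \<omega>)) + expectation (\<lambda>\<omega>. complex_of_real (Y a \<omega>) * G' (vec \<omega>))"
      using i2 add.hyps by (simp add: distrib_left)
    moreover have "expectation (\<lambda>\<omega>. D b (vec \<omega>) + D' b (vec \<omega>)) = expectation (\<lambda>\<omega>. D b (vec \<omega>)) + expectation (\<lambda>\<omega>. D' b (vec \<omega>))" for b
    proof -
      have "integrable M (\<lambda>\<omega>. D b (vec \<omega>))" "integrable M (\<lambda>\<omega>. D' b (vec \<omega>))"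
        using trig_deriv[OF add.hyps(1), of b] trig_deriv[OF add.hyps(2), of b] i1 by blast+
      then show ?thesis by simp
    qed
    ultimately show ?case using add.IH by (simp add: distrib_left sum.distrib)
  next
    case (cmult G D z)
    then show ?case by (simp add: mult.left_commute[of _ z] sum_distrib_left)
  qed
qed

end

section \<open>Taylor polynomials of the exponential at bounded arguments\<close>

lemma trig_const: "trig J (\<lambda>y. 1) (\<lambda>b y. 0)"
  by (rule trig_cong[OF trig.exp[of J "\<lambda>_. 0"]]) auto

lemma trig_sum:
  assumes "finite A" "\<And>k. k \<in> A \<Longrightarrow> trig J (G k) (D k)"
  shows "trig J (\<lambda>y. \<Sum>k\<in>A. G k y) (\<lambda>b y. \<Sum>k\<in>A. D k b y)"
  using assms
proof (induction A rule: finite_induct)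
  case empty
  show ?case by (rule trig_cong[OF trig.cmult[OF trig_const, where z=0]]) auto
qed (auto intro: trig.intros)

lemma pdiff_bounded_on:
  assumes "finite J" "pdiff J p dp"
  obtains B where "0 \<le> B" "\<And>y. (\<And>b. b \<in> J \<Longrightarrow> \<bar>y b\<bar> \<le> r) \<Longrightarrow> \<bar>p y\<bar> \<le> B"
proof -
  obtain K N where K: "0 \<le> K" "\<And>y. \<bar>p y\<bar> \<le> K * (1 + (\<Sum>b\<in>J. \<bar>y b\<bar>)) ^ N" using pdiff_bound[OF assms] by auto
  have "\<bar>p y\<bar> \<le> K * (1 + (\<Sum>b\<in>J. \<bar>r\<bar>)) ^ N" if "\<And>b. b \<in> J \<Longrightarrow> \<bar>y b\<bar> \<le> r" for y
  proof -
    have "(\<Sum>b\<in>J. \<bar>y b\<bar>) \<le> (\<Sum>b\<in>J. \<bar>r\<bar>)" using that by (intro sum_mono) (meson abs_ge_self order_trans)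
    then have "K * (1 + (\<Sum>b\<in>J. \<bar>y b\<bar>)) ^ N \<le> K * (1 + (\<Sum>b\<in>J. \<bar>r\<bar>)) ^ N"
      using K(1) by (intro mult_left_mono power_mono) (auto intro!: sum_nonneg add_nonneg_nonneg)
    with K(2)[of y] show ?thesis by linarith
  qed
  then show ?thesis using K(1) by (intro that[of "K * (1 + (\<Sum>b\<in>J. \<bar>r\<bar>)) ^ N"]) (auto intro!: mult_nonneg_nonneg)
qed

text \<open>The exponential of a nonlinear expression in sines is not a trigonometric polynomial,
  but its Taylor polynomials are, which is why they stand in for it.\<close>

definition iexp_poly :: "nat \<Rightarrow> real \<Rightarrow> complex" where
  "iexp_poly K x = (\<Sum>k\<le>K. (\<i> * complex_of_real x) ^ k / fact k)"

lemma iexp_poly_approx: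
  assumes "\<bar>x\<bar> \<le> r" shows "norm (iexp_poly K x - iexp x) \<le> 2 * r ^ K / fact K"
proof -
  have "norm (iexp_poly K x - iexp x) = norm (iexp x - iexp_poly K x)" by (rule norm_minus_commute)
  also have "\<dots> \<le> 2 * \<bar>x\<bar> ^ K / fact K"
    using iexp_approx2[of x K] unfolding iexp_poly_def by simp
  also have "\<dots> \<le> 2 * r ^ K / fact K"
    using assms by (intro divide_right_mono mult_left_mono power_mono) auto
  finally show ?thesis .
qed

lemma power_over_fact_tendsto: "(\<lambda>K. 2 * r ^ K / fact K) \<longlonglongrightarrow> (0::real)"
proof -
  have "(\<lambda>K. 2 * (r ^ K / fact K)) \<longlonglongrightarrow> 2 * 0"
    by (intro tendsto_mult tendsto_const)
      (use summable_LIMSEQ_zero[OF summable_exp[of r]] in \<open>simp add: field_simps\<close>)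
  then show ?thesis by simp
qed

lemma iexp_poly_tendsto: "(\<lambda>K. iexp_poly K x) \<longlonglongrightarrow> iexp x"
  by (rule Lim_transform[OF tendsto_const], rule Lim_null_comparison[OF always_eventually power_over_fact_tendsto[of "\<bar>x\<bar>"]])
    (use iexp_poly_approx in auto)

text \<open>The bound is uniform in the degree, as dominated convergence in the degree
  requires.\<close>

lemma iexp_poly_bounded:
  obtains B where "\<And>K x. \<bar>x\<bar> \<le> r \<Longrightarrow> norm (iexp_poly K x) \<le> B"
proof -
  obtain B where B: "\<And>K. norm (2 * r ^ K / fact K) \<le> B"
    using convergent_imp_Bseq[OF convergentI[OF power_over_fact_tendsto[of r]]] unfolding Bseq_def by auto
  show ?thesis
  proof (rule that[of "1 + B"])
    fix K x assume x: "\<bar>x\<bar> \<le> r"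
    have "norm (iexp_poly K x) \<le> norm (iexp x) + norm (iexp_poly K x - iexp x)"
      by (rule norm_triangle_sub)
    also have "\<dots> \<le> 1 + B"
      using iexp_poly_approx[OF x, of K] B[of K] unfolding norm_exp_i_times real_norm_def by linarith
    finally show "norm (iexp_poly K x) \<le> 1 + B" .
  qed
qed

text \<open>Differentiating a Taylor polynomial of e^{iux} lowers its degree by one, hence
  \<open>Suc K\<close> on the left against \<open>K\<close> on the right.\<close>

lemma iexp_poly_deriv_sum:
  "(\<Sum>k\<le>Suc K. (\<i> * complex_of_real u) ^ k / fact k * complex_of_real (real k * x ^ (k - 1)))
    = \<i> * complex_of_real u * iexp_poly K (u * x)"
proof -
  have "(\<Sum>k\<le>Suc K. (\<i> * complex_of_real u) ^ k / fact k * complex_of_real (real k * x ^ (k - 1))) =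
    (\<Sum>k\<le>K. (\<i> * complex_of_real u) ^ Suc k / fact (Suc k) * complex_of_real (real (Suc k) * x ^ k))"
    by (subst sum.atMost_Suc_shift) simp
  also have "\<dots> = \<i> * complex_of_real u * iexp_poly K (u * x)"
    unfolding iexp_poly_def sum_distrib_left
  proof (intro sum.cong refl)
    fix k
    have "complex_of_real (real (Suc k)) / fact (Suc k) = 1 / fact k"
      unfolding fact_Suc of_real_of_nat_eq by (simp del: of_nat_Suc)
    moreover have "(\<i> * complex_of_real u) ^ Suc k / fact (Suc k) * complex_of_real (real (Suc k) * x ^ k) =
      complex_of_real (real (Suc k)) / fact (Suc k) * (\<i> * complex_of_real u * ((\<i> * complex_of_real u) ^ k * complex_of_real x ^ k))"
      by (simp del: fact_Suc of_nat_Suc)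
    ultimately show "(\<i> * complex_of_real u) ^ Suc k / fact (Suc k) * complex_of_real (real (Suc k) * x ^ k) =
      \<i> * complex_of_real u * ((\<i> * complex_of_real (u * x)) ^ k / fact k)"
      by (simp only:) (simp add: power_mult_distrib)
  qed
  finally show ?thesis .
qed

lemma sin_quotient_tendsto:
  assumes "s \<longlonglongrightarrow> 0" "\<And>n. s n \<noteq> 0"
  shows "(\<lambda>n. sin (s n * y) / s n) \<longlonglongrightarrow> (y::real)"
proof -
  have "((\<lambda>x. sin (x * y)) has_real_derivative y) (at 0)" by (auto intro!: derivative_eq_intros)
  then have "(\<lambda>h. (sin ((0 + h) * y) - sin (0 * y)) / h) \<midarrow>0\<rightarrow> y" unfolding DERIV_def .
  then have *: "(\<lambda>h. sin (h * y) / h) \<midarrow>0\<rightarrow> y" by simp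
  have "filterlim s (at 0) sequentially" using assms by (intro filterlim_atI) auto
  from filterlim_compose[OF * this] show ?thesis .
qed

section \<open>Integration by parts for polynomials times exponentials of polynomials\<close>

context gaussian_family
begin

text \<open>With sines in place of the variables, q(Z) takes values in a bounded set, where the
  Taylor polynomials of the exponential are bounded uniformly in the degree. So
  \<open>ibp_trig\<close> applies to each of them and dominated convergence passes to the
  exponential.\<close>

lemma ibp_sin:
  assumes J: "finite J" and a: "a \<in> J" and p: "pdiff J p dp" and q: "pdiff J q dq" and s: "s \<noteq> 0"
  defines "Z \<equiv> \<lambda>\<omega> b. sin (s * Y b \<omega>) / s"
  shows "expectation (\<lambda>\<omega>. complex_of_real (Y a \<omega> * p (Z \<omega>)) * iexp (u * q (Z \<omega>))) =
    (\<Sum>b\<in>J. complex_of_real (c a b) *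
      (expectation (\<lambda>\<omega>. complex_of_real (cos (s * Y b \<omega>) * dp b (Z \<omega>)) * iexp (u * q (Z \<omega>))) +
       \<i> * complex_of_real u *
       expectation (\<lambda>\<omega>. complex_of_real (cos (s * Y b \<omega>) * (p (Z \<omega>) * dq b (Z \<omega>))) * iexp (u * q (Z \<omega>)))))"
proof -
  have Zb: "\<bar>Z \<omega> b\<bar> \<le> 1 / \<bar>s\<bar>" for \<omega> b
    using abs_sin_le_one[of "s * Y b \<omega>"] s by (simp add: Z_def divide_right_mono)
  have Zm: "(\<lambda>\<omega>. r (Z \<omega>)) \<in> borel_measurable M" if "pdiff J r dr" for r dr
    unfolding Z_def using that by (rule pdiff_measurable[where Z="\<lambda>b \<omega>. sin (s * Y b \<omega>) / s"]) simp
  obtain Bq where Bq: "0 \<le> Bq" "\<And>y. (\<And>b. b \<in> J \<Longrightarrow> \<bar>y b\<bar> \<le> 1 / \<bar>s\<bar>) \<Longrightarrow> \<bar>q y\<bar> \<le> Bq"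
    using pdiff_bounded_on[OF J q] by blast
  have uq: "\<bar>u * q (Z \<omega>)\<bar> \<le> \<bar>u\<bar> * Bq" for \<omega>
    using Bq Zb by (auto simp: abs_mult intro!: mult_left_mono)
  obtain E where E: "\<And>K x. \<bar>x\<bar> \<le> \<bar>u\<bar> * Bq \<Longrightarrow> norm (iexp_poly K x) \<le> E"
    using iexp_poly_bounded by blast
  \<comment> \<open>The weight \<open>h\<close> is Y_a on the left of the formula and a cosine on
    the right; the common majorant 1 + |Y_a| treats both at once.\<close>
  have lim: "(\<lambda>K. expectation (\<lambda>\<omega>. complex_of_real (h \<omega> * r (Z \<omega>)) * iexp_poly (f K) (u * q (Z \<omega>))))
      \<longlonglongrightarrow> expectation (\<lambda>\<omega>. complex_of_real (h \<omega> * r (Z \<omega>)) * iexp (u * q (Z \<omega>)))" 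
    (is ?L) and int: "integrable M (\<lambda>\<omega>. complex_of_real (h \<omega> * r (Z \<omega>)) * iexp_poly k (u * q (Z \<omega>)))" (is ?I)
    if h: "h \<in> borel_measurable M" "\<And>\<omega>. \<bar>h \<omega>\<bar> \<le> 1 + \<bar>Y a \<omega>\<bar>" and r: "pdiff J r dr"
     and f: "filterlim f sequentially sequentially" for h r dr f k
  proof -
    obtain B where B: "0 \<le> B" "\<And>y. (\<And>b. b \<in> J \<Longrightarrow> \<bar>y b\<bar> \<le> 1 / \<bar>s\<bar>) \<Longrightarrow> \<bar>r y\<bar> \<le> B"
      using pdiff_bounded_on[OF J r] by blast
    note [measurable] = h(1) Zm[OF r] Zm[OF q]
    have [measurable]: "iexp_poly K \<in> borel_measurable borel" for K unfolding iexp_poly_def by measurable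
    have E0: "0 \<le> E" using order_trans[OF norm_ge_zero E[of 0 0]] Bq(1) by simp
    have "integrable M (\<lambda>\<omega>. \<bar>Y a \<omega>\<bar>)" using integrable_Y_power[of a 1] by simp
    then have w: "integrable M (\<lambda>\<omega>. (1 + \<bar>Y a \<omega>\<bar>) * B * E)" by auto
    have dom: "norm (complex_of_real (h \<omega> * r (Z \<omega>)) * iexp_poly K (u * q (Z \<omega>))) \<le> (1 + \<bar>Y a \<omega>\<bar>) * B * E" for K \<omega>
      unfolding norm_mult norm_of_real abs_mult using h B Zb E uq E0
      by (intro mult_mono) auto
    show ?L
    proof (rule integral_dominated_convergence[OF _ _ w])
      show "AE \<omega> in M. (\<lambda>K. complex_of_real (h \<omega> * r (Z \<omega>)) * iexp_poly (f K) (u * q (Z \<omega>))) \<longlonglongrightarrow>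
          complex_of_real (h \<omega> * r (Z \<omega>)) * iexp (u * q (Z \<omega>))"
        by (intro AE_I2 tendsto_mult tendsto_const filterlim_compose[OF iexp_poly_tendsto f])
    qed (use dom in auto)
    show ?I
      by (rule Bochner_Integration.integrable_bound[OF w]) (simp, intro AE_I2, unfold real_norm_def, rule order_trans[OF dom abs_ge_self])
  qed
  \<comment> \<open>The range up to \<open>Suc K\<close> leaves a Taylor polynomial of degree
    \<open>K\<close> after differentiation. The trailing factors 1 and 0 are the constant function 1
    and its derivative, in the shape in which \<open>trig_pdiff_mult\<close> returns the
    product.\<close>
  define G where "G K y = (\<Sum>k\<le>Suc K. (\<i> * complex_of_real u) ^ k / fact k *
      (complex_of_real (p (\<lambda>b. sin (s * y b) / s) * q (\<lambda>b. sin (s * y b) / s) ^ k) * 1))" for K and y :: "'i \<Rightarrow> real"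
  define D where "D K b y = (\<Sum>k\<le>Suc K. (\<i> * complex_of_real u) ^ k / fact k *
      (complex_of_real ((dp b (\<lambda>b. sin (s * y b) / s) * q (\<lambda>b. sin (s * y b) / s) ^ k +
         p (\<lambda>b. sin (s * y b) / s) * (real k * q (\<lambda>b. sin (s * y b) / s) ^ (k - 1) * dq b (\<lambda>b. sin (s * y b) / s))) * cos (s * y b)) * 1
        + complex_of_real (p (\<lambda>b. sin (s * y b) / s) * q (\<lambda>b. sin (s * y b) / s) ^ k) * 0))" for K b and y :: "'i \<Rightarrow> real"
  have "trig J (G K) (D K)" for K
    unfolding G_def D_def
    by (intro trig_sum trig.cmult trig_pdiff_mult[OF J pdiff.mult[OF p pdiff_power[OF q]] trig_const s]) simp
  note ibp = ibp_trig[OF J this a]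
  have G: "G K (vec \<omega>) = complex_of_real (p (Z \<omega>)) * iexp_poly (Suc K) (u * q (Z \<omega>))" for K \<omega>
    by (simp only: G_def iexp_poly_def Z_def vec_def sum_distrib_left of_real_mult of_real_power power_mult_distrib)
      (intro sum.cong refl, simp add: mult_ac)
  have D: "D K b (vec \<omega>) = complex_of_real (cos (s * Y b \<omega>) * dp b (Z \<omega>)) * iexp_poly (Suc K) (u * q (Z \<omega>)) +
     \<i> * complex_of_real u * (complex_of_real (cos (s * Y b \<omega>) * (p (Z \<omega>) * dq b (Z \<omega>))) * iexp_poly K (u * q (Z \<omega>)))" for K b \<omega>
  proof -
    have "D K b (vec \<omega>) = (\<Sum>k\<le>Suc K. complex_of_real (cos (s * Y b \<omega>) * dp b (Z \<omega>)) * ((\<i> * complex_of_real (u * q (Z \<omega>))) ^ k / fact k)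
       + complex_of_real (cos (s * Y b \<omega>) * (p (Z \<omega>) * dq b (Z \<omega>))) *
          ((\<i> * complex_of_real u) ^ k / fact k * complex_of_real (real k * q (Z \<omega>) ^ (k - 1))))"
      unfolding D_def Z_def vec_def by (intro sum.cong refl) (simp add: algebra_simps power_mult_distrib)
    also have "\<dots> = complex_of_real (cos (s * Y b \<omega>) * dp b (Z \<omega>)) * iexp_poly (Suc K) (u * q (Z \<omega>)) +
       complex_of_real (cos (s * Y b \<omega>) * (p (Z \<omega>) * dq b (Z \<omega>))) * (\<i> * complex_of_real u * iexp_poly K (u * q (Z \<omega>)))"
      unfolding sum.distrib sum_distrib_left[symmetric] iexp_poly_deriv_sum iexp_poly_def[symmetric] ..
    finally show ?thesis by (simp only: mult_ac)
  qed
  have cb: "\<bar>cos (s * Y b \<omega>)\<bar> \<le> 1 + \<bar>Y a \<omega>\<bar>" for b \<omega> using abs_cos_le_one[of "s * Y b \<omega>"] by linarith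
  have f1: "filterlim Suc sequentially sequentially" by (rule filterlim_Suc)
  have f2: "filterlim (\<lambda>K::nat. K) sequentially sequentially" by (rule filterlim_ident)
  have dpd: "\<exists>ddp. pdiff J (dp b) ddp" for b by (rule pdiff_deriv[OF p])
  have pdq: "\<exists>ddp. pdiff J (\<lambda>y. p y * dq b y) ddp" for b using pdiff_deriv[OF q, of b] pdiff.mult[OF p] by blast
  have ED: "expectation (\<lambda>\<omega>. D K b (vec \<omega>)) =
      expectation (\<lambda>\<omega>. complex_of_real (cos (s * Y b \<omega>) * dp b (Z \<omega>)) * iexp_poly (Suc K) (u * q (Z \<omega>))) +
     \<i> * complex_of_real u * expectation (\<lambda>\<omega>. complex_of_real (cos (s * Y b \<omega>) * (p (Z \<omega>) * dq b (Z \<omega>))) * iexp_poly K (u * q (Z \<omega>)))"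
    for K b
  proof -
    obtain d1 d2 where d: "pdiff J (dp b) d1" "pdiff J (\<lambda>y. p y * dq b y) d2" using dpd pdq by blast
    have "integrable M (\<lambda>\<omega>. complex_of_real (cos (s * Y b \<omega>) * dp b (Z \<omega>)) * iexp_poly (Suc K) (u * q (Z \<omega>)))"
      by (rule int[OF _ cb d(1) f1]) simp
    moreover have "integrable M (\<lambda>\<omega>. complex_of_real (cos (s * Y b \<omega>) * (p (Z \<omega>) * dq b (Z \<omega>))) * iexp_poly K (u * q (Z \<omega>)))"
      by (rule int[OF _ cb d(2) f1]) simp
    ultimately show ?thesis unfolding D by (simp only: Bochner_Integration.integral_add integrable_mult_right integral_mult_right_zero)
  qed
  have EG: "expectation (\<lambda>\<omega>. complex_of_real (Y a \<omega>) * G K (vec \<omega>)) =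
     expectation (\<lambda>\<omega>. complex_of_real (Y a \<omega> * p (Z \<omega>)) * iexp_poly (Suc K) (u * q (Z \<omega>)))" for K
    unfolding G by (simp add: mult.assoc)
  have L: "(\<lambda>K. expectation (\<lambda>\<omega>. complex_of_real (Y a \<omega>) * G K (vec \<omega>))) \<longlonglongrightarrow>
      expectation (\<lambda>\<omega>. complex_of_real (Y a \<omega> * p (Z \<omega>)) * iexp (u * q (Z \<omega>)))"
    unfolding EG by (rule lim[OF _ _ p f1]) auto
  have R: "(\<lambda>K. (\<Sum>b\<in>J. complex_of_real (c a b) * expectation (\<lambda>\<omega>. D K b (vec \<omega>)))) \<longlonglongrightarrow>
     (\<Sum>b\<in>J. complex_of_real (c a b) *
      (expectation (\<lambda>\<omega>. complex_of_real (cos (s * Y b \<omega>) * dp b (Z \<omega>)) * iexp (u * q (Z \<omega>))) +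
       \<i> * complex_of_real u *
       expectation (\<lambda>\<omega>. complex_of_real (cos (s * Y b \<omega>) * (p (Z \<omega>) * dq b (Z \<omega>))) * iexp (u * q (Z \<omega>)))))"
    unfolding ED
  proof (intro tendsto_sum tendsto_mult tendsto_add tendsto_const)
    fix b
    obtain d1 d2 where d: "pdiff J (dp b) d1" "pdiff J (\<lambda>y. p y * dq b y) d2" using dpd pdq by blast
    show "(\<lambda>K. expectation (\<lambda>\<omega>. complex_of_real (cos (s * Y b \<omega>) * dp b (Z \<omega>)) * iexp_poly (Suc K) (u * q (Z \<omega>))))
      \<longlonglongrightarrow> expectation (\<lambda>\<omega>. complex_of_real (cos (s * Y b \<omega>) * dp b (Z \<omega>)) * iexp (u * q (Z \<omega>)))"
      by (rule lim[OF _ cb d(1) f1]) simp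
    show "(\<lambda>K. expectation (\<lambda>\<omega>. complex_of_real (cos (s * Y b \<omega>) * (p (Z \<omega>) * dq b (Z \<omega>))) * iexp_poly K (u * q (Z \<omega>))))
      \<longlonglongrightarrow> expectation (\<lambda>\<omega>. complex_of_real (cos (s * Y b \<omega>) * (p (Z \<omega>) * dq b (Z \<omega>))) * iexp (u * q (Z \<omega>)))"
      by (rule lim[OF _ cb d(2) f2]) simp
  qed
  show ?thesis using LIMSEQ_unique[OF L R[folded ibp]] .
qed

text \<open>The limit s \<rightarrow> 0 in abstract form. Since |sin(sy) / s| \<le> |y|, the growth
  bound at the true variables dominates uniformly, and one extra power of it absorbs the weight
  \<open>h\<close>.\<close>

lemma expectation_pdiff_tendsto:
  assumes J: "finite J" and a: "a \<in> J" and r: "pdiff J r dr"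
    and [measurable]: "\<And>n. h n \<in> borel_measurable M" "\<And>n. g n \<in> borel_measurable M" "\<And>n b. z n b \<in> borel_measurable M"
      "h' \<in> borel_measurable M" "g' \<in> borel_measurable M"
    and h: "\<And>n \<omega>. \<bar>h n \<omega>\<bar> \<le> 1 + \<bar>Y a \<omega>\<bar>" "\<And>\<omega>. (\<lambda>n. h n \<omega>) \<longlonglongrightarrow> h' \<omega>"
    and g: "\<And>n \<omega>. norm (g n \<omega>) \<le> 1" "\<And>\<omega>. (\<lambda>n. g n \<omega>) \<longlonglongrightarrow> (g' \<omega> :: complex)"
    and z: "\<And>n b \<omega>. \<bar>z n b \<omega>\<bar> \<le> \<bar>Y b \<omega>\<bar>" "\<And>b \<omega>. (\<lambda>n. z n b \<omega>) \<longlonglongrightarrow> Y b \<omega>"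
  shows "(\<lambda>n. expectation (\<lambda>\<omega>. complex_of_real (h n \<omega> * r (\<lambda>b. z n b \<omega>)) * g n \<omega>)) \<longlonglongrightarrow>
    expectation (\<lambda>\<omega>. complex_of_real (h' \<omega> * r (vec \<omega>)) * g' \<omega>)"
proof -
  obtain K N where K: "0 \<le> K" "\<And>y. \<bar>r y\<bar> \<le> K * (1 + (\<Sum>b\<in>J. \<bar>y b\<bar>)) ^ N" using pdiff_bound[OF J r] by auto
  define R where "R \<omega> = 1 + (\<Sum>b\<in>J. \<bar>Y b \<omega>\<bar>)" for \<omega>
  have R1: "1 \<le> R \<omega>" for \<omega> by (simp add: R_def sum_nonneg)
  have aR: "1 + \<bar>Y a \<omega>\<bar> \<le> R \<omega>" for \<omega>
    using member_le_sum[of a J "\<lambda>b. \<bar>Y b \<omega>\<bar>"] a J by (simp add: R_def)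
  have w: "integrable M (\<lambda>\<omega>. R \<omega> * (K * R \<omega> ^ N))"
  proof -
    have "(\<lambda>\<omega>. R \<omega> * (K * R \<omega> ^ N)) = (\<lambda>\<omega>. K * R \<omega> ^ Suc N)" by (simp add: mult_ac)
    then show ?thesis using integrable_dominating[OF J, of "Suc N"] unfolding R_def by (metis integrable_mult_right)
  qed
  have [measurable]: "(\<lambda>\<omega>. r (\<lambda>b. z n b \<omega>)) \<in> borel_measurable M" "(\<lambda>\<omega>. r (vec \<omega>)) \<in> borel_measurable M" for n
    using pdiff_measurable[OF r, of "z n" M] pdiff_vec_measurable[OF r] by auto
  have rz: "\<bar>r (\<lambda>b. z n b \<omega>)\<bar> \<le> K * R \<omega> ^ N" for n \<omega>
  proof -
    have "(1 + (\<Sum>b\<in>J. \<bar>z n b \<omega>\<bar>)) ^ N \<le> R \<omega> ^ N"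
      unfolding R_def by (intro power_mono add_left_mono sum_mono z add_nonneg_nonneg sum_nonneg) auto
    with K(1) have "K * (1 + (\<Sum>b\<in>J. \<bar>z n b \<omega>\<bar>)) ^ N \<le> K * R \<omega> ^ N" by (intro mult_left_mono)
    with K(2)[of "\<lambda>b. z n b \<omega>"] show ?thesis by linarith
  qed
  have dom: "norm (complex_of_real (h n \<omega> * r (\<lambda>b. z n b \<omega>)) * g n \<omega>) \<le> R \<omega> * (K * R \<omega> ^ N)" for n \<omega>
  proof -
    have "norm (complex_of_real (h n \<omega> * r (\<lambda>b. z n b \<omega>)) * g n \<omega>) \<le> (\<bar>h n \<omega>\<bar> * \<bar>r (\<lambda>b. z n b \<omega>)\<bar>) * 1"
      unfolding norm_mult norm_of_real abs_mult by (rule mult_left_mono[OF g(1)]) simp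
    also have "\<bar>h n \<omega>\<bar> * \<bar>r (\<lambda>b. z n b \<omega>)\<bar> \<le> R \<omega> * (K * R \<omega> ^ N)"
      using h(1)[of n \<omega>] aR[of \<omega>] rz[of n \<omega>] R1[of \<omega>] by (intro mult_mono) auto
    finally show ?thesis by simp
  qed
  show ?thesis
  proof (rule integral_dominated_convergence[OF _ _ w])
    show "AE \<omega> in M. (\<lambda>n. complex_of_real (h n \<omega> * r (\<lambda>b. z n b \<omega>)) * g n \<omega>) \<longlonglongrightarrow>
       complex_of_real (h' \<omega> * r (vec \<omega>)) * g' \<omega>"
      unfolding vec_def by (intro AE_I2 tendsto_intros h g pdiff_tendsto[OF r] z)
  qed (use dom in auto)
qed

text \<open>The order of the two limits matters: the Taylor degree goes to infinity while s is
  fixed, in \<open>ibp_sin\<close>, and only then s = 1 / (n + 1) goes to 0. At that stage the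
  exponential has modulus 1 and polynomial growth is all there is to dominate.\<close>

theorem ibp:
  assumes J: "finite J" and a: "a \<in> J" and p: "pdiff J p dp" and q: "pdiff J q dq"
  shows "expectation (\<lambda>\<omega>. complex_of_real (Y a \<omega> * p (vec \<omega>)) * iexp (u * q (vec \<omega>))) =
    (\<Sum>b\<in>J. complex_of_real (c a b) *
      (expectation (\<lambda>\<omega>. complex_of_real (dp b (vec \<omega>)) * iexp (u * q (vec \<omega>))) +
       \<i> * complex_of_real u * expectation (\<lambda>\<omega>. complex_of_real (p (vec \<omega>) * dq b (vec \<omega>)) * iexp (u * q (vec \<omega>)))))"
proof -
  define s where "s n = 1 / real (Suc n)" for n
  have s: "s n \<noteq> 0" "s \<longlonglongrightarrow> 0" for n
    unfolding s_def using LIMSEQ_inverse_real_of_nat by (auto simp: inverse_eq_divide)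
  define z where "z n b \<omega> = sin (s n * Y b \<omega>) / s n" for n b \<omega>
  have zm[measurable]: "z n b \<in> borel_measurable M" for n b unfolding z_def by measurable
  have z1: "\<bar>z n b \<omega>\<bar> \<le> \<bar>Y b \<omega>\<bar>" for n b \<omega>
    using abs_sin_x_le_abs_x[of "s n * Y b \<omega>"] s(1)[of n] by (simp add: z_def abs_mult field_simps)
  have z2: "(\<lambda>n. z n b \<omega>) \<longlonglongrightarrow> Y b \<omega>" for b \<omega>
    unfolding z_def by (rule sin_quotient_tendsto[OF s(2,1)])
  define g where "g n \<omega> = iexp (u * q (\<lambda>b. z n b \<omega>))" for n \<omega>
  have gm: "g n \<in> borel_measurable M" for n
    unfolding g_def using pdiff_measurable[OF q, of "z n" M] zm by measurable
  have g'm: "(\<lambda>\<omega>. iexp (u * q (vec \<omega>))) \<in> borel_measurable M"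
    using pdiff_vec_measurable[OF q] by measurable
  have g1: "norm (g n \<omega>) \<le> 1" for n \<omega> by (simp add: g_def)
  have g2: "(\<lambda>n. g n \<omega>) \<longlonglongrightarrow> iexp (u * q (vec \<omega>))" for \<omega>
    unfolding g_def vec_def by (intro tendsto_intros pdiff_tendsto[OF q] z2)
  note lim = expectation_pdiff_tendsto[OF J a, where z=z and g=g and g'="\<lambda>\<omega>. iexp (u * q (vec \<omega>))"]
  have cb: "\<bar>cos (s n * Y b \<omega>)\<bar> \<le> 1 + \<bar>Y a \<omega>\<bar>" for n b \<omega> using abs_cos_le_one[of "s n * Y b \<omega>"] by linarith
  have cl: "(\<lambda>n. cos (s n * Y b \<omega>)) \<longlonglongrightarrow> 1" for b \<omega>
    using tendsto_cos[OF tendsto_mult_left_zero[OF s(2), of "Y b \<omega>"]] by simp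
  have L: "(\<lambda>n. expectation (\<lambda>\<omega>. complex_of_real (Y a \<omega> * p (\<lambda>b. z n b \<omega>)) * g n \<omega>)) \<longlonglongrightarrow>
      expectation (\<lambda>\<omega>. complex_of_real (Y a \<omega> * p (vec \<omega>)) * iexp (u * q (vec \<omega>)))"
    by (rule lim[OF p]) (use gm g'm g1 g2 z1 z2 in auto)
  have R: "(\<lambda>n. \<Sum>b\<in>J. complex_of_real (c a b) *
      (expectation (\<lambda>\<omega>. complex_of_real (cos (s n * Y b \<omega>) * dp b (\<lambda>b. z n b \<omega>)) * g n \<omega>) +
       \<i> * complex_of_real u *
       expectation (\<lambda>\<omega>. complex_of_real (cos (s n * Y b \<omega>) * (p (\<lambda>b. z n b \<omega>) * dq b (\<lambda>b. z n b \<omega>))) * g n \<omega>)))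
     \<longlonglongrightarrow> (\<Sum>b\<in>J. complex_of_real (c a b) *
      (expectation (\<lambda>\<omega>. complex_of_real (1 * dp b (vec \<omega>)) * iexp (u * q (vec \<omega>))) +
       \<i> * complex_of_real u * expectation (\<lambda>\<omega>. complex_of_real (1 * (p (vec \<omega>) * dq b (vec \<omega>))) * iexp (u * q (vec \<omega>)))))"
  proof (intro tendsto_sum tendsto_mult tendsto_add tendsto_const)
    fix b
    obtain d1 d2 where d: "pdiff J (dp b) d1" "pdiff J (\<lambda>y. p y * dq b y) d2"
      using pdiff_deriv[OF p, of b] pdiff_deriv[OF q, of b] pdiff.mult[OF p] by blast
    show "(\<lambda>n. expectation (\<lambda>\<omega>. complex_of_real (cos (s n * Y b \<omega>) * dp b (\<lambda>b. z n b \<omega>)) * g n \<omega>)) \<longlonglongrightarrow>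
       expectation (\<lambda>\<omega>. complex_of_real (1 * dp b (vec \<omega>)) * iexp (u * q (vec \<omega>)))"
      by (rule lim[OF d(1)]) (use gm g'm g1 g2 z1 z2 cb cl in auto)
    show "(\<lambda>n. expectation (\<lambda>\<omega>. complex_of_real (cos (s n * Y b \<omega>) * (p (\<lambda>b. z n b \<omega>) * dq b (\<lambda>b. z n b \<omega>))) * g n \<omega>)) \<longlonglongrightarrow>
       expectation (\<lambda>\<omega>. complex_of_real (1 * (p (vec \<omega>) * dq b (vec \<omega>))) * iexp (u * q (vec \<omega>)))"
      by (rule lim[OF d(2)]) (use gm g'm g1 g2 z1 z2 cb cl in auto)
  qed
  have "expectation (\<lambda>\<omega>. complex_of_real (Y a \<omega> * p (\<lambda>b. z n b \<omega>)) * g n \<omega>) =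
     (\<Sum>b\<in>J. complex_of_real (c a b) *
      (expectation (\<lambda>\<omega>. complex_of_real (cos (s n * Y b \<omega>) * dp b (\<lambda>b. z n b \<omega>)) * g n \<omega>) +
       \<i> * complex_of_real u *
       expectation (\<lambda>\<omega>. complex_of_real (cos (s n * Y b \<omega>) * (p (\<lambda>b. z n b \<omega>) * dq b (\<lambda>b. z n b \<omega>))) * g n \<omega>)))" for n
    using ibp_sin[OF J a p q s(1)[of n], of u] unfolding z_def g_def .
  with L R show ?thesis using LIMSEQ_unique by (simp only: mult_1_left) blast
qed

end

section \<open>Hermite products of Gaussian variables\<close>

text \<open>The Appell property, by differentiating the defining recursion and using the induction
  hypothesis one degree lower. At n = 0 the factor 0 makes the truncated index harmless.\<close>

lemma pderiv_hermite: "pderiv (hermite n) = smult (of_nat n) (hermite (n - 1))"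
proof (induction n rule: less_induct)
  case (less n)
  show ?case
  proof (cases n)
    case (Suc m)
    have m: "pderiv (hermite m) = smult (of_nat m) (hermite (m - 1))" using less Suc by simp
    have "pderiv (hermite n) = hermite m + [:0, 1:] * pderiv (hermite m) - pderiv (pderiv (hermite m))"
      by (simp add: Suc pderiv_diff pderiv_mult pderiv_pCons)
    also have "\<dots> = hermite m + smult (of_nat m) ([:0, 1:] * hermite (m - 1) - pderiv (hermite (m - 1)))"
      unfolding m by (simp add: pderiv_smult smult_diff_right)
    also have "smult (of_nat m) ([:0, 1:] * hermite (m - 1) - pderiv (hermite (m - 1))) = smult (of_nat m) (hermite m)"
      by (cases m) simp_all
    also have "hermite m + smult (of_nat m) (hermite m) = smult (of_nat n) (hermite m)"
      by (simp add: Suc smult_add_left)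
    finally show ?thesis by (simp add: Suc)
  qed simp
qed

text \<open>The three-term recurrence; at n = 1 the truncated index is multiplied by 0.\<close>

lemma poly_hermite_rec:
  "n > 0 \<Longrightarrow> poly (hermite n) x = x * poly (hermite (n - 1)) x - real (n - 1) * poly (hermite (n - 1 - 1)) x"
  by (cases n) (simp_all add: pderiv_hermite)

lemma pdiff_poly:
  assumes "a \<in> J" shows "pdiff J (\<lambda>y. poly P (y a)) (\<lambda>b y. of_bool (b = a) * poly (pderiv P) (y a))"
proof (induction P)
  case 0 show ?case by (rule pdiff_cong[OF pdiff.const[of J 0]]) auto
next
  case (pCons c P)
  show ?case
    by (rule pdiff_cong[OF pdiff.add[OF pdiff.const[of J c] pdiff.mult[OF pdiff.var[OF assms] pCons(2)]]])
      (simp_all add: pderiv_pCons algebra_simps)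
qed

lemma pdiff_prod:
  assumes "finite A" "\<And>a. a \<in> A \<Longrightarrow> pdiff J (p a) (dp a)"
  shows "pdiff J (\<lambda>y. \<Prod>a\<in>A. p a y) (\<lambda>b y. \<Sum>a\<in>A. dp a b y * (\<Prod>a'\<in>A - {a}. p a' y))"
  using assms
proof (induction A rule: finite_induct)
  case empty
  show ?case by (rule pdiff_cong[OF pdiff.const[of J 1]]) auto
next
  case (insert x A)
  have i: "insert x A - {a} = insert x (A - {a})" if "a \<in> A" for a using insert.hyps that by auto
  have "pdiff J (\<lambda>y. p x y * (\<Prod>a\<in>A. p a y))
     (\<lambda>b y. dp x b y * (\<Prod>a\<in>A. p a y) + p x y * (\<Sum>a\<in>A. dp a b y * (\<Prod>a'\<in>A - {a}. p a' y)))"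
    using insert by (intro pdiff.mult) auto
  then show ?case
    by (rule pdiff_cong) (use insert.hyps in \<open>auto simp: sum_distrib_left mult_ac i intro!: sum.cong\<close>)
qed

section \<open>Hermite products in several variables and Wick's formula\<close>

definition msize :: "('d::finite \<Rightarrow> nat) \<Rightarrow> nat" where "msize \<alpha> = (\<Sum>i\<in>UNIV. \<alpha> i)"

text \<open>Truncated at 0. Where the exponent may vanish, a factor such as
  \<open>real (\<alpha> i)\<close> annihilates the term.\<close>

definition dec :: "('d \<Rightarrow> nat) \<Rightarrow> 'd \<Rightarrow> 'd \<Rightarrow> nat" where "dec \<alpha> i = \<alpha>(i := \<alpha> i - 1)"

lemma msize_dec: "\<alpha> i > 0 \<Longrightarrow> msize \<alpha> = Suc (msize (dec \<alpha> i))"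
  unfolding msize_def dec_def by (simp add: sum.remove[of UNIV i])

lemma msize_pos: "msize \<alpha> > 0 \<Longrightarrow> \<exists>i. \<alpha> i > 0"
  unfolding msize_def by (metis not_gr_zero sum.neutral)

lemma msize_0: "msize \<alpha> = 0 \<Longrightarrow> \<alpha> = (\<lambda>_. 0)"
  unfolding msize_def by auto

definition hprod :: "('d::finite \<Rightarrow> nat) \<Rightarrow> int \<Rightarrow> (int \<times> 'd \<Rightarrow> real) \<Rightarrow> real" where
  "hprod \<alpha> k y = (\<Prod>i\<in>UNIV. poly (hermite (\<alpha> i)) (y (k, i)))"

definition dhprod :: "('d::finite \<Rightarrow> nat) \<Rightarrow> int \<Rightarrow> int \<times> 'd \<Rightarrow> (int \<times> 'd \<Rightarrow> real) \<Rightarrow> real" where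
  "dhprod \<alpha> k b y = of_bool (fst b = k) * (real (\<alpha> (snd b)) * hprod (dec \<alpha> (snd b)) k y)"

lemma hprod_0 [simp]: "hprod (\<lambda>_. 0) k y = 1"
  by (simp add: hprod_def)

lemma hprod_dec:
  "hprod (dec \<alpha> i) k y = poly (hermite (\<alpha> i - 1)) (y (k, i)) * (\<Prod>j\<in>UNIV - {i}. poly (hermite (\<alpha> j)) (y (k, j)))"
  unfolding hprod_def dec_def by (subst prod.remove[of UNIV i]) (auto intro!: prod.cong)

lemma hprod_rec:
  assumes "\<alpha> i > 0"
  shows "hprod \<alpha> k y = y (k, i) * hprod (dec \<alpha> i) k y - real (dec \<alpha> i i) * hprod (dec (dec \<alpha> i) i) k y"
proof -
  have "hprod \<alpha> k y = poly (hermite (\<alpha> i)) (y (k, i)) * (\<Prod>j\<in>UNIV - {i}. poly (hermite (\<alpha> j)) (y (k, j)))"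
    unfolding hprod_def by (subst prod.remove[of UNIV i]) auto
  moreover have "hprod (dec (dec \<alpha> i) i) k y =
     poly (hermite (\<alpha> i - 1 - 1)) (y (k, i)) * (\<Prod>j\<in>UNIV - {i}. poly (hermite (\<alpha> j)) (y (k, j)))"
    unfolding hprod_dec[of "dec \<alpha> i"] by (auto simp: dec_def intro!: prod.cong)
  ultimately show ?thesis
    unfolding hprod_dec poly_hermite_rec[OF assms] by (simp add: dec_def algebra_simps)
qed

lemma pdiff_hprod:
  assumes "k \<in> K" shows "pdiff (K \<times> UNIV) (hprod \<alpha> k) (dhprod \<alpha> k)"
proof -
  have "pdiff (K \<times> UNIV) (\<lambda>y. \<Prod>i\<in>UNIV. poly (hermite (\<alpha> i)) (y (k, i)))
    (\<lambda>b y. \<Sum>i\<in>UNIV. of_bool (b = (k, i)) * poly (pderiv (hermite (\<alpha> i))) (y (k, i)) *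
       (\<Prod>j\<in>UNIV - {i}. poly (hermite (\<alpha> j)) (y (k, j))))"
    by (rule pdiff_prod) (use assms in \<open>auto intro!: pdiff_poly\<close>)
  then show ?thesis
  proof (rule pdiff_cong)
    fix b :: "int \<times> 'a" and y :: "int \<times> 'a \<Rightarrow> real"
    obtain l i where b: "b = (l, i)" by (cases b)
    have "(\<Sum>j\<in>UNIV. of_bool (b = (k, j)) * poly (pderiv (hermite (\<alpha> j))) (y (k, j)) *
       (\<Prod>j'\<in>UNIV - {j}. poly (hermite (\<alpha> j')) (y (k, j')))) =
       (\<Sum>j\<in>UNIV. if j = i then of_bool (l = k) * (poly (pderiv (hermite (\<alpha> i))) (y (k, i)) *
       (\<Prod>j'\<in>UNIV - {i}. poly (hermite (\<alpha> j')) (y (k, j')))) else 0)"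
      by (rule sum.cong) (auto simp: b)
    then show "(\<Sum>j\<in>UNIV. of_bool (b = (k, j)) * poly (pderiv (hermite (\<alpha> j))) (y (k, j)) *
       (\<Prod>j'\<in>UNIV - {j}. poly (hermite (\<alpha> j')) (y (k, j')))) = dhprod \<alpha> k b y"
      by (simp add: dhprod_def hprod_dec b pderiv_hermite mult.assoc)
  qed (simp add: hprod_def)
qed

text \<open>The gradient of a Hermite product is supported at a single time, so sums over time and
  coordinate collapse to sums over the coordinate.\<close>

lemma sum_times_slice:
  fixes g :: "int \<times> 'd::finite \<Rightarrow> 'b::comm_ring_1"
  assumes "finite K" "l \<in> K"
  shows "(\<Sum>b\<in>K \<times> UNIV. g b * (of_bool (fst b = l) * X (snd b))) = (\<Sum>j\<in>UNIV. g (l, j) * X j)"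
proof -
  have "(\<Sum>b\<in>K \<times> UNIV. g b * (of_bool (fst b = l) * X (snd b))) =
     (\<Sum>k\<in>K. \<Sum>j\<in>UNIV. g (k, j) * (of_bool (k = l) * X j))"
    by (simp add: sum.cartesian_product case_prod_unfold)
  also have "\<dots> = (\<Sum>k\<in>K. if k = l then (\<Sum>j\<in>UNIV. g (l, j) * X j) else 0)"
    by (rule sum.cong) auto
  finally show ?thesis using assms by simp
qed

text \<open>Uncorrelated unit coordinates at each time are what makes Hermite products at one time
  orthogonal and removes contractions of a product with itself.\<close>

locale hermite_family = gaussian_family M Y c
  for M :: "'a measure" and Y :: "int \<times> 'd::finite \<Rightarrow> 'a \<Rightarrow> real" and c +
  assumes c_diag: "c (k, i) (k, j) = of_bool (i = j)"
begin

lemma integrable_iexp: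
  assumes "finite J" "pdiff J p dp" "pdiff J q dq"
  shows "integrable M (\<lambda>\<omega>. complex_of_real (p (vec \<omega>)) * iexp (u * q (vec \<omega>)))"
  by (rule integrable_pdiff_mult_bounded[OF assms(1,2)]) (use pdiff_vec_measurable[OF assms(3)] in auto)

text \<open>The recurrence peels off one variable Y(k, i), to which \<open>ibp\<close> applies. The
  derivative that falls back on the same Hermite product is, by \<open>c_diag\<close>, exactly the
  second term of the recurrence and cancels. So Y(k, i) is contracted only with the other factors
  \<open>p\<close> and the exponential.\<close>

lemma wick:
  assumes K: "finite K" "k \<in> K" and \<alpha>: "\<alpha> i > 0"
    and p: "pdiff (K \<times> UNIV) p dp" and q: "pdiff (K \<times> UNIV) q dq"
  shows "expectation (\<lambda>\<omega>. complex_of_real (hprod \<alpha> k (vec \<omega>) * p (vec \<omega>)) * iexp (u * q (vec \<omega>))) =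
    (\<Sum>b\<in>K \<times> UNIV. complex_of_real (c (k, i) b) *
      (expectation (\<lambda>\<omega>. complex_of_real (hprod (dec \<alpha> i) k (vec \<omega>) * dp b (vec \<omega>)) * iexp (u * q (vec \<omega>))) +
       \<i> * complex_of_real u *
         expectation (\<lambda>\<omega>. complex_of_real (hprod (dec \<alpha> i) k (vec \<omega>) * p (vec \<omega>) * dq b (vec \<omega>)) * iexp (u * q (vec \<omega>)))))"
proof -
  let ?J = "K \<times> (UNIV :: 'd set)"
  let ?e = "\<lambda>\<omega>. iexp (u * q (vec \<omega>))"
  let ?h = "hprod (dec \<alpha> i) k"
  have J: "finite ?J" using K by simp
  note h = pdiff_hprod[OF K(2)]
  note int = integrable_iexp[OF J _ q]
  have "expectation (\<lambda>\<omega>. complex_of_real (Y (k, i) \<omega> * (?h (vec \<omega>) * p (vec \<omega>))) * ?e \<omega>) =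
    (\<Sum>b\<in>?J. complex_of_real (c (k, i) b) *
      (expectation (\<lambda>\<omega>. complex_of_real (dhprod (dec \<alpha> i) k b (vec \<omega>) * p (vec \<omega>) + ?h (vec \<omega>) * dp b (vec \<omega>)) * ?e \<omega>) +
       \<i> * complex_of_real u * expectation (\<lambda>\<omega>. complex_of_real (?h (vec \<omega>) * p (vec \<omega>) * dq b (vec \<omega>)) * ?e \<omega>)))"
    by (rule ibp[OF J _ pdiff.mult[OF h p] q]) (use K in auto)
  also have "\<dots> = (\<Sum>b\<in>?J. complex_of_real (c (k, i) b) *
      expectation (\<lambda>\<omega>. complex_of_real (dhprod (dec \<alpha> i) k b (vec \<omega>) * p (vec \<omega>)) * ?e \<omega>)) +
     (\<Sum>b\<in>?J. complex_of_real (c (k, i) b) *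
      (expectation (\<lambda>\<omega>. complex_of_real (?h (vec \<omega>) * dp b (vec \<omega>)) * ?e \<omega>) +
       \<i> * complex_of_real u * expectation (\<lambda>\<omega>. complex_of_real (?h (vec \<omega>) * p (vec \<omega>) * dq b (vec \<omega>)) * ?e \<omega>)))"
    unfolding sum.distrib[symmetric]
  proof (intro sum.cong refl)
    fix b
    obtain d1 where d1: "pdiff ?J (dhprod (dec \<alpha> i) k b) d1" using pdiff_deriv[OF h] by blast
    obtain d2 where d2: "pdiff ?J (dp b) d2" using pdiff_deriv[OF p] by blast
    have "expectation (\<lambda>\<omega>. complex_of_real (dhprod (dec \<alpha> i) k b (vec \<omega>) * p (vec \<omega>) + ?h (vec \<omega>) * dp b (vec \<omega>)) * ?e \<omega>) =
      expectation (\<lambda>\<omega>. complex_of_real (dhprod (dec \<alpha> i) k b (vec \<omega>) * p (vec \<omega>)) * ?e \<omega>) +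
      expectation (\<lambda>\<omega>. complex_of_real (?h (vec \<omega>) * dp b (vec \<omega>)) * ?e \<omega>)"
      unfolding of_real_add distrib_right
      by (rule Bochner_Integration.integral_add[OF int[OF pdiff.mult[OF d1 p]] int[OF pdiff.mult[OF h d2]]])
    then show "complex_of_real (c (k, i) b) *
      (expectation (\<lambda>\<omega>. complex_of_real (dhprod (dec \<alpha> i) k b (vec \<omega>) * p (vec \<omega>) + ?h (vec \<omega>) * dp b (vec \<omega>)) * ?e \<omega>) +
       \<i> * complex_of_real u * expectation (\<lambda>\<omega>. complex_of_real (?h (vec \<omega>) * p (vec \<omega>) * dq b (vec \<omega>)) * ?e \<omega>)) =
      complex_of_real (c (k, i) b) * expectation (\<lambda>\<omega>. complex_of_real (dhprod (dec \<alpha> i) k b (vec \<omega>) * p (vec \<omega>)) * ?e \<omega>) +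
      complex_of_real (c (k, i) b) *
      (expectation (\<lambda>\<omega>. complex_of_real (?h (vec \<omega>) * dp b (vec \<omega>)) * ?e \<omega>) +
       \<i> * complex_of_real u * expectation (\<lambda>\<omega>. complex_of_real (?h (vec \<omega>) * p (vec \<omega>) * dq b (vec \<omega>)) * ?e \<omega>))"
      by (simp only: distrib_left add.assoc)
  qed
  also have "(\<Sum>b\<in>?J. complex_of_real (c (k, i) b) *
      expectation (\<lambda>\<omega>. complex_of_real (dhprod (dec \<alpha> i) k b (vec \<omega>) * p (vec \<omega>)) * ?e \<omega>)) =
    (\<Sum>b\<in>?J. complex_of_real (c (k, i) b) * (of_bool (fst b = k) * (of_nat (dec \<alpha> i (snd b)) *
      expectation (\<lambda>\<omega>. complex_of_real (hprod (dec (dec \<alpha> i) (snd b)) k (vec \<omega>) * p (vec \<omega>)) * ?e \<omega>))))"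
    unfolding dhprod_def by (intro sum.cong refl) (simp add: of_bool_def mult.assoc)
  also have "\<dots> = of_nat (dec \<alpha> i i) * expectation (\<lambda>\<omega>. complex_of_real (hprod (dec (dec \<alpha> i) i) k (vec \<omega>) * p (vec \<omega>)) * ?e \<omega>)"
    by (subst sum_times_slice[OF K])
      (simp add: c_diag of_bool_def if_distrib[of complex_of_real] if_distrib[of "\<lambda>x. x * _"] cong: if_cong)
  finally have Y: "expectation (\<lambda>\<omega>. complex_of_real (Y (k, i) \<omega> * (?h (vec \<omega>) * p (vec \<omega>))) * ?e \<omega>) -
      of_nat (dec \<alpha> i i) * expectation (\<lambda>\<omega>. complex_of_real (hprod (dec (dec \<alpha> i) i) k (vec \<omega>) * p (vec \<omega>)) * ?e \<omega>) =
     (\<Sum>b\<in>?J. complex_of_real (c (k, i) b) *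
      (expectation (\<lambda>\<omega>. complex_of_real (?h (vec \<omega>) * dp b (vec \<omega>)) * ?e \<omega>) +
       \<i> * complex_of_real u * expectation (\<lambda>\<omega>. complex_of_real (?h (vec \<omega>) * p (vec \<omega>) * dq b (vec \<omega>)) * ?e \<omega>)))"
    by simp
  have vy: "vec \<omega> (k, i) = Y (k, i) \<omega>" for \<omega> by (simp add: vec_def)
  have i1: "integrable M (\<lambda>\<omega>. complex_of_real (Y (k, i) \<omega> * (?h (vec \<omega>) * p (vec \<omega>))) * ?e \<omega>)"
    using int[OF pdiff.mult[OF pdiff.var[of "(k, i)"] pdiff.mult[OF h p]]] K by (simp add: vy)
  have "expectation (\<lambda>\<omega>. complex_of_real (hprod \<alpha> k (vec \<omega>) * p (vec \<omega>)) * ?e \<omega>) =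
    expectation (\<lambda>\<omega>. complex_of_real (Y (k, i) \<omega> * (?h (vec \<omega>) * p (vec \<omega>))) * ?e \<omega> -
      of_nat (dec \<alpha> i i) * (complex_of_real (hprod (dec (dec \<alpha> i) i) k (vec \<omega>) * p (vec \<omega>)) * ?e \<omega>))"
    unfolding hprod_rec[where \<alpha>=\<alpha>, OF \<alpha>] vy by (simp add: algebra_simps)
  also have "\<dots> = expectation (\<lambda>\<omega>. complex_of_real (Y (k, i) \<omega> * (?h (vec \<omega>) * p (vec \<omega>))) * ?e \<omega>) -
      of_nat (dec \<alpha> i i) * expectation (\<lambda>\<omega>. complex_of_real (hprod (dec (dec \<alpha> i) i) k (vec \<omega>) * p (vec \<omega>)) * ?e \<omega>)"
    by (subst Bochner_Integration.integral_diff[OF i1 integrable_mult_right[OF int[OF pdiff.mult[OF h p]]]]) simp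
  finally show ?thesis unfolding Y .
qed

lemma wick_real:
  assumes K: "finite K" "k \<in> K" and \<alpha>: "\<alpha> i > 0" and p: "pdiff (K \<times> UNIV) p dp"
  shows "expectation (\<lambda>\<omega>. hprod \<alpha> k (vec \<omega>) * p (vec \<omega>)) =
    (\<Sum>b\<in>K \<times> UNIV. c (k, i) b * expectation (\<lambda>\<omega>. hprod (dec \<alpha> i) k (vec \<omega>) * dp b (vec \<omega>)))"
proof -
  have "complex_of_real (expectation (\<lambda>\<omega>. hprod \<alpha> k (vec \<omega>) * p (vec \<omega>))) =
      (\<Sum>b\<in>K \<times> UNIV. complex_of_real (c (k, i) b) * complex_of_real (expectation (\<lambda>\<omega>. hprod (dec \<alpha> i) k (vec \<omega>) * dp b (vec \<omega>))))"
    using wick[where \<alpha>=\<alpha> and i=i and k=k, OF assms pdiff.const[of _ 0], of 0] by (simp del: of_real_mult)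
  also have "\<dots> = complex_of_real (\<Sum>b\<in>K \<times> UNIV. c (k, i) b * expectation (\<lambda>\<omega>. hprod (dec \<alpha> i) k (vec \<omega>) * dp b (vec \<omega>)))"
    by simp
  finally show ?thesis by (simp only: of_real_eq_iff)
qed

lemma expectation_hprod:
  assumes "msize \<alpha> > 0" shows "expectation (\<lambda>\<omega>. hprod \<alpha> k (vec \<omega>)) = 0"
proof -
  obtain i where "\<alpha> i > 0" using msize_pos[OF assms] by blast
  from wick_real[of "{k}" k \<alpha> i, OF _ _ this pdiff.const[of _ 1]] show ?thesis by simp
qed

lemma wick_two:
  assumes \<alpha>: "\<alpha> i > 0"
  shows "expectation (\<lambda>\<omega>. hprod \<alpha> k (vec \<omega>) * hprod \<beta> l (vec \<omega>)) =
    (\<Sum>j\<in>UNIV. c (k, i) (l, j) * real (\<beta> j) * expectation (\<lambda>\<omega>. hprod (dec \<alpha> i) k (vec \<omega>) * hprod (dec \<beta> j) l (vec \<omega>)))"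
proof -
  have "expectation (\<lambda>\<omega>. hprod \<alpha> k (vec \<omega>) * hprod \<beta> l (vec \<omega>)) =
    (\<Sum>b\<in>{k, l} \<times> UNIV. c (k, i) b * expectation (\<lambda>\<omega>. hprod (dec \<alpha> i) k (vec \<omega>) * dhprod \<beta> l b (vec \<omega>)))"
    by (rule wick_real[where \<alpha>=\<alpha>, OF _ _ \<alpha> pdiff_hprod]) auto
  also have "\<dots> = (\<Sum>b\<in>{k, l} \<times> UNIV. c (k, i) b * (of_bool (fst b = l) * (real (\<beta> (snd b)) *
      expectation (\<lambda>\<omega>. hprod (dec \<alpha> i) k (vec \<omega>) * hprod (dec \<beta> (snd b)) l (vec \<omega>)))))"
    unfolding dhprod_def by (simp add: mult.left_commute)
  also have "\<dots> = (\<Sum>j\<in>UNIV. c (k, i) (l, j) * (real (\<beta> j) *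
      expectation (\<lambda>\<omega>. hprod (dec \<alpha> i) k (vec \<omega>) * hprod (dec \<beta> j) l (vec \<omega>))))"
    by (rule sum_times_slice) auto
  finally show ?thesis by (simp add: mult.assoc)
qed

text \<open>Every contraction takes one degree from each product. With unequal degrees a nonconstant
  product is left alone at the end, and it has mean zero.\<close>

lemma two_point_zero:
  "msize \<alpha> \<noteq> msize \<beta> \<Longrightarrow> expectation (\<lambda>\<omega>. hprod \<alpha> k (vec \<omega>) * hprod \<beta> l (vec \<omega>)) = 0"
proof (induction "msize \<alpha>" arbitrary: \<alpha> \<beta>)
  case 0
  then have "\<alpha> = (\<lambda>_. 0)" "msize \<beta> > 0" using msize_0[of \<alpha>] by auto
  then show ?case using expectation_hprod[of \<beta>] by simp
next
  case (Suc n)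
  then obtain i where i: "\<alpha> i > 0" using msize_pos[of \<alpha>] by auto
  have "real (\<beta> j) * expectation (\<lambda>\<omega>. hprod (dec \<alpha> i) k (vec \<omega>) * hprod (dec \<beta> j) l (vec \<omega>)) = 0" for j
  proof (cases "\<beta> j > 0")
    case True
    then show ?thesis using Suc.hyps(1)[of "dec \<alpha> i" "dec \<beta> j"] Suc.hyps(2) Suc.prems msize_dec[of \<beta> j] msize_dec[of \<alpha> i] i by simp
  qed simp
  then show ?case unfolding wick_two[where \<alpha>=\<alpha>, OF i] mult.assoc by (simp only: mult_zero_right sum.neutral_const)
qed

text \<open>Each contraction costs at most \<theta>, and the multiplicities of the possible partners
  add up to the degree of the second product, which builds up the factorial.\<close>

lemma two_point_bound:
  assumes "0 \<le> \<theta>" "\<And>i j. \<bar>c (k, i) (l, j)\<bar> \<le> \<theta>"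
  shows "msize \<alpha> = p \<Longrightarrow> msize \<beta> = p \<Longrightarrow> \<bar>expectation (\<lambda>\<omega>. hprod \<alpha> k (vec \<omega>) * hprod \<beta> l (vec \<omega>))\<bar> \<le> fact p * \<theta> ^ p"
proof (induction p arbitrary: \<alpha> \<beta>)
  case 0
  then have "\<alpha> = (\<lambda>_. 0)" "\<beta> = (\<lambda>_. 0)" using msize_0[of \<alpha>] msize_0[of \<beta>] by auto
  then show ?case by (simp add: prob_space)
next
  case (Suc p)
  then obtain i where i: "\<alpha> i > 0" using msize_pos[of \<alpha>] by auto
  have "\<bar>c (k, i) (l, j) * real (\<beta> j) * expectation (\<lambda>\<omega>. hprod (dec \<alpha> i) k (vec \<omega>) * hprod (dec \<beta> j) l (vec \<omega>))\<bar>
      \<le> \<theta> * real (\<beta> j) * (fact p * \<theta> ^ p)" for j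
  proof (cases "\<beta> j > 0")
    case True
    have "\<bar>expectation (\<lambda>\<omega>. hprod (dec \<alpha> i) k (vec \<omega>) * hprod (dec \<beta> j) l (vec \<omega>))\<bar> \<le> fact p * \<theta> ^ p"
      using Suc.prems msize_dec[of \<alpha> i, OF i] msize_dec[of \<beta> j, OF True] by (intro Suc.IH) auto
    then show ?thesis unfolding abs_mult using assms by (intro mult_mono) auto
  qed (simp)
  then have "\<bar>expectation (\<lambda>\<omega>. hprod \<alpha> k (vec \<omega>) * hprod \<beta> l (vec \<omega>))\<bar> \<le> (\<Sum>j\<in>UNIV. \<theta> * real (\<beta> j) * (fact p * \<theta> ^ p))"
    unfolding wick_two[where \<alpha>=\<alpha>, OF i] by (intro order_trans[OF sum_abs sum_mono]) auto
  also have "\<dots> = \<theta> * real (msize \<beta>) * (fact p * \<theta> ^ p)" by (simp add: msize_def sum_distrib_left sum_distrib_right)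
  also have "\<dots> = fact (Suc p) * \<theta> ^ Suc p" using Suc.prems by (simp add: algebra_simps)
  finally show ?case .
qed

text \<open>At equal times only equal coordinates can be contracted, so both indices are lowered in
  the same coordinate until one of them is exhausted.\<close>

lemma orthogonality:
  "expectation (\<lambda>\<omega>. hprod \<alpha> k (vec \<omega>) * hprod \<beta> k (vec \<omega>)) = of_bool (\<alpha> = \<beta>) * (\<Prod>i\<in>UNIV. fact (\<alpha> i))"
proof (induction "msize \<alpha>" arbitrary: \<alpha> \<beta>)
  case 0
  then have a: "\<alpha> = (\<lambda>_. 0)" using msize_0[of \<alpha>] by auto
  show ?case
  proof (cases "msize \<beta> = 0")
    case True
    then have "\<beta> = (\<lambda>_. 0)" using msize_0[of \<beta>] by auto
    then show ?thesis using a by (simp add: prob_space)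
  next
    case False
    then have "\<alpha> \<noteq> \<beta>" using 0 by auto
    then show ?thesis using a expectation_hprod[of \<beta>] False by simp
  qed
next
  case (Suc n)
  then obtain i where i: "\<alpha> i > 0" using msize_pos[of \<alpha>] by auto
  have IH: "expectation (\<lambda>\<omega>. hprod (dec \<alpha> i) k (vec \<omega>) * hprod (dec \<beta> i) k (vec \<omega>)) =
      of_bool (dec \<alpha> i = dec \<beta> i) * (\<Prod>j\<in>UNIV. fact (dec \<alpha> i j))"
    using Suc.hyps msize_dec[of \<alpha> i, OF i] by auto
  have E: "expectation (\<lambda>\<omega>. hprod \<alpha> k (vec \<omega>) * hprod \<beta> k (vec \<omega>)) =
      real (\<beta> i) * (of_bool (dec \<alpha> i = dec \<beta> i) * (\<Prod>j\<in>UNIV. fact (dec \<alpha> i j)))"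
    unfolding wick_two[where \<alpha>=\<alpha>, OF i] c_diag IH[symmetric] mult.assoc
    by (simp add: of_bool_def if_distrib[of "\<lambda>x. x * _"] cong: if_cong)
  show ?case
  proof (cases "\<beta> i > 0")
    case True
    have eq: "dec \<alpha> i = dec \<beta> i \<longleftrightarrow> \<alpha> = \<beta>"
    proof
      assume *: "dec \<alpha> i = dec \<beta> i"
      show "\<alpha> = \<beta>"
      proof
        fix j show "\<alpha> j = \<beta> j" using fun_cong[OF *, of j] i True by (auto simp: dec_def split: if_splits)
      qed
    qed simp
    have "(\<Prod>j\<in>UNIV. fact (\<alpha> j)) = real (\<alpha> i) * (\<Prod>j\<in>UNIV. fact (dec \<alpha> i j) :: real)"
    proof -
      have "(\<Prod>j\<in>UNIV. fact (dec \<alpha> i j) :: real) = fact (\<alpha> i - 1) * (\<Prod>j\<in>UNIV - {i}. fact (\<alpha> j))"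
        by (subst prod.remove[of UNIV i]) (auto simp: dec_def intro!: prod.cong)
      moreover have "(\<Prod>j\<in>UNIV. fact (\<alpha> j) :: real) = fact (\<alpha> i) * (\<Prod>j\<in>UNIV - {i}. fact (\<alpha> j))"
        by (subst prod.remove[of UNIV i]) auto
      moreover have "(fact (\<alpha> i) :: real) = real (\<alpha> i) * fact (\<alpha> i - 1)" using i by (rule fact_reduce)
      ultimately show ?thesis by simp
    qed
    then show ?thesis unfolding E eq by auto
  next
    case False
    then have "\<alpha> \<noteq> \<beta>" using i by auto
    then show ?thesis unfolding E using False by simp
  qed
qed

end

section \<open>Diagrams on four vertices\<close>

text \<open>The m_ij are the edge multiplicities of a loopless multigraph on four vertices with
  prescribed degrees, that is, of a diagram in the expansion of a four-point function.
  \<open>x\<close> is the least number of edges between the pairs {1, 2} and {3, 4}, and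
  \<open>s\<close> collects the factors of edges already drawn, so the predicate bounds every
  completion of a partial diagram.\<close>

definition deg_bound ::
  "real \<Rightarrow> real \<Rightarrow> nat \<Rightarrow> nat \<Rightarrow> nat \<Rightarrow> nat \<Rightarrow> nat \<Rightarrow> real \<Rightarrow> real \<Rightarrow> real \<Rightarrow> real \<Rightarrow> real \<Rightarrow> real \<Rightarrow> bool" where
  "deg_bound s B x d1 d2 d3 d4 r12 r13 r14 r23 r24 r34 \<longleftrightarrow>
    (\<forall>m12 m13 m14 m23 m24 m34. m12 + m13 + m14 = d1 \<longrightarrow> m12 + m23 + m24 = d2 \<longrightarrow> m13 + m23 + m34 = d3 \<longrightarrow>
       m14 + m24 + m34 = d4 \<longrightarrow> x \<le> m13 + m14 + m23 + m24 \<longrightarrow>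
       s * (r12 ^ m12 * r13 ^ m13 * r14 ^ m14 * r23 ^ m23 * r24 ^ m24 * r34 ^ m34) \<le> B)"

lemma deg_boundD:
  assumes "deg_bound s B x d1 d2 d3 d4 r12 r13 r14 r23 r24 r34"
    "m12 + m13 + m14 = d1" "m12 + m23 + m24 = d2" "m13 + m23 + m34 = d3"
    "m14 + m24 + m34 = d4" "x \<le> m13 + m14 + m23 + m24"
  shows "s * (r12 ^ m12 * r13 ^ m13 * r14 ^ m14 * r23 ^ m23 * r24 ^ m24 * r34 ^ m34) \<le> B"
  using assms unfolding deg_bound_def by blast

lemma deg_boundI:
  assumes "\<And>m12 m13 m14 m23 m24 m34. m12 + m13 + m14 = d1 \<Longrightarrow> m12 + m23 + m24 = d2 \<Longrightarrow> m13 + m23 + m34 = d3 \<Longrightarrow>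
       m14 + m24 + m34 = d4 \<Longrightarrow> x \<le> m13 + m14 + m23 + m24 \<Longrightarrow>
       s * (r12 ^ m12 * r13 ^ m13 * r14 ^ m14 * r23 ^ m23 * r24 ^ m24 * r34 ^ m34) \<le> B"
  shows "deg_bound s B x d1 d2 d3 d4 r12 r13 r14 r23 r24 r34"
  using assms unfolding deg_bound_def by blast

text \<open>Drawing an edge moves its factor into \<open>s\<close> and lowers two degrees. An edge
  inside {1, 2} leaves the required number of crossing edges alone; the edges to 3 and 4 below lower
  it by one.\<close>

lemma deg_bound_edge12:
  assumes "deg_bound s B x (Suc d1) (Suc d2) d3 d4 r12 r13 r14 r23 r24 r34"
  shows "deg_bound (s * r12) B x d1 d2 d3 d4 r12 r13 r14 r23 r24 r34"
proof (rule deg_boundI)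
  fix m12 m13 m14 m23 m24 m34
  assume "m12 + m13 + m14 = d1" "m12 + m23 + m24 = d2" "m13 + m23 + m34 = d3" "m14 + m24 + m34 = d4"
    "x \<le> m13 + m14 + m23 + m24"
  then show "s * r12 * (r12 ^ m12 * r13 ^ m13 * r14 ^ m14 * r23 ^ m23 * r24 ^ m24 * r34 ^ m34) \<le> B"
    using deg_boundD[OF assms, of "Suc m12" m13 m14 m23 m24 m34] by (simp add: mult_ac)
qed

lemma deg_bound_edge13:
  assumes "deg_bound s B x (Suc d1) d2 (Suc d3) d4 r12 r13 r14 r23 r24 r34"
  shows "deg_bound (s * r13) B (x - 1) d1 d2 d3 d4 r12 r13 r14 r23 r24 r34"
proof (rule deg_boundI)
  fix m12 m13 m14 m23 m24 m34
  assume "m12 + m13 + m14 = d1" "m12 + m23 + m24 = d2" "m13 + m23 + m34 = d3" "m14 + m24 + m34 = d4"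
    "x - 1 \<le> m13 + m14 + m23 + m24"
  then show "s * r13 * (r12 ^ m12 * r13 ^ m13 * r14 ^ m14 * r23 ^ m23 * r24 ^ m24 * r34 ^ m34) \<le> B"
    using deg_boundD[OF assms, of m12 "Suc m13" m14 m23 m24 m34] by (simp add: mult_ac)
qed

lemma deg_bound_edge14:
  assumes "deg_bound s B x (Suc d1) d2 d3 (Suc d4) r12 r13 r14 r23 r24 r34"
  shows "deg_bound (s * r14) B (x - 1) d1 d2 d3 d4 r12 r13 r14 r23 r24 r34"
proof (rule deg_boundI)
  fix m12 m13 m14 m23 m24 m34
  assume "m12 + m13 + m14 = d1" "m12 + m23 + m24 = d2" "m13 + m23 + m34 = d3" "m14 + m24 + m34 = d4"
    "x - 1 \<le> m13 + m14 + m23 + m24"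
  then show "s * r14 * (r12 ^ m12 * r13 ^ m13 * r14 ^ m14 * r23 ^ m23 * r24 ^ m24 * r34 ^ m34) \<le> B"
    using deg_boundD[OF assms, of m12 m13 "Suc m14" m23 m24 m34] by (simp add: mult_ac)
qed

lemma deg_bound_swap12:
  assumes "deg_bound s B x d1 d2 d3 d4 r12 r13 r14 r23 r24 r34"
  shows "deg_bound s B x d2 d1 d3 d4 r12 r23 r24 r13 r14 r34"
proof (rule deg_boundI)
  fix m12 m13 m14 m23 m24 m34
  assume "m12 + m13 + m14 = d2" "m12 + m23 + m24 = d1" "m13 + m23 + m34 = d3" "m14 + m24 + m34 = d4"
    "x \<le> m13 + m14 + m23 + m24"
  then show "s * (r12 ^ m12 * r23 ^ m13 * r24 ^ m14 * r13 ^ m23 * r14 ^ m24 * r34 ^ m34) \<le> B"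
    using deg_boundD[OF assms, of m12 m23 m24 m13 m14 m34] by (simp add: mult_ac)
qed

text \<open>This relabelling, like the next one, does not respect the pairs {1, 2} and {3, 4}, so it
  is stated with no requirement on crossing edges, in contrast to
  \<open>deg_bound_swap12\<close>.\<close>

lemma deg_bound_swap13:
  assumes "deg_bound s B 0 d1 d2 d3 d4 r12 r13 r14 r23 r24 r34"
  shows "deg_bound s B 0 d3 d2 d1 d4 r23 r13 r34 r12 r24 r14"
proof (rule deg_boundI)
  fix m12 m13 m14 m23 m24 m34
  assume "m12 + m13 + m14 = d3" "m12 + m23 + m24 = d2" "m13 + m23 + m34 = d1" "m14 + m24 + m34 = d4"
  then show "s * (r23 ^ m12 * r13 ^ m13 * r34 ^ m14 * r12 ^ m23 * r24 ^ m24 * r14 ^ m34) \<le> B"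
    using deg_boundD[OF assms, of m23 m13 m34 m12 m24 m14] by (simp add: mult_ac)
qed

lemma deg_bound_swap14:
  assumes "deg_bound s B 0 d1 d2 d3 d4 r12 r13 r14 r23 r24 r34"
  shows "deg_bound s B 0 d4 d2 d3 d1 r24 r34 r14 r23 r12 r13"
proof (rule deg_boundI)
  fix m12 m13 m14 m23 m24 m34
  assume "m12 + m13 + m14 = d4" "m12 + m23 + m24 = d2" "m13 + m23 + m34 = d3" "m14 + m24 + m34 = d1"
  then show "s * (r24 ^ m12 * r34 ^ m13 * r14 ^ m14 * r23 ^ m23 * r12 ^ m24 * r13 ^ m34) \<le> B"
    using deg_boundD[OF assms, of m24 m34 m14 m23 m12 m13] by (simp add: mult_ac)
qed

text \<open>Closes the inductions below: a Wick step at total degree N' offers at most N' - 1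
  partners, each leaving total degree N' - 2. For N = 0 there is no partner and the truncated
  difference does not matter.\<close>

lemma fact_step:
  assumes "N' = Suc N" "(D::nat) \<le> N" shows "real D * fact (N' - 2) \<le> (fact N' :: real)"
proof (cases N)
  case 0 then show ?thesis using assms by simp
next
  case (Suc n)
  have "(fact N' :: real) = real N' * (real N * fact n)" by (simp add: assms Suc)
  moreover have "real D * fact n \<le> real N' * (real N * fact n)"
  proof -
    have "real D * fact n \<le> 1 * (real N * fact n)" using assms by simp
    also have "\<dots> \<le> real N' * (real N * fact n)" using assms by (intro mult_right_mono) auto
    finally show ?thesis .
  qed
  moreover have "N' - 2 = n" using assms Suc by simp
  ultimately show ?thesis by simp
qed

text \<open>Handles all edges from a chosen vertex to one other vertex; the multiplicities
  \<open>a j\<close> of the possible partners add up to its degree.\<close>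

lemma weighted_edge_sum:
  fixes cc h :: "'d::finite \<Rightarrow> real" and a :: "'d \<Rightarrow> nat"
  assumes "0 \<le> s" "0 \<le> r" "\<And>j. \<bar>cc j\<bar> \<le> r" "\<And>j. a j > 0 \<Longrightarrow> s * r * \<bar>h j\<bar> \<le> X"
  shows "s * \<bar>\<Sum>j\<in>UNIV. cc j * real (a j) * h j\<bar> \<le> real (msize a) * X"
proof -
  have "s * \<bar>cc j * real (a j) * h j\<bar> \<le> real (a j) * X" for j
  proof (cases "a j > 0")
    case True
    have "s * (\<bar>cc j\<bar> * \<bar>h j\<bar>) \<le> s * (r * \<bar>h j\<bar>)" using assms by (intro mult_left_mono mult_right_mono) auto
    also have "\<dots> \<le> X" using assms(4)[OF True] by (simp add: mult.assoc)
    finally have "real (a j) * (s * (\<bar>cc j\<bar> * \<bar>h j\<bar>)) \<le> real (a j) * X" by (intro mult_left_mono) auto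
    then show ?thesis by (simp add: abs_mult mult_ac)
  qed simp
  then have "(\<Sum>j\<in>UNIV. s * \<bar>cc j * real (a j) * h j\<bar>) \<le> (\<Sum>j\<in>UNIV. real (a j) * X)" by (intro sum_mono)
  moreover have "s * \<bar>\<Sum>j\<in>UNIV. cc j * real (a j) * h j\<bar> \<le> s * (\<Sum>j\<in>UNIV. \<bar>cc j * real (a j) * h j\<bar>)"
    using assms(1) by (intro mult_left_mono sum_abs)
  ultimately show ?thesis by (simp add: sum_distrib_left sum_distrib_right msize_def)
qed

section \<open>Four-point functions and their covariances\<close>

context hermite_family
begin

definition H2 :: "('d \<Rightarrow> nat) \<Rightarrow> ('d \<Rightarrow> nat) \<Rightarrow> int \<Rightarrow> int \<Rightarrow> real" where
  "H2 \<alpha> \<beta> k l = expectation (\<lambda>\<omega>. hprod \<alpha> k (vec \<omega>) * hprod \<beta> l (vec \<omega>))"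

definition H4 :: "('d \<Rightarrow> nat) \<Rightarrow> ('d \<Rightarrow> nat) \<Rightarrow> ('d \<Rightarrow> nat) \<Rightarrow> ('d \<Rightarrow> nat) \<Rightarrow> int \<Rightarrow> int \<Rightarrow> int \<Rightarrow> int \<Rightarrow> real" where
  "H4 \<alpha> \<beta> \<gamma> \<delta> k l k' l' = expectation (\<lambda>\<omega>. hprod \<alpha> k (vec \<omega>) *
     (hprod \<beta> l (vec \<omega>) * (hprod \<gamma> k' (vec \<omega>) * hprod \<delta> l' (vec \<omega>))))"

lemma H4_swap12: "H4 \<alpha> \<beta> \<gamma> \<delta> k l k' l' = H4 \<beta> \<alpha> \<gamma> \<delta> l k k' l'"
  and H4_swap13: "H4 \<alpha> \<beta> \<gamma> \<delta> k l k' l' = H4 \<gamma> \<beta> \<alpha> \<delta> k' l k l'"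
  and H4_swap14: "H4 \<alpha> \<beta> \<gamma> \<delta> k l k' l' = H4 \<delta> \<beta> \<gamma> \<alpha> l' l k' k"
  unfolding H4_def by (simp_all only: mult_ac)

text \<open>The product rule for the three remaining factors gives one group of terms for each
  endpoint of the edge drawn from vertex 1.\<close>

lemma wick_four:
  assumes \<alpha>: "\<alpha> i > 0"
  shows "H4 \<alpha> \<beta> \<gamma> \<delta> k l k' l' =
    (\<Sum>j\<in>UNIV. c (k, i) (l, j) * real (\<beta> j) * H4 (dec \<alpha> i) (dec \<beta> j) \<gamma> \<delta> k l k' l') +
    (\<Sum>j\<in>UNIV. c (k, i) (k', j) * real (\<gamma> j) * H4 (dec \<alpha> i) \<beta> (dec \<gamma> j) \<delta> k l k' l') +
    (\<Sum>j\<in>UNIV. c (k, i) (l', j) * real (\<delta> j) * H4 (dec \<alpha> i) \<beta> \<gamma> (dec \<delta> j) k l k' l')"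
proof -
  let ?K = "{k, l, k', l'}"
  let ?J = "?K \<times> (UNIV :: 'd set)"
  let ?a = "\<lambda>\<omega>. hprod (dec \<alpha> i) k (vec \<omega>)" and ?b = "\<lambda>\<omega>. hprod \<beta> l (vec \<omega>)"
    and ?c = "\<lambda>\<omega>. hprod \<gamma> k' (vec \<omega>)" and ?d = "\<lambda>\<omega>. hprod \<delta> l' (vec \<omega>)"
  have J: "finite ?J" by simp
  have h: "pdiff ?J (hprod \<alpha> x) (dhprod \<alpha> x)" if "x \<in> ?K" for x \<alpha> using that by (rule pdiff_hprod)
  have ex: "\<exists>dq. pdiff ?J (dhprod \<alpha> x b) dq" if "x \<in> ?K" for x \<alpha> b by (rule pdiff_deriv[OF h[OF that]])
  have int: "integrable M (\<lambda>\<omega>. ?a \<omega> * (dhprod \<beta> l b (vec \<omega>) * (?c \<omega> * ?d \<omega>)))"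
    "integrable M (\<lambda>\<omega>. ?a \<omega> * (?b \<omega> * (dhprod \<gamma> k' b (vec \<omega>) * ?d \<omega>)))"
    "integrable M (\<lambda>\<omega>. ?a \<omega> * (?b \<omega> * (?c \<omega> * dhprod \<delta> l' b (vec \<omega>))))" for b
  proof -
    from ex[of l \<beta> b] obtain d1 where d1: "pdiff ?J (dhprod \<beta> l b) d1" by auto
    from ex[of k' \<gamma> b] obtain d2 where d2: "pdiff ?J (dhprod \<gamma> k' b) d2" by auto
    from ex[of l' \<delta> b] obtain d3 where d3: "pdiff ?J (dhprod \<delta> l' b) d3" by auto
    note d = d1 d2 d3
    note m = pdiff.mult
    have k: "k \<in> ?K" "l \<in> ?K" "k' \<in> ?K" "l' \<in> ?K" by auto
    show "integrable M (\<lambda>\<omega>. ?a \<omega> * (dhprod \<beta> l b (vec \<omega>) * (?c \<omega> * ?d \<omega>)))"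
      by (rule integrable_pdiff[OF J m[OF h[OF k(1)] m[OF d(1) m[OF h[OF k(3)] h[OF k(4)]]]]])
    show "integrable M (\<lambda>\<omega>. ?a \<omega> * (?b \<omega> * (dhprod \<gamma> k' b (vec \<omega>) * ?d \<omega>)))"
      by (rule integrable_pdiff[OF J m[OF h[OF k(1)] m[OF h[OF k(2)] m[OF d(2) h[OF k(4)]]]]])
    show "integrable M (\<lambda>\<omega>. ?a \<omega> * (?b \<omega> * (?c \<omega> * dhprod \<delta> l' b (vec \<omega>))))"
      by (rule integrable_pdiff[OF J m[OF h[OF k(1)] m[OF h[OF k(2)] m[OF h[OF k(3)] d(3)]]]])
  qed
  have "H4 \<alpha> \<beta> \<gamma> \<delta> k l k' l' = (\<Sum>b\<in>?J. c (k, i) b * expectation (\<lambda>\<omega>. ?a \<omega> *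
     (dhprod \<beta> l b (vec \<omega>) * (?c \<omega> * ?d \<omega>) + ?b \<omega> * (dhprod \<gamma> k' b (vec \<omega>) * ?d \<omega> + ?c \<omega> * dhprod \<delta> l' b (vec \<omega>)))))"
    unfolding H4_def
    by (rule wick_real[where \<alpha>=\<alpha>, OF _ _ \<alpha> pdiff.mult[OF h pdiff.mult[OF h h]]]) auto
  also have "\<dots> = (\<Sum>b\<in>?J. c (k, i) b * expectation (\<lambda>\<omega>. ?a \<omega> * (dhprod \<beta> l b (vec \<omega>) * (?c \<omega> * ?d \<omega>)))) +
    (\<Sum>b\<in>?J. c (k, i) b * expectation (\<lambda>\<omega>. ?a \<omega> * (?b \<omega> * (dhprod \<gamma> k' b (vec \<omega>) * ?d \<omega>)))) +
    (\<Sum>b\<in>?J. c (k, i) b * expectation (\<lambda>\<omega>. ?a \<omega> * (?b \<omega> * (?c \<omega> * dhprod \<delta> l' b (vec \<omega>)))))"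
    unfolding sum.distrib[symmetric] distrib_left
    by (intro sum.cong refl) (simp add: int distrib_left add.assoc)
  also have "(\<Sum>b\<in>?J. c (k, i) b * expectation (\<lambda>\<omega>. ?a \<omega> * (dhprod \<beta> l b (vec \<omega>) * (?c \<omega> * ?d \<omega>)))) =
     (\<Sum>b\<in>?J. c (k, i) b * (of_bool (fst b = l) * (real (\<beta> (snd b)) * H4 (dec \<alpha> i) (dec \<beta> (snd b)) \<gamma> \<delta> k l k' l')))"
    unfolding dhprod_def H4_def by (intro sum.cong refl) (simp add: of_bool_def mult_ac)
  also have "\<dots> = (\<Sum>j\<in>UNIV. c (k, i) (l, j) * (real (\<beta> j) * H4 (dec \<alpha> i) (dec \<beta> j) \<gamma> \<delta> k l k' l'))"
    by (rule sum_times_slice) auto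
  also have "(\<Sum>b\<in>?J. c (k, i) b * expectation (\<lambda>\<omega>. ?a \<omega> * (?b \<omega> * (dhprod \<gamma> k' b (vec \<omega>) * ?d \<omega>)))) =
     (\<Sum>b\<in>?J. c (k, i) b * (of_bool (fst b = k') * (real (\<gamma> (snd b)) * H4 (dec \<alpha> i) \<beta> (dec \<gamma> (snd b)) \<delta> k l k' l')))"
    unfolding dhprod_def H4_def by (intro sum.cong refl) (simp add: of_bool_def mult_ac)
  also have "\<dots> = (\<Sum>j\<in>UNIV. c (k, i) (k', j) * (real (\<gamma> j) * H4 (dec \<alpha> i) \<beta> (dec \<gamma> j) \<delta> k l k' l'))"
    by (rule sum_times_slice) auto
  also have "(\<Sum>b\<in>?J. c (k, i) b * expectation (\<lambda>\<omega>. ?a \<omega> * (?b \<omega> * (?c \<omega> * dhprod \<delta> l' b (vec \<omega>))))) =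
     (\<Sum>b\<in>?J. c (k, i) b * (of_bool (fst b = l') * (real (\<delta> (snd b)) * H4 (dec \<alpha> i) \<beta> \<gamma> (dec \<delta> (snd b)) k l k' l')))"
    unfolding dhprod_def H4_def by (intro sum.cong refl) (simp add: of_bool_def mult_ac)
  also have "\<dots> = (\<Sum>j\<in>UNIV. c (k, i) (l', j) * (real (\<delta> j) * H4 (dec \<alpha> i) \<beta> \<gamma> (dec \<delta> j) k l k' l'))"
    by (rule sum_times_slice) auto
  finally show ?thesis by (simp only: mult.assoc)
qed

text \<open>\<open>r k l\<close> majorizes the covariances of all coordinates between the times k
  and l at once, so that the bounds depend on edge multiplicities only.\<close>

context
  fixes r :: "int \<Rightarrow> int \<Rightarrow> real"
  assumes r0: "\<And>k l. 0 \<le> r k l" and cr: "\<And>k i l j. \<bar>c (k, i) (l, j)\<bar> \<le> r k l" and r_sym: "\<And>k l. r k l = r l k"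
begin

text \<open>One edge is drawn from vertex 1. Its factor passes into \<open>s\<close>, which is why
  the induction hypothesis is needed for arbitrary \<open>s\<close>.\<close>

lemma four_point_bound_step:
  assumes IH: "\<And>\<alpha> \<beta> \<gamma> \<delta> s. msize \<alpha> + msize \<beta> + msize \<gamma> + msize \<delta> < N \<Longrightarrow> 0 \<le> s \<Longrightarrow>
     deg_bound s B 0 (msize \<alpha>) (msize \<beta>) (msize \<gamma>) (msize \<delta>) (r k l) (r k k') (r k l') (r l k') (r l l') (r k' l') \<Longrightarrow>
     s * \<bar>H4 \<alpha> \<beta> \<gamma> \<delta> k l k' l'\<bar> \<le> fact (msize \<alpha> + msize \<beta> + msize \<gamma> + msize \<delta>) * B"
    and N: "msize \<alpha> + msize \<beta> + msize \<gamma> + msize \<delta> = N" and s: "0 \<le> s" and B: "0 \<le> B"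
    and bd: "deg_bound s B 0 (msize \<alpha>) (msize \<beta>) (msize \<gamma>) (msize \<delta>) (r k l) (r k k') (r k l') (r l k') (r l l') (r k' l')"
    and pos: "msize \<alpha> > 0"
  shows "s * \<bar>H4 \<alpha> \<beta> \<gamma> \<delta> k l k' l'\<bar> \<le> fact N * B"
proof -
  obtain i where i: "\<alpha> i > 0" using msize_pos[OF pos] by blast
  note a = msize_dec[of \<alpha> i, OF i]
  let ?X = "fact (N - 2) * B"
  have 1: "s * \<bar>\<Sum>j\<in>UNIV. c (k, i) (l, j) * real (\<beta> j) * H4 (dec \<alpha> i) (dec \<beta> j) \<gamma> \<delta> k l k' l'\<bar> \<le> real (msize \<beta>) * ?X"
  proof (rule weighted_edge_sum[OF s r0 cr])
    fix j assume j: "0 < \<beta> j"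
    note b = msize_dec[of \<beta> j, OF j]
    have "msize (dec \<alpha> i) + msize (dec \<beta> j) + msize \<gamma> + msize \<delta> = N - 2" using N a b by simp
    moreover have "s * r k l * \<bar>H4 (dec \<alpha> i) (dec \<beta> j) \<gamma> \<delta> k l k' l'\<bar> \<le>
       fact (msize (dec \<alpha> i) + msize (dec \<beta> j) + msize \<gamma> + msize \<delta>) * B"
      using N a b s r0 by (intro IH deg_bound_edge12 bd[unfolded a b]) auto
    ultimately show "s * r k l * \<bar>H4 (dec \<alpha> i) (dec \<beta> j) \<gamma> \<delta> k l k' l'\<bar> \<le> ?X" by simp
  qed
  have 2: "s * \<bar>\<Sum>j\<in>UNIV. c (k, i) (k', j) * real (\<gamma> j) * H4 (dec \<alpha> i) \<beta> (dec \<gamma> j) \<delta> k l k' l'\<bar> \<le> real (msize \<gamma>) * ?X"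
  proof (rule weighted_edge_sum[OF s r0 cr])
    fix j assume j: "0 < \<gamma> j"
    note b = msize_dec[of \<gamma> j, OF j]
    have "msize (dec \<alpha> i) + msize \<beta> + msize (dec \<gamma> j) + msize \<delta> = N - 2" using N a b by simp
    moreover have "s * r k k' * \<bar>H4 (dec \<alpha> i) \<beta> (dec \<gamma> j) \<delta> k l k' l'\<bar> \<le>
       fact (msize (dec \<alpha> i) + msize \<beta> + msize (dec \<gamma> j) + msize \<delta>) * B"
      using N a b s r0 deg_bound_edge13[OF bd[unfolded a b]] by (intro IH) auto
    ultimately show "s * r k k' * \<bar>H4 (dec \<alpha> i) \<beta> (dec \<gamma> j) \<delta> k l k' l'\<bar> \<le> ?X" by simp
  qed
  have 3: "s * \<bar>\<Sum>j\<in>UNIV. c (k, i) (l', j) * real (\<delta> j) * H4 (dec \<alpha> i) \<beta> \<gamma> (dec \<delta> j) k l k' l'\<bar> \<le> real (msize \<delta>) * ?X"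
  proof (rule weighted_edge_sum[OF s r0 cr])
    fix j assume j: "0 < \<delta> j"
    note b = msize_dec[of \<delta> j, OF j]
    have "msize (dec \<alpha> i) + msize \<beta> + msize \<gamma> + msize (dec \<delta> j) = N - 2" using N a b by simp
    moreover have "s * r k l' * \<bar>H4 (dec \<alpha> i) \<beta> \<gamma> (dec \<delta> j) k l k' l'\<bar> \<le>
       fact (msize (dec \<alpha> i) + msize \<beta> + msize \<gamma> + msize (dec \<delta> j)) * B"
      using N a b s r0 deg_bound_edge14[OF bd[unfolded a b]] by (intro IH) auto
    ultimately show "s * r k l' * \<bar>H4 (dec \<alpha> i) \<beta> \<gamma> (dec \<delta> j) k l k' l'\<bar> \<le> ?X" by simp
  qed
  have "s * \<bar>x + y + z\<bar> \<le> s * \<bar>x\<bar> + s * \<bar>y\<bar> + s * \<bar>z\<bar>" for x y z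
    unfolding distrib_left[symmetric] using s by (intro mult_left_mono) auto
  from order_trans[OF this add_mono[OF add_mono[OF 1 2] 3]]
  have "s * \<bar>H4 \<alpha> \<beta> \<gamma> \<delta> k l k' l'\<bar> \<le> real (msize \<beta>) * ?X + real (msize \<gamma>) * ?X + real (msize \<delta>) * ?X"
    unfolding wick_four[where \<alpha>=\<alpha>, OF i] .
  also have "\<dots> = (real (msize \<beta> + msize \<gamma> + msize \<delta>) * fact (N - 2)) * B" by (simp add: algebra_simps)
  also have "\<dots> \<le> fact N * B"
    using B N a by (intro mult_right_mono fact_step[where N="msize (dec \<alpha> i) + msize \<beta> + msize \<gamma> + msize \<delta>"]) auto
  finally show ?thesis .
qed

text \<open>Induction on the total degree; when vertex 1 is exhausted, a vertex of positive degree
  is relabelled as the first. At total degree 0 the empty diagram in the hypothesis says s \<le>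
  B.\<close>

lemma four_point_bound:
  assumes "0 \<le> s" "0 \<le> B"
    "deg_bound s B 0 (msize \<alpha>) (msize \<beta>) (msize \<gamma>) (msize \<delta>) (r k l) (r k k') (r k l') (r l k') (r l l') (r k' l')"
  shows "s * \<bar>H4 \<alpha> \<beta> \<gamma> \<delta> k l k' l'\<bar> \<le> fact (msize \<alpha> + msize \<beta> + msize \<gamma> + msize \<delta>) * B"
  using assms(1,3)
proof (induction "msize \<alpha> + msize \<beta> + msize \<gamma> + msize \<delta>" arbitrary: \<alpha> \<beta> \<gamma> \<delta> s k l k' l' rule: less_induct)
  case less
  let ?N = "msize \<alpha> + msize \<beta> + msize \<gamma> + msize \<delta>"
  note step = four_point_bound_step[of ?N B, OF less.hyps _ _ assms(2)]
  consider "msize \<alpha> > 0" | "msize \<beta> > 0" | "msize \<gamma> > 0" | "msize \<delta> > 0" | "?N = 0" by linarith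
  then show ?case
  proof cases
    case 1 then show ?thesis using less.prems by (intro step) auto
  next
    case 2
    show ?thesis unfolding H4_swap12[of \<alpha>]
      by (rule step) (use 2 less.prems deg_bound_swap12[OF less.prems(2)] r_sym[of l k] in auto)
  next
    case 3
    show ?thesis unfolding H4_swap13[of \<alpha>]
      by (rule step) (use 3 less.prems deg_bound_swap13[OF less.prems(2)] r_sym[of k' k] r_sym[of k' l] r_sym[of l k] in auto)
  next
    case 4
    show ?thesis unfolding H4_swap14[of \<alpha>]
      by (rule step) (use 4 less.prems deg_bound_swap14[OF less.prems(2)] r_sym[of l' k] r_sym[of l' l] r_sym[of l' k'] r_sym[of l k] r_sym[of k' k] in auto)
  next
    case 5
    then have "\<alpha> = (\<lambda>_. 0)" "\<beta> = (\<lambda>_. 0)" "\<gamma> = (\<lambda>_. 0)" "\<delta> = (\<lambda>_. 0)" by (auto intro: msize_0)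
    moreover have "s \<le> B" using deg_boundD[OF less.prems(2), of 0 0 0 0 0 0] 5 by simp
    ultimately show ?thesis by (simp add: H4_def prob_space msize_def)
  qed
qed

text \<open>An edge from 1 to 2 appears identically in the product of the two-point functions, so
  the difference recurs with smaller indices. An edge from 1 to 3 or 4 has no counterpart there, but
  the diagram then already crosses, the requirement on crossing edges drops to 0, and
  \<open>four_point_bound\<close> takes over.\<close>

lemma covariance_bound_step:
  assumes IH: "\<And>\<alpha> \<beta> s. msize \<alpha> + msize \<beta> + msize \<gamma> + msize \<delta> < N \<Longrightarrow> 0 \<le> s \<Longrightarrow>
     deg_bound s B 1 (msize \<alpha>) (msize \<beta>) (msize \<gamma>) (msize \<delta>) (r k l) (r k k') (r k l') (r l k') (r l l') (r k' l') \<Longrightarrow>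
     s * \<bar>H4 \<alpha> \<beta> \<gamma> \<delta> k l k' l' - H2 \<alpha> \<beta> k l * H2 \<gamma> \<delta> k' l'\<bar> \<le> fact (msize \<alpha> + msize \<beta> + msize \<gamma> + msize \<delta>) * B"
    and N: "msize \<alpha> + msize \<beta> + msize \<gamma> + msize \<delta> = N" and s: "0 \<le> s" and B: "0 \<le> B"
    and bd: "deg_bound s B 1 (msize \<alpha>) (msize \<beta>) (msize \<gamma>) (msize \<delta>) (r k l) (r k k') (r k l') (r l k') (r l l') (r k' l')"
    and pos: "msize \<alpha> > 0"
  shows "s * \<bar>H4 \<alpha> \<beta> \<gamma> \<delta> k l k' l' - H2 \<alpha> \<beta> k l * H2 \<gamma> \<delta> k' l'\<bar> \<le> fact N * B"
proof -
  obtain i where i: "\<alpha> i > 0" using msize_pos[OF pos] by blast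
  note a = msize_dec[of \<alpha> i, OF i]
  let ?X = "fact (N - 2) * B"
  have 1: "s * \<bar>\<Sum>j\<in>UNIV. c (k, i) (l, j) * real (\<beta> j) *
       (H4 (dec \<alpha> i) (dec \<beta> j) \<gamma> \<delta> k l k' l' - H2 (dec \<alpha> i) (dec \<beta> j) k l * H2 \<gamma> \<delta> k' l')\<bar> \<le> real (msize \<beta>) * ?X"
  proof (rule weighted_edge_sum[OF s r0 cr])
    fix j assume j: "0 < \<beta> j"
    note b = msize_dec[of \<beta> j, OF j]
    have "msize (dec \<alpha> i) + msize (dec \<beta> j) + msize \<gamma> + msize \<delta> = N - 2" using N a b by simp
    moreover have "s * r k l * \<bar>H4 (dec \<alpha> i) (dec \<beta> j) \<gamma> \<delta> k l k' l' - H2 (dec \<alpha> i) (dec \<beta> j) k l * H2 \<gamma> \<delta> k' l'\<bar> \<le>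
       fact (msize (dec \<alpha> i) + msize (dec \<beta> j) + msize \<gamma> + msize \<delta>) * B"
      using N a b s r0 by (intro IH deg_bound_edge12 bd[unfolded a b]) auto
    ultimately show "s * r k l * \<bar>H4 (dec \<alpha> i) (dec \<beta> j) \<gamma> \<delta> k l k' l' - H2 (dec \<alpha> i) (dec \<beta> j) k l * H2 \<gamma> \<delta> k' l'\<bar> \<le> ?X" by simp
  qed
  have 2: "s * \<bar>\<Sum>j\<in>UNIV. c (k, i) (k', j) * real (\<gamma> j) * H4 (dec \<alpha> i) \<beta> (dec \<gamma> j) \<delta> k l k' l'\<bar> \<le> real (msize \<gamma>) * ?X"
  proof (rule weighted_edge_sum[OF s r0 cr])
    fix j assume j: "0 < \<gamma> j"
    note b = msize_dec[of \<gamma> j, OF j]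
    have "msize (dec \<alpha> i) + msize \<beta> + msize (dec \<gamma> j) + msize \<delta> = N - 2" using N a b by simp
    moreover have "s * r k k' * \<bar>H4 (dec \<alpha> i) \<beta> (dec \<gamma> j) \<delta> k l k' l'\<bar> \<le>
       fact (msize (dec \<alpha> i) + msize \<beta> + msize (dec \<gamma> j) + msize \<delta>) * B"
      using s r0 B deg_bound_edge13[OF bd[unfolded a b]] by (intro four_point_bound) auto
    ultimately show "s * r k k' * \<bar>H4 (dec \<alpha> i) \<beta> (dec \<gamma> j) \<delta> k l k' l'\<bar> \<le> ?X" by simp
  qed
  have 3: "s * \<bar>\<Sum>j\<in>UNIV. c (k, i) (l', j) * real (\<delta> j) * H4 (dec \<alpha> i) \<beta> \<gamma> (dec \<delta> j) k l k' l'\<bar> \<le> real (msize \<delta>) * ?X"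
  proof (rule weighted_edge_sum[OF s r0 cr])
    fix j assume j: "0 < \<delta> j"
    note b = msize_dec[of \<delta> j, OF j]
    have "msize (dec \<alpha> i) + msize \<beta> + msize \<gamma> + msize (dec \<delta> j) = N - 2" using N a b by simp
    moreover have "s * r k l' * \<bar>H4 (dec \<alpha> i) \<beta> \<gamma> (dec \<delta> j) k l k' l'\<bar> \<le>
       fact (msize (dec \<alpha> i) + msize \<beta> + msize \<gamma> + msize (dec \<delta> j)) * B"
      using s r0 B deg_bound_edge14[OF bd[unfolded a b]] by (intro four_point_bound) auto
    ultimately show "s * r k l' * \<bar>H4 (dec \<alpha> i) \<beta> \<gamma> (dec \<delta> j) k l k' l'\<bar> \<le> ?X" by simp
  qed
  have H2: "H2 \<alpha> \<beta> k l * H2 \<gamma> \<delta> k' l' =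
     (\<Sum>j\<in>UNIV. c (k, i) (l, j) * real (\<beta> j) * (H2 (dec \<alpha> i) (dec \<beta> j) k l * H2 \<gamma> \<delta> k' l'))"
    unfolding H2_def wick_two[where \<alpha>=\<alpha>, OF i] by (simp add: sum_distrib_right mult.assoc)
  have "s * \<bar>x + y + z\<bar> \<le> s * \<bar>x\<bar> + s * \<bar>y\<bar> + s * \<bar>z\<bar>" for x y z
    unfolding distrib_left[symmetric] using s by (intro mult_left_mono) auto
  from order_trans[OF this add_mono[OF add_mono[OF 1 2] 3]]
  have "s * \<bar>H4 \<alpha> \<beta> \<gamma> \<delta> k l k' l' - H2 \<alpha> \<beta> k l * H2 \<gamma> \<delta> k' l'\<bar> \<le> real (msize \<beta>) * ?X + real (msize \<gamma>) * ?X + real (msize \<delta>) * ?X"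
    unfolding wick_four[where \<alpha>=\<alpha>, OF i] H2 by (simp add: right_diff_distrib sum_subtractf algebra_simps)
  also have "\<dots> = (real (msize \<beta> + msize \<gamma> + msize \<delta>) * fact (N - 2)) * B" by (simp add: algebra_simps)
  also have "\<dots> \<le> fact N * B"
    using B N a by (intro mult_right_mono fact_step[where N="msize (dec \<alpha> i) + msize \<beta> + msize \<gamma> + msize \<delta>"]) auto
  finally show ?thesis .
qed

text \<open>Only the vertices 1 and 2 may be exchanged, since the pairing matters, so the induction
  runs on their degrees alone. When both vanish, the four-point function equals the second two-point
  function and the covariance is 0.\<close>

lemma covariance_bound:
  assumes "0 \<le> s" "0 \<le> B"
    "deg_bound s B 1 (msize \<alpha>) (msize \<beta>) (msize \<gamma>) (msize \<delta>) (r k l) (r k k') (r k l') (r l k') (r l l') (r k' l')"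
  shows "s * \<bar>H4 \<alpha> \<beta> \<gamma> \<delta> k l k' l' - H2 \<alpha> \<beta> k l * H2 \<gamma> \<delta> k' l'\<bar> \<le> fact (msize \<alpha> + msize \<beta> + msize \<gamma> + msize \<delta>) * B"
  using assms(1,3)
proof (induction "msize \<alpha> + msize \<beta>" arbitrary: \<alpha> \<beta> s k l rule: less_induct)
  case less
  let ?N = "msize \<alpha> + msize \<beta> + msize \<gamma> + msize \<delta>"
  have IH: "s' * \<bar>H4 \<alpha>' \<beta>' \<gamma> \<delta> k l k' l' - H2 \<alpha>' \<beta>' k l * H2 \<gamma> \<delta> k' l'\<bar> \<le> fact (msize \<alpha>' + msize \<beta>' + msize \<gamma> + msize \<delta>) * B"
    if "msize \<alpha>' + msize \<beta>' + msize \<gamma> + msize \<delta> < ?N" "0 \<le> s'"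
     "deg_bound s' B 1 (msize \<alpha>') (msize \<beta>') (msize \<gamma>) (msize \<delta>) (r k l) (r k k') (r k l') (r l k') (r l l') (r k' l')"
    for \<alpha>' \<beta>' s' k l using less.hyps[of \<alpha>' \<beta>' s' k l] that by simp
  note step = covariance_bound_step[OF IH _ _ assms(2)]
  consider "msize \<alpha> > 0" | "msize \<beta> > 0" | "msize \<alpha> = 0" "msize \<beta> = 0" by linarith
  then show ?case
  proof cases
    case 1
    show ?thesis by (rule step) (use 1 less.prems in auto)
  next
    case 2
    have "H2 \<alpha> \<beta> k l = H2 \<beta> \<alpha> l k" by (simp add: H2_def mult.commute)
    moreover have "s * \<bar>H4 \<beta> \<alpha> \<gamma> \<delta> l k k' l' - H2 \<beta> \<alpha> l k * H2 \<gamma> \<delta> k' l'\<bar> \<le> fact ?N * B"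
      by (rule step) (use 2 less.prems deg_bound_swap12[OF less.prems(2)] r_sym[of l k] in auto)
    ultimately show ?thesis unfolding H4_swap12[of \<alpha>] by simp
  next
    case 3
    then have "\<alpha> = (\<lambda>_. 0)" "\<beta> = (\<lambda>_. 0)" by (auto intro: msize_0)
    then show ?thesis using assms(2) by (simp add: H4_def H2_def prob_space)
  qed
qed

end

end

section \<open>Density of Hermite polynomials\<close>

text \<open>The product formula for \<open>lborel\<close> runs over basis vectors; the inverse of
  \<open>axis\<close> recovers the coordinate that a basis vector stands for.\<close>

lemma prod_Basis_vec:
  fixes x :: "real ^ 'd::finite" and F :: "'d \<Rightarrow> real \<Rightarrow> 'b::comm_monoid_mult"
  shows "(\<Prod>b\<in>Basis. F (the_inv_into UNIV (\<lambda>i. axis i (1::real)) b) (x \<bullet> b)) = (\<Prod>i\<in>UNIV. F i (x $ i))"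
proof -
  have inj: "inj (\<lambda>i::'d. axis i (1::real))" by (auto simp: inj_on_def axis_eq_axis)
  have B: "(Basis :: (real ^ 'd) set) = range (\<lambda>i. axis i 1)" by (auto simp: Basis_vec_def)
  show ?thesis
    unfolding B by (subst prod.reindex[OF inj]) (simp add: the_inv_into_f_f[OF inj] inner_axis)
qed

text \<open>Total mass, marginals, vanishing cross moments and exponential moments of the vector law
  are all drawn from this factorization.\<close>

lemma nn_integral_std_normal_law_vec_prod:
  fixes g :: "'d::finite \<Rightarrow> real \<Rightarrow> ennreal"
  assumes [measurable]: "\<And>i. g i \<in> borel_measurable borel"
  shows "(\<integral>\<^sup>+x. (\<Prod>i\<in>UNIV. g i (x $ i)) \<partial>std_normal_law_vec) = (\<Prod>i\<in>UNIV. \<integral>\<^sup>+x. g i x \<partial>std_normal_distribution)"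
proof -
  let ?F = "\<lambda>i x. ennreal (std_normal_density x) * g i x"
  have inj: "inj (\<lambda>i::'d. axis i (1::real))" by (auto simp: inj_on_def axis_eq_axis)
  have B: "(Basis :: (real ^ 'd) set) = range (\<lambda>i. axis i 1)" by (auto simp: Basis_vec_def)
  have "(\<integral>\<^sup>+x. (\<Prod>i\<in>UNIV. g i (x $ i)) \<partial>std_normal_law_vec) = (\<integral>\<^sup>+x. (\<Prod>i\<in>UNIV. ?F i (x $ i)) \<partial>lborel)"
    unfolding std_normal_law_vec_def by (subst nn_integral_density) (simp_all add: prod.distrib)
  also have "\<dots> = (\<integral>\<^sup>+x. (\<Prod>b\<in>Basis. ?F (the_inv_into UNIV (\<lambda>i. axis i (1::real)) b) (x \<bullet> b)) \<partial>lborel)"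
    by (intro nn_integral_cong) (rule prod_Basis_vec[of ?F, symmetric])
  also have "\<dots> = (\<Prod>b\<in>(Basis :: (real ^ 'd) set). \<integral>\<^sup>+x. ?F (the_inv_into UNIV (\<lambda>i. axis i 1) b) x \<partial>lborel)"
    by (rule nn_integral_lborel_prod) auto
  also have "\<dots> = (\<Prod>i\<in>UNIV. \<integral>\<^sup>+x. ?F i x \<partial>lborel)"
    unfolding B by (subst prod.reindex[OF inj]) (simp add: the_inv_into_f_f[OF inj])
  also have "\<dots> = (\<Prod>i\<in>UNIV. \<integral>\<^sup>+x. g i x \<partial>std_normal_distribution)"
    by (simp add: nn_integral_density)
  finally show ?thesis .
qed

lemma sets_std_normal_law_vec [simp, measurable_cong]: "sets std_normal_law_vec = sets borel"
  by (simp add: std_normal_law_vec_def)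

lemma space_std_normal_law_vec [simp]: "space std_normal_law_vec = UNIV"
  by (simp add: std_normal_law_vec_def)

lemma AE_std_normal_law_vecI: "AE x in lborel. P x \<Longrightarrow> AE x in std_normal_law_vec. P x"
  unfolding std_normal_law_vec_def by (subst AE_density) auto

lemma prob_space_std_normal_law_vec: "prob_space (std_normal_law_vec :: (real ^ 'd::finite) measure)"
proof
  interpret G: real_distribution std_normal_distribution by (rule real_dist_normal_dist)
  show "emeasure std_normal_law_vec (space std_normal_law_vec :: (real ^ 'd) set) = 1"
    using nn_integral_std_normal_law_vec_prod[of "\<lambda>_ _. 1"] G.emeasure_space_1 by simp
qed

lemma nn_integral_two_coordinates:
  fixes i j :: "'d::finite"
  assumes [measurable]: "g \<in> borel_measurable borel" "h \<in> borel_measurable borel" and ij: "i \<noteq> j"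
  shows "(\<integral>\<^sup>+x. g (x $ i) * h (x $ j) \<partial>std_normal_law_vec) =
    (\<integral>\<^sup>+x. g x \<partial>std_normal_distribution) * (\<integral>\<^sup>+x. h x \<partial>std_normal_distribution)"
proof -
  interpret G: real_distribution std_normal_distribution by (rule real_dist_normal_dist)
  let ?g = "\<lambda>k. if k = i then g else if k = j then h else (\<lambda>_. 1)"
  have P: "(\<Prod>k\<in>UNIV. F k) = F i * F j" if "\<And>k. k \<noteq> i \<Longrightarrow> k \<noteq> j \<Longrightarrow> F k = 1" for F :: "'d \<Rightarrow> ennreal"
  proof -
    have "(\<Prod>k\<in>UNIV. F k) = F i * (F j * (\<Prod>k\<in>UNIV - {i} - {j}. F k))"
      using ij by (subst prod.remove[of _ i], simp, simp, subst prod.remove[of _ j]) auto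
    also have "(\<Prod>k\<in>UNIV - {i} - {j}. F k) = 1" by (rule prod.neutral) (use that in auto)
    finally show ?thesis by simp
  qed
  have "(\<integral>\<^sup>+x. (\<Prod>k\<in>UNIV. ?g k (x $ k)) \<partial>std_normal_law_vec) = (\<Prod>k\<in>UNIV. \<integral>\<^sup>+x. ?g k x \<partial>std_normal_distribution)"
    by (rule nn_integral_std_normal_law_vec_prod) auto
  then show ?thesis
    using ij G.emeasure_space_1 by (subst (asm) (1 2) P) auto
qed

lemma std_normal_law_vec_marginal:
  fixes i :: "'d::finite"
  shows "distr std_normal_law_vec borel (\<lambda>x. x $ i) = std_normal_distribution"
proof (rule measure_eqI)
  interpret G: real_distribution std_normal_distribution by (rule real_dist_normal_dist)
  fix A :: "real set" assume "A \<in> sets (distr std_normal_law_vec borel (\<lambda>x :: real ^ 'd. x $ i))"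
  then have [measurable]: "A \<in> sets borel" by simp
  let ?g = "\<lambda>k. if k = i then indicator A else (\<lambda>_. 1 :: ennreal)"
  have P: "(\<Prod>k\<in>UNIV. F k) = F i" if "\<And>k. k \<noteq> i \<Longrightarrow> F k = 1" for F :: "'d \<Rightarrow> ennreal"
  proof -
    have "(\<Prod>k\<in>UNIV. F k) = F i * (\<Prod>k\<in>UNIV - {i}. F k)" by (subst prod.remove[of _ i]) auto
    also have "(\<Prod>k\<in>UNIV - {i}. F k) = 1" by (rule prod.neutral) (use that in auto)
    finally show ?thesis by simp
  qed
  have "(\<integral>\<^sup>+x. (\<Prod>k\<in>UNIV. ?g k (x $ k)) \<partial>std_normal_law_vec) = (\<Prod>k\<in>UNIV. \<integral>\<^sup>+x. ?g k x \<partial>std_normal_distribution)"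
    by (rule nn_integral_std_normal_law_vec_prod) auto
  then have "(\<integral>\<^sup>+x. indicator A (x $ i) \<partial>std_normal_law_vec) = (\<integral>\<^sup>+x. indicator A x \<partial>std_normal_distribution)"
    using G.emeasure_space_1 by (subst (asm) (1 2) P) auto
  also have "(\<integral>\<^sup>+x. indicator A x \<partial>std_normal_distribution) = emeasure std_normal_distribution A" by simp
  also have "(\<integral>\<^sup>+x. indicator A (x $ i) \<partial>std_normal_law_vec) = emeasure (distr std_normal_law_vec borel (\<lambda>x. x $ i)) A"
    by (subst nn_integral_indicator[symmetric], simp, subst nn_integral_distr) auto
  finally show "emeasure (distr std_normal_law_vec borel (\<lambda>x. x $ i)) A = emeasure std_normal_distribution A" .
qed simp

text \<open>The factorization is available for nonnegative functions only, so both coordinates are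
  split into positive and negative parts. These have equal means by symmetry, and the four products
  cancel.\<close>

lemma std_normal_law_vec_cross:
  fixes i j :: "'d::finite"
  assumes ij: "i \<noteq> j"
  shows "(\<integral>x. x $ i * x $ j \<partial>std_normal_law_vec) = 0"
proof -
  let ?G = "std_normal_law_vec :: (real ^ 'd) measure"
  let ?g = "std_normal_distribution"
  let ?P = "\<lambda>x::real. max x 0" and ?N = "\<lambda>x::real. max (- x) 0"
  have i1: "integrable ?g (\<lambda>x. x)" using integrable_std_normal_distribution_moment[of 1] by simp
  have iP: "integrable ?g ?P" and iN: "integrable ?g ?N" using i1 by (auto intro!: integrable_max)
  have "(\<integral>x. x \<partial>?g) = 0" using integral_std_normal_distribution_moment_odd[of 1] by simp
  moreover have "(\<integral>x. x \<partial>?g) = (\<integral>x. ?P x - ?N x \<partial>?g)" by (rule Bochner_Integration.integral_cong) auto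
  ultimately have PN: "(\<integral>x. ?P x \<partial>?g) = (\<integral>x. ?N x \<partial>?g)" using iP iN by simp
  have main: "has_bochner_integral ?G (\<lambda>x. a (x $ i) * b (x $ j)) ((\<integral>x. a x \<partial>?g) * (\<integral>x. b x \<partial>?g))"
    if ab: "integrable ?g a" "integrable ?g b" "\<And>x. 0 \<le> a x" "\<And>x. 0 \<le> b x" for a b :: "real \<Rightarrow> real"
  proof (rule has_bochner_integral_nn_integral)
    have [measurable]: "a \<in> borel_measurable borel" "b \<in> borel_measurable borel"
      using ab(1,2) borel_measurable_integrable by fastforce+
    show "(\<lambda>x. a (x $ i) * b (x $ j)) \<in> borel_measurable ?G" by simp
    have "(\<integral>\<^sup>+x. ennreal (a (x $ i) * b (x $ j)) \<partial>?G) = (\<integral>\<^sup>+x. ennreal (a x) \<partial>?g) * (\<integral>\<^sup>+x. ennreal (b x) \<partial>?g)"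
      using ab ij nn_integral_two_coordinates[of "\<lambda>x. ennreal (a x)" "\<lambda>x. ennreal (b x)" i j] by (simp add: ennreal_mult)
    also have "\<dots> = ennreal ((\<integral>x. a x \<partial>?g) * (\<integral>x. b x \<partial>?g))"
      using ab by (simp add: nn_integral_eq_integral ennreal_mult)
    finally show "(\<integral>\<^sup>+x. ennreal (a (x $ i) * b (x $ j)) \<partial>?G) = ennreal ((\<integral>x. a x \<partial>?g) * (\<integral>x. b x \<partial>?g))" .
    show "AE x in ?G. 0 \<le> a (x $ i) * b (x $ j)" using ab by simp
    show "0 \<le> (\<integral>x. a x \<partial>?g) * (\<integral>x. b x \<partial>?g)" using ab by simp
  qed
  have "has_bochner_integral ?G (\<lambda>x. ?P (x $ i) * ?P (x $ j) - ?P (x $ i) * ?N (x $ j) - ?N (x $ i) * ?P (x $ j) + ?N (x $ i) * ?N (x $ j))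
    ((\<integral>x. ?P x \<partial>?g) * (\<integral>x. ?P x \<partial>?g) - (\<integral>x. ?P x \<partial>?g) * (\<integral>x. ?N x \<partial>?g) - (\<integral>x. ?N x \<partial>?g) * (\<integral>x. ?P x \<partial>?g) + (\<integral>x. ?N x \<partial>?g) * (\<integral>x. ?N x \<partial>?g))"
    by (intro has_bochner_integral_add has_bochner_integral_diff main iP iN) auto
  moreover have "(\<lambda>x. ?P (x $ i) * ?P (x $ j) - ?P (x $ i) * ?N (x $ j) - ?N (x $ i) * ?P (x $ j) + ?N (x $ i) * ?N (x $ j)) = (\<lambda>x::real^'d. x $ i * x $ j)"
    by (auto simp: max_def)
  ultimately show ?thesis unfolding PN by (simp add: has_bochner_integral_integral_eq)
qed

text \<open>Completing the square turns e^{sx} times the density into a constant times a shifted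
  density, and e^{t|x|} \<le> e^{tx} + e^{-tx}. Exponential integrability is what makes polynomials
  dense in the Gaussian L^2 space.\<close>

lemma integrable_exp_abs_std_normal_law_vec:
  "integrable std_normal_law_vec (\<lambda>x :: real ^ 'd::finite. exp (t * (\<Sum>i\<in>UNIV. \<bar>x $ i\<bar>)))"
proof (rule integrableI_nonneg)
  have shift: "std_normal_density x * exp (s * x) = exp (s\<^sup>2 / 2) * normal_density s 1 x" for s x :: real
  proof -
    have "- x\<^sup>2 / 2 + s * x = s\<^sup>2 / 2 + (- (x - s)\<^sup>2 / 2)" by (simp add: power2_diff field_simps)
    then show ?thesis by (simp add: normal_density_def exp_add[symmetric])
  qed
  have fin: "(\<integral>\<^sup>+x. ennreal (exp (s * x)) \<partial>std_normal_distribution) < \<infinity>" for s :: real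
  proof -
    have "(\<integral>\<^sup>+x. ennreal (exp (s * x)) \<partial>std_normal_distribution) =
       (\<integral>\<^sup>+x. ennreal (exp (s\<^sup>2 / 2)) * ennreal (normal_density s 1 x) \<partial>lborel)"
      by (subst nn_integral_density) (auto simp: shift[symmetric] ennreal_mult[symmetric])
    also have "\<dots> = ennreal (exp (s\<^sup>2 / 2)) * (\<integral>\<^sup>+x. ennreal (normal_density s 1 x) \<partial>lborel)"
      by (rule nn_integral_cmult) simp
    also have "(\<integral>\<^sup>+x. ennreal (normal_density s 1 x) \<partial>lborel) = 1"
      by (subst nn_integral_eq_integral) auto
    finally show ?thesis by simp
  qed
  have "(\<integral>\<^sup>+x. ennreal (exp (t * (\<Sum>i\<in>UNIV. \<bar>x $ i\<bar>))) \<partial>(std_normal_law_vec :: (real ^ 'd) measure)) =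
    (\<integral>\<^sup>+x. (\<Prod>i\<in>UNIV. ennreal (exp (t * \<bar>x $ i\<bar>))) \<partial>(std_normal_law_vec :: (real ^ 'd) measure))"
    by (simp add: sum_distrib_left exp_sum prod_ennreal)
  also have "\<dots> = (\<Prod>i\<in>(UNIV :: 'd set). \<integral>\<^sup>+x. ennreal (exp (t * \<bar>x\<bar>)) \<partial>std_normal_distribution)"
    by (rule nn_integral_std_normal_law_vec_prod) simp
  also have "\<dots> < \<infinity>"
  proof -
    have "(\<integral>\<^sup>+x. ennreal (exp (t * \<bar>x\<bar>)) \<partial>std_normal_distribution) \<le>
       (\<integral>\<^sup>+x. ennreal (exp (t * x)) + ennreal (exp (- t * x)) \<partial>std_normal_distribution)"
      by (intro nn_integral_mono) (auto simp: abs_if)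
    also have "\<dots> = (\<integral>\<^sup>+x. ennreal (exp (t * x)) \<partial>std_normal_distribution) + (\<integral>\<^sup>+x. ennreal (exp (- t * x)) \<partial>std_normal_distribution)"
      by (rule nn_integral_add) auto
    also have "\<dots> < \<infinity>" using fin[of t] fin[of "- t"] by simp
    finally show ?thesis by (simp add: power_less_top_ennreal)
  qed
  finally show "(\<integral>\<^sup>+x. ennreal (exp (t * (\<Sum>i\<in>UNIV. \<bar>x $ i\<bar>))) \<partial>(std_normal_law_vec :: (real ^ 'd) measure)) < \<infinity>" .
qed auto

section \<open>The span of Hermite products contains all polynomials\<close>

definition hermite_vec :: "('d::finite \<Rightarrow> nat) \<Rightarrow> real ^ 'd \<Rightarrow> real" where
  "hermite_vec \<alpha> x = (\<Prod>i\<in>UNIV. poly (hermite (\<alpha> i)) (x $ i))"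

inductive hermite_span :: "(real ^ 'd::finite \<Rightarrow> real) \<Rightarrow> bool" where
  base: "hermite_span (hermite_vec \<alpha>)"
| scale: "hermite_span p \<Longrightarrow> hermite_span (\<lambda>x. c * p x)"
| add: "hermite_span p \<Longrightarrow> hermite_span q \<Longrightarrow> hermite_span (\<lambda>x. p x + q x)"

lemma hermite_span_eq_sum:
  assumes "hermite_span p"
  shows "\<exists>A a. finite A \<and> p = (\<lambda>x. \<Sum>\<alpha>\<in>A. a \<alpha> * hermite_vec \<alpha> x)"
  using assms
proof (induction rule: hermite_span.induct)
  case (base \<alpha>)
  show ?case by (intro exI[of _ "{\<alpha>}"] exI[of _ "\<lambda>_. 1"]) auto
next
  case (scale p c)
  then obtain A a where "finite A" "p = (\<lambda>x. \<Sum>\<alpha>\<in>A. a \<alpha> * hermite_vec \<alpha> x)" by blast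
  then show ?case by (intro exI[of _ A] exI[of _ "\<lambda>\<alpha>. c * a \<alpha>"]) (auto simp: sum_distrib_left mult.assoc)
next
  case (add p q)
  then obtain A a B b where A: "finite A" "p = (\<lambda>x. \<Sum>\<alpha>\<in>A. a \<alpha> * hermite_vec \<alpha> x)"
    and B: "finite B" "q = (\<lambda>x. \<Sum>\<alpha>\<in>B. b \<alpha> * hermite_vec \<alpha> x)" by blast
  \<comment> \<open>The coefficients are masked by membership because \<open>a\<close> and
    \<open>b\<close> are arbitrary outside their index sets, and the two sets may overlap.\<close>
  let ?c = "\<lambda>\<alpha>. of_bool (\<alpha> \<in> A) * a \<alpha> + of_bool (\<alpha> \<in> B) * b \<alpha>"
  have "(\<Sum>\<alpha>\<in>A. a \<alpha> * hermite_vec \<alpha> x) = (\<Sum>\<alpha>\<in>A \<union> B. of_bool (\<alpha> \<in> A) * a \<alpha> * hermite_vec \<alpha> x)" for x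
    using A B by (intro sum.mono_neutral_cong_left) auto
  moreover have "(\<Sum>\<alpha>\<in>B. b \<alpha> * hermite_vec \<alpha> x) = (\<Sum>\<alpha>\<in>A \<union> B. of_bool (\<alpha> \<in> B) * b \<alpha> * hermite_vec \<alpha> x)" for x
    using A B by (intro sum.mono_neutral_cong_left) auto
  ultimately have "(\<lambda>x. p x + q x) = (\<lambda>x. \<Sum>\<alpha>\<in>A \<union> B. ?c \<alpha> * hermite_vec \<alpha> x)"
    by (simp add: A B distrib_right sum.distrib)
  then show ?case using A B by (intro exI[of _ "A \<union> B"] exI[of _ ?c]) auto
qed

lemma hermite_span_cong: "hermite_span p \<Longrightarrow> (\<And>x. p x = q x) \<Longrightarrow> hermite_span q"
  by (metis ext)

lemma hermite_span_const: "hermite_span (\<lambda>x :: real ^ 'd::finite. c)"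
  by (rule hermite_span_cong[OF hermite_span.scale[OF hermite_span.base[of "\<lambda>_. 0"], of c]]) (simp add: hermite_vec_def)

text \<open>The recurrence read backwards. It makes the span stable under multiplication by a
  coordinate function.\<close>

lemma hermite_vec_coordinate:
  fixes i :: "'d::finite"
  shows "x $ i * hermite_vec \<alpha> x = hermite_vec (\<alpha>(i := Suc (\<alpha> i))) x + real (\<alpha> i) * hermite_vec (\<alpha>(i := \<alpha> i - 1)) x"
proof -
  have pd: "pderiv (hermite n) = smult (of_nat n) (hermite (n - 1))" for n
    by (rule pderiv_hermite)
  have r: "hermite_vec (\<alpha>(i := n)) x = poly (hermite n) (x $ i) * (\<Prod>j\<in>UNIV - {i}. poly (hermite (\<alpha> j)) (x $ j))" for n
    unfolding hermite_vec_def by (subst prod.remove[of UNIV i]) (auto intro!: prod.cong)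
  have "hermite_vec \<alpha> x = hermite_vec (\<alpha>(i := \<alpha> i)) x" by simp
  then show ?thesis unfolding r by (simp add: pd algebra_simps)
qed

lemma hermite_span_coordinate_mult:
  assumes "hermite_span p" shows "hermite_span (\<lambda>x. x $ i * p x)"
  using assms
proof (induction rule: hermite_span.induct)
  case (base \<alpha>)
  show ?case unfolding hermite_vec_coordinate by (intro hermite_span.intros)
next
  case (scale p c)
  show ?case by (rule hermite_span_cong[OF hermite_span.scale[OF scale.IH, of c]]) simp
next
  case (add p q)
  show ?case by (rule hermite_span_cong[OF hermite_span.add[OF add.IH]]) (simp add: algebra_simps)
qed

text \<open>Multipliers of the span form an algebra for trivial reasons, whereas closing the span
  itself under products would require a product formula for Hermite polynomials. As the span
  contains 1, every multiplier lies in it.\<close>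

definition span_multiplier :: "(real ^ 'd::finite \<Rightarrow> real) \<Rightarrow> bool" where
  "span_multiplier P \<longleftrightarrow> (\<forall>p. hermite_span p \<longrightarrow> hermite_span (\<lambda>x. P x * p x))"

lemma span_multiplier_intros:
  "span_multiplier (\<lambda>x. c)" "span_multiplier (\<lambda>x. x $ i)"
  "span_multiplier P \<Longrightarrow> span_multiplier Q \<Longrightarrow> span_multiplier (\<lambda>x. P x + Q x)"
  "span_multiplier P \<Longrightarrow> span_multiplier Q \<Longrightarrow> span_multiplier (\<lambda>x. P x * Q x)"
  unfolding span_multiplier_def
  by (auto intro: hermite_span.intros hermite_span_coordinate_mult simp: distrib_right mult.assoc)

lemma span_multiplier_sum:
  "finite A \<Longrightarrow> (\<And>k. k \<in> A \<Longrightarrow> span_multiplier (p k)) \<Longrightarrow> span_multiplier (\<lambda>x. \<Sum>k\<in>A. p k x)"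
  by (induction A rule: finite_induct) (auto intro: span_multiplier_intros)

lemma span_multiplier_power: "span_multiplier P \<Longrightarrow> span_multiplier (\<lambda>x. P x ^ k)"
  by (induction k) (auto intro: span_multiplier_intros)

lemma span_multiplier_imp_span: "span_multiplier P \<Longrightarrow> hermite_span P"
  unfolding span_multiplier_def using hermite_span_const[of 1] by fastforce

lemma span_multiplier_polynomial_compose:
  fixes Q :: "real ^ 'd::finite \<Rightarrow> real"
  assumes "real_polynomial_function Q" "\<And>i. span_multiplier (\<lambda>x. g x $ i)"
  shows "span_multiplier (\<lambda>x. Q (g x))"
  using assms(1)
proof (induction rule: real_polynomial_function.induct)
  case (linear f)
  interpret f: bounded_linear f by fact
  have "f (g x) = (\<Sum>i\<in>UNIV. f (axis i 1) * g x $ i)" for x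
  proof -
    have "f (g x) = f (\<Sum>i\<in>UNIV. g x $ i *\<^sub>R axis i 1)"
      by (simp add: basis_expansion flip: scalar_mult_eq_scaleR)
    then show ?thesis by (simp add: f.sum f.scaleR mult.commute)
  qed
  then show ?case by (simp only:) (intro span_multiplier_sum span_multiplier_intros assms(2), simp)
qed (auto intro: span_multiplier_intros)

lemma real_polynomial_function_bound:
  fixes Q :: "real ^ 'd::finite \<Rightarrow> real"
  assumes "real_polynomial_function Q"
  shows "\<exists>K N. 0 \<le> K \<and> (\<forall>R u. 1 \<le> R \<longrightarrow> (\<forall>i. \<bar>u $ i\<bar> \<le> R) \<longrightarrow> \<bar>Q u\<bar> \<le> K * R ^ N)"
  using assms
proof (induction rule: real_polynomial_function.induct)
  case (linear f)
  then obtain K where K: "0 \<le> K" "\<And>u. norm (f u) \<le> norm u * K" using bounded_linear.nonneg_bounded by blast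
  have "\<bar>f u\<bar> \<le> (K * real CARD('d)) * R ^ 1" if "\<And>i. \<bar>u $ i\<bar> \<le> R" for R u
  proof -
    have "norm u \<le> (\<Sum>i\<in>UNIV. \<bar>u $ i\<bar>)" by (rule norm_le_l1_cart)
    also have "\<dots> \<le> (\<Sum>i\<in>(UNIV :: 'd set). R)" using that by (intro sum_mono)
    finally have "norm u * K \<le> real CARD('d) * R * K" using K by (intro mult_right_mono) auto
    then show ?thesis using K(2)[of u] by (simp add: mult_ac)
  qed
  with K(1) show ?case by (intro exI[of _ "K * real CARD('d)"] exI[of _ 1]) auto
next
  case (const c)
  show ?case by (rule exI[of _ "\<bar>c\<bar>"], rule exI[of _ 0]) auto
next
  case (add f g)
  then obtain K N K' N' where K: "0 \<le> K" "0 \<le> K'"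
    and b: "\<And>R u. 1 \<le> R \<Longrightarrow> (\<And>i. \<bar>u $ i\<bar> \<le> R) \<Longrightarrow> \<bar>f u\<bar> \<le> K * R ^ N"
     "\<And>R u. 1 \<le> R \<Longrightarrow> (\<And>i. \<bar>u $ i\<bar> \<le> R) \<Longrightarrow> \<bar>g u\<bar> \<le> K' * R ^ N'" by metis
  have "\<bar>f u + g u\<bar> \<le> (K + K') * R ^ (N + N')" if R: "1 \<le> R" and u: "\<And>i. \<bar>u $ i\<bar> \<le> R" for R u
  proof -
    have "K * R ^ N \<le> K * R ^ (N + N')" "K' * R ^ N' \<le> K' * R ^ (N + N')"
      using K R by (auto intro!: mult_left_mono power_increasing)
    then show ?thesis using b(1)[OF R u] b(2)[OF R u] by (simp add: distrib_right)
  qed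
  with K show ?case by (intro exI[of _ "K + K'"] exI[of _ "N + N'"]) auto
next
  case (mult f g)
  then obtain K N K' N' where K: "0 \<le> K" "0 \<le> K'"
    and b: "\<And>R u. 1 \<le> R \<Longrightarrow> (\<And>i. \<bar>u $ i\<bar> \<le> R) \<Longrightarrow> \<bar>f u\<bar> \<le> K * R ^ N"
     "\<And>R u. 1 \<le> R \<Longrightarrow> (\<And>i. \<bar>u $ i\<bar> \<le> R) \<Longrightarrow> \<bar>g u\<bar> \<le> K' * R ^ N'" by metis
  have "\<bar>f u * g u\<bar> \<le> (K * K') * R ^ (N + N')" if R: "1 \<le> R" and u: "\<And>i. \<bar>u $ i\<bar> \<le> R" for R u
  proof -
    have "\<bar>f u * g u\<bar> \<le> (K * R ^ N) * (K' * R ^ N')"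
      unfolding abs_mult by (rule mult_mono'[OF b(1)[OF R u] b(2)[OF R u]]) auto
    then show ?thesis by (simp add: power_add mult_ac)
  qed
  with K show ?case by (intro exI[of _ "K * K'"] exI[of _ "N + N'"]) auto
qed

section \<open>The closure of the span in the Gaussian L^2 space\<close>

definition span_closure :: "(real ^ 'd::finite \<Rightarrow> real) \<Rightarrow> bool" where
  "span_closure f \<longleftrightarrow> f \<in> borel_measurable borel \<and>
    (\<forall>e>0. \<exists>p. hermite_span p \<and> integrable std_normal_law_vec (\<lambda>x. (f x - p x)\<^sup>2) \<and>
       (\<integral>x. (f x - p x)\<^sup>2 \<partial>std_normal_law_vec) \<le> e)"

lemma hermite_span_measurable: "hermite_span p \<Longrightarrow> p \<in> borel_measurable borel"
proof (induction rule: hermite_span.induct)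
  case (base \<alpha>)
  show ?case unfolding hermite_vec_def[abs_def]
    by (intro borel_measurable_continuous_onI continuous_intros)
qed auto

lemma hermite_span_imp_closure: "hermite_span p \<Longrightarrow> span_closure p"
  unfolding span_closure_def using hermite_span_measurable by (auto intro!: exI[of _ p])

lemma span_closure_limit:
  fixes f :: "real ^ 'd::finite \<Rightarrow> real"
  assumes g: "\<And>n. span_closure (g n)" and fm: "f \<in> borel_measurable borel"
    and lim: "AE x in std_normal_law_vec. (\<lambda>n. g n x) \<longlonglongrightarrow> f x"
    and w: "integrable std_normal_law_vec (\<lambda>x. (w x)\<^sup>2)" and b: "\<And>n x. \<bar>g n x\<bar> \<le> w x" "\<And>x. \<bar>f x\<bar> \<le> w x"
  shows "span_closure f"
  unfolding span_closure_def
proof (intro conjI allI impI fm)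
  fix e :: real assume e: "e > 0"
  have gm: "g n \<in> borel_measurable borel" for n using g unfolding span_closure_def by auto
  note [measurable] = fm gm
  have dom: "norm ((f x - g n x)\<^sup>2) \<le> 4 * (w x)\<^sup>2" for n x
  proof -
    have "\<bar>f x - g n x\<bar> \<le> 2 * w x" using b(1)[of n x] b(2)[of x] by linarith
    then have "\<bar>f x - g n x\<bar>\<^sup>2 \<le> (2 * w x)\<^sup>2" by (intro power_mono) auto
    then show ?thesis by (simp add: power_mult_distrib)
  qed
  have w4: "integrable std_normal_law_vec (\<lambda>x. 4 * (w x)\<^sup>2)" using w by simp
  have "(\<lambda>n. \<integral>x. (f x - g n x)\<^sup>2 \<partial>std_normal_law_vec) \<longlonglongrightarrow> (\<integral>x. (0::real) \<partial>(std_normal_law_vec :: (real^'d) measure))"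
  proof (rule integral_dominated_convergence[OF _ _ w4])
    show "AE x in std_normal_law_vec. (\<lambda>n. (f x - g n x)\<^sup>2) \<longlonglongrightarrow> 0"
      using lim
    proof eventually_elim
      case (elim x)
      have "(\<lambda>n. (f x - g n x)\<^sup>2) \<longlonglongrightarrow> (f x - f x)\<^sup>2" by (intro tendsto_intros elim)
      then show ?case by simp
    qed
  qed (use dom in auto)
  \<comment> \<open>A quarter of \<open>e\<close> each for the limit and for the polynomial
    approximation, since the square of a sum costs a factor 2 below.\<close>
  then have "\<forall>\<^sub>F n in sequentially. (\<integral>x. (f x - g n x)\<^sup>2 \<partial>std_normal_law_vec) < e / 4"
    using e by (intro order_tendstoD(2)) auto
  then obtain n where n: "(\<integral>x. (f x - g n x)\<^sup>2 \<partial>std_normal_law_vec) < e / 4"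
    using eventually_happens'[OF sequentially_bot] by blast
  have i1: "integrable std_normal_law_vec (\<lambda>x. (f x - g n x)\<^sup>2)"
    by (rule Bochner_Integration.integrable_bound[OF w4]) (use dom in auto)
  from g[of n] e obtain p where p: "hermite_span p" "integrable std_normal_law_vec (\<lambda>x. (g n x - p x)\<^sup>2)"
    "(\<integral>x. (g n x - p x)\<^sup>2 \<partial>std_normal_law_vec) \<le> e / 4"
    unfolding span_closure_def by (meson zero_less_divide_iff zero_less_numeral)
  have [measurable]: "p \<in> borel_measurable borel" by (rule hermite_span_measurable) fact
  have pt: "(f x - p x)\<^sup>2 \<le> 2 * (f x - g n x)\<^sup>2 + 2 * (g n x - p x)\<^sup>2" for x
  proof -
    have "0 \<le> ((f x - g n x) - (g n x - p x))\<^sup>2" by simp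
    then show ?thesis by (simp add: power2_eq_square algebra_simps)
  qed
  have i2: "integrable std_normal_law_vec (\<lambda>x. 2 * (f x - g n x)\<^sup>2 + 2 * (g n x - p x)\<^sup>2)" using i1 p by auto
  have i3: "integrable std_normal_law_vec (\<lambda>x. (f x - p x)\<^sup>2)"
    by (rule Bochner_Integration.integrable_bound[OF i2]) (use pt in auto)
  have "(\<integral>x. (f x - p x)\<^sup>2 \<partial>std_normal_law_vec) \<le> (\<integral>x. 2 * (f x - g n x)\<^sup>2 + 2 * (g n x - p x)\<^sup>2 \<partial>std_normal_law_vec)"
    using i2 i3 pt by (intro integral_mono) auto
  also have "\<dots> \<le> e" using i1 p n by simp
  finally show "\<exists>p. hermite_span p \<and> integrable std_normal_law_vec (\<lambda>x. (f x - p x)\<^sup>2) \<and>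
       (\<integral>x. (f x - p x)\<^sup>2 \<partial>std_normal_law_vec) \<le> e" using p i3 by blast
qed

text \<open>The partial sums of the sine series are polynomials bounded by e^{|y|}. Inserted into Q
  they are dominated by a multiple of exp (N |t| sum |x_i|), which is square integrable for the
  Gaussian law, so they converge in L^2.\<close>

lemma span_closure_polynomial_sin:
  fixes Q :: "real ^ 'd::finite \<Rightarrow> real"
  assumes Q: "real_polynomial_function Q"
  shows "span_closure (\<lambda>x. Q (\<chi> i. sin (t * x $ i)))"
proof -
  define P where "P n y = (\<Sum>k<n. sin_coeff k * y ^ k)" for n and y :: real
  have Plim: "(\<lambda>n. P n y) \<longlonglongrightarrow> sin y" for y
    using sin_converges[of y] unfolding sums_def P_def by simp
  have Pb: "\<bar>P n y\<bar> \<le> exp \<bar>y\<bar>" for n y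
  proof -
    have "\<bar>P n y\<bar> \<le> (\<Sum>k<n. \<bar>sin_coeff k * y ^ k\<bar>)" unfolding P_def by (rule sum_abs)
    also have "\<dots> \<le> (\<Sum>k<n. \<bar>y\<bar> ^ k /\<^sub>R fact k)"
    proof (intro sum_mono)
      fix k
      have "\<bar>sin_coeff k\<bar> \<le> inverse (fact k)" by (auto simp: sin_coeff_def abs_mult power_abs divide_inverse)
      then have "\<bar>sin_coeff k\<bar> * \<bar>y\<bar> ^ k \<le> inverse (fact k) * \<bar>y\<bar> ^ k" by (intro mult_right_mono) auto
      then show "\<bar>sin_coeff k * y ^ k\<bar> \<le> \<bar>y\<bar> ^ k /\<^sub>R fact k" by (simp add: abs_mult power_abs)
    qed
    also have "\<dots> \<le> (\<Sum>k. \<bar>y\<bar> ^ k /\<^sub>R fact k)"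
      by (intro sum_le_suminf summable_exp_generic) auto
    finally show ?thesis by (simp add: exp_def)
  qed
  obtain K N where K: "0 \<le> K" "\<And>R u. 1 \<le> R \<Longrightarrow> (\<And>i. \<bar>u $ i\<bar> \<le> R) \<Longrightarrow> \<bar>Q u\<bar> \<le> K * R ^ N"
    using real_polynomial_function_bound[OF Q] by metis
  define R where "R x = exp (\<bar>t\<bar> * (\<Sum>i\<in>UNIV. \<bar>x $ i\<bar>))" for x :: "real ^ 'd"
  have R1: "1 \<le> R x" for x unfolding R_def by (simp add: sum_nonneg)
  have Rx: "exp \<bar>t * x $ i\<bar> \<le> R x" for x i
    unfolding R_def using member_le_sum[of i UNIV "\<lambda>i. \<bar>x $ i\<bar>"] by (simp add: abs_mult mult_left_mono)
  have contQ: "continuous_on UNIV Q" using Q continuous_on_polymonial_function real_polynomial_function_eq by blast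
  then have Qc: "isCont Q x" for x by (simp add: continuous_on_eq_continuous_at)
  have Qm[measurable]: "Q \<in> borel_measurable borel" by (rule borel_measurable_continuous_onI[OF contQ])
  have vm: "(\<lambda>x::real^'d. \<chi> i. sin (t * x $ i)) \<in> borel_measurable borel"
    by (intro borel_measurable_continuous_onI continuous_on_vec_lambda continuous_intros)
  show ?thesis
  proof (rule span_closure_limit[where g="\<lambda>n x. Q (\<chi> i. P n (t * x $ i))" and w="\<lambda>x. K * R x ^ N"])
    show "span_closure (\<lambda>x. Q (\<chi> i. P n (t * x $ i)))" for n
    proof (rule hermite_span_imp_closure, rule span_multiplier_imp_span, rule span_multiplier_polynomial_compose[OF Q])
      show "span_multiplier (\<lambda>x. (\<chi> i. P n (t * x $ i)) $ i)" for i
        unfolding P_def by (simp, intro span_multiplier_sum span_multiplier_intros span_multiplier_power) auto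
    qed
    show "(\<lambda>x. Q (\<chi> i. sin (t * x $ i))) \<in> borel_measurable borel" using vm by measurable
    have "(\<lambda>n. Q (\<chi> i. P n (t * x $ i))) \<longlonglongrightarrow> Q (\<chi> i. sin (t * x $ i))" for x
      by (rule isCont_tendsto_compose[OF Qc], rule vec_tendstoI) (simp add: Plim)
    then show "AE x in std_normal_law_vec. (\<lambda>n. Q (\<chi> i. P n (t * x $ i))) \<longlonglongrightarrow> Q (\<chi> i. sin (t * x $ i))" by simp
    have "(\<lambda>x::real^'d. (K * R x ^ N)\<^sup>2) = (\<lambda>x. K\<^sup>2 * exp ((real (2 * N) * \<bar>t\<bar>) * (\<Sum>i\<in>UNIV. \<bar>x $ i\<bar>)))"
      by (simp add: R_def power_mult_distrib exp_of_nat_mult[symmetric] power_mult[symmetric] mult_ac)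
    then show "integrable std_normal_law_vec (\<lambda>x::real^'d. (K * R x ^ N)\<^sup>2)"
      by (simp only:) (rule integrable_mult_right, rule integrable_exp_abs_std_normal_law_vec)
    show "\<bar>Q (\<chi> i. P n (t * x $ i))\<bar> \<le> K * R x ^ N" for n x
      by (rule K(2)[OF R1]) (simp add: order_trans[OF Pb Rx])
    have "\<bar>sin (t * x $ i)\<bar> \<le> R x" for x i
      using R1[of x] abs_sin_le_one[of "t * x $ i"] by linarith
    then show "\<bar>Q (\<chi> i. sin (t * x $ i))\<bar> \<le> K * R x ^ N" for x by (intro K(2)[OF R1]) auto
  qed
qed

lemma Stone_Weierstrass_ex:
  fixes f :: "'a::euclidean_space \<Rightarrow> real"
  assumes "compact S" "continuous_on S f" "0 < e"
  shows "\<exists>g. real_polynomial_function g \<and> (\<forall>x\<in>S. \<bar>f x - g x\<bar> < e)"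
  by (rule Stone_Weierstrass_real_polynomial_function[OF assms]) blast

text \<open>On the box |t x_i| \<le> pi / 2 the substitution u_i = sin(t x_i) is undone by arcsin,
  so g is there a continuous function of u in a compact cube, and Stone-Weierstrass approximates it
  within t by a polynomial in sines. Outside the box arcsin returns a different point, but the
  approximants stay bounded by B + 1; each x lies in the box once t is small.\<close>

lemma span_closure_bounded_continuous:
  fixes g :: "real ^ 'd::finite \<Rightarrow> real"
  assumes cont: "continuous_on UNIV g" and B: "\<And>x. \<bar>g x\<bar> \<le> B"
  shows "span_closure g"
proof -
  interpret G: prob_space "std_normal_law_vec :: (real ^ 'd) measure" by (rule prob_space_std_normal_law_vec)
  define t where "t n = 1 / real (Suc n)" for n
  have t: "t n > 0" "t n \<le> 1" for n by (auto simp: t_def)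
  have t0: "t \<longlonglongrightarrow> 0" unfolding t_def using LIMSEQ_inverse_real_of_nat by (simp add: inverse_eq_divide)
  let ?C = "cbox (- 1) 1 :: (real ^ 'd) set"
  have C: "u \<in> ?C \<longleftrightarrow> (\<forall>i. - 1 \<le> u $ i \<and> u $ i \<le> 1)" for u by (simp add: mem_box_cart)
  have "\<exists>Q. real_polynomial_function Q \<and> (\<forall>u\<in>?C. \<bar>g (\<chi> i. arcsin (u $ i) / t n) - Q u\<bar> < t n)" for n
  proof -
    have "continuous_on ?C (\<lambda>u. \<chi> i. arcsin (u $ i) / t n)"
      using t(1)[of n] by (intro continuous_on_vec_lambda continuous_intros) (auto simp: C)
    then have "continuous_on ?C (\<lambda>u. g (\<chi> i. arcsin (u $ i) / t n))"
      by (rule continuous_on_compose2[OF cont]) auto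
    then show ?thesis by (rule Stone_Weierstrass_ex[OF compact_cbox _ t(1)])
  qed
  note ex = this
  define Q where "Q n = (SOME Q. real_polynomial_function Q \<and> (\<forall>u\<in>?C. \<bar>g (\<chi> i. arcsin (u $ i) / t n) - Q u\<bar> < t n))" for n
  have QQ: "real_polynomial_function (Q n) \<and> (\<forall>u\<in>?C. \<bar>g (\<chi> i. arcsin (u $ i) / t n) - Q n u\<bar> < t n)" for n
    unfolding Q_def by (rule someI_ex[OF ex])
  have Q: "real_polynomial_function (Q n)" for n using QQ by simp
  have Qg: "\<bar>g (\<chi> i. arcsin (u $ i) / t n) - Q n u\<bar> < t n" if "u \<in> ?C" for n u
    using QQ that by simp
  have in_C: "(\<chi> i. sin (t n * x $ i)) \<in> ?C" for n x by (simp add: C)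
  have Qg': "\<bar>g (\<chi> i. arcsin ((\<chi> i. sin (t n * x $ i)) $ i) / t n) - Q n (\<chi> i. sin (t n * x $ i))\<bar> < t n" for n x
    by (rule Qg[OF in_C])
  show ?thesis
  proof (rule span_closure_limit[where g="\<lambda>n x. Q n (\<chi> i. sin (t n * x $ i))" and w="\<lambda>x. B + 1"])
    show "span_closure (\<lambda>x. Q n (\<chi> i. sin (t n * x $ i)))" for n by (rule span_closure_polynomial_sin[OF Q])
    show "g \<in> borel_measurable borel" using cont by (rule borel_measurable_continuous_onI)
    show "integrable std_normal_law_vec (\<lambda>x :: real ^ 'd. (B + 1)\<^sup>2)" by simp
    show "\<bar>g x\<bar> \<le> B + 1" for x using B[of x] by simp
    show "\<bar>Q n (\<chi> i. sin (t n * x $ i))\<bar> \<le> B + 1" for n x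
      using Qg'[of n x] B[of "\<chi> i. arcsin ((\<chi> i. sin (t n * x $ i)) $ i) / t n"] t(2)[of n] by linarith
    have "(\<lambda>n. Q n (\<chi> i. sin (t n * x $ i))) \<longlonglongrightarrow> g x" for x
    proof (rule Lim_transform[OF tendsto_const], rule Lim_null_comparison[OF _ t0])
      have "\<forall>\<^sub>F n in sequentially. \<forall>i\<in>UNIV. \<bar>t n * x $ i\<bar> \<le> pi / 2"
      proof (intro eventually_ball_finite ballI)
        fix i
        have "(\<lambda>n. \<bar>t n * x $ i\<bar>) \<longlonglongrightarrow> \<bar>0 * x $ i\<bar>" by (intro tendsto_intros t0)
        then have "\<forall>\<^sub>F n in sequentially. \<bar>t n * x $ i\<bar> < pi / 2" by (rule order_tendstoD) (simp add: pi_half_gt_zero)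
        then show "\<forall>\<^sub>F n in sequentially. \<bar>t n * x $ i\<bar> \<le> pi / 2" by eventually_elim simp
      qed simp
      then show "\<forall>\<^sub>F n in sequentially. norm (Q n (\<chi> i. sin (t n * x $ i)) - g x) \<le> t n"
      proof eventually_elim
        case (elim n)
        have "\<bar>t n * x $ i\<bar> \<le> pi / 2" for i using elim by blast
        then have "arcsin (sin (t n * x $ i)) = t n * x $ i" for i
          by (intro arcsin_sin) (simp_all only: abs_le_iff minus_le_iff)
        then have "(\<chi> i. arcsin ((\<chi> i. sin (t n * x $ i)) $ i) / t n) = x"
          using t(1)[of n] by (simp add: vec_eq_iff)
        then show ?case using Qg'[of n x] by simp
      qed
    qed
    then show "AE x in std_normal_law_vec. (\<lambda>n. Q n (\<chi> i. sin (t n * x $ i))) \<longlonglongrightarrow> g x" by simp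
  qed
qed

definition clamp_real :: "real \<Rightarrow> real \<Rightarrow> real" where "clamp_real B y = max (- B) (min B y)"

text \<open>A Lebesgue measurable function is a limit of continuous ones off a negligible set, which
  is also null for the Gaussian law. Clamping at the bound of f makes the approximants bounded
  without changing the limit.\<close>

lemma span_closure_bounded:
  fixes f :: "real ^ 'd::finite \<Rightarrow> real"
  assumes fm: "f \<in> borel_measurable borel" and B: "\<And>x. \<bar>f x\<bar> \<le> B"
  shows "span_closure f"
proof -
  interpret G: prob_space "std_normal_law_vec :: (real ^ 'd) measure" by (rule prob_space_std_normal_law_vec)
  have "f \<in> borel_measurable lebesgue" using fm by (simp add: measurable_completion)
  then have "f measurable_on UNIV" by (rule lebesgue_measurable_imp_measurable_on) simp
  then obtain N g where N: "negligible N" and g: "\<And>n. continuous_on UNIV (g n)"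
    and lim: "\<And>x. x \<notin> N \<Longrightarrow> (\<lambda>n. g n x) \<longlonglongrightarrow> f x" unfolding measurable_on_def by auto
  have B0: "B \<ge> 0" using B[of 0] by linarith
  have f: "clamp_real B (f x) = f x" for x using B[of x] by (auto simp: clamp_real_def)
  show ?thesis
  proof (rule span_closure_limit[OF _ fm, where g="\<lambda>n x. clamp_real B (g n x)" and w="\<lambda>x. B"])
    have cb: "\<bar>clamp_real B y\<bar> \<le> B" for y using B0 by (auto simp: clamp_real_def)
    show "span_closure (\<lambda>x. clamp_real B (g n x))" for n
      by (rule span_closure_bounded_continuous[OF _ cb]) (unfold clamp_real_def, intro continuous_intros g)
    show "\<bar>clamp_real B (g n x)\<bar> \<le> B" for n x by (rule cb)
    have "AE x in lebesgue. x \<notin> N" using N by (auto simp: negligible_iff_null_sets intro: AE_not_in)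
    then have "AE x in lborel. x \<notin> N" by (simp add: AE_completion_iff)
    then have "AE x in std_normal_law_vec. x \<notin> N" by (rule AE_std_normal_law_vecI)
    then show "AE x in std_normal_law_vec. (\<lambda>n. clamp_real B (g n x)) \<longlonglongrightarrow> f x"
    proof eventually_elim
      case (elim x)
      have "(\<lambda>n. clamp_real B (g n x)) \<longlonglongrightarrow> clamp_real B (f x)"
        unfolding clamp_real_def by (intro tendsto_intros lim[OF elim])
      then show ?case by (simp add: f)
    qed
  qed (use B in auto)
qed

text \<open>Truncation of the values reduces to the bounded case, with |f| itself as the
  square-integrable majorant.\<close>

theorem hermite_span_dense:
  fixes f :: "real ^ 'd::finite \<Rightarrow> real"
  assumes fm: "f \<in> borel_measurable borel" and f2: "integrable std_normal_law_vec (\<lambda>x. (f x)\<^sup>2)"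
  shows "span_closure f"
proof (rule span_closure_limit[OF _ fm, where g="\<lambda>n x. clamp_real (real n) (f x)" and w="\<lambda>x. \<bar>f x\<bar>"])
  show "span_closure (\<lambda>x. clamp_real (real n) (f x))" for n
    by (rule span_closure_bounded[where B="real n"]) (use fm in \<open>auto simp: clamp_real_def\<close>)
  show "\<bar>clamp_real (real n) (f x)\<bar> \<le> \<bar>f x\<bar>" for n x by (auto simp: clamp_real_def)
  have "(\<lambda>n. clamp_real (real n) (f x)) \<longlonglongrightarrow> f x" for x
  proof (rule tendsto_eventually)
    show "\<forall>\<^sub>F n in sequentially. clamp_real (real n) (f x) = f x"
      using eventually_ge_at_top[of "nat \<lceil>\<bar>f x\<bar>\<rceil>"] by eventually_elim (auto simp: clamp_real_def)
  qed
  then show "AE x in std_normal_law_vec. (\<lambda>n. clamp_real (real n) (f x)) \<longlonglongrightarrow> f x" by simp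
qed (use f2 in auto)

section \<open>Sums over four times\<close>

text \<open>A majorant of the crossing diagrams after the total degree at a vertex has been cut down
  to q. Either the inner edges 12 and 34 already supply the power q and some crossing correlation is
  left over, or they supply a power a < q that is completed to q by 13 and 24, or by 14 and
  23.\<close>

definition cross_bound :: "nat \<Rightarrow> real \<Rightarrow> real \<Rightarrow> real \<Rightarrow> real \<Rightarrow> real \<Rightarrow> real \<Rightarrow> real" where
  "cross_bound q r12 r13 r14 r23 r24 r34 =
     (r12 * r34) ^ q * (r13 + r14 + r23 + r24) +
     (\<Sum>a = 1..<q. (r12 * r34) ^ a * (r13 * r24) ^ (q - a) + (r12 * r34) ^ a * (r14 * r23) ^ (q - a))"

lemma power_mult_power_le_max:
  fixes B C :: real
  assumes "0 \<le> B" "B \<le> 1" "0 \<le> C" "C \<le> 1" "b \<le> z + y"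
  shows "B ^ z * C ^ y \<le> B ^ b + C ^ b"
proof -
  have "B ^ z * C ^ y \<le> max B C ^ z * max B C ^ y"
    using assms by (intro mult_mono power_mono) auto
  also have "\<dots> = max B C ^ (z + y)" by (simp add: power_add)
  also have "\<dots> \<le> max B C ^ b" using assms by (intro power_decreasing) auto
  also have "\<dots> \<le> B ^ b + C ^ b" using assms by (auto simp: max_def)
  finally show ?thesis .
qed

text \<open>The degree conditions force $m_{12} = m_{34}$ and $m_{14} = m_{23}$.\<close>

lemma monomial_le_cross_bound:
  fixes r12 r13 r14 r23 r24 r34 :: real
  assumes r: "r12 \<in> {0..1}" "r13 \<in> {0..1}" "r14 \<in> {0..1}" "r23 \<in> {0..1}" "r24 \<in> {0..1}" "r34 \<in> {0..1}"
    and d: "m12 + m13 + m14 = d1" "m12 + m23 + m24 = d2" "m13 + m23 + m34 = d1" "m14 + m24 + m34 = d2"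
    and q: "q \<le> Suc d1" "q \<le> Suc d2" and cross: "1 \<le> m13 + m14 + m23 + m24"
  shows "r12 * r34 * (r12 ^ m12 * r13 ^ m13 * r14 ^ m14 * r23 ^ m23 * r24 ^ m24 * r34 ^ m34)
     \<le> cross_bound q r12 r13 r14 r23 r24 r34"
proof -
  define A B C where "A = r12 * r34" and "B = r13 * r24" and "C = r14 * r23"
  have A: "0 \<le> A" "A \<le> 1" and B: "0 \<le> B" "B \<le> 1" and C: "0 \<le> C" "C \<le> 1"
    using r by (auto simp: A_def B_def C_def mult_le_one)
  have m: "m34 = m12" "m23 = m14" using d by linarith+
  have L: "r12 * r34 * (r12 ^ m12 * r13 ^ m13 * r14 ^ m14 * r23 ^ m23 * r24 ^ m24 * r34 ^ m34)
      = A ^ Suc m12 * (r13 ^ m13 * r24 ^ m24 * C ^ m14)"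
    by (simp add: m A_def C_def power_mult_distrib)
  have p1: "0 \<le> r ^ k" "r ^ k \<le> 1" if "r \<in> {0..1}" for r :: real and k
    using that by (auto intro: power_le_one)
  have CB: "cross_bound q r12 r13 r14 r23 r24 r34 = A ^ q * (r13 + r14 + r23 + r24) +
      (\<Sum>a = 1..<q. A ^ a * B ^ (q - a) + A ^ a * C ^ (q - a))"
    by (simp add: cross_bound_def A_def B_def C_def)
  have S0: "0 \<le> (\<Sum>a = 1..<q. A ^ a * B ^ (q - a) + A ^ a * C ^ (q - a))"
    using A B C by (intro sum_nonneg) auto
  show ?thesis
  proof (cases "q \<le> Suc m12")
    case True
    \<comment> \<open>Here the inner edges alone account for the power q, and any one crossing edge
      may be kept while the others are bounded by 1.\<close>
    have c: "r13 ^ m13 * r24 ^ m24 * C ^ m14 \<le> r13 + r14 + r23 + r24"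
    proof -
      have le1: "u * v * w \<le> u" "u * v * w \<le> v" "u * v * w \<le> w" if "u \<in> {0..1}" "v \<in> {0..1}" "w \<in> {0..1}" for u v w :: real
      proof -
        have "u * v \<in> {0..1}" using that by (auto intro: mult_le_one)
        moreover have "u * v \<le> u" "u * v \<le> v" using that by (auto simp: mult_left_le mult_left_le_one_le)
        ultimately show "u * v * w \<le> u" "u * v * w \<le> v" "u * v * w \<le> w"
          using that mult_left_le[of w "u * v"] mult_left_le_one_le[of w "u * v"] by auto
      qed
      have in1: "r13 ^ m13 \<in> {0..1}" "r24 ^ m24 \<in> {0..1}" "C ^ m14 \<in> {0..1}"
        using p1 r C by auto
      have pw: "r ^ k \<le> r" if "r \<in> {0..1}" "k \<ge> 1" for r :: real and k
        using that power_decreasing[of 1 k r] by auto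
      consider "m13 \<ge> 1" | "m24 \<ge> 1" | "m14 \<ge> 1" using cross m by linarith
      then show ?thesis
      proof cases
        case 1 then show ?thesis using le1(1)[OF in1] pw[OF r(2) 1] r by auto
      next
        case 2 then show ?thesis using le1(2)[OF in1] pw[OF r(5) 2] r by auto
      next
        case 3
        have "C ^ m14 \<le> C" using pw[of C] C 3 by auto
        also have "C \<le> r14" using r by (auto simp: C_def mult_left_le)
        finally show ?thesis using le1(3)[OF in1] r by auto
      qed
    qed
    have "A ^ Suc m12 \<le> A ^ q" using A True by (intro power_decreasing) auto
    then have "A ^ Suc m12 * (r13 ^ m13 * r24 ^ m24 * C ^ m14) \<le> A ^ q * (r13 + r14 + r23 + r24)"
      using c r A C by (intro mult_mono) auto
    with S0 show ?thesis unfolding L CB by linarith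
  next
    case False
    define z where "z = min m13 m24"
    have "r13 ^ m13 * r24 ^ m24 \<le> r13 ^ z * r24 ^ z"
      using r by (intro mult_mono power_decreasing) (auto simp: z_def)
    also have "\<dots> = B ^ z" by (simp add: B_def power_mult_distrib)
    finally have "r13 ^ m13 * r24 ^ m24 * C ^ m14 \<le> B ^ z * C ^ m14"
      using C by (intro mult_right_mono) auto
    \<comment> \<open>Since m_23 = m_14, the degrees at 1 and 2 make both m_13 + m_14 and m_24 +
      m_14 at least q - 1 - m_12, hence so is \<open>z + m14\<close>.\<close>
    also have "\<dots> \<le> B ^ (q - Suc m12) + C ^ (q - Suc m12)"
      using B C d q m by (intro power_mult_power_le_max) (auto simp: z_def)
    finally have "A ^ Suc m12 * (r13 ^ m13 * r24 ^ m24 * C ^ m14)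
        \<le> A ^ Suc m12 * (B ^ (q - Suc m12) + C ^ (q - Suc m12))"
      using A by (intro mult_left_mono) auto
    also have "\<dots> = A ^ Suc m12 * B ^ (q - Suc m12) + A ^ Suc m12 * C ^ (q - Suc m12)" by (simp add: algebra_simps)
    also have "\<dots> \<le> (\<Sum>a = 1..<q. A ^ a * B ^ (q - a) + A ^ a * C ^ (q - a))"
      using A B C False by (intro member_le_sum[where f="\<lambda>a. A ^ a * B ^ (q - a) + A ^ a * C ^ (q - a)"]) auto
    also have "\<dots> \<le> cross_bound q r12 r13 r14 r23 r24 r34"
      using r A unfolding CB by auto
    finally show ?thesis unfolding L .
  qed
qed

text \<open>Either A \<le> \<eta> B, and one factor \<eta> can be kept because a \<ge> 1, or B < A /
  \<eta>, and every B is traded for A / \<eta>. The constants are far from optimal, but either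
  summand can be given the small factor.\<close>

lemma Young_epsilon:
  fixes A B \<eta> :: real
  assumes "0 \<le> A" "0 \<le> B" "0 < \<eta>" "\<eta> \<le> 1" "1 \<le> a" "a \<le> q"
  shows "A ^ a * B ^ (q - a) \<le> \<eta> * B ^ q + (1 / \<eta>) ^ q * A ^ q"
proof (cases "A \<le> \<eta> * B")
  case True
  have "A ^ a * B ^ (q - a) \<le> (\<eta> * B) ^ a * B ^ (q - a)"
    using assms True by (intro mult_right_mono power_mono) auto
  also have "\<dots> = \<eta> ^ a * (B ^ a * B ^ (q - a))" by (simp add: power_mult_distrib)
  also have "B ^ a * B ^ (q - a) = B ^ q" using assms by (simp add: power_add[symmetric])
  also have "\<eta> ^ a * B ^ q \<le> \<eta> * B ^ q"
    using assms power_decreasing[of 1 a \<eta>] by (intro mult_right_mono) auto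
  moreover have "0 \<le> (1 / \<eta>) ^ q * A ^ q" using assms by simp
  ultimately show ?thesis by linarith
next
  case False
  then have "B \<le> 1 / \<eta> * A" using assms by (simp add: field_simps)
  then have "A ^ a * B ^ (q - a) \<le> A ^ a * (1 / \<eta> * A) ^ (q - a)"
    using assms by (intro mult_left_mono power_mono) auto
  also have "\<dots> = (1 / \<eta>) ^ (q - a) * (A ^ a * A ^ (q - a))" by (simp only: power_mult_distrib mult_ac)
  also have "A ^ a * A ^ (q - a) = A ^ q" using assms by (simp add: power_add[symmetric])
  also have "(1 / \<eta>) ^ (q - a) * A ^ q \<le> (1 / \<eta>) ^ q * A ^ q"
    using assms by (intro mult_right_mono power_increasing) auto
  moreover have "0 \<le> \<eta> * B ^ q" using assms by simp
  ultimately show ?thesis by linarith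
qed

section \<open>Asymptotics of sums over four times\<close>

definition quad_sum :: "nat \<Rightarrow> (int \<Rightarrow> int \<Rightarrow> int \<Rightarrow> int \<Rightarrow> real) \<Rightarrow> real" where
  "quad_sum n F = (\<Sum>k\<in>{1..int n}. \<Sum>l\<in>{1..int n}. \<Sum>k'\<in>{1..int n}. \<Sum>l'\<in>{1..int n}. F k l k' l')"

lemma quad_sum_swap12: "quad_sum n (\<lambda>k l k' l'. F l k k' l') = quad_sum n F"
  unfolding quad_sum_def by (rule sum.swap)

lemma quad_sum_swap34: "quad_sum n (\<lambda>k l k' l'. F k l l' k') = quad_sum n F"
  unfolding quad_sum_def by (rule sum.cong[OF refl], rule sum.cong[OF refl], rule sum.swap)

lemma quad_sum_add: "quad_sum n (\<lambda>k l k' l'. F k l k' l' + G k l k' l') = quad_sum n F + quad_sum n G"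
  unfolding quad_sum_def by (simp add: sum.distrib)

lemma quad_sum_cmult: "quad_sum n (\<lambda>k l k' l'. c * F k l k' l') = c * quad_sum n F"
  unfolding quad_sum_def by (simp add: sum_distrib_left)

lemma quad_sum_mono: "(\<And>k l k' l'. F k l k' l' \<le> G k l k' l') \<Longrightarrow> quad_sum n F \<le> quad_sum n G"
  unfolding quad_sum_def by (intro sum_mono) auto

lemma quad_sum_sum: "quad_sum n (\<lambda>k l k' l'. \<Sum>a\<in>A. F a k l k' l') = (\<Sum>a\<in>A. quad_sum n (F a))"
  unfolding quad_sum_def by (simp only: sum.swap[where B=A and A="{1..int n}"])

lemma quad_sum_nonneg: "(\<And>k l k' l'. 0 \<le> F k l k' l') \<Longrightarrow> 0 \<le> quad_sum n F"
  unfolding quad_sum_def by (intro sum_nonneg) auto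

lemma pairs_near:
  "(\<Sum>k\<in>{1..int n}. \<Sum>k'\<in>{1..int n}. of_bool (\<bar>k' - k\<bar> \<le> int m)) \<le> real n * (2 * real m + 1)"
proof -
  have "(\<Sum>k'\<in>{1..int n}. of_bool (\<bar>k' - k\<bar> \<le> int m)) \<le> 2 * real m + 1" for k
  proof -
    have "(\<Sum>k'\<in>{1..int n}. of_bool (\<bar>k' - k\<bar> \<le> int m)) = real (card ({1..int n} \<inter> {k'. \<bar>k' - k\<bar> \<le> int m}))"
      by (simp add: of_bool_def sum.If_cases)
    also have "\<dots> \<le> real (card {k - int m..k + int m})"
      by (intro of_nat_mono card_mono) auto
    finally show ?thesis by simp
  qed
  then have "(\<Sum>k\<in>{1..int n}. \<Sum>k'\<in>{1..int n}. of_bool (\<bar>k' - k\<bar> \<le> int m)) \<le> (\<Sum>k\<in>{1..int n}. 2 * real m + 1)"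
    by (intro sum_mono)
  then show ?thesis by simp
qed

lemma eventually_div_le:
  assumes "e > 0" shows "\<forall>\<^sub>F n in sequentially. c / real n \<le> e"
proof -
  have "(\<lambda>n. c / real n) \<longlonglongrightarrow> 0" by (rule lim_const_over_n)
  from order_tendstoD(2)[OF this assms] show ?thesis by eventually_elim simp
qed

lemma tendsto_0_realI:
  fixes f :: "nat \<Rightarrow> real"
  assumes "\<And>n. 0 \<le> f n" "\<And>e. e > 0 \<Longrightarrow> \<forall>\<^sub>F n in sequentially. f n \<le> e"
  shows "f \<longlonglongrightarrow> 0"
proof (rule order_tendstoI)
  show "\<forall>\<^sub>F n in sequentially. a < f n" if "a < 0" for a using assms(1) that by (meson always_eventually less_le_trans)
  fix a :: real assume "0 < a"
  then show "\<forall>\<^sub>F n in sequentially. f n < a" using assms(2)[of "a/2"] by (auto elim!: eventually_mono)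
qed

text \<open>The deterministic side of the argument: only these properties of the majorant of the
  correlations enter the counting.\<close>

locale summable_correlation =
  fixes \<rho> :: "int \<Rightarrow> real" and q :: nat
  assumes rho0: "0 \<le> \<rho> j" and rho1: "\<rho> j \<le> 1" and rho_sym: "\<rho> (- j) = \<rho> j"
    and q1: "1 \<le> q" and summ: "(\<lambda>j. \<rho> j ^ q) summable_on UNIV"
begin

definition "C = (\<Sum>\<^sub>\<infinity>j. \<rho> j ^ q)"

lemma sum_le_C: "finite F \<Longrightarrow> (\<Sum>j\<in>F. \<rho> j ^ q) \<le> C"
  unfolding C_def using rho0 by (intro finite_sum_le_infsum summ) auto

lemma C_nonneg: "0 \<le> C"
  using sum_le_C[of "{}"] by simp

lemma rho_minus: "\<rho> (x - y) = \<rho> (y - x)"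
  using rho_sym[of "y - x"] by simp

lemma sum_shift_le_C: "finite F \<Longrightarrow> (\<Sum>l\<in>F. \<rho> (l - k) ^ q) \<le> C"
  using sum_le_C[of "(\<lambda>l. l - k) ` F"] by (simp add: sum.reindex inj_on_def)

lemma tail:
  assumes "e > 0"
  obtains m :: nat where "\<And>F. finite F \<Longrightarrow> (\<Sum>j\<in>F. \<rho> j ^ q * of_bool (int m < \<bar>j\<bar>)) \<le> e"
proof -
  have "((\<lambda>j. \<rho> j ^ q) has_sum C) UNIV" unfolding C_def using summ by simp
  then have "\<forall>\<^sub>F F in finite_subsets_at_top UNIV. dist (\<Sum>j\<in>F. \<rho> j ^ q) C < e"
    unfolding has_sum_def using assms by (rule tendstoD)
  then obtain F0 where F0: "finite F0" and "\<And>F. finite F \<Longrightarrow> F0 \<subseteq> F \<Longrightarrow> dist (\<Sum>j\<in>F. \<rho> j ^ q) C < e"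
    unfolding eventually_finite_subsets_at_top by auto
  then have d: "C - e < (\<Sum>j\<in>F0. \<rho> j ^ q)" by (force simp: dist_real_def)
  obtain m where m: "\<And>j. j \<in> F0 \<Longrightarrow> \<bar>j\<bar> \<le> int m"
  proof
    \<comment> \<open>The sum of the absolute values is a crude upper bound for their maximum that
      also makes sense for an empty set.\<close>
    show "j \<in> F0 \<Longrightarrow> \<bar>j\<bar> \<le> int (nat (\<Sum>j\<in>F0. \<bar>j\<bar>))" for j
      using member_le_sum[of j F0 "\<lambda>j. \<bar>j\<bar>"] F0 by (simp add: sum_nonneg)
  qed
  show ?thesis
  proof (rule that)
    fix F :: "int set" assume F: "finite F"
    let ?F = "{j \<in> F. int m < \<bar>j\<bar>}"
    have "(\<Sum>j\<in>F. \<rho> j ^ q * of_bool (int m < \<bar>j\<bar>)) = (\<Sum>j\<in>?F. \<rho> j ^ q)"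
      using F by (intro sum.mono_neutral_cong_right) auto
    also have "(\<Sum>j\<in>?F. \<rho> j ^ q) + (\<Sum>j\<in>F0. \<rho> j ^ q) = (\<Sum>j\<in>?F \<union> F0. \<rho> j ^ q)"
      using F F0 m by (intro sum.union_disjoint[symmetric]) force+
    then have "(\<Sum>j\<in>?F. \<rho> j ^ q) \<le> e" using sum_le_C[of "?F \<union> F0"] F F0 d by auto
    finally show "(\<Sum>j\<in>F. \<rho> j ^ q * of_bool (int m < \<bar>j\<bar>)) \<le> e" .
  qed
qed

text \<open>A single term beyond the cutoff is itself a tail sum, applied here with e^q in place of
  e.\<close>

lemma rho_small:
  assumes "e > 0"
  obtains m :: nat where "\<And>j. int m < \<bar>j\<bar> \<Longrightarrow> \<rho> j \<le> e"
proof -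
  obtain m where m: "\<And>F. finite F \<Longrightarrow> (\<Sum>j\<in>F. \<rho> j ^ q * of_bool (int m < \<bar>j\<bar>)) \<le> e ^ q"
    using tail[of "e ^ q"] assms by auto
  show ?thesis
  proof (rule that)
    fix j assume "int m < \<bar>j\<bar>"
    then have "\<rho> j ^ q \<le> e ^ q" using m[of "{j}"] by simp
    then show "\<rho> j \<le> e" using assms q1 rho0 by (subst (asm) power_mono_iff) auto
  qed
qed

text \<open>For fixed k and k' the sums over l and l' separate, and each is at most
  \<open>C\<close>; only the weight is left to count.\<close>

lemma quad_sum_A_weighted:
  assumes "\<And>k k'. 0 \<le> w k k'"
  shows "quad_sum n (\<lambda>k l k' l'. (\<rho> (l - k) * \<rho> (l' - k')) ^ q * w k k')
    \<le> C\<^sup>2 * (\<Sum>k\<in>{1..int n}. \<Sum>k'\<in>{1..int n}. w k k')"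
proof -
  have "quad_sum n (\<lambda>k l k' l'. (\<rho> (l - k) * \<rho> (l' - k')) ^ q * w k k') =
    (\<Sum>k\<in>{1..int n}. \<Sum>k'\<in>{1..int n}. (\<Sum>l\<in>{1..int n}. \<rho> (l - k) ^ q) * (\<Sum>l'\<in>{1..int n}. \<rho> (l' - k') ^ q) * w k k')"
    unfolding quad_sum_def
    by (rule sum.cong[OF refl], subst sum.swap, simp only: power_mult_distrib sum_product)
      (simp only: sum_distrib_right)
  also have "\<dots> \<le> (\<Sum>k\<in>{1..int n}. \<Sum>k'\<in>{1..int n}. C * C * w k k')"
    using assms C_nonneg rho0
    by (intro sum_mono mult_right_mono mult_mono sum_shift_le_C sum_nonneg) auto
  also have "\<dots> = C\<^sup>2 * (\<Sum>k\<in>{1..int n}. \<Sum>k'\<in>{1..int n}. w k k')"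
    by (simp add: sum_distrib_left power2_eq_square)
  finally show ?thesis .
qed

text \<open>Here k and l are fixed instead: the sum over k' is a tail, the sum over l' is at most
  \<open>C\<close>, and n^2 pairs remain.\<close>

lemma quad_sum_B_far:
  assumes "\<And>F. finite F \<Longrightarrow> (\<Sum>j\<in>F. \<rho> j ^ q * of_bool (int m < \<bar>j\<bar>)) \<le> \<tau>" "0 \<le> \<tau>"
  shows "quad_sum n (\<lambda>k l k' l'. (\<rho> (k' - k) * \<rho> (l' - l)) ^ q * of_bool (int m < \<bar>k' - k\<bar>))
    \<le> (real n)\<^sup>2 * (\<tau> * C)"
proof -
  have t: "(\<Sum>k'\<in>{1..int n}. \<rho> (k' - k) ^ q * of_bool (int m < \<bar>k' - k\<bar>)) \<le> \<tau>" for k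
  proof -
    have "(\<Sum>k'\<in>{1..int n}. \<rho> (k' - k) ^ q * of_bool (int m < \<bar>k' - k\<bar>)) =
      (\<Sum>j\<in>(\<lambda>k'. k' - k) ` {1..int n}. \<rho> j ^ q * of_bool (int m < \<bar>j\<bar>))"
      by (subst sum.reindex) (auto simp: inj_on_def)
    then show ?thesis using assms(1)[of "(\<lambda>k'. k' - k) ` {1..int n}"] by simp
  qed
  have "quad_sum n (\<lambda>k l k' l'. (\<rho> (k' - k) * \<rho> (l' - l)) ^ q * of_bool (int m < \<bar>k' - k\<bar>)) =
    (\<Sum>k\<in>{1..int n}. \<Sum>l\<in>{1..int n}. (\<Sum>k'\<in>{1..int n}. \<rho> (k' - k) ^ q * of_bool (int m < \<bar>k' - k\<bar>)) *
      (\<Sum>l'\<in>{1..int n}. \<rho> (l' - l) ^ q))"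
    unfolding quad_sum_def
    by (intro sum.cong refl, simp only: power_mult_distrib sum_product) (simp only: mult_ac)
  also have "\<dots> \<le> (\<Sum>k\<in>{1..int n}. \<Sum>l\<in>{1..int n}. \<tau> * C)"
    using t rho0 assms(2) by (intro sum_mono mult_mono sum_shift_le_C sum_nonneg) auto
  also have "\<dots> = (real n)\<^sup>2 * (\<tau> * C)" by (simp add: power2_eq_square)
  finally show ?thesis .
qed

lemma quad_sum_B_le:
  "quad_sum n (\<lambda>k l k' l'. (\<rho> (k' - k) * \<rho> (l' - l)) ^ q) \<le> (real n)\<^sup>2 * C\<^sup>2"
proof -
  have "quad_sum n (\<lambda>k l k' l'. (\<rho> (k' - k) * \<rho> (l' - l)) ^ q) =
    (\<Sum>k\<in>{1..int n}. \<Sum>l\<in>{1..int n}. (\<Sum>k'\<in>{1..int n}. \<rho> (k' - k) ^ q) * (\<Sum>l'\<in>{1..int n}. \<rho> (l' - l) ^ q))"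
    unfolding quad_sum_def by (intro sum.cong refl) (simp add: power_mult_distrib sum_product)
  also have "\<dots> \<le> (\<Sum>k\<in>{1..int n}. \<Sum>l\<in>{1..int n}. C * C)"
    using C_nonneg rho0 by (intro sum_mono mult_mono sum_shift_le_C sum_nonneg) auto
  also have "\<dots> = (real n)\<^sup>2 * C\<^sup>2" by (simp add: power2_eq_square)
  finally show ?thesis .
qed

text \<open>The sums of A^q and of B^q are each of order at most n^2, which is not enough by itself.
  When k' is near k, Young's inequality puts the large constant on A^q, whose sum over such k and k'
  is only of order n. When k' is far from k, it puts the large constant on B^q, where the tail of
  the correlations is small.\<close>

lemma quad_sum_AB_tendsto:
  assumes "1 \<le> a" "a < q"
  shows "(\<lambda>n. quad_sum n (\<lambda>k l k' l'. (\<rho> (l - k) * \<rho> (l' - k')) ^ a * (\<rho> (k' - k) * \<rho> (l' - l)) ^ (q - a)) / (real n)\<^sup>2)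
    \<longlonglongrightarrow> 0"
proof (rule tendsto_0_realI)
  let ?A = "\<lambda>k l k' l'. \<rho> (l - k) * \<rho> (l' - k')" and ?B = "\<lambda>k l k' l'. \<rho> (k' - k) * \<rho> (l' - l)"
  show "0 \<le> quad_sum n (\<lambda>k l k' l'. ?A k l k' l' ^ a * ?B k l k' l' ^ (q - a)) / (real n)\<^sup>2" for n
    using rho0 by (intro divide_nonneg_nonneg quad_sum_nonneg) auto
  fix e :: real assume e: "e > 0"
  \<comment> \<open>Two terms carry the factor \<eta>, so \<eta> C^2 \<le> e / 8 lets them
    contribute e / 4 together; the near pairs and the tail get e / 4 each.\<close>
  define \<eta> where "\<eta> = min 1 (e / (8 * (C\<^sup>2 + 1)))"
  have \<eta>: "0 < \<eta>" "\<eta> \<le> 1" using e by (auto simp: \<eta>_def add_nonneg_pos)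
  have \<eta>e: "\<eta> * C\<^sup>2 \<le> e / 8"
  proof -
    have "\<eta> * C\<^sup>2 \<le> e / (8 * (C\<^sup>2 + 1)) * (C\<^sup>2 + 1)"
      using e by (intro mult_mono) (auto simp: \<eta>_def)
    also have "\<dots> = e / 8"
    proof -
      have "e / (8 * D) * D = e / 8" if "D \<noteq> 0" for D using that by simp
      moreover have "C\<^sup>2 + 1 \<noteq> 0" using zero_le_power2[of C] by linarith
      ultimately show ?thesis by blast
    qed
    finally show ?thesis .
  qed
  define K where "K = (1 / \<eta>) ^ q"
  have K: "K > 0" using \<eta> by (simp add: K_def)
  \<comment> \<open>Chosen after \<open>K\<close>, because the large factor of Young's inequality
    stands in front of the tail.\<close>
  define \<tau> where "\<tau> = e / (4 * K * (C + 1))"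
  have \<tau>: "\<tau> > 0" using e K C_nonneg by (auto simp: \<tau>_def)
  have \<tau>e: "K * (\<tau> * C) \<le> e / 4"
  proof -
    have "K * (\<tau> * C) \<le> K * (\<tau> * (C + 1))" using K \<tau> by (intro mult_left_mono) auto
    also have "\<dots> = e / 4"
    proof -
      have "k * (e / (4 * k * D) * D) = e / 4" if "k \<noteq> 0" "D \<noteq> 0" for k D using that by simp
      moreover have "K \<noteq> 0" "C + 1 \<noteq> 0" using K C_nonneg by auto
      ultimately show ?thesis unfolding \<tau>_def by blast
    qed
    finally show ?thesis .
  qed
  obtain m where m: "\<And>F. finite F \<Longrightarrow> (\<Sum>j\<in>F. \<rho> j ^ q * of_bool (int m < \<bar>j\<bar>)) \<le> \<tau>"
    using tail[OF \<tau>] by blast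
  have pw: "?A k l k' l' ^ a * ?B k l k' l' ^ (q - a) \<le>
      \<eta> * (?A k l k' l' ^ q * 1) + \<eta> * ?B k l k' l' ^ q +
      K * (?A k l k' l' ^ q * of_bool (\<bar>k' - k\<bar> \<le> int m)) + K * (?B k l k' l' ^ q * of_bool (int m < \<bar>k' - k\<bar>))"
    for k l k' l'
  proof -
    have A0: "0 \<le> ?A k l k' l'" and B0: "0 \<le> ?B k l k' l'" using rho0 by auto
    have AQ: "0 \<le> \<eta> * ?A k l k' l' ^ q" and BQ: "0 \<le> \<eta> * ?B k l k' l' ^ q"
      using A0 B0 \<eta> by (auto intro!: mult_nonneg_nonneg)
    show ?thesis
    proof (cases "\<bar>k' - k\<bar> \<le> int m")
      case True
      have "?A k l k' l' ^ a * ?B k l k' l' ^ (q - a) \<le> \<eta> * ?B k l k' l' ^ q + K * ?A k l k' l' ^ q"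
        unfolding K_def using A0 B0 \<eta> assms by (intro Young_epsilon) auto
      moreover have "of_bool (\<bar>k' - k\<bar> \<le> int m) = (1::real)" "of_bool (int m < \<bar>k' - k\<bar>) = (0::real)"
        using True by auto
      ultimately show ?thesis using AQ by simp
    next
      case False
      have "?B k l k' l' ^ (q - a) * ?A k l k' l' ^ (q - (q - a)) \<le> \<eta> * ?A k l k' l' ^ q + K * ?B k l k' l' ^ q"
        unfolding K_def using A0 B0 \<eta> assms by (intro Young_epsilon) auto
      moreover have "q - (q - a) = a" using assms by simp
      moreover have "?B k l k' l' ^ (q - a) * ?A k l k' l' ^ a = ?A k l k' l' ^ a * ?B k l k' l' ^ (q - a)"
        by (rule mult.commute)
      moreover have "of_bool (\<bar>k' - k\<bar> \<le> int m) = (0::real)" "of_bool (int m < \<bar>k' - k\<bar>) = (1::real)"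
        using False by auto
      ultimately show ?thesis using BQ by simp
    qed
  qed
  have bound: "quad_sum n (\<lambda>k l k' l'. ?A k l k' l' ^ a * ?B k l k' l' ^ (q - a)) \<le>
     \<eta> * (C\<^sup>2 * (real n)\<^sup>2) + \<eta> * ((real n)\<^sup>2 * C\<^sup>2) + K * (C\<^sup>2 * (real n * (2 * real m + 1)))
       + K * ((real n)\<^sup>2 * (\<tau> * C))" for n
  proof -
    have "quad_sum n (\<lambda>k l k' l'. ?A k l k' l' ^ a * ?B k l k' l' ^ (q - a)) \<le>
      \<eta> * quad_sum n (\<lambda>k l k' l'. ?A k l k' l' ^ q * 1) + \<eta> * quad_sum n (\<lambda>k l k' l'. ?B k l k' l' ^ q) +
      K * quad_sum n (\<lambda>k l k' l'. ?A k l k' l' ^ q * of_bool (\<bar>k' - k\<bar> \<le> int m)) +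
      K * quad_sum n (\<lambda>k l k' l'. ?B k l k' l' ^ q * of_bool (int m < \<bar>k' - k\<bar>))"
      unfolding quad_sum_cmult[symmetric] quad_sum_add[symmetric] by (rule quad_sum_mono) (rule pw)
    also have "\<dots> \<le> \<eta> * (C\<^sup>2 * (real n)\<^sup>2) + \<eta> * ((real n)\<^sup>2 * C\<^sup>2) + K * (C\<^sup>2 * (real n * (2 * real m + 1)))
       + K * ((real n)\<^sup>2 * (\<tau> * C))"
    proof (intro add_mono mult_left_mono)
      show "quad_sum n (\<lambda>k l k' l'. ?A k l k' l' ^ q * 1) \<le> C\<^sup>2 * (real n)\<^sup>2"
        using quad_sum_A_weighted[of "\<lambda>_ _. 1" n] by (simp add: power2_eq_square)
      show "quad_sum n (\<lambda>k l k' l'. ?A k l k' l' ^ q * of_bool (\<bar>k' - k\<bar> \<le> int m)) \<le> C\<^sup>2 * (real n * (2 * real m + 1))"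
        by (rule order_trans[OF quad_sum_A_weighted mult_left_mono[OF pairs_near]]) auto
    qed (use \<eta> K \<tau> quad_sum_B_le quad_sum_B_far[OF m] in auto)
    finally show ?thesis .
  qed
  have "\<forall>\<^sub>F n in sequentially. (K * C\<^sup>2 * (2 * real m + 1)) / real n \<le> e / 4"
    using e by (intro eventually_div_le) auto
  with eventually_gt_at_top[of 0]
  show "\<forall>\<^sub>F n in sequentially. quad_sum n (\<lambda>k l k' l'. ?A k l k' l' ^ a * ?B k l k' l' ^ (q - a)) / (real n)\<^sup>2 \<le> e"
  proof eventually_elim
    case (elim n)
    have "quad_sum n (\<lambda>k l k' l'. ?A k l k' l' ^ a * ?B k l k' l' ^ (q - a)) / (real n)\<^sup>2
      \<le> (\<eta> * (C\<^sup>2 * (real n)\<^sup>2) + \<eta> * ((real n)\<^sup>2 * C\<^sup>2) + K * (C\<^sup>2 * (real n * (2 * real m + 1)))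
       + K * ((real n)\<^sup>2 * (\<tau> * C))) / (real n)\<^sup>2"
      by (intro divide_right_mono bound) auto
    also have "\<dots> = 2 * (\<eta> * C\<^sup>2) + (K * C\<^sup>2 * (2 * real m + 1)) / real n + K * (\<tau> * C)"
    proof -
      have *: "(\<eta> * (c * x\<^sup>2) + \<eta> * (x\<^sup>2 * c) + K * (c * (x * d)) + K * (x\<^sup>2 * t)) / x\<^sup>2
        = 2 * (\<eta> * c) + K * c * d / x + K * t" if "x \<noteq> 0" for x c d t
        using that by (simp add: add_divide_distrib power2_eq_square)
      show ?thesis by (rule *) (use elim in simp)
    qed
    also have "\<dots> \<le> e" using \<eta>e \<tau>e elim e by linarith
    finally show ?case .
  qed
qed

text \<open>The surplus correlation is at most 1 for the few near pairs and uniformly small for all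
  others.\<close>

lemma quad_sum_edge_tendsto:
  "(\<lambda>n. quad_sum n (\<lambda>k l k' l'. (\<rho> (l - k) * \<rho> (l' - k')) ^ q * \<rho> (k' - k)) / (real n)\<^sup>2) \<longlonglongrightarrow> 0"
proof (rule tendsto_0_realI)
  let ?F = "\<lambda>k l k' l'. (\<rho> (l - k) * \<rho> (l' - k')) ^ q * \<rho> (k' - k)"
  show "0 \<le> quad_sum n ?F / (real n)\<^sup>2" for n
    using rho0 by (intro divide_nonneg_nonneg quad_sum_nonneg) auto
  fix e :: real assume e: "e > 0"
  define \<eta> where "\<eta> = e / (2 * (C\<^sup>2 + 1))"
  have "C\<^sup>2 + 1 > 0" by (simp add: add_nonneg_pos)
  then have \<eta>: "0 < \<eta>" and \<eta>e: "C\<^sup>2 * \<eta> \<le> e / 2" using e by (auto simp: \<eta>_def field_simps)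
  obtain m where m: "\<And>j. int m < \<bar>j\<bar> \<Longrightarrow> \<rho> j \<le> \<eta>" using rho_small[OF \<eta>] by blast
  have "\<forall>\<^sub>F n in sequentially. (C\<^sup>2 * (2 * real m + 1)) / real n \<le> e / 2"
    using e by (intro eventually_div_le) auto
  with eventually_gt_at_top[of 0]
  show "\<forall>\<^sub>F n in sequentially. quad_sum n ?F / (real n)\<^sup>2 \<le> e"
  proof eventually_elim
    case (elim n)
    have "\<rho> (k' - k) \<le> of_bool (\<bar>k' - k\<bar> \<le> int m) + \<eta>" for k k'
      using m[of "k' - k"] rho1[of "k' - k"] \<eta> by (cases "\<bar>k' - k\<bar> \<le> int m") auto
    then have "(\<Sum>k\<in>{1..int n}. \<Sum>k'\<in>{1..int n}. \<rho> (k' - k)) \<le> (\<Sum>k\<in>{1..int n}. \<Sum>k'\<in>{1..int n}. of_bool (\<bar>k' - k\<bar> \<le> int m) + \<eta>)"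
      by (intro sum_mono)
    also have "\<dots> \<le> real n * (2 * real m + 1) + (real n)\<^sup>2 * \<eta>"
      using pairs_near[where n=n and m=m] by (simp add: sum.distrib power2_eq_square)
    finally have "quad_sum n ?F \<le> C\<^sup>2 * (real n * (2 * real m + 1) + (real n)\<^sup>2 * \<eta>)"
      using rho0 by (intro order_trans[OF quad_sum_A_weighted] mult_left_mono) auto
    then have "quad_sum n ?F / (real n)\<^sup>2 \<le> C\<^sup>2 * (real n * (2 * real m + 1) + (real n)\<^sup>2 * \<eta>) / (real n)\<^sup>2"
      by (intro divide_right_mono) auto
    also have "\<dots> = (C\<^sup>2 * (2 * real m + 1)) / real n + C\<^sup>2 * \<eta>"
    proof -
      have *: "c * (x * d + x\<^sup>2 * \<eta>) / x\<^sup>2 = c * d / x + c * \<eta>" if "x \<noteq> 0" for x c d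
        using that by (simp add: add_divide_distrib power2_eq_square distrib_left)
      show ?thesis by (rule *) (use elim in simp)
    qed
    finally show ?case using \<eta>e elim by linarith
  qed
qed

text \<open>Exchanging k with l, or k' with l', preserves the inner factor by symmetry of \<rho> and
  permutes the crossing edges. This reduces everything to one surplus edge and one kind of mixed
  product.\<close>

lemma quad_sum_cross_bound_tendsto:
  "(\<lambda>n. quad_sum n (\<lambda>k l k' l'. cross_bound q (\<rho> (l - k)) (\<rho> (k' - k)) (\<rho> (l' - k)) (\<rho> (k' - l)) (\<rho> (l' - l)) (\<rho> (l' - k')))
     / (real n)\<^sup>2) \<longlonglongrightarrow> 0"
proof -
  let ?A = "\<lambda>k l k' l'. \<rho> (l - k) * \<rho> (l' - k')"
  have e1: "quad_sum n (\<lambda>k l k' l'. ?A k l k' l' ^ q * \<rho> (l' - k)) = quad_sum n (\<lambda>k l k' l'. ?A k l k' l' ^ q * \<rho> (k' - k))" for n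
    by (subst quad_sum_swap34[symmetric]) (simp add: rho_minus[of "_::int" _] rho_minus)
  have e2: "quad_sum n (\<lambda>k l k' l'. ?A k l k' l' ^ q * \<rho> (k' - l)) = quad_sum n (\<lambda>k l k' l'. ?A k l k' l' ^ q * \<rho> (k' - k))" for n
    by (subst quad_sum_swap12[symmetric]) (metis (no_types, lifting) rho_minus)
  have e3: "quad_sum n (\<lambda>k l k' l'. ?A k l k' l' ^ q * \<rho> (l' - l)) = quad_sum n (\<lambda>k l k' l'. ?A k l k' l' ^ q * \<rho> (k' - l))" for n
    by (subst quad_sum_swap34[symmetric]) (metis (no_types, lifting) rho_minus)
  have e4: "quad_sum n (\<lambda>k l k' l'. ?A k l k' l' ^ a * (\<rho> (l' - k) * \<rho> (k' - l)) ^ (q - a)) =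
     quad_sum n (\<lambda>k l k' l'. ?A k l k' l' ^ a * (\<rho> (k' - k) * \<rho> (l' - l)) ^ (q - a))" for n a
    by (subst quad_sum_swap34[symmetric]) (metis (no_types, lifting) rho_minus)
  have "(\<lambda>n. 4 * (quad_sum n (\<lambda>k l k' l'. ?A k l k' l' ^ q * \<rho> (k' - k)) / (real n)\<^sup>2) +
    (\<Sum>a = 1..<q. 2 * (quad_sum n (\<lambda>k l k' l'. ?A k l k' l' ^ a * (\<rho> (k' - k) * \<rho> (l' - l)) ^ (q - a)) / (real n)\<^sup>2)))
    \<longlonglongrightarrow> 4 * 0 + (\<Sum>a = 1..<q. 2 * 0)"
    by (intro tendsto_intros quad_sum_edge_tendsto quad_sum_AB_tendsto) auto
  then show ?thesis
    unfolding cross_bound_def distrib_left quad_sum_add quad_sum_sum e1 e2 e3 e4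
    by (simp add: add_divide_distrib sum_divide_distrib)
qed

end

section \<open>Gaussian sequences\<close>

lemma normal_law_transfer:
  fixes h :: "real \<Rightarrow> 'b::{banach, second_countable_topology}"
  assumes d: "distr M borel L = normal_law m v" and [measurable]: "L \<in> borel_measurable M" "h \<in> borel_measurable borel"
  shows "integrable M (\<lambda>x. h (L x)) \<longleftrightarrow> integrable std_normal_distribution (\<lambda>x. h (m + sqrt v * x))"
    "(\<integral>x. h (L x) \<partial>M) = (\<integral>x. h (m + sqrt v * x) \<partial>std_normal_distribution)"
proof -
  have "integrable M (\<lambda>x. h (L x)) \<longleftrightarrow> integrable (distr M borel L) h" by (subst integrable_distr_eq) auto
  also have "\<dots> \<longleftrightarrow> integrable std_normal_distribution (\<lambda>x. h (m + sqrt v * x))"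
    unfolding d normal_law_def by (subst integrable_distr_eq) auto
  finally show "integrable M (\<lambda>x. h (L x)) \<longleftrightarrow> integrable std_normal_distribution (\<lambda>x. h (m + sqrt v * x))" .
  have "(\<integral>x. h (L x) \<partial>M) = integral\<^sup>L (distr M borel L) h" by (subst integral_distr) auto
  also have "\<dots> = (\<integral>x. h (m + sqrt v * x) \<partial>std_normal_distribution)"
    unfolding d normal_law_def by (subst integral_distr) auto
  finally show "(\<integral>x. h (L x) \<partial>M) = (\<integral>x. h (m + sqrt v * x) \<partial>std_normal_distribution)" .
qed

lemma normal_law_moments:
  assumes d: "distr M borel L = normal_law m v" and [measurable]: "L \<in> borel_measurable M" and v: "0 \<le> v"
  shows "integrable M L" "(\<integral>x. L x \<partial>M) = m" "integrable M (\<lambda>x. (L x)\<^sup>2)" "m = 0 \<Longrightarrow> (\<integral>x. (L x)\<^sup>2 \<partial>M) = v"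
    "m = 0 \<Longrightarrow> (\<integral>x. iexp (t * L x) \<partial>M) = complex_of_real (exp (- (t\<^sup>2 * v) / 2))"
proof -
  let ?g = "std_normal_distribution"
  interpret G: real_distribution ?g by (rule real_dist_normal_dist)
  have i1: "integrable ?g (\<lambda>x. x)" and i2: "integrable ?g (\<lambda>x. x\<^sup>2)"
    using integrable_std_normal_distribution_moment[of 1] integrable_std_normal_distribution_moment[of 2] by simp_all
  have e1: "(\<integral>x. x \<partial>?g) = 0" and e2: "(\<integral>x. x\<^sup>2 \<partial>?g) = 1"
    using integral_std_normal_distribution_moment_odd[of 1] std_normal_distribution_even_moments(1)[of 1] by simp_all
  note tr = normal_law_transfer[OF d assms(2)]
  have l: "integrable ?g (\<lambda>x. m + sqrt v * x)" "(\<integral>x. m + sqrt v * x \<partial>?g) = m"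
    using i1 e1 G.prob_space by simp_all
  show "integrable M L" by (subst tr(1)[where h="\<lambda>x. x"]) (simp, rule l)
  show "(\<integral>x. L x \<partial>M) = m" by (subst tr(2)[where h="\<lambda>x. x"]) (simp, rule l)
  have sq: "(m + sqrt v * x)\<^sup>2 = m\<^sup>2 + 2 * m * sqrt v * x + v * x\<^sup>2" for x
    using v by (simp add: power2_sum power_mult_distrib)
  show "integrable M (\<lambda>x. (L x)\<^sup>2)"
    by (subst tr(1)[where h="\<lambda>x. x\<^sup>2"]) (simp, unfold sq, use i1 i2 in auto)
  show "(\<integral>x. (L x)\<^sup>2 \<partial>M) = v" if "m = 0"
    by (subst tr(2)[where h="\<lambda>x. x\<^sup>2"]) (simp, use v i2 e2 that in \<open>simp add: power_mult_distrib\<close>)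
  show "(\<integral>x. iexp (t * L x) \<partial>M) = complex_of_real (exp (- (t\<^sup>2 * v) / 2))" if "m = 0"
  proof -
    have "(\<integral>x. iexp (t * L x) \<partial>M) = (\<integral>x. iexp (t * (m + sqrt v * x)) \<partial>?g)"
      by (rule tr(2)[where h="\<lambda>x. iexp (t * x)"]) simp
    also have "\<dots> = char ?g (t * sqrt v)" unfolding char_def that by (simp add: mult.assoc)
    also have "\<dots> = complex_of_real (exp (- (t * sqrt v)\<^sup>2 / 2))" by (simp add: char_std_normal_distribution)
    finally show ?thesis using v by (simp add: power_mult_distrib)
  qed
qed

lemma borel_measurable_vec_component [measurable (raw)]:
  fixes f :: "'a \<Rightarrow> real ^ 'd::finite"
  shows "f \<in> borel_measurable M \<Longrightarrow> (\<lambda>x. f x $ i) \<in> borel_measurable M"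
  by (rule measurable_compose[OF _ borel_measurable_continuous_onI]) (auto intro: continuous_intros)

lemma summable_on_finite_sum:
  fixes f :: "'i \<Rightarrow> 'a \<Rightarrow> real"
  assumes "finite I" "\<And>i. i \<in> I \<Longrightarrow> f i summable_on A"
  shows "(\<lambda>x. \<Sum>i\<in>I. f i x) summable_on A"
  using assms by (induction I rule: finite_induct) (auto intro: summable_on_add)

locale gaussian_sequence = prob_space M for M :: "'a measure" +
  fixes X :: "int \<Rightarrow> 'a \<Rightarrow> real ^ 'd::finite"
  assumes gaussian: "gaussian_process M X" and centered: "centered_process M X"
    and stationary: "stationary_process M X" and X1_law: "distr M borel (X 1) = std_normal_law_vec"
begin

lemma X_measurable [measurable]: "X k \<in> borel_measurable M"
  using gaussian unfolding gaussian_process_def by auto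

lemma law_stationary:
  "distr M (borel \<Otimes>\<^sub>M borel) (\<lambda>\<omega>. (X k \<omega>, X (k + m) \<omega>)) = distr M (borel \<Otimes>\<^sub>M borel) (\<lambda>\<omega>. (X 1 \<omega>, X (1 + m) \<omega>))"
proof -
  let ?J = "{1, 1 + m}"
  have [measurable]: "(\<lambda>x. (x 1, x (1 + m))) \<in> Pi\<^sub>M ?J (\<lambda>_. borel) \<rightarrow>\<^sub>M (borel \<Otimes>\<^sub>M (borel :: (real ^ 'd) measure))"
    by (intro measurable_Pair measurable_component_singleton) auto
  have m: "(\<lambda>\<omega>. \<lambda>j\<in>?J. X (j + h) \<omega>) \<in> M \<rightarrow>\<^sub>M Pi\<^sub>M ?J (\<lambda>_. borel)" for h
    by (rule measurable_restrict) simp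
  \<comment> \<open>Stationarity is used for the window {1, 1 + m} with the shift k - 1, which moves
    it to {k, k + m}.\<close>
  have "distr M (Pi\<^sub>M ?J (\<lambda>_. borel)) (\<lambda>\<omega>. \<lambda>j\<in>?J. X (j + (k - 1)) \<omega>) =
      distr M (Pi\<^sub>M ?J (\<lambda>_. borel)) (\<lambda>\<omega>. \<lambda>j\<in>?J. X (j + 0) \<omega>)"
    using stationary unfolding stationary_process_def by simp
  then have "distr (distr M (Pi\<^sub>M ?J (\<lambda>_. borel)) (\<lambda>\<omega>. \<lambda>j\<in>?J. X (j + (k - 1)) \<omega>)) (borel \<Otimes>\<^sub>M borel) (\<lambda>x. (x 1, x (1 + m))) =
      distr (distr M (Pi\<^sub>M ?J (\<lambda>_. borel)) (\<lambda>\<omega>. \<lambda>j\<in>?J. X (j + 0) \<omega>)) (borel \<Otimes>\<^sub>M borel) (\<lambda>x. (x 1, x (1 + m)))" by simp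
  then show ?thesis
    by (subst (asm) (1 2) distr_distr) (auto simp: m comp_def add.commute)
qed

lemma X_law: "distr M borel (X k) = std_normal_law_vec"
proof -
  have "distr (distr M (borel \<Otimes>\<^sub>M borel) (\<lambda>\<omega>. (X k \<omega>, X (k + 0) \<omega>))) borel fst =
      distr (distr M (borel \<Otimes>\<^sub>M borel) (\<lambda>\<omega>. (X 1 \<omega>, X (1 + 0) \<omega>))) borel fst"
    by (simp only: law_stationary[of k 0])
  then show ?thesis by (subst (asm) (1 2) distr_distr) (auto simp: comp_def X1_law)
qed

lemma expectation_X:
  fixes g :: "real ^ 'd \<Rightarrow> real"
  assumes [measurable]: "g \<in> borel_measurable borel"
  shows "expectation (\<lambda>\<omega>. g (X k \<omega>)) = (\<integral>x. g x \<partial>std_normal_law_vec)"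
    "integrable M (\<lambda>\<omega>. g (X k \<omega>)) \<longleftrightarrow> integrable std_normal_law_vec g"
  unfolding X_law[of k, symmetric] by (simp_all add: integral_distr integrable_distr_eq)

lemma expectation_pair:
  fixes g :: "(real ^ 'd) \<times> (real ^ 'd) \<Rightarrow> real"
  assumes [measurable]: "g \<in> borel_measurable (borel \<Otimes>\<^sub>M borel)"
  shows "expectation (\<lambda>\<omega>. g (X k \<omega>, X l \<omega>)) = expectation (\<lambda>\<omega>. g (X 1 \<omega>, X (1 + (l - k)) \<omega>))"
proof -
  have "expectation (\<lambda>\<omega>. g (X k \<omega>, X (k + (l - k)) \<omega>)) =
     integral\<^sup>L (distr M (borel \<Otimes>\<^sub>M borel) (\<lambda>\<omega>. (X k \<omega>, X (k + (l - k)) \<omega>))) g"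
    by (subst integral_distr) auto
  also have "\<dots> = expectation (\<lambda>\<omega>. g (X 1 \<omega>, X (1 + (l - k)) \<omega>))"
    unfolding law_stationary[of k "l - k"] by (subst integral_distr) auto
  finally show ?thesis by simp
qed

definition coord :: "int \<times> 'd \<Rightarrow> 'a \<Rightarrow> real" where "coord b \<omega> = X (fst b) \<omega> $ snd b"

definition coord_cov :: "int \<times> 'd \<Rightarrow> int \<times> 'd \<Rightarrow> real" where
  "coord_cov a b = expectation (\<lambda>\<omega>. coord a \<omega> * coord b \<omega>)"

lemma coord_measurable [measurable]: "coord b \<in> borel_measurable M"
  unfolding coord_def[abs_def] by measurable

lemma coord_law: "distr M borel (coord b) = std_normal_distribution"
proof -
  have "distr M borel (coord b) = distr (distr M borel (X (fst b))) borel (\<lambda>x. x $ snd b)"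
    by (subst distr_distr) (auto simp: comp_def coord_def[abs_def])
  then show ?thesis by (simp add: X_law std_normal_law_vec_marginal)
qed

lemma coord_square: "integrable M (\<lambda>\<omega>. (coord b \<omega>)\<^sup>2)" "expectation (\<lambda>\<omega>. (coord b \<omega>)\<^sup>2) = 1"
proof -
  have "std_normal_distribution = normal_law 0 1" unfolding normal_law_def
    by (rule measure_eqI) (auto simp: emeasure_distr vimage_def)
  then have *: "distr M borel (coord b) = normal_law 0 1" by (simp add: coord_law)
  show "integrable M (\<lambda>\<omega>. (coord b \<omega>)\<^sup>2)" "expectation (\<lambda>\<omega>. (coord b \<omega>)\<^sup>2) = 1"
    using normal_law_moments(3,4)[OF * coord_measurable] by auto
qed

lemma coord_mult_integrable: "integrable M (\<lambda>\<omega>. coord a \<omega> * coord b \<omega>)"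
  by (rule integrable_mult_square) (auto simp: coord_square)

text \<open>Coefficients indexed by time and coordinate are packed into one vector per time, which
  is the form in which the process is assumed Gaussian. Centering and the second moment then
  identify the two parameters of the normal law.\<close>

lemma coord_char:
  assumes J: "finite J"
  shows "expectation (\<lambda>\<omega>. iexp (\<Sum>b\<in>J. t b * coord b \<omega>)) =
    complex_of_real (exp (- (\<Sum>a\<in>J. \<Sum>b\<in>J. t a * t b * coord_cov a b) / 2))"
proof -
  define L where "L \<omega> = (\<Sum>b\<in>J. t b * coord b \<omega>)" for \<omega>
  have Lm[measurable]: "L \<in> borel_measurable M" unfolding L_def[abs_def] by measurable
  define w where "w k = (\<chi> i. if (k, i) \<in> J then t (k, i) else 0)" for k
  have L_eq: "L \<omega> = (\<Sum>k\<in>fst ` J. w k \<bullet> X k \<omega>)" for \<omega>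
  proof -
    have "(\<Sum>k\<in>fst ` J. w k \<bullet> X k \<omega>) = (\<Sum>k\<in>fst ` J. \<Sum>i\<in>UNIV. if (k, i) \<in> J then t (k, i) * X k \<omega> $ i else 0)"
      by (simp add: w_def inner_vec_def if_distrib[of "\<lambda>x. x * _"] cong: if_cong)
    also have "\<dots> = (\<Sum>b\<in>fst ` J \<times> UNIV. if b \<in> J then t b * coord b \<omega> else 0)"
      unfolding sum.cartesian_product by (intro sum.cong refl) (auto simp: coord_def)
    also have "\<dots> = L \<omega>" unfolding L_def
      by (rule sum.mono_neutral_cong_right) (use J in \<open>auto simp: image_iff intro!: bexI[rotated]\<close>)
    finally show ?thesis by simp
  qed
  obtain m v where v: "0 \<le> v" and law: "distr M borel L = normal_law m v"
    using gaussian J unfolding gaussian_process_def L_eq[abs_def] by blast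
  note mom = normal_law_moments[OF law Lm v]
  have "expectation L = 0"
  proof -
    have "integrable M (coord b)" "expectation (coord b) = 0" for b
      using centered unfolding centered_process_def coord_def[abs_def] by auto
    then show ?thesis unfolding L_def[abs_def] by (simp add: Bochner_Integration.integral_sum)
  qed
  then have m0: "m = 0" using mom(2) by simp
  have "expectation (\<lambda>\<omega>. (L \<omega>)\<^sup>2) = expectation (\<lambda>\<omega>. \<Sum>a\<in>J. \<Sum>b\<in>J. t a * t b * (coord a \<omega> * coord b \<omega>))"
    unfolding L_def power2_eq_square sum_product by (simp add: mult_ac)
  also have "\<dots> = (\<Sum>a\<in>J. \<Sum>b\<in>J. t a * t b * coord_cov a b)"
    unfolding coord_cov_def by (simp add: Bochner_Integration.integral_sum coord_mult_integrable)
  finally have "v = (\<Sum>a\<in>J. \<Sum>b\<in>J. t a * t b * coord_cov a b)" using mom(4)[OF m0] by simp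
  then show ?thesis using mom(5)[OF m0, of 1] by (simp add: L_def)
qed

lemma coord_cov_diag: "coord_cov (k, i) (k, j) = of_bool (i = j)"
proof (cases "i = j")
  case True
  then show ?thesis using coord_square(2)[of "(k, i)"] by (simp add: coord_cov_def power2_eq_square)
next
  case False
  have "coord_cov (k, i) (k, j) = (\<integral>x. x $ i * x $ j \<partial>std_normal_law_vec)"
    unfolding coord_cov_def coord_def using expectation_X(1)[of "\<lambda>x. x $ i * x $ j" k] by simp
  then show ?thesis using std_normal_law_vec_cross[OF False] False by simp
qed

lemma coord_cov_cross_cov: "coord_cov (k, i) (l, j) = cross_cov M X i j (l - k)"
proof -
  have "expectation (\<lambda>\<omega>. (\<lambda>(x, y). x $ i * y $ j) (X k \<omega>, X l \<omega>)) =
    expectation (\<lambda>\<omega>. (\<lambda>(x, y). x $ i * y $ j) (X 1 \<omega>, X (1 + (l - k)) \<omega>))"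
    by (rule expectation_pair) measurable
  then show ?thesis by (simp add: coord_cov_def coord_def cross_cov_def)
qed

lemma coord_cov_sym: "coord_cov a b = coord_cov b a"
  by (simp add: coord_cov_def mult.commute)

lemma coord_cov_le_1: "\<bar>coord_cov a b\<bar> \<le> 1"
proof -
  have "\<bar>coord_cov a b\<bar> \<le> expectation (\<lambda>\<omega>. \<bar>coord a \<omega> * coord b \<omega>\<bar>)"
    unfolding coord_cov_def by (rule integral_abs_bound)
  also have "\<dots> \<le> sqrt (expectation (\<lambda>\<omega>. (coord a \<omega>)\<^sup>2)) * sqrt (expectation (\<lambda>\<omega>. (coord b \<omega>)\<^sup>2))"
    by (rule Cauchy_Schwarz_integral) (auto simp: coord_square)
  finally show ?thesis by (simp add: coord_square)
qed

sublocale hermite_family M coord coord_cov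
proof
  show "coord b \<in> borel_measurable M" for b by simp
  show "expectation (\<lambda>\<omega>. iexp (\<Sum>b\<in>J. t b * coord b \<omega>)) =
    complex_of_real (exp (- (\<Sum>a\<in>J. \<Sum>b\<in>J. t a * t b * coord_cov a b) / 2))" if "finite J" for J t
    using that by (rule coord_char)
qed (rule coord_law coord_cov_diag coord_cov_sym)+

lemma hprod_vec: "hprod \<alpha> k (vec \<omega>) = hermite_vec \<alpha> (X k \<omega>)"
  by (simp add: hprod_def hermite_vec_def vec_def coord_def)

text \<open>The maximum over both coordinates restores symmetry in the lag: reversing the lag
  exchanges the two coordinates. Its q-th power is at most the finite sum of all q-th powers, hence
  summable.\<close>

definition max_cov :: "int \<Rightarrow> real" where
  "max_cov j = Max (range (\<lambda>(i, l). \<bar>cross_cov M X i l j\<bar>))"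

lemma cross_cov_le_max: "\<bar>cross_cov M X i l j\<bar> \<le> max_cov j"
  unfolding max_cov_def by (rule Max_ge) (auto intro: image_eqI[of _ _ "(i, l)"])

lemma max_cov_attained: "\<exists>i l. max_cov j = \<bar>cross_cov M X i l j\<bar>"
proof -
  have "max_cov j \<in> range (\<lambda>(i, l). \<bar>cross_cov M X i l j\<bar>)" unfolding max_cov_def by (rule Max_in) auto
  then show ?thesis by auto
qed

lemma summable_correlation_max_cov:
  assumes q: "1 \<le> q" and s: "\<And>i l. (\<lambda>j. \<bar>cross_cov M X i l j\<bar> ^ q) summable_on UNIV"
  shows "summable_correlation max_cov q"
proof
  have cc: "cross_cov M X i l j = coord_cov (1, i) (1 + j, l)" for i l j
    unfolding coord_cov_cross_cov by simp
  show "0 \<le> max_cov j" "max_cov j \<le> 1" for j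
    using max_cov_attained[of j] coord_cov_le_1 by (auto simp: cc)
  have flip: "cross_cov M X i l (- j) = cross_cov M X l i j" for i l j
    using coord_cov_cross_cov[of 1 i "1 - j" l] coord_cov_cross_cov[of "1 - j" l 1 i] coord_cov_sym[of "(1, i)" "(1 - j, l)"]
    by simp
  have "max_cov (- j) \<le> max_cov j" for j
    using max_cov_attained[of "- j"] cross_cov_le_max flip by metis
  from this this[of "- _"] show "max_cov (- j) = max_cov j" for j by (metis antisym minus_minus)
  show "1 \<le> q" by fact
  show "(\<lambda>j. max_cov j ^ q) summable_on UNIV"
  proof (rule summable_on_comparison_test)
    show "(\<lambda>j. \<Sum>i\<in>UNIV. \<Sum>l\<in>UNIV. \<bar>cross_cov M X i l j\<bar> ^ q) summable_on UNIV"
      by (intro summable_on_finite_sum s) auto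
    fix j
    obtain i l where il: "max_cov j = \<bar>cross_cov M X i l j\<bar>" using max_cov_attained by blast
    show "0 \<le> max_cov j ^ q" unfolding il by simp
    have "max_cov j ^ q \<le> (\<Sum>l\<in>UNIV. \<bar>cross_cov M X i l j\<bar> ^ q)"
      unfolding il by (rule member_le_sum[of l UNIV "\<lambda>l. \<bar>cross_cov M X i l j\<bar> ^ q"]) auto
    also have "\<dots> \<le> (\<Sum>i\<in>UNIV. \<Sum>l\<in>UNIV. \<bar>cross_cov M X i l j\<bar> ^ q)"
      by (rule member_le_sum[of i UNIV "\<lambda>i. \<Sum>l\<in>UNIV. \<bar>cross_cov M X i l j\<bar> ^ q"]) (auto intro: sum_nonneg)
    finally show "max_cov j ^ q \<le> (\<Sum>i\<in>UNIV. \<Sum>l\<in>UNIV. \<bar>cross_cov M X i l j\<bar> ^ q)" .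
  qed
qed

end

section \<open>Concentration for finite Hermite expansions\<close>

definition mfact :: "('d::finite \<Rightarrow> nat) \<Rightarrow> real" where "mfact \<alpha> = (\<Prod>i\<in>UNIV. fact (\<alpha> i))"

lemma mfact_pos: "mfact \<alpha> > 0"
  unfolding mfact_def by (intro prod_pos) auto

lemma mfact_nonzero: "mfact \<alpha> \<noteq> 0"
  using mfact_pos[of \<alpha>] by simp

lemma sqrt_mfact_square: "(sqrt (mfact \<alpha>))\<^sup>2 = mfact \<alpha>"
  using mfact_pos[of \<alpha>] by simp

lemma mfact_dec: "\<alpha> i > 0 \<Longrightarrow> mfact \<alpha> = real (\<alpha> i) * mfact (dec \<alpha> i)"
proof -
  assume i: "\<alpha> i > 0"
  have "mfact (dec \<alpha> i) = fact (\<alpha> i - 1) * (\<Prod>j\<in>UNIV - {i}. fact (\<alpha> j))"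
    unfolding mfact_def by (subst prod.remove[of UNIV i]) (auto simp: dec_def intro!: prod.cong)
  moreover have "mfact \<alpha> = fact (\<alpha> i) * (\<Prod>j\<in>UNIV - {i}. fact (\<alpha> j))"
    unfolding mfact_def by (subst prod.remove[of UNIV i]) auto
  moreover have "(fact (\<alpha> i) :: real) = real (\<alpha> i) * fact (\<alpha> i - 1)" using i by (rule fact_reduce)
  ultimately show ?thesis by simp
qed

lemma finite_msize: "finite {\<alpha> :: 'd::finite \<Rightarrow> nat. msize \<alpha> = p}"
proof (rule finite_subset)
  show "{\<alpha> :: 'd \<Rightarrow> nat. msize \<alpha> = p} \<subseteq> PiE UNIV (\<lambda>_. {..p})"
  proof
    fix \<alpha> :: "'d \<Rightarrow> nat" assume "\<alpha> \<in> {\<alpha>. msize \<alpha> = p}"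
    then have "\<alpha> i \<le> p" for i
      using member_le_sum[of i UNIV \<alpha>] by (simp add: msize_def)
    then show "\<alpha> \<in> PiE UNIV (\<lambda>_. {..p})" by auto
  qed
qed (intro finite_PiE, auto)

text \<open>The multinomial theorem, evaluated at the all-ones vector.\<close>

lemma sum_inverse_mfact:
  "(\<Sum>\<alpha> | msize \<alpha> = p. 1 / mfact (\<alpha> :: 'd::finite \<Rightarrow> nat)) = real CARD('d) ^ p / fact p"
proof (induction p)
  case 0
  have "{\<alpha> :: 'd \<Rightarrow> nat. msize \<alpha> = 0} = {\<lambda>_. 0}" using msize_0 by (auto simp: msize_def)
  then show ?case by (simp add: mfact_def)
next
  case (Suc p)
  let ?A = "\<lambda>p. {\<alpha> :: 'd \<Rightarrow> nat. msize \<alpha> = p}"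
  have shift: "(\<Sum>\<alpha>\<in>?A (Suc p). real (\<alpha> i) / mfact \<alpha>) = (\<Sum>\<beta>\<in>?A p. 1 / mfact \<beta>)" for i
  proof -
    have "(\<Sum>\<alpha>\<in>?A (Suc p). real (\<alpha> i) / mfact \<alpha>) = (\<Sum>\<alpha>\<in>{\<alpha> \<in> ?A (Suc p). \<alpha> i > 0}. real (\<alpha> i) / mfact \<alpha>)"
      by (rule sum.mono_neutral_right) (auto simp: finite_msize)
    also have "\<dots> = (\<Sum>\<beta>\<in>?A p. 1 / mfact \<beta>)"
    proof (rule sum.reindex_bij_witness[of _ "\<lambda>\<beta>. \<beta>(i := Suc (\<beta> i))" "\<lambda>\<alpha>. dec \<alpha> i"])
      fix \<alpha> assume a: "\<alpha> \<in> {\<alpha> \<in> ?A (Suc p). \<alpha> i > 0}"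
      then show "(dec \<alpha> i)(i := Suc (dec \<alpha> i i)) = \<alpha>" by (auto simp: dec_def)
      show "dec \<alpha> i \<in> ?A p" using a msize_dec[of \<alpha> i] by auto
      show "1 / mfact (dec \<alpha> i) = real (\<alpha> i) / mfact \<alpha>"
        using a mfact_dec[of \<alpha> i] by simp
    next
      fix \<beta> assume b: "\<beta> \<in> ?A p"
      have d: "dec (\<beta>(i := Suc (\<beta> i))) i = \<beta>" by (auto simp: dec_def)
      then show "dec (\<beta>(i := Suc (\<beta> i))) i = \<beta>" .
      show "\<beta>(i := Suc (\<beta> i)) \<in> {\<alpha> \<in> ?A (Suc p). \<alpha> i > 0}"
        using msize_dec[of "\<beta>(i := Suc (\<beta> i))" i] b d by simp
    qed
    finally show ?thesis .
  qed
  have "real (Suc p) * (\<Sum>\<alpha>\<in>?A (Suc p). 1 / mfact \<alpha>) = (\<Sum>\<alpha>\<in>?A (Suc p). \<Sum>i\<in>UNIV. real (\<alpha> i) / mfact \<alpha>)"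
    unfolding sum_distrib_left sum_divide_distrib[symmetric]
    by (intro sum.cong refl) (auto simp: msize_def simp flip: of_nat_sum)
  also have "\<dots> = (\<Sum>i\<in>(UNIV :: 'd set). \<Sum>\<alpha>\<in>?A (Suc p). real (\<alpha> i) / mfact \<alpha>)" by (rule sum.swap)
  also have "\<dots> = real CARD('d) * (real CARD('d) ^ p / fact p)" unfolding shift Suc.IH by simp
  finally show ?case by (simp add: field_simps del: of_nat_Suc)
qed

locale breuer_major = hermite_family M Y c + summable_correlation \<rho> q
  for M :: "'a measure" and Y :: "int \<times> 'd::finite \<Rightarrow> 'a \<Rightarrow> real" and c and \<rho> and q +
  assumes c_le: "\<bar>c (k, i) (l, j)\<bar> \<le> \<rho> (l - k)"
begin

lemma integrable_hprod: "integrable M (\<lambda>\<omega>. hprod \<alpha> k (vec \<omega>))"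
  by (rule integrable_pdiff[OF _ pdiff_hprod[of k "{k}"]]) auto

lemma integrable_hprod2: "integrable M (\<lambda>\<omega>. hprod \<alpha> k (vec \<omega>) * hprod \<beta> l (vec \<omega>))"
  by (rule integrable_pdiff[OF _ pdiff.mult[OF pdiff_hprod[of k "{k, l}"] pdiff_hprod[of l "{k, l}"]]]) auto

lemma integrable_hprod4: "integrable M (\<lambda>\<omega>. hprod \<alpha> k (vec \<omega>) * (hprod \<beta> l (vec \<omega>) * (hprod \<gamma> k' (vec \<omega>) * hprod \<delta> l' (vec \<omega>))))"
  by (rule integrable_pdiff[OF _ pdiff.mult[OF pdiff_hprod[of k "{k, l, k', l'}"] pdiff.mult[OF pdiff_hprod[of l "{k, l, k', l'}"]
     pdiff.mult[OF pdiff_hprod[of k' "{k, l, k', l'}"] pdiff_hprod[of l' "{k, l, k', l'}"]]]]]) auto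

section \<open>Covariances of finite Hermite expansions\<close>

definition hpoly :: "('d \<Rightarrow> nat) set \<Rightarrow> (('d \<Rightarrow> nat) \<Rightarrow> real) \<Rightarrow> int \<Rightarrow> 'a \<Rightarrow> real" where
  "hpoly A a k \<omega> = (\<Sum>\<alpha>\<in>A. a \<alpha> * hprod \<alpha> k (vec \<omega>))"

lemma hpoly_measurable [measurable]: "hpoly A a k \<in> borel_measurable M"
  unfolding hpoly_def[abs_def] using integrable_hprod by (intro borel_measurable_sum borel_measurable_times) auto

lemma hpoly_mult: "hpoly A a k \<omega> * hpoly A a l \<omega> = (\<Sum>\<alpha>\<in>A. \<Sum>\<beta>\<in>A. a \<alpha> * a \<beta> * (hprod \<alpha> k (vec \<omega>) * hprod \<beta> l (vec \<omega>)))"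
  unfolding hpoly_def sum_product by (simp add: mult_ac)

lemma integrable_hpoly2: "integrable M (\<lambda>\<omega>. hpoly A a k \<omega> * hpoly A a l \<omega>)"
  unfolding hpoly_mult by (intro Bochner_Integration.integrable_sum integrable_mult_right integrable_hprod2)

lemma expectation_hpoly2:
  "expectation (\<lambda>\<omega>. hpoly A a k \<omega> * hpoly A a l \<omega>) = (\<Sum>\<alpha>\<in>A. \<Sum>\<beta>\<in>A. a \<alpha> * a \<beta> * H2 \<alpha> \<beta> k l)"
  unfolding hpoly_mult H2_def
  by (subst Bochner_Integration.integral_sum, intro Bochner_Integration.integrable_sum integrable_mult_right integrable_hprod2,
      intro sum.cong refl, subst Bochner_Integration.integral_sum, intro integrable_mult_right integrable_hprod2) simp

lemma expectation_hpoly_square: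
  assumes "finite A" shows "expectation (\<lambda>\<omega>. (hpoly A a k \<omega>)\<^sup>2) = (\<Sum>\<alpha>\<in>A. (a \<alpha>)\<^sup>2 * mfact \<alpha>)"
proof -
  have "H2 \<alpha> \<beta> k k = (if \<alpha> = \<beta> then mfact \<alpha> else 0)" for \<alpha> \<beta>
    unfolding H2_def orthogonality mfact_def by simp
  then show ?thesis
    unfolding power2_eq_square expectation_hpoly2 using assms
    by (intro sum.cong refl) (simp add: if_distrib[of "\<lambda>x. _ * x"] cong: if_cong)
qed

text \<open>Different degrees are uncorrelated. Within degree p, the p! of the two-point bound is
  cancelled by Cauchy-Schwarz with weights \<open>mfact\<close> and the multinomial sum d^p / p!,
  leaving (d \<theta>)^p. If d \<theta> \<le> 1, this is at most (d \<theta>)^q; otherwise (d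
  \<theta>)^q \<ge> 1 and plain Cauchy-Schwarz suffices. No constant depends on \<open>A\<close>,
  which is what allows passage to infinite expansions.\<close>

lemma hpoly_covariance_bound:
  assumes A: "finite A" and rank: "\<And>\<alpha>. \<alpha> \<in> A \<Longrightarrow> q \<le> msize \<alpha>"
  shows "\<bar>expectation (\<lambda>\<omega>. hpoly A a k \<omega> * hpoly A a l \<omega>)\<bar> \<le>
    (real CARD('d) * \<rho> (l - k)) ^ q * (\<Sum>\<alpha>\<in>A. (a \<alpha>)\<^sup>2 * mfact \<alpha>)"
proof -
  define \<theta> where "\<theta> = \<rho> (l - k)"
  define D where "D = real CARD('d)"
  have \<theta>: "0 \<le> \<theta>" and D: "0 \<le> D" using rho0 by (auto simp: \<theta>_def D_def)
  have S0: "0 \<le> (\<Sum>\<alpha>\<in>B. (a \<alpha>)\<^sup>2 * mfact \<alpha>)" for B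
    by (intro sum_nonneg mult_nonneg_nonneg) (auto simp: less_imp_le mfact_pos)
  show ?thesis
  proof (cases "D * \<theta> \<le> 1")
    case False
    have i: "integrable M (\<lambda>\<omega>. (hpoly A a k \<omega>)\<^sup>2)" for k using integrable_hpoly2[of A a k k] by (simp add: power2_eq_square)
    have "\<bar>expectation (\<lambda>\<omega>. hpoly A a k \<omega> * hpoly A a l \<omega>)\<bar> \<le> expectation (\<lambda>\<omega>. \<bar>hpoly A a k \<omega> * hpoly A a l \<omega>\<bar>)"
      by (rule integral_abs_bound)
    also have "\<dots> \<le> sqrt (expectation (\<lambda>\<omega>. (hpoly A a k \<omega>)\<^sup>2)) * sqrt (expectation (\<lambda>\<omega>. (hpoly A a l \<omega>)\<^sup>2))"
      by (rule Cauchy_Schwarz_integral) (auto simp: i)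
    also have "\<dots> = (\<Sum>\<alpha>\<in>A. (a \<alpha>)\<^sup>2 * mfact \<alpha>)" using S0 by (simp add: expectation_hpoly_square A)
    also have "\<dots> \<le> (D * \<theta>) ^ q * (\<Sum>\<alpha>\<in>A. (a \<alpha>)\<^sup>2 * mfact \<alpha>)"
      using False one_le_power[of "D * \<theta>" q] S0[of A] mult_right_mono[of 1 "(D * \<theta>) ^ q"] by simp
    finally show ?thesis by (simp add: D_def \<theta>_def)
  next
    case True
    have H: "\<bar>a \<alpha> * a \<beta> * H2 \<alpha> \<beta> k l\<bar> \<le> of_bool (msize \<alpha> = msize \<beta>) * (\<bar>a \<alpha>\<bar> * \<bar>a \<beta>\<bar> * (fact (msize \<alpha>) * \<theta> ^ msize \<alpha>))" for \<alpha> \<beta>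
    proof (cases "msize \<alpha> = msize \<beta>")
      case True
      have "\<bar>H2 \<alpha> \<beta> k l\<bar> \<le> fact (msize \<alpha>) * \<theta> ^ msize \<alpha>"
        unfolding H2_def by (rule two_point_bound[OF \<theta> _ refl True[symmetric]]) (simp add: \<theta>_def c_le)
      then show ?thesis using True by (simp add: abs_mult mult_left_mono)
    next
      case False
      then show ?thesis using two_point_zero[OF False] by (simp add: H2_def)
    qed
    let ?Ap = "\<lambda>p. {\<alpha> \<in> A. msize \<alpha> = p}"
    have "\<bar>expectation (\<lambda>\<omega>. hpoly A a k \<omega> * hpoly A a l \<omega>)\<bar> \<le> (\<Sum>\<alpha>\<in>A. \<Sum>\<beta>\<in>A. \<bar>a \<alpha> * a \<beta> * H2 \<alpha> \<beta> k l\<bar>)"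
      unfolding expectation_hpoly2 by (rule order_trans[OF sum_abs sum_mono[OF sum_abs]])
    also have "\<dots> \<le> (\<Sum>\<alpha>\<in>A. \<Sum>\<beta>\<in>A. of_bool (msize \<alpha> = msize \<beta>) * (\<bar>a \<alpha>\<bar> * \<bar>a \<beta>\<bar> * (fact (msize \<alpha>) * \<theta> ^ msize \<alpha>)))"
      by (intro sum_mono H)
    also have "\<dots> = (\<Sum>p\<in>msize ` A. \<Sum>\<alpha>\<in>?Ap p. \<Sum>\<beta>\<in>A. of_bool (msize \<alpha> = msize \<beta>) * (\<bar>a \<alpha>\<bar> * \<bar>a \<beta>\<bar> * (fact (msize \<alpha>) * \<theta> ^ msize \<alpha>)))"
      by (rule sum.group[symmetric]) (use A in auto)
    also have "\<dots> \<le> (\<Sum>p\<in>msize ` A. (D * \<theta>) ^ q * (\<Sum>\<alpha>\<in>?Ap p. (a \<alpha>)\<^sup>2 * mfact \<alpha>))"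
    proof (rule sum_mono)
      fix p assume "p \<in> msize ` A"
      then have pq: "q \<le> p" using rank by auto
      have "(\<Sum>\<alpha>\<in>?Ap p. \<Sum>\<beta>\<in>A. of_bool (msize \<alpha> = msize \<beta>) * (\<bar>a \<alpha>\<bar> * \<bar>a \<beta>\<bar> * (fact (msize \<alpha>) * \<theta> ^ msize \<alpha>))) =
        (\<Sum>\<alpha>\<in>?Ap p. \<Sum>\<beta>\<in>?Ap p. \<bar>a \<alpha>\<bar> * \<bar>a \<beta>\<bar> * (fact p * \<theta> ^ p))"
      proof (rule sum.cong[OF refl])
        fix \<alpha> assume "\<alpha> \<in> ?Ap p"
        then show "(\<Sum>\<beta>\<in>A. of_bool (msize \<alpha> = msize \<beta>) * (\<bar>a \<alpha>\<bar> * \<bar>a \<beta>\<bar> * (fact (msize \<alpha>) * \<theta> ^ msize \<alpha>))) =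
          (\<Sum>\<beta>\<in>?Ap p. \<bar>a \<alpha>\<bar> * \<bar>a \<beta>\<bar> * (fact p * \<theta> ^ p))"
          using A by (intro sum.mono_neutral_cong_right) auto
      qed
      also have "\<dots> = (fact p * \<theta> ^ p) * (\<Sum>\<alpha>\<in>?Ap p. \<bar>a \<alpha>\<bar>)\<^sup>2"
        unfolding power2_eq_square sum_product by (simp add: sum_distrib_left mult_ac)
      also have "\<dots> \<le> (fact p * \<theta> ^ p) * ((\<Sum>\<alpha>\<in>?Ap p. (a \<alpha>)\<^sup>2 * mfact \<alpha>) * (D ^ p / fact p))"
      proof (rule mult_left_mono)
        have "(\<Sum>\<alpha>\<in>?Ap p. \<bar>a \<alpha>\<bar>)\<^sup>2 = (\<Sum>\<alpha>\<in>?Ap p. (\<bar>a \<alpha>\<bar> * sqrt (mfact \<alpha>)) * (1 / sqrt (mfact \<alpha>)))\<^sup>2"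
          by (simp add: mfact_nonzero)
        also have "\<dots> \<le> (\<Sum>\<alpha>\<in>?Ap p. (\<bar>a \<alpha>\<bar> * sqrt (mfact \<alpha>))\<^sup>2) * (\<Sum>\<alpha>\<in>?Ap p. (1 / sqrt (mfact \<alpha>))\<^sup>2)"
          by (rule Cauchy_Schwarz_ineq_sum)
        also have "\<dots> = (\<Sum>\<alpha>\<in>?Ap p. (a \<alpha>)\<^sup>2 * mfact \<alpha>) * (\<Sum>\<alpha>\<in>?Ap p. 1 / mfact \<alpha>)"
          by (simp add: power_mult_distrib power_divide sqrt_mfact_square)
        also have "\<dots> \<le> (\<Sum>\<alpha>\<in>?Ap p. (a \<alpha>)\<^sup>2 * mfact \<alpha>) * (\<Sum>\<alpha> | msize (\<alpha> :: 'd \<Rightarrow> nat) = p. 1 / mfact \<alpha>)"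
          using finite_msize mfact_pos S0 by (intro mult_left_mono sum_mono2) (auto simp: less_imp_le intro: less_imp_le)
        also have "\<dots> = (\<Sum>\<alpha>\<in>?Ap p. (a \<alpha>)\<^sup>2 * mfact \<alpha>) * (D ^ p / fact p)"
          unfolding sum_inverse_mfact D_def ..
        finally show "(\<Sum>\<alpha>\<in>?Ap p. \<bar>a \<alpha>\<bar>)\<^sup>2 \<le> (\<Sum>\<alpha>\<in>?Ap p. (a \<alpha>)\<^sup>2 * mfact \<alpha>) * (D ^ p / fact p)" .
      qed (use \<theta> in auto)
      also have "\<dots> = (D * \<theta>) ^ p * (\<Sum>\<alpha>\<in>?Ap p. (a \<alpha>)\<^sup>2 * mfact \<alpha>)" by (simp add: power_mult_distrib)
      also have "\<dots> \<le> (D * \<theta>) ^ q * (\<Sum>\<alpha>\<in>?Ap p. (a \<alpha>)\<^sup>2 * mfact \<alpha>)"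
        using True D \<theta> pq S0 by (intro mult_right_mono power_decreasing) auto
      finally show "(\<Sum>\<alpha>\<in>?Ap p. \<Sum>\<beta>\<in>A. of_bool (msize \<alpha> = msize \<beta>) * (\<bar>a \<alpha>\<bar> * \<bar>a \<beta>\<bar> * (fact (msize \<alpha>) * \<theta> ^ msize \<alpha>)))
         \<le> (D * \<theta>) ^ q * (\<Sum>\<alpha>\<in>?Ap p. (a \<alpha>)\<^sup>2 * mfact \<alpha>)" .
    qed
    also have "\<dots> = (D * \<theta>) ^ q * (\<Sum>p\<in>msize ` A. \<Sum>\<alpha>\<in>?Ap p. (a \<alpha>)\<^sup>2 * mfact \<alpha>)" by (simp add: sum_distrib_left)
    also have "(\<Sum>p\<in>msize ` A. \<Sum>\<alpha>\<in>?Ap p. (a \<alpha>)\<^sup>2 * mfact \<alpha>) = (\<Sum>\<alpha>\<in>A. (a \<alpha>)\<^sup>2 * mfact \<alpha>)"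
      by (rule sum.group) (use A in auto)
    finally show ?thesis by (simp add: D_def \<theta>_def)
  qed
qed

section \<open>Variances of the quadratic forms that make up \<Gamma>\<close>

definition pair_sum :: "('d \<Rightarrow> nat) \<Rightarrow> 'd \<Rightarrow> ('d \<Rightarrow> nat) \<Rightarrow> 'd \<Rightarrow> nat \<Rightarrow> 'a \<Rightarrow> real" where
  "pair_sum \<alpha> i \<beta> j n \<omega> = (\<Sum>k\<in>{1..int n}. \<Sum>l\<in>{1..int n}. c (k, i) (l, j) * (hprod \<alpha> k (vec \<omega>) * hprod \<beta> l (vec \<omega>)))"

lemma integrable_pair_sum: "integrable M (pair_sum \<alpha> i \<beta> j n)"
  unfolding pair_sum_def[abs_def] by (intro Bochner_Integration.integrable_sum integrable_mult_right integrable_hprod2)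

lemma pair_sum_covariance:
  shows "integrable M (\<lambda>\<omega>. (hprod \<alpha> k (vec \<omega>) * hprod \<beta> l (vec \<omega>) - H2 \<alpha> \<beta> k l) * (hprod \<alpha> k' (vec \<omega>) * hprod \<beta> l' (vec \<omega>) - H2 \<alpha> \<beta> k' l'))"
    and "expectation (\<lambda>\<omega>. (hprod \<alpha> k (vec \<omega>) * hprod \<beta> l (vec \<omega>) - H2 \<alpha> \<beta> k l) * (hprod \<alpha> k' (vec \<omega>) * hprod \<beta> l' (vec \<omega>) - H2 \<alpha> \<beta> k' l')) =
      H4 \<alpha> \<beta> \<alpha> \<beta> k l k' l' - H2 \<alpha> \<beta> k l * H2 \<alpha> \<beta> k' l'"
proof -
  let ?u = "\<lambda>\<omega>. hprod \<alpha> k (vec \<omega>) * hprod \<beta> l (vec \<omega>)" and ?v = "\<lambda>\<omega>. hprod \<alpha> k' (vec \<omega>) * hprod \<beta> l' (vec \<omega>)"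
  have i: "integrable M ?u" "integrable M ?v" "integrable M (\<lambda>\<omega>. ?u \<omega> * ?v \<omega>)"
    using integrable_hprod2 integrable_hprod4[of \<alpha> k \<beta> l \<alpha> k' \<beta> l'] by (auto simp: mult.assoc)
  have eq: "(?u \<omega> - H2 \<alpha> \<beta> k l) * (?v \<omega> - H2 \<alpha> \<beta> k' l') = ?u \<omega> * ?v \<omega> - H2 \<alpha> \<beta> k' l' * ?u \<omega> - H2 \<alpha> \<beta> k l * ?v \<omega> + H2 \<alpha> \<beta> k l * H2 \<alpha> \<beta> k' l'" for \<omega>
    by (simp add: algebra_simps)
  show "integrable M (\<lambda>\<omega>. (?u \<omega> - H2 \<alpha> \<beta> k l) * (?v \<omega> - H2 \<alpha> \<beta> k' l'))" unfolding eq using i by auto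
  have "expectation (\<lambda>\<omega>. ?u \<omega> * ?v \<omega> - H2 \<alpha> \<beta> k' l' * ?u \<omega> - H2 \<alpha> \<beta> k l * ?v \<omega> + H2 \<alpha> \<beta> k l * H2 \<alpha> \<beta> k' l') =
     expectation (\<lambda>\<omega>. ?u \<omega> * ?v \<omega>) - H2 \<alpha> \<beta> k' l' * expectation ?u - H2 \<alpha> \<beta> k l * expectation ?v + H2 \<alpha> \<beta> k l * H2 \<alpha> \<beta> k' l'"
    using i by (simp add: prob_space)
  moreover have "expectation ?u = H2 \<alpha> \<beta> k l" "expectation ?v = H2 \<alpha> \<beta> k' l'" by (simp_all add: H2_def)
  ultimately show "expectation (\<lambda>\<omega>. (?u \<omega> - H2 \<alpha> \<beta> k l) * (?v \<omega> - H2 \<alpha> \<beta> k' l')) = H4 \<alpha> \<beta> \<alpha> \<beta> k l k' l' - H2 \<alpha> \<beta> k l * H2 \<alpha> \<beta> k' l'"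
    unfolding eq by (simp add: H4_def mult.assoc)
qed

text \<open>The products have degree at least q - 1 only, as one variable of each has been
  contracted. The two coefficient covariances, bounded by \<rho>(l - k) and \<rho>(l' - k'), enter
  \<open>covariance_bound\<close> as the initial factor \<open>s\<close>, that is, as one edge 12
  and one edge 34 drawn in advance, and bring every degree back to q.\<close>

lemma pair_sum_variance:
  assumes d: "q \<le> Suc (msize \<alpha>)" "q \<le> Suc (msize \<beta>)"
  shows "integrable M (\<lambda>\<omega>. (pair_sum \<alpha> i \<beta> j n \<omega> - expectation (pair_sum \<alpha> i \<beta> j n))\<^sup>2)"
    "expectation (\<lambda>\<omega>. (pair_sum \<alpha> i \<beta> j n \<omega> - expectation (pair_sum \<alpha> i \<beta> j n))\<^sup>2) \<le>
     fact (msize \<alpha> + msize \<beta> + msize \<alpha> + msize \<beta>) *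
      quad_sum n (\<lambda>k l k' l'. cross_bound q (\<rho> (l - k)) (\<rho> (k' - k)) (\<rho> (l' - k)) (\<rho> (k' - l)) (\<rho> (l' - l)) (\<rho> (l' - k')))"
proof -
  let ?I = "{1..int n}"
  let ?m = "H2 \<alpha> \<beta>"
  let ?w = "\<lambda>k l \<omega>. hprod \<alpha> k (vec \<omega>) * hprod \<beta> l (vec \<omega>) - ?m k l"
  let ?F = "fact (msize \<alpha> + msize \<beta> + msize \<alpha> + msize \<beta>) :: real"
  have E: "expectation (pair_sum \<alpha> i \<beta> j n) = (\<Sum>k\<in>?I. \<Sum>l\<in>?I. c (k, i) (l, j) * ?m k l)"
    unfolding pair_sum_def[abs_def] H2_def
    by (subst Bochner_Integration.integral_sum, intro Bochner_Integration.integrable_sum integrable_mult_right integrable_hprod2,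
      intro sum.cong refl, subst Bochner_Integration.integral_sum, intro integrable_mult_right integrable_hprod2) simp
  have sq: "(pair_sum \<alpha> i \<beta> j n \<omega> - expectation (pair_sum \<alpha> i \<beta> j n))\<^sup>2 =
     (\<Sum>k\<in>?I. \<Sum>l\<in>?I. \<Sum>k'\<in>?I. \<Sum>l'\<in>?I. c (k, i) (l, j) * c (k', i) (l', j) * (?w k l \<omega> * ?w k' l' \<omega>))" for \<omega>
  proof -
    have "pair_sum \<alpha> i \<beta> j n \<omega> - expectation (pair_sum \<alpha> i \<beta> j n) = (\<Sum>k\<in>?I. \<Sum>l\<in>?I. c (k, i) (l, j) * ?w k l \<omega>)"
      unfolding E pair_sum_def sum_subtractf[symmetric] by (simp add: right_diff_distrib)
    then show ?thesis
      by (simp only: power2_eq_square sum_distrib_left sum_distrib_right) (intro sum.cong refl, simp only: mult_ac)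
  qed
  show "integrable M (\<lambda>\<omega>. (pair_sum \<alpha> i \<beta> j n \<omega> - expectation (pair_sum \<alpha> i \<beta> j n))\<^sup>2)"
    unfolding sq by (intro Bochner_Integration.integrable_sum integrable_mult_right pair_sum_covariance)
  have "expectation (\<lambda>\<omega>. (pair_sum \<alpha> i \<beta> j n \<omega> - expectation (pair_sum \<alpha> i \<beta> j n))\<^sup>2) =
    (\<Sum>k\<in>?I. \<Sum>l\<in>?I. \<Sum>k'\<in>?I. \<Sum>l'\<in>?I. c (k, i) (l, j) * c (k', i) (l', j) * expectation (\<lambda>\<omega>. ?w k l \<omega> * ?w k' l' \<omega>))"
    unfolding sq
    by (simp only: Bochner_Integration.integral_sum Bochner_Integration.integrable_sum integrable_mult_right pair_sum_covariance integral_mult_right_zero)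
  also have "\<dots> \<le> (\<Sum>k\<in>?I. \<Sum>l\<in>?I. \<Sum>k'\<in>?I. \<Sum>l'\<in>?I. ?F *
     cross_bound q (\<rho> (l - k)) (\<rho> (k' - k)) (\<rho> (l' - k)) (\<rho> (k' - l)) (\<rho> (l' - l)) (\<rho> (l' - k')))"
  proof (intro sum_mono)
    fix k l k' l'
    let ?B = "cross_bound q (\<rho> (l - k)) (\<rho> (k' - k)) (\<rho> (l' - k)) (\<rho> (k' - l)) (\<rho> (l' - l)) (\<rho> (l' - k'))"
    have B0: "0 \<le> ?B" unfolding cross_bound_def
      using rho0 by (intro add_nonneg_nonneg mult_nonneg_nonneg sum_nonneg) auto
    have in1: "\<rho> x \<in> {0..1}" for x using rho0 rho1 by auto
    have "(\<rho> (l - k) * \<rho> (l' - k')) * \<bar>H4 \<alpha> \<beta> \<alpha> \<beta> k l k' l' - ?m k l * ?m k' l'\<bar> \<le> ?F * ?B"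
    proof (rule covariance_bound[where r="\<lambda>k l. \<rho> (l - k)"])
      show "deg_bound (\<rho> (l - k) * \<rho> (l' - k')) ?B 1 (msize \<alpha>) (msize \<beta>) (msize \<alpha>) (msize \<beta>)
         (\<rho> (l - k)) (\<rho> (k' - k)) (\<rho> (l' - k)) (\<rho> (k' - l)) (\<rho> (l' - l)) (\<rho> (l' - k'))"
        by (rule deg_boundI, rule monomial_le_cross_bound[where ?d1.0="msize \<alpha>" and ?d2.0="msize \<beta>"]) (use d in1 in auto)
    qed (use rho0 B0 c_le rho_minus in auto)
    moreover have "\<bar>c (k, i) (l, j) * c (k', i) (l', j)\<bar> \<le> \<rho> (l - k) * \<rho> (l' - k')"
      unfolding abs_mult by (intro mult_mono c_le rho0) auto
    then have "\<bar>c (k, i) (l, j) * c (k', i) (l', j)\<bar> * \<bar>H4 \<alpha> \<beta> \<alpha> \<beta> k l k' l' - ?m k l * ?m k' l'\<bar> \<le>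
        (\<rho> (l - k) * \<rho> (l' - k')) * \<bar>H4 \<alpha> \<beta> \<alpha> \<beta> k l k' l' - ?m k l * ?m k' l'\<bar>"
      by (rule mult_right_mono) simp
    moreover have "c (k, i) (l, j) * c (k', i) (l', j) * expectation (\<lambda>\<omega>. ?w k l \<omega> * ?w k' l' \<omega>) \<le>
       \<bar>c (k, i) (l, j) * c (k', i) (l', j)\<bar> * \<bar>H4 \<alpha> \<beta> \<alpha> \<beta> k l k' l' - ?m k l * ?m k' l'\<bar>"
      unfolding pair_sum_covariance(2) abs_mult[symmetric] by (rule abs_ge_self)
    ultimately show "c (k, i) (l, j) * c (k', i) (l', j) * expectation (\<lambda>\<omega>. ?w k l \<omega> * ?w k' l' \<omega>) \<le> ?F * ?B"
      by linarith
  qed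
  finally show "expectation (\<lambda>\<omega>. (pair_sum \<alpha> i \<beta> j n \<omega> - expectation (pair_sum \<alpha> i \<beta> j n))\<^sup>2) \<le> ?F *
      quad_sum n (\<lambda>k l k' l'. cross_bound q (\<rho> (l - k)) (\<rho> (k' - k)) (\<rho> (l' - k)) (\<rho> (k' - l)) (\<rho> (l' - l)) (\<rho> (l' - k')))"
    unfolding quad_sum_def by (simp only: sum_distrib_left)
qed

lemma pair_sum_variance_tendsto:
  assumes d: "q \<le> Suc (msize \<alpha>)" "q \<le> Suc (msize \<beta>)"
  shows "(\<lambda>n. expectation (\<lambda>\<omega>. (pair_sum \<alpha> i \<beta> j n \<omega> - expectation (pair_sum \<alpha> i \<beta> j n))\<^sup>2) / (real n)\<^sup>2) \<longlonglongrightarrow> 0"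
proof (rule tendsto_sandwich[OF _ _ tendsto_const])
  let ?F = "fact (msize \<alpha> + msize \<beta> + msize \<alpha> + msize \<beta>) :: real"
  show "(\<lambda>n. ?F * (quad_sum n (\<lambda>k l k' l'. cross_bound q (\<rho> (l - k)) (\<rho> (k' - k)) (\<rho> (l' - k)) (\<rho> (k' - l)) (\<rho> (l' - l)) (\<rho> (l' - k')))
     / (real n)\<^sup>2)) \<longlonglongrightarrow> 0"
    by (rule tendsto_mult_right_zero[OF quad_sum_cross_bound_tendsto])
  show "\<forall>\<^sub>F n in sequentially. expectation (\<lambda>\<omega>. (pair_sum \<alpha> i \<beta> j n \<omega> - expectation (pair_sum \<alpha> i \<beta> j n))\<^sup>2) / (real n)\<^sup>2 \<le>
     ?F * (quad_sum n (\<lambda>k l k' l'. cross_bound q (\<rho> (l - k)) (\<rho> (k' - k)) (\<rho> (l' - k)) (\<rho> (k' - l)) (\<rho> (l' - l)) (\<rho> (l' - k'))) / (real n)\<^sup>2)"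
    unfolding times_divide_eq_right by (intro always_eventually allI divide_right_mono pair_sum_variance(2) d) simp
qed (auto intro!: always_eventually)

end

section \<open>The perturbed differential equation of the characteristic function\<close>

context breuer_major
begin

context
  fixes A :: "('d \<Rightarrow> nat) set" and a :: "('d \<Rightarrow> nat) \<Rightarrow> real"
  assumes A: "finite A" and rank: "\<And>\<alpha>. \<alpha> \<in> A \<Longrightarrow> q \<le> msize \<alpha>"
begin

text \<open>The coordinate contracted first in each product. Any coordinate with a positive exponent
  will do; one exists because the degree is at least q \<ge> 1.\<close>

definition lead :: "('d \<Rightarrow> nat) \<Rightarrow> 'd" where "lead \<alpha> = (SOME i. \<alpha> i > 0)"

lemma lead_pos: "\<alpha> \<in> A \<Longrightarrow> \<alpha> (lead \<alpha>) > 0"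
  unfolding lead_def using someI_ex[OF msize_pos[of \<alpha>]] rank[of \<alpha>] q1 by simp

definition sum_poly :: "nat \<Rightarrow> (int \<times> 'd \<Rightarrow> real) \<Rightarrow> real" where
  "sum_poly n y = (\<Sum>k\<in>{1..int n}. \<Sum>\<alpha>\<in>A. a \<alpha> / sqrt (real n) * hprod \<alpha> k y)"

definition sum_poly_deriv :: "nat \<Rightarrow> int \<times> 'd \<Rightarrow> (int \<times> 'd \<Rightarrow> real) \<Rightarrow> real" where
  "sum_poly_deriv n b y = (\<Sum>k\<in>{1..int n}. \<Sum>\<alpha>\<in>A. a \<alpha> / sqrt (real n) * dhprod \<alpha> k b y)"

text \<open>This is $\langle DF, -DL^{-1}F\rangle$ of the Malliavin calculus up to the choice of the
  contracted variable, and has the same role.\<close>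

definition gamma :: "nat \<Rightarrow> (int \<times> 'd \<Rightarrow> real) \<Rightarrow> real" where
  "gamma n y = (\<Sum>k\<in>{1..int n}. \<Sum>\<alpha>\<in>A. a \<alpha> / sqrt (real n) *
     (\<Sum>b\<in>{1..int n} \<times> UNIV. c (k, lead \<alpha>) b * (hprod (dec \<alpha> (lead \<alpha>)) k y * sum_poly_deriv n b y)))"

lemma pdiff_sum_poly: "pdiff ({1..int n} \<times> UNIV) (sum_poly n) (sum_poly_deriv n)"
proof (rule pdiff_cong)
  show "pdiff ({1..int n} \<times> UNIV) (\<lambda>y. \<Sum>k\<in>{1..int n}. \<Sum>\<alpha>\<in>A. a \<alpha> / sqrt (real n) * hprod \<alpha> k y)
    (\<lambda>b y. \<Sum>k\<in>{1..int n}. \<Sum>\<alpha>\<in>A. a \<alpha> / sqrt (real n) * dhprod \<alpha> k b y)"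
    by (intro pdiff_sum pdiff_cmult pdiff_hprod A) auto
qed (simp_all add: sum_poly_def sum_poly_deriv_def)

lemma pdiff_gamma_term:
  assumes "k \<in> {1..int n}"
  shows "\<exists>d. pdiff ({1..int n} \<times> UNIV) (\<lambda>y. hprod \<alpha> k y * sum_poly_deriv n b y) d"
proof -
  obtain d where "pdiff ({1..int n} \<times> UNIV) (sum_poly_deriv n b) d" using pdiff_deriv[OF pdiff_sum_poly] by blast
  from pdiff.mult[OF pdiff_hprod[OF assms] this] show ?thesis by blast
qed

text \<open>Wick's formula with the constant 1 as second factor: its derivative vanishes and only
  the derivative of the exponential contributes, with the factor iu.\<close>

lemma expectation_sum_poly_iexp:
  "expectation (\<lambda>\<omega>. complex_of_real (sum_poly n (vec \<omega>)) * iexp (u * sum_poly n (vec \<omega>))) =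
    \<i> * complex_of_real u * expectation (\<lambda>\<omega>. complex_of_real (gamma n (vec \<omega>)) * iexp (u * sum_poly n (vec \<omega>)))"
proof -
  let ?K = "{1..int n}"
  let ?e = "\<lambda>\<omega>. iexp (u * sum_poly n (vec \<omega>))"
  have J: "finite (?K \<times> (UNIV :: 'd set))" by simp
  note int = integrable_iexp[OF J _ pdiff_sum_poly]
  have ih: "integrable M (\<lambda>\<omega>. complex_of_real (hprod \<alpha> k (vec \<omega>)) * ?e \<omega>)" if "k \<in> ?K" for k \<alpha>
    by (rule int[OF pdiff_hprod[OF that]])
  have ig: "integrable M (\<lambda>\<omega>. complex_of_real (hprod \<alpha> k (vec \<omega>) * sum_poly_deriv n b (vec \<omega>)) * ?e \<omega>)" if k: "k \<in> ?K" for k \<alpha> b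
  proof -
    obtain d where "pdiff (?K \<times> UNIV) (\<lambda>y. hprod \<alpha> k y * sum_poly_deriv n b y) d" using pdiff_gamma_term[OF k] by blast
    from int[OF this] show ?thesis .
  qed
  have W: "expectation (\<lambda>\<omega>. complex_of_real (hprod \<alpha> k (vec \<omega>)) * ?e \<omega>) =
     (\<Sum>b\<in>?K \<times> UNIV. complex_of_real (c (k, lead \<alpha>) b) * (\<i> * complex_of_real u *
       expectation (\<lambda>\<omega>. complex_of_real (hprod (dec \<alpha> (lead \<alpha>)) k (vec \<omega>) * sum_poly_deriv n b (vec \<omega>)) * ?e \<omega>)))"
    if "k \<in> ?K" "\<alpha> \<in> A" for k \<alpha>
    using wick[where \<alpha>=\<alpha> and i="lead \<alpha>" and k=k and K="?K", OF _ that(1) lead_pos[OF that(2)] pdiff.const[of _ 1] pdiff_sum_poly, of u]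
    by simp
  have s1: "complex_of_real (sum_poly n (vec \<omega>)) * ?e \<omega> =
     (\<Sum>k\<in>?K. \<Sum>\<alpha>\<in>A. complex_of_real (a \<alpha> / sqrt (real n)) * (complex_of_real (hprod \<alpha> k (vec \<omega>)) * ?e \<omega>))" for \<omega>
    unfolding sum_poly_def by (simp add: sum_distrib_right mult.assoc)
  have "complex_of_real (x * (\<Sum>b\<in>B. C b * Z b)) * e = complex_of_real x * (\<Sum>b\<in>B. complex_of_real (C b) * (complex_of_real (Z b) * e))"
    for x :: real and B :: "(int \<times> 'd) set" and C Z e by (simp add: sum_distrib_left sum_distrib_right mult.assoc)
  then have s2: "complex_of_real (gamma n (vec \<omega>)) * ?e \<omega> = (\<Sum>k\<in>?K. \<Sum>\<alpha>\<in>A. complex_of_real (a \<alpha> / sqrt (real n)) *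
     (\<Sum>b\<in>?K \<times> UNIV. complex_of_real (c (k, lead \<alpha>) b) *
       (complex_of_real (hprod (dec \<alpha> (lead \<alpha>)) k (vec \<omega>) * sum_poly_deriv n b (vec \<omega>)) * ?e \<omega>)))" for \<omega>
    unfolding gamma_def of_real_sum sum_distrib_right by (simp only:)
  have "expectation (\<lambda>\<omega>. complex_of_real (sum_poly n (vec \<omega>)) * ?e \<omega>) =
     (\<Sum>k\<in>?K. \<Sum>\<alpha>\<in>A. complex_of_real (a \<alpha> / sqrt (real n)) * expectation (\<lambda>\<omega>. complex_of_real (hprod \<alpha> k (vec \<omega>)) * ?e \<omega>))"
    unfolding s1
    by (subst Bochner_Integration.integral_sum, intro Bochner_Integration.integrable_sum integrable_mult_right ih, assumption,
      rule sum.cong[OF refl], subst Bochner_Integration.integral_sum, intro integrable_mult_right ih, assumption)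
      (simp only: integral_mult_right_zero)
  also have "\<dots> = (\<Sum>k\<in>?K. \<Sum>\<alpha>\<in>A. complex_of_real (a \<alpha> / sqrt (real n)) *
     (\<Sum>b\<in>?K \<times> UNIV. complex_of_real (c (k, lead \<alpha>) b) * (\<i> * complex_of_real u *
       expectation (\<lambda>\<omega>. complex_of_real (hprod (dec \<alpha> (lead \<alpha>)) k (vec \<omega>) * sum_poly_deriv n b (vec \<omega>)) * ?e \<omega>))))"
    by (intro sum.cong refl) (simp only: W)
  also have "\<dots> = \<i> * complex_of_real u * (\<Sum>k\<in>?K. \<Sum>\<alpha>\<in>A. complex_of_real (a \<alpha> / sqrt (real n)) *
     (\<Sum>b\<in>?K \<times> UNIV. complex_of_real (c (k, lead \<alpha>) b) *
       expectation (\<lambda>\<omega>. complex_of_real (hprod (dec \<alpha> (lead \<alpha>)) k (vec \<omega>) * sum_poly_deriv n b (vec \<omega>)) * ?e \<omega>)))"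
    unfolding sum_distrib_left by (intro sum.cong refl) (simp only: mult_ac)
  also have "(\<Sum>k\<in>?K. \<Sum>\<alpha>\<in>A. complex_of_real (a \<alpha> / sqrt (real n)) *
     (\<Sum>b\<in>?K \<times> UNIV. complex_of_real (c (k, lead \<alpha>) b) *
       expectation (\<lambda>\<omega>. complex_of_real (hprod (dec \<alpha> (lead \<alpha>)) k (vec \<omega>) * sum_poly_deriv n b (vec \<omega>)) * ?e \<omega>)))
     = expectation (\<lambda>\<omega>. complex_of_real (gamma n (vec \<omega>)) * ?e \<omega>)"
    unfolding s2
    by (subst Bochner_Integration.integral_sum, intro Bochner_Integration.integrable_sum integrable_mult_right ig, assumption,
      rule sum.cong[OF refl], subst Bochner_Integration.integral_sum, intro Bochner_Integration.integrable_sum integrable_mult_right ig, assumption,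
      rule sum.cong[OF refl], subst integral_mult_right_zero, subst Bochner_Integration.integral_sum, intro integrable_mult_right ig, assumption)
      (simp only: integral_mult_right_zero)
  finally show ?thesis .
qed

lemma gamma_integrable: "integrable M (\<lambda>\<omega>. gamma n (vec \<omega>))"
proof -
  have "integrable M (\<lambda>\<omega>. hprod \<alpha> k (vec \<omega>) * sum_poly_deriv n b (vec \<omega>))" if k: "k \<in> {1..int n}" for k \<alpha> b
  proof -
    obtain d where "pdiff ({1..int n} \<times> UNIV) (\<lambda>y. hprod \<alpha> k y * sum_poly_deriv n b y) d" using pdiff_gamma_term[OF k] by blast
    from integrable_pdiff[OF _ this] show ?thesis by simp
  qed
  then show ?thesis unfolding gamma_def by (intro Bochner_Integration.integrable_sum integrable_mult_right)
qed

text \<open>The same contraction with the sum itself in place of the exponential. It identifies the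
  mean of \<open>gamma\<close> with the variance, the coefficient that the Gaussian differential
  equation needs.\<close>

lemma expectation_sum_poly_square:
  "expectation (\<lambda>\<omega>. (sum_poly n (vec \<omega>))\<^sup>2) = expectation (\<lambda>\<omega>. gamma n (vec \<omega>))"
proof -
  let ?K = "{1..int n}"
  have J: "finite (?K \<times> (UNIV :: 'd set))" by simp
  have ih: "integrable M (\<lambda>\<omega>. hprod \<alpha> k (vec \<omega>) * sum_poly n (vec \<omega>))" if "k \<in> ?K" for k \<alpha>
    by (rule integrable_pdiff[OF J pdiff.mult[OF pdiff_hprod[OF that] pdiff_sum_poly]])
  have ig: "integrable M (\<lambda>\<omega>. hprod \<alpha> k (vec \<omega>) * sum_poly_deriv n b (vec \<omega>))" if k: "k \<in> ?K" for k \<alpha> b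
  proof -
    obtain d where "pdiff (?K \<times> UNIV) (\<lambda>y. hprod \<alpha> k y * sum_poly_deriv n b y) d" using pdiff_gamma_term[OF k] by blast
    from integrable_pdiff[OF J this] show ?thesis .
  qed
  have s1: "(sum_poly n (vec \<omega>))\<^sup>2 = (\<Sum>k\<in>?K. \<Sum>\<alpha>\<in>A. a \<alpha> / sqrt (real n) * (hprod \<alpha> k (vec \<omega>) * sum_poly n (vec \<omega>)))" for \<omega>
    unfolding power2_eq_square by (subst (1) sum_poly_def) (simp add: sum_distrib_right mult.assoc)
  have "expectation (\<lambda>\<omega>. (sum_poly n (vec \<omega>))\<^sup>2) =
     (\<Sum>k\<in>?K. \<Sum>\<alpha>\<in>A. a \<alpha> / sqrt (real n) * expectation (\<lambda>\<omega>. hprod \<alpha> k (vec \<omega>) * sum_poly n (vec \<omega>)))"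
    unfolding s1
    by (subst Bochner_Integration.integral_sum, intro Bochner_Integration.integrable_sum integrable_mult_right ih, assumption,
      rule sum.cong[OF refl], subst Bochner_Integration.integral_sum, intro integrable_mult_right ih, assumption)
      (simp only: integral_mult_right_zero)
  also have "\<dots> = (\<Sum>k\<in>?K. \<Sum>\<alpha>\<in>A. a \<alpha> / sqrt (real n) * (\<Sum>b\<in>?K \<times> UNIV. c (k, lead \<alpha>) b *
       expectation (\<lambda>\<omega>. hprod (dec \<alpha> (lead \<alpha>)) k (vec \<omega>) * sum_poly_deriv n b (vec \<omega>))))"
  proof (rule sum.cong[OF refl], rule sum.cong[OF refl])
    fix k \<alpha> assume k: "k \<in> ?K" and \<alpha>: "\<alpha> \<in> A"
    show "a \<alpha> / sqrt (real n) * expectation (\<lambda>\<omega>. hprod \<alpha> k (vec \<omega>) * sum_poly n (vec \<omega>)) =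
       a \<alpha> / sqrt (real n) * (\<Sum>b\<in>?K \<times> UNIV. c (k, lead \<alpha>) b *
       expectation (\<lambda>\<omega>. hprod (dec \<alpha> (lead \<alpha>)) k (vec \<omega>) * sum_poly_deriv n b (vec \<omega>)))"
      by (subst wick_real[where \<alpha>=\<alpha> and i="lead \<alpha>" and K="?K", OF _ k lead_pos[OF \<alpha>] pdiff_sum_poly]) simp_all
  qed
  also have "\<dots> = expectation (\<lambda>\<omega>. gamma n (vec \<omega>))"
    unfolding gamma_def
    by (subst Bochner_Integration.integral_sum, intro Bochner_Integration.integrable_sum integrable_mult_right ig, assumption,
      rule sum.cong[OF refl], subst Bochner_Integration.integral_sum, intro Bochner_Integration.integrable_sum integrable_mult_right ig, assumption,
      rule sum.cong[OF refl], subst integral_mult_right_zero, subst Bochner_Integration.integral_sum, intro integrable_mult_right ig, assumption)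
      (simp only: integral_mult_right_zero)
  finally show ?thesis .
qed

text \<open>The number of terms on the right does not depend on n, so it will suffice to control
  each normalized pair sum separately.\<close>

lemma gamma_eq_pair_sums:
  "gamma n (vec \<omega>) = (\<Sum>(\<alpha>, \<beta>, j)\<in>A \<times> A \<times> UNIV. (a \<alpha> * a \<beta> * real (\<beta> j)) *
     (pair_sum (dec \<alpha> (lead \<alpha>)) (lead \<alpha>) (dec \<beta> j) j n \<omega> / real n))"
proof -
  let ?K = "{1..int n}"
  let ?h = "\<lambda>\<alpha> k. hprod (dec \<alpha> (lead \<alpha>)) k (vec \<omega>)"
  let ?s = "sqrt (real n)"
  have inner: "(\<Sum>b\<in>?K \<times> UNIV. c (k, lead \<alpha>) b * (?h \<alpha> k * sum_poly_deriv n b (vec \<omega>))) =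
     (\<Sum>l\<in>?K. \<Sum>\<beta>\<in>A. \<Sum>j\<in>UNIV. a \<beta> / ?s * real (\<beta> j) * (c (k, lead \<alpha>) (l, j) * (?h \<alpha> k * hprod (dec \<beta> j) l (vec \<omega>))))" for k \<alpha>
  proof -
    have "(\<Sum>b\<in>?K \<times> UNIV. c (k, lead \<alpha>) b * (?h \<alpha> k * sum_poly_deriv n b (vec \<omega>))) =
      (\<Sum>b\<in>?K \<times> UNIV. \<Sum>l\<in>?K. \<Sum>\<beta>\<in>A. c (k, lead \<alpha>) b * (of_bool (fst b = l) *
         (a \<beta> / ?s * real (\<beta> (snd b)) * (?h \<alpha> k * hprod (dec \<beta> (snd b)) l (vec \<omega>)))))"
      unfolding sum_poly_deriv_def dhprod_def sum_distrib_left by (intro sum.cong refl) (simp only: mult_ac)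
    also have "\<dots> = (\<Sum>l\<in>?K. \<Sum>\<beta>\<in>A. \<Sum>b\<in>?K \<times> UNIV. c (k, lead \<alpha>) b * (of_bool (fst b = l) *
         (a \<beta> / ?s * real (\<beta> (snd b)) * (?h \<alpha> k * hprod (dec \<beta> (snd b)) l (vec \<omega>)))))"
      by (subst sum.swap, rule sum.cong[OF refl], rule sum.swap)
    also have "\<dots> = (\<Sum>l\<in>?K. \<Sum>\<beta>\<in>A. \<Sum>j\<in>UNIV. c (k, lead \<alpha>) (l, j) *
         (a \<beta> / ?s * real (\<beta> j) * (?h \<alpha> k * hprod (dec \<beta> j) l (vec \<omega>))))"
      by (rule sum.cong[OF refl], rule sum.cong[OF refl], rule sum_times_slice) auto
    finally show ?thesis by (simp only: mult_ac)
  qed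
  have "gamma n (vec \<omega>) = (\<Sum>k\<in>?K. \<Sum>\<alpha>\<in>A. \<Sum>l\<in>?K. \<Sum>\<beta>\<in>A. \<Sum>j\<in>UNIV.
      (a \<alpha> * a \<beta> * real (\<beta> j)) * (c (k, lead \<alpha>) (l, j) * (?h \<alpha> k * hprod (dec \<beta> j) l (vec \<omega>)) / real n))"
    unfolding gamma_def inner sum_distrib_left
  proof (intro sum.cong refl)
    fix k \<alpha> l \<beta> j
    \<comment> \<open>For n = 0 both sides vanish because division by 0 yields 0.\<close>
    have s: "x / ?s * (y / ?s * z * w) = (x * y * z) * (w / real n)" for x y z w
    proof (cases "n = 0")
      case False
      have "x / ?s * (y / ?s * z * w) = x * y * z * w / (?s * ?s)" by simp
      then show ?thesis by simp
    qed simp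
    show "a \<alpha> / ?s * (a \<beta> / ?s * real (\<beta> j) * (c (k, lead \<alpha>) (l, j) * (?h \<alpha> k * hprod (dec \<beta> j) l (vec \<omega>)))) =
      (a \<alpha> * a \<beta> * real (\<beta> j)) * (c (k, lead \<alpha>) (l, j) * (?h \<alpha> k * hprod (dec \<beta> j) l (vec \<omega>)) / real n)"
      by (rule s)
  qed
  also have "\<dots> = (\<Sum>\<alpha>\<in>A. \<Sum>\<beta>\<in>A. \<Sum>j\<in>UNIV. \<Sum>k\<in>?K. \<Sum>l\<in>?K.
      (a \<alpha> * a \<beta> * real (\<beta> j)) * (c (k, lead \<alpha>) (l, j) * (?h \<alpha> k * hprod (dec \<beta> j) l (vec \<omega>)) / real n))"
    (is "(\<Sum>k\<in>?K. \<Sum>\<alpha>\<in>A. \<Sum>l\<in>?K. \<Sum>\<beta>\<in>A. \<Sum>j\<in>UNIV. ?T k \<alpha> l \<beta> j) = _")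
  proof -
    have "(\<Sum>k\<in>?K. \<Sum>\<alpha>\<in>A. \<Sum>l\<in>?K. \<Sum>\<beta>\<in>A. \<Sum>j\<in>UNIV. ?T k \<alpha> l \<beta> j) = (\<Sum>\<alpha>\<in>A. \<Sum>k\<in>?K. \<Sum>l\<in>?K. \<Sum>\<beta>\<in>A. \<Sum>j\<in>UNIV. ?T k \<alpha> l \<beta> j)"
      by (rule sum.swap)
    also have "\<dots> = (\<Sum>\<alpha>\<in>A. \<Sum>k\<in>?K. \<Sum>\<beta>\<in>A. \<Sum>l\<in>?K. \<Sum>j\<in>UNIV. ?T k \<alpha> l \<beta> j)"
      by (rule sum.cong[OF refl], rule sum.cong[OF refl], rule sum.swap)
    also have "\<dots> = (\<Sum>\<alpha>\<in>A. \<Sum>\<beta>\<in>A. \<Sum>k\<in>?K. \<Sum>l\<in>?K. \<Sum>j\<in>UNIV. ?T k \<alpha> l \<beta> j)"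
      by (rule sum.cong[OF refl], rule sum.swap)
    also have "\<dots> = (\<Sum>\<alpha>\<in>A. \<Sum>\<beta>\<in>A. \<Sum>k\<in>?K. \<Sum>j\<in>UNIV. \<Sum>l\<in>?K. ?T k \<alpha> l \<beta> j)"
      by (rule sum.cong[OF refl], rule sum.cong[OF refl], rule sum.cong[OF refl], rule sum.swap)
    also have "\<dots> = (\<Sum>\<alpha>\<in>A. \<Sum>\<beta>\<in>A. \<Sum>j\<in>UNIV. \<Sum>k\<in>?K. \<Sum>l\<in>?K. ?T k \<alpha> l \<beta> j)"
      by (rule sum.cong[OF refl], rule sum.cong[OF refl], rule sum.swap)
    finally show ?thesis .
  qed
  also have "\<dots> = (\<Sum>\<alpha>\<in>A. \<Sum>\<beta>\<in>A. \<Sum>j\<in>UNIV. (a \<alpha> * a \<beta> * real (\<beta> j)) *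
     (pair_sum (dec \<alpha> (lead \<alpha>)) (lead \<alpha>) (dec \<beta> j) j n \<omega> / real n))"
    unfolding pair_sum_def sum_distrib_left[symmetric] sum_divide_distrib[symmetric] ..
  finally show ?thesis by (simp only: sum.cartesian_product case_prod_unfold fst_conv snd_conv)
qed

lemma gamma_variance:
  "integrable M (\<lambda>\<omega>. (gamma n (vec \<omega>) - expectation (\<lambda>\<omega>. gamma n (vec \<omega>)))\<^sup>2)"
  "(\<lambda>n. expectation (\<lambda>\<omega>. (gamma n (vec \<omega>) - expectation (\<lambda>\<omega>. gamma n (vec \<omega>)))\<^sup>2)) \<longlonglongrightarrow> 0"
proof -
  \<comment> \<open>Terms with a zero exponent have coefficient 0; discarding them ensures that
    \<open>dec\<close> lowers the degree by exactly one, as the degree condition of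
    \<open>pair_sum_variance\<close> requires.\<close>
  let ?I = "{x \<in> A \<times> A \<times> UNIV. fst (snd x) (snd (snd x)) > 0} :: (('d \<Rightarrow> nat) \<times> ('d \<Rightarrow> nat) \<times> 'd) set"
  have I: "finite ?I" using A by auto
  define w where "w x = (case x of (\<alpha>, \<beta>, j) \<Rightarrow> a \<alpha> * a \<beta> * real (\<beta> j))" for x :: "('d \<Rightarrow> nat) \<times> ('d \<Rightarrow> nat) \<times> 'd"
  define T where "T x n = (case x of (\<alpha>, \<beta>, j) \<Rightarrow> pair_sum (dec \<alpha> (lead \<alpha>)) (lead \<alpha>) (dec \<beta> j) j n)" for x :: "('d \<Rightarrow> nat) \<times> ('d \<Rightarrow> nat) \<times> 'd" and n
  have g: "gamma n (vec \<omega>) = (\<Sum>x\<in>?I. w x * (T x n \<omega> / real n))" for n \<omega>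
    unfolding gamma_eq_pair_sums w_def T_def case_prod_unfold
    by (rule sum.mono_neutral_right) (use A in auto)
  have iT: "integrable M (T x n)" for x n unfolding T_def by (simp add: case_prod_unfold integrable_pair_sum)
  define V where "V x n \<omega> = T x n \<omega> - expectation (T x n)" for x n \<omega>
  have d: "integrable M (\<lambda>\<omega>. (V x n \<omega>)\<^sup>2)" "(\<lambda>n. expectation (\<lambda>\<omega>. (V x n \<omega>)\<^sup>2) / (real n)\<^sup>2) \<longlonglongrightarrow> 0" if x: "x \<in> ?I" for x n
  proof -
    obtain \<alpha> \<beta> j where x': "x = (\<alpha>, \<beta>, j)" by (cases x)
    with x have \<alpha>: "\<alpha> \<in> A" and \<beta>: "\<beta> \<in> A" "\<beta> j > 0" by auto
    have deg: "q \<le> Suc (msize (dec \<alpha> (lead \<alpha>)))" "q \<le> Suc (msize (dec \<beta> j))"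
      using rank[OF \<alpha>] rank[OF \<beta>(1)] msize_dec[of \<alpha> "lead \<alpha>", OF lead_pos[OF \<alpha>]] msize_dec[of \<beta> j, OF \<beta>(2)] by auto
    show "integrable M (\<lambda>\<omega>. (V x n \<omega>)\<^sup>2)" unfolding V_def T_def x' using pair_sum_variance(1)[OF deg] by simp
    show "(\<lambda>n. expectation (\<lambda>\<omega>. (V x n \<omega>)\<^sup>2) / (real n)\<^sup>2) \<longlonglongrightarrow> 0"
      unfolding V_def T_def x' using pair_sum_variance_tendsto[OF deg] by simp
  qed
  have [measurable]: "V x n \<in> borel_measurable M" for x n unfolding V_def[abs_def] using iT by auto
  have E: "expectation (\<lambda>\<omega>. gamma n (vec \<omega>)) = (\<Sum>x\<in>?I. w x * (expectation (T x n) / real n))" for n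
    unfolding g by (subst Bochner_Integration.integral_sum) (auto intro!: iT)
  have diff: "gamma n (vec \<omega>) - expectation (\<lambda>\<omega>. gamma n (vec \<omega>)) = (\<Sum>x\<in>?I. w x * V x n \<omega> / real n)" for n \<omega>
    unfolding E unfolding g V_def sum_subtractf[symmetric] by (intro sum.cong refl) (simp add: right_diff_distrib diff_divide_distrib)
  have pt: "(gamma n (vec \<omega>) - expectation (\<lambda>\<omega>. gamma n (vec \<omega>)))\<^sup>2 \<le>
      (\<Sum>x\<in>?I. (w x)\<^sup>2 * ((V x n \<omega>)\<^sup>2 / (real n)\<^sup>2)) * real (card ?I)" for n \<omega>
    unfolding diff using sum_squared_le_sum_of_squares[of "\<lambda>x. w x * V x n \<omega> / real n" ?I]
    by (simp add: power_mult_distrib power_divide)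
  have iB: "integrable M (\<lambda>\<omega>. (\<Sum>x\<in>?I. (w x)\<^sup>2 * ((V x n \<omega>)\<^sup>2 / (real n)\<^sup>2)) * real (card ?I))" for n
    using d(1) by (intro integrable_mult_left Bochner_Integration.integrable_sum integrable_mult_right integrable_divide) auto
  show i: "integrable M (\<lambda>\<omega>. (gamma n (vec \<omega>) - expectation (\<lambda>\<omega>. gamma n (vec \<omega>)))\<^sup>2)" for n
  proof (rule Bochner_Integration.integrable_bound[OF iB[of n]])
    show "(\<lambda>\<omega>. (gamma n (vec \<omega>) - expectation (\<lambda>\<omega>. gamma n (vec \<omega>)))\<^sup>2) \<in> borel_measurable M"
      using gamma_integrable[of n] by auto
    show "AE \<omega> in M. norm ((gamma n (vec \<omega>) - expectation (\<lambda>\<omega>. gamma n (vec \<omega>)))\<^sup>2) \<le>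
       norm ((\<Sum>x\<in>?I. (w x)\<^sup>2 * ((V x n \<omega>)\<^sup>2 / (real n)\<^sup>2)) * real (card ?I))"
      unfolding real_norm_def abs_power2 by (intro AE_I2 order_trans[OF pt abs_ge_self])
  qed
  show "(\<lambda>n. expectation (\<lambda>\<omega>. (gamma n (vec \<omega>) - expectation (\<lambda>\<omega>. gamma n (vec \<omega>)))\<^sup>2)) \<longlonglongrightarrow> 0"
  proof (rule tendsto_sandwich[OF _ _ tendsto_const])
    have "(\<lambda>n. (\<Sum>x\<in>?I. (w x)\<^sup>2 * (expectation (\<lambda>\<omega>. (V x n \<omega>)\<^sup>2) / (real n)\<^sup>2)) * real (card ?I)) \<longlonglongrightarrow> (\<Sum>x\<in>?I. (w x)\<^sup>2 * 0) * real (card ?I)"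
      by (rule tendsto_mult[OF tendsto_sum tendsto_const], rule tendsto_mult[OF tendsto_const d(2)])
    then show "(\<lambda>n. (\<Sum>x\<in>?I. (w x)\<^sup>2 * (expectation (\<lambda>\<omega>. (V x n \<omega>)\<^sup>2) / (real n)\<^sup>2)) * real (card ?I)) \<longlonglongrightarrow> 0" by simp
    have "expectation (\<lambda>\<omega>. (gamma n (vec \<omega>) - expectation (\<lambda>\<omega>. gamma n (vec \<omega>)))\<^sup>2) \<le>
       expectation (\<lambda>\<omega>. (\<Sum>x\<in>?I. (w x)\<^sup>2 * ((V x n \<omega>)\<^sup>2 / (real n)\<^sup>2)) * real (card ?I))" for n
      by (rule integral_mono[OF i iB pt])
    moreover have "expectation (\<lambda>\<omega>. (\<Sum>x\<in>?I. (w x)\<^sup>2 * ((V x n \<omega>)\<^sup>2 / (real n)\<^sup>2)) * real (card ?I)) =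
      (\<Sum>x\<in>?I. (w x)\<^sup>2 * (expectation (\<lambda>\<omega>. (V x n \<omega>)\<^sup>2) / (real n)\<^sup>2)) * real (card ?I)" for n
      unfolding integral_mult_left_zero using d(1) by (subst Bochner_Integration.integral_sum) auto
    ultimately show "\<forall>\<^sub>F n in sequentially. expectation (\<lambda>\<omega>. (gamma n (vec \<omega>) - expectation (\<lambda>\<omega>. gamma n (vec \<omega>)))\<^sup>2) \<le>
      (\<Sum>x\<in>?I. (w x)\<^sup>2 * (expectation (\<lambda>\<omega>. (V x n \<omega>)\<^sup>2) / (real n)\<^sup>2)) * real (card ?I)" by (intro always_eventually allI) (simp only:)
  qed (auto intro!: always_eventually)
qed

text \<open>The characteristic function satisfies \<phi>' = -u (v \<phi> + R) with |R| \<le>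
  \<delta>. The integrating factor e^{u^2 v / 2} leaves \<psi>' = -u e^{u^2 v / 2} R, and undoing it
  at t cancels the exponential growth, so the bound does not depend on the variance.\<close>

lemma char_sum_poly_close:
  fixes t :: real and n :: nat
  defines "v \<equiv> expectation (\<lambda>\<omega>. (sum_poly n (vec \<omega>))\<^sup>2)"
    and "\<delta> \<equiv> sqrt (expectation (\<lambda>\<omega>. (gamma n (vec \<omega>) - expectation (\<lambda>\<omega>. gamma n (vec \<omega>)))\<^sup>2))"
  shows "norm (expectation (\<lambda>\<omega>. iexp (t * sum_poly n (vec \<omega>))) - complex_of_real (exp (- (t\<^sup>2 * v) / 2))) \<le> t\<^sup>2 * \<delta>"
proof -
  let ?F = "\<lambda>\<omega>. sum_poly n (vec \<omega>)" and ?G = "\<lambda>\<omega>. gamma n (vec \<omega>)"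
  have J: "finite ({1..int n} \<times> (UNIV :: 'd set))" by simp
  have Fm[measurable]: "?F \<in> borel_measurable M" by (rule pdiff_vec_measurable[OF pdiff_sum_poly])
  have Gm[measurable]: "?G \<in> borel_measurable M" using gamma_integrable by auto
  have iF2: "integrable M (\<lambda>\<omega>. (?F \<omega>)\<^sup>2)"
    using integrable_pdiff[OF J pdiff.mult[OF pdiff_sum_poly pdiff_sum_poly]] by (simp add: power2_eq_square)
  have v: "v = expectation ?G" unfolding v_def by (rule expectation_sum_poly_square)
  have v0: "v \<ge> 0" unfolding v_def by simp
  have \<delta>0: "\<delta> \<ge> 0" unfolding \<delta>_def by simp
  define \<phi> where "\<phi> u = expectation (\<lambda>\<omega>. iexp (u * ?F \<omega>))" for u
  define R where "R u = expectation (\<lambda>\<omega>. complex_of_real (?G \<omega> - v) * iexp (u * ?F \<omega>))" for u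
  have e1: "integrable M (\<lambda>\<omega>. iexp (u * ?F \<omega>))" for u by (rule integrable_const_bound[of _ 1]) auto
  have iG: "integrable M (\<lambda>\<omega>. complex_of_real (?G \<omega>) * iexp (u * ?F \<omega>))" for u
    by (rule Bochner_Integration.integrable_bound[OF gamma_integrable[of n]]) (auto simp: norm_mult)
  have R: "expectation (\<lambda>\<omega>. complex_of_real (?G \<omega>) * iexp (u * ?F \<omega>)) = complex_of_real v * \<phi> u + R u" for u
    unfolding R_def \<phi>_def of_real_diff left_diff_distrib using iG[of u] e1[of u]
    by (subst Bochner_Integration.integral_diff) auto
  have Rb: "norm (R u) \<le> \<delta>" for u
  proof -
    have "norm (R u) \<le> expectation (\<lambda>\<omega>. norm (complex_of_real (?G \<omega> - v) * iexp (u * ?F \<omega>)))"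
      unfolding R_def by (rule integral_norm_bound)
    also have "\<dots> = expectation (\<lambda>\<omega>. \<bar>?G \<omega> - v\<bar>)" unfolding norm_mult norm_exp_i_times norm_of_real by simp
    also have "\<dots> \<le> \<delta>" unfolding \<delta>_def v by (rule abs_expectation_le_sqrt) (use gamma_variance(1) in auto)
    finally show ?thesis .
  qed
  have "((\<lambda>h. expectation (\<lambda>\<omega>. iexp (0 + h * ?F \<omega>))) has_vector_derivative
      expectation (\<lambda>\<omega>. \<i> * complex_of_real (?F \<omega>) * iexp (0 + u * ?F \<omega>))) (at u)" for u
    by (rule has_vector_derivative_expectation_iexp) (use iF2 in auto)
  moreover have "expectation (\<lambda>\<omega>. \<i> * complex_of_real (?F \<omega>) * iexp (0 + u * ?F \<omega>)) = - (complex_of_real u * (complex_of_real v * \<phi> u + R u))" for u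
  proof -
    have "expectation (\<lambda>\<omega>. \<i> * complex_of_real (?F \<omega>) * iexp (0 + u * ?F \<omega>)) = \<i> * expectation (\<lambda>\<omega>. complex_of_real (?F \<omega>) * iexp (u * ?F \<omega>))"
      by (simp only: mult.assoc integral_mult_right_zero add_0_left)
    also have "\<dots> = \<i> * (\<i> * complex_of_real u * (complex_of_real v * \<phi> u + R u))"
      unfolding expectation_sum_poly_iexp R ..
    finally show ?thesis by (simp add: mult.assoc[symmetric])
  qed
  ultimately have d\<phi>: "(\<phi> has_vector_derivative - (complex_of_real u * (complex_of_real v * \<phi> u + R u))) (at u)" for u
    unfolding \<phi>_def by (simp only: add_0_left)
  define \<psi> where "\<psi> u = complex_of_real (exp (u\<^sup>2 * v / 2)) * \<phi> u" for u
  have d\<psi>: "(\<psi> has_vector_derivative - (complex_of_real (u * exp (u\<^sup>2 * v / 2)) * R u)) (at u)" for u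
  proof -
    have "((\<lambda>u. exp (u\<^sup>2 * v / 2)) has_real_derivative u * v * exp (u\<^sup>2 * v / 2)) (at u)"
      by (auto intro!: derivative_eq_intros)
    then have "((\<lambda>u. complex_of_real (exp (u\<^sup>2 * v / 2))) has_vector_derivative complex_of_real (u * v * exp (u\<^sup>2 * v / 2))) (at u)"
      by (intro has_vector_derivative_of_real) (simp add: has_real_derivative_iff_has_vector_derivative)
    from has_vector_derivative_mult[OF this d\<phi>[of u]] show ?thesis unfolding \<psi>_def
      by (rule has_vector_derivative_eq_rhs) (simp add: algebra_simps)
  qed
  \<comment> \<open>The linearization at 0 is used because the derivative of \<psi> vanishes there,
    so it is the plain mean value inequality.\<close>
  have "norm (\<psi> t - \<psi> 0 - (t - 0) *\<^sub>R (- (complex_of_real (0 * exp (0\<^sup>2 * v / 2)) * R 0))) \<le> norm (t - 0) * (\<bar>t\<bar> * exp (t\<^sup>2 * v / 2) * \<delta>)"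
  proof (rule vector_differentiable_bound_linearization[where S="closed_segment 0 t"])
    fix u assume u: "u \<in> closed_segment 0 t"
    show "(\<psi> has_vector_derivative - (complex_of_real (u * exp (u\<^sup>2 * v / 2)) * R u)) (at u within closed_segment 0 t)"
      using d\<psi> by (rule has_vector_derivative_at_within)
    have ut: "\<bar>u\<bar> \<le> \<bar>t\<bar>" using u by (auto simp: closed_segment_eq_real_ivl split: if_splits)
    then have "u\<^sup>2 \<le> t\<^sup>2" by (simp add: abs_le_square_iff)
    then have "exp (u\<^sup>2 * v / 2) \<le> exp (t\<^sup>2 * v / 2)" using v0 by (simp add: mult_right_mono)
    with ut have "\<bar>u\<bar> * exp (u\<^sup>2 * v / 2) * norm (R u) \<le> \<bar>t\<bar> * exp (t\<^sup>2 * v / 2) * \<delta>"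
      by (intro mult_mono Rb) auto
    then show "norm (- (complex_of_real (u * exp (u\<^sup>2 * v / 2)) * R u) - - (complex_of_real (0 * exp (0\<^sup>2 * v / 2)) * R 0)) \<le> \<bar>t\<bar> * exp (t\<^sup>2 * v / 2) * \<delta>"
      by (simp add: norm_mult abs_mult)
  qed auto
  moreover have "\<psi> 0 = 1" by (simp add: \<psi>_def \<phi>_def prob_space)
  ultimately have "norm (\<psi> t - 1) \<le> t\<^sup>2 * \<delta> * exp (t\<^sup>2 * v / 2)"
    by (simp add: power2_eq_square mult_ac)
  moreover have "norm (\<phi> t - complex_of_real (exp (- (t\<^sup>2 * v) / 2))) = exp (- (t\<^sup>2 * v) / 2) * norm (\<psi> t - 1)"
  proof -
    have "complex_of_real (exp (- (t\<^sup>2 * v) / 2)) * complex_of_real (exp (t\<^sup>2 * v / 2)) = 1"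
      unfolding of_real_mult[symmetric] exp_add[symmetric] by simp
    then have "\<phi> t - complex_of_real (exp (- (t\<^sup>2 * v) / 2)) = complex_of_real (exp (- (t\<^sup>2 * v) / 2)) * (\<psi> t - 1)"
      by (simp only: \<psi>_def right_diff_distrib mult.assoc[symmetric] mult_1_left mult_1_right)
    then show ?thesis by (simp only: norm_mult norm_of_real abs_exp_cancel)
  qed
  ultimately have "norm (\<phi> t - complex_of_real (exp (- (t\<^sup>2 * v) / 2))) \<le> exp (- (t\<^sup>2 * v) / 2) * (t\<^sup>2 * \<delta> * exp (t\<^sup>2 * v / 2))"
    by (simp add: mult_left_mono)
  also have "\<dots> = t\<^sup>2 * \<delta> * (exp (- (t\<^sup>2 * v) / 2) * exp (t\<^sup>2 * v / 2))" by (simp only: mult_ac)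
  also have "exp (- (t\<^sup>2 * v) / 2) * exp (t\<^sup>2 * v / 2) = 1" unfolding exp_add[symmetric] by simp
  finally show ?thesis by (simp add: \<phi>_def)
qed

lemma char_sum_poly_tendsto:
  "(\<lambda>n. expectation (\<lambda>\<omega>. iexp (t * sum_poly n (vec \<omega>))) -
     complex_of_real (exp (- (t\<^sup>2 * expectation (\<lambda>\<omega>. (sum_poly n (vec \<omega>))\<^sup>2)) / 2))) \<longlonglongrightarrow> 0"
proof (rule Lim_null_comparison[OF always_eventually])
  show "(\<lambda>n. t\<^sup>2 * sqrt (expectation (\<lambda>\<omega>. (gamma n (vec \<omega>) - expectation (\<lambda>\<omega>. gamma n (vec \<omega>)))\<^sup>2))) \<longlonglongrightarrow> 0"
    using tendsto_mult_right_zero[OF tendsto_real_sqrt[OF gamma_variance(2), simplified]] by blast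
qed (use char_sum_poly_close in blast)

lemma sum_poly_eq_hpoly: "sum_poly n (vec \<omega>) = (\<Sum>k\<in>{1..int n}. hpoly A a k \<omega>) / sqrt (real n)"
  unfolding sum_poly_def hpoly_def by (simp add: sum_divide_distrib)

end

end

section \<open>The general case\<close>

lemma Cesaro_mean:
  fixes b :: "nat \<Rightarrow> real"
  assumes b: "b \<longlonglongrightarrow> L"
  shows "(\<lambda>n. (\<Sum>m<n. b m) / real n) \<longlonglongrightarrow> L"
proof -
  have "(\<lambda>n. \<bar>(\<Sum>m<n. b m) / real n - L\<bar>) \<longlonglongrightarrow> 0"
  proof (rule order_tendstoI)
    fix e :: real assume e: "0 < e"
    obtain N where N: "\<And>m. m \<ge> N \<Longrightarrow> \<bar>b m - L\<bar> < e / 2"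
      using LIMSEQ_D[OF b, of "e / 2"] e by auto
    define c where "c = (\<Sum>m<N. \<bar>b m - L\<bar>)"
    have "(\<lambda>n. c / real n) \<longlonglongrightarrow> 0" by (rule lim_const_over_n)
    from order_tendstoD(2)[OF this, of "e / 2"] e have "\<forall>\<^sub>F n in sequentially. c / real n < e / 2" by simp
    then show "\<forall>\<^sub>F n in sequentially. \<bar>(\<Sum>m<n. b m) / real n - L\<bar> < e"
      using eventually_gt_at_top[of "0::nat"] eventually_ge_at_top[of N]
    proof eventually_elim
      case (elim n)
      have "(\<Sum>m<n. b m) / real n - L = (\<Sum>m<n. b m - L) / real n"
        using elim by (simp add: sum_subtractf diff_divide_distrib)
      then have "\<bar>(\<Sum>m<n. b m) / real n - L\<bar> = \<bar>\<Sum>m<n. b m - L\<bar> / real n"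
        by (simp only: abs_divide abs_of_nat)
      also have "\<dots> \<le> (\<Sum>m<n. \<bar>b m - L\<bar>) / real n" by (intro divide_right_mono sum_abs) simp
      also have "\<dots> \<le> (c + real n * (e / 2)) / real n"
      proof (rule divide_right_mono)
        have "(\<Sum>m<n. \<bar>b m - L\<bar>) = c + (\<Sum>m\<in>{N..<n}. \<bar>b m - L\<bar>)"
          unfolding c_def using elim sum.atLeastLessThan_concat[of 0 N n "\<lambda>m. \<bar>b m - L\<bar>"] by (simp add: lessThan_atLeast0)
        moreover have "(\<Sum>m\<in>{N..<n}. \<bar>b m - L\<bar>) \<le> (\<Sum>m\<in>{N..<n}. e / 2)"
          by (rule sum_mono, rule less_imp_le[OF N]) simp
        moreover have "(\<Sum>m\<in>{N..<n}. e / 2) \<le> real n * (e / 2)" using e by (simp add: mult_right_mono)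
        ultimately show "(\<Sum>m<n. \<bar>b m - L\<bar>) \<le> c + real n * (e / 2)" by linarith
      qed simp
      also have "\<dots> = c / real n + e / 2" using elim by (simp add: add_divide_distrib)
      finally show ?case using elim by linarith
    qed
  qed (auto intro!: always_eventually less_le_trans[OF _ abs_ge_zero])
  then show ?thesis by (simp add: tendsto_rabs_zero_iff LIM_zero_iff)
qed

lemma exp_minus_lipschitz: "\<bar>exp (- x) - exp (- y)\<bar> \<le> \<bar>x - y\<bar>" if "0 \<le> x" "0 \<le> (y::real)"
proof -
  have "norm (exp (- x) - exp (- y)) \<le> 1 * norm (x - y)"
    by (rule field_differentiable_bound[of "{0..}" _ "\<lambda>x. - exp (- x)"])
      (use that in \<open>auto intro!: derivative_eq_intros\<close>)
  then show ?thesis by simp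
qed

lemma norm_iexp_diff: "norm (iexp x - iexp y) \<le> \<bar>x - y\<bar>"
proof -
  have "iexp x - iexp y = iexp y * (iexp (x - y) - 1)"
    by (simp add: algebra_simps flip: exp_add)
  moreover have "norm (iexp (x - y) - 1) \<le> \<bar>x - y\<bar>" using iexp_approx1[of "x - y" 0] by simp
  ultimately show ?thesis by (simp only: norm_mult norm_exp_i_times mult_1)
qed

locale breuer_major_sequence = gaussian_sequence M X for M :: "'a measure" and X :: "int \<Rightarrow> 'a \<Rightarrow> real ^ 'd::finite" +
  fixes q :: nat
  assumes corr: "summable_correlation max_cov q"
begin

sublocale breuer_major M coord coord_cov max_cov q
proof (rule breuer_major.intro[OF _ corr breuer_major_axioms.intro])
  show "hermite_family M coord coord_cov" by unfold_locales
qed (simp add: coord_cov_cross_cov cross_cov_le_max)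

section \<open>Square-integrable functions of rank at least q\<close>

abbreviation G :: "(real ^ 'd) measure" where "G \<equiv> std_normal_law_vec"

definition L2 :: "(real ^ 'd \<Rightarrow> real) \<Rightarrow> bool" where
  "L2 g \<longleftrightarrow> g \<in> borel_measurable borel \<and> integrable G (\<lambda>x. (g x)\<^sup>2)"

text \<open>Only the vanishing of the low coefficients is kept, not that some coefficient of degree
  q is nonzero. This makes the class closed under differences, so that approximation errors belong
  to it as well.\<close>

definition ranked :: "(real ^ 'd \<Rightarrow> real) \<Rightarrow> bool" where
  "ranked g \<longleftrightarrow> L2 g \<and> (\<forall>\<alpha>. msize \<alpha> < q \<longrightarrow> (\<integral>x. g x * hermite_vec \<alpha> x \<partial>G) = 0)"

definition nrm :: "(real ^ 'd \<Rightarrow> real) \<Rightarrow> real" where "nrm g = sqrt (\<integral>x. (g x)\<^sup>2 \<partial>G)"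

definition hsum :: "('d \<Rightarrow> nat) set \<Rightarrow> (('d \<Rightarrow> nat) \<Rightarrow> real) \<Rightarrow> real ^ 'd \<Rightarrow> real" where
  "hsum A a x = (\<Sum>\<alpha>\<in>A. a \<alpha> * hermite_vec \<alpha> x)"

lemma hpoly_eq_hsum: "hpoly A a k \<omega> = hsum A a (X k \<omega>)"
  by (simp add: hpoly_def hsum_def hprod_vec)

lemma L2_measurable: "L2 g \<Longrightarrow> g \<in> borel_measurable borel"
  by (simp add: L2_def)

lemma nrm_nonneg: "0 \<le> nrm g"
  by (simp add: nrm_def)

lemma nrm_square: "(nrm g)\<^sup>2 = (\<integral>x. (g x)\<^sup>2 \<partial>G)"
  by (simp add: nrm_def)

lemma L2_add:
  assumes "L2 g" "L2 h" shows "L2 (\<lambda>x. g x + h x)" "nrm (\<lambda>x. g x + h x) \<le> nrm g + nrm h"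
  using sqrt_integral_add_le[of g G h] assms by (auto simp: L2_def nrm_def)

lemma L2_uminus: "L2 g \<Longrightarrow> L2 (\<lambda>x. - g x)" and nrm_uminus: "nrm (\<lambda>x. - g x) = nrm g"
  by (auto simp: L2_def nrm_def)

lemma L2_diff: "L2 g \<Longrightarrow> L2 h \<Longrightarrow> L2 (\<lambda>x. g x - h x)"
  using L2_add(1)[of g "\<lambda>x. - h x"] L2_uminus[of h] by simp

lemma L2_integrable_mult: "L2 g \<Longrightarrow> L2 h \<Longrightarrow> integrable G (\<lambda>x. g x * h x)"
  by (rule integrable_mult_square) (auto simp: L2_def)

lemma hermite_vec_inner: "(\<integral>x. hermite_vec \<alpha> x * hermite_vec \<beta> x \<partial>G) = of_bool (\<alpha> = \<beta>) * mfact \<alpha>"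
  and L2_hermite_vec: "L2 (hermite_vec \<alpha>)"
proof -
  have m[measurable]: "hermite_vec \<alpha> \<in> borel_measurable borel" for \<alpha> :: "'d \<Rightarrow> nat"
    by (rule hermite_span_measurable[OF hermite_span.base])
  show "(\<integral>x. hermite_vec \<alpha> x * hermite_vec \<beta> x \<partial>G) = of_bool (\<alpha> = \<beta>) * mfact \<alpha>"
    using expectation_X(1)[of "\<lambda>x. hermite_vec \<alpha> x * hermite_vec \<beta> x" 1] orthogonality[of \<alpha> 1 \<beta>]
    by (simp add: hprod_vec mfact_def)
  show "L2 (hermite_vec \<alpha>)"
    using expectation_X(2)[of "\<lambda>x. hermite_vec \<alpha> x * hermite_vec \<alpha> x" 1] integrable_hprod2[of \<alpha> 1 \<alpha> 1] m[of \<alpha>]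
    by (simp add: L2_def hprod_vec power2_eq_square)
qed

lemma L2_hsum: "finite A \<Longrightarrow> L2 (hsum A a)"
proof (induction A rule: finite_induct)
  case empty
  show ?case by (simp add: L2_def hsum_def[abs_def])
next
  case (insert \<alpha> A)
  have "L2 (\<lambda>x. a \<alpha> * hermite_vec \<alpha> x)" using L2_hermite_vec[of \<alpha>] by (auto simp: L2_def power_mult_distrib)
  from L2_add(1)[OF this insert.IH] show ?case using insert.hyps by (simp add: hsum_def[abs_def])
qed

lemma ranked_hsum:
  assumes A: "finite A" "\<And>\<alpha>. \<alpha> \<in> A \<Longrightarrow> q \<le> msize \<alpha>" shows "ranked (hsum A a)"
  unfolding ranked_def
proof (intro conjI allI impI L2_hsum A)
  fix \<beta> :: "'d \<Rightarrow> nat" assume \<beta>: "msize \<beta> < q"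
  have "(\<integral>x. hsum A a x * hermite_vec \<beta> x \<partial>G) = (\<integral>x. (\<Sum>\<alpha>\<in>A. a \<alpha> * (hermite_vec \<alpha> x * hermite_vec \<beta> x)) \<partial>G)"
    by (simp add: hsum_def sum_distrib_right mult.assoc)
  also have "\<dots> = (\<Sum>\<alpha>\<in>A. a \<alpha> * (of_bool (\<alpha> = \<beta>) * mfact \<alpha>))"
    by (subst Bochner_Integration.integral_sum) (auto simp: hermite_vec_inner intro!: integrable_mult_right L2_integrable_mult L2_hermite_vec)
  also have "\<dots> = 0"
  proof -
    have "\<beta> \<notin> A" using A(2)[of \<beta>] \<beta> by auto
    then show ?thesis by (intro sum.neutral) auto
  qed
  finally show "(\<integral>x. hsum A a x * hermite_vec \<beta> x \<partial>G) = 0" .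
qed

lemma ranked_diff:
  assumes "ranked g" "ranked h" shows "ranked (\<lambda>x. g x - h x)"
  unfolding ranked_def
proof (intro conjI allI impI)
  show "L2 (\<lambda>x. g x - h x)" using assms L2_diff by (auto simp: ranked_def)
  fix \<beta> :: "'d \<Rightarrow> nat" assume "msize \<beta> < q"
  then show "(\<integral>x. (g x - h x) * hermite_vec \<beta> x \<partial>G) = 0"
    using assms L2_integrable_mult[OF _ L2_hermite_vec[of \<beta>]] by (simp add: ranked_def left_diff_distrib)
qed

text \<open>Dropping the terms of low degree from an approximating polynomial is an orthogonal projection
  and only improves the approximation.\<close>

lemma ranked_approximation:
  assumes g: "ranked g" and e: "e > 0"
  obtains A a where "finite A" "\<And>\<alpha>. \<alpha> \<in> A \<Longrightarrow> q \<le> msize \<alpha>" "nrm (\<lambda>x. g x - hsum A a x) \<le> e"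
proof -
  have gL: "L2 g" using g by (simp add: ranked_def)
  then have "span_closure g" by (intro hermite_span_dense) (auto simp: L2_def)
  then obtain p where p: "hermite_span p" "(\<integral>x. (g x - p x)\<^sup>2 \<partial>G) \<le> e\<^sup>2"
    unfolding span_closure_def using e by (meson zero_less_power)
  obtain A a where A: "finite A" and pA: "p = (\<lambda>x. \<Sum>\<alpha>\<in>A. a \<alpha> * hermite_vec \<alpha> x)"
    using hermite_span_eq_sum[OF p(1)] by blast
  let ?H = "{\<alpha> \<in> A. q \<le> msize \<alpha>}" and ?B = "{\<alpha> \<in> A. msize \<alpha> < q}"
  have H: "finite ?H" "finite ?B" using A by auto
  have split: "p x = hsum ?H a x + hsum ?B a x" for x
  proof -
    have "(\<Sum>\<alpha>\<in>?H \<union> ?B. a \<alpha> * hermite_vec \<alpha> x) = hsum ?H a x + hsum ?B a x"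
      unfolding hsum_def by (rule sum.union_disjoint) (use A in auto)
    moreover have "?H \<union> ?B = A" by auto
    ultimately show ?thesis by (simp add: pA)
  qed
  let ?d = "\<lambda>x. g x - hsum ?H a x" and ?r = "hsum ?B a"
  have rd: "ranked ?d" by (intro ranked_diff g ranked_hsum H) auto
  then have dL: "L2 ?d" by (simp add: ranked_def)
  have rL: "L2 ?r" by (rule L2_hsum[OF H(2)])
  have "(\<integral>x. ?d x * ?r x \<partial>G) = (\<integral>x. (\<Sum>\<beta>\<in>?B. a \<beta> * (?d x * hermite_vec \<beta> x)) \<partial>G)"
    unfolding hsum_def[of ?B] by (simp add: sum_distrib_left mult_ac)
  also have "\<dots> = (\<Sum>\<beta>\<in>?B. a \<beta> * (\<integral>x. ?d x * hermite_vec \<beta> x \<partial>G))"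
    by (subst Bochner_Integration.integral_sum) (auto intro!: integrable_mult_right L2_integrable_mult L2_hermite_vec dL)
  also have "\<dots> = 0" using rd by (intro sum.neutral) (auto simp: ranked_def)
  finally have orth: "(\<integral>x. ?d x * ?r x \<partial>G) = 0" .
  have eq: "(g x - p x)\<^sup>2 = (?d x)\<^sup>2 - 2 * (?d x * ?r x) + (?r x)\<^sup>2" for x
    unfolding split by (simp add: power2_eq_square algebra_simps)
  have i: "integrable G (\<lambda>x. (?d x)\<^sup>2)" "integrable G (\<lambda>x. (?r x)\<^sup>2)" "integrable G (\<lambda>x. ?d x * ?r x)"
    using dL rL L2_integrable_mult[OF dL rL] by (auto simp: L2_def)
  have "(\<integral>x. (g x - p x)\<^sup>2 \<partial>G) = (\<integral>x. (?d x)\<^sup>2 \<partial>G) - 2 * (\<integral>x. ?d x * ?r x \<partial>G) + (\<integral>x. (?r x)\<^sup>2 \<partial>G)"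
    unfolding eq using i by (simp del: of_nat_numeral)
  then have "(\<integral>x. (?d x)\<^sup>2 \<partial>G) \<le> (\<integral>x. (g x - p x)\<^sup>2 \<partial>G)" unfolding orth by simp
  then have d: "nrm ?d \<le> e" unfolding nrm_def using p(2) e by (intro real_le_lsqrt) auto
  show ?thesis by (rule that[OF H(1) _ d]) simp
qed

lemma L2_X: "L2 g \<Longrightarrow> (\<lambda>\<omega>. g (X k \<omega>)) \<in> borel_measurable M"
  "L2 g \<Longrightarrow> integrable M (\<lambda>\<omega>. (g (X k \<omega>))\<^sup>2)"
  "L2 g \<Longrightarrow> expectation (\<lambda>\<omega>. (g (X k \<omega>))\<^sup>2) = (nrm g)\<^sup>2"
proof -
  assume g: "L2 g"
  then have [measurable]: "g \<in> borel_measurable borel" by (simp add: L2_def)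
  show "(\<lambda>\<omega>. g (X k \<omega>)) \<in> borel_measurable M" by measurable
  show "integrable M (\<lambda>\<omega>. (g (X k \<omega>))\<^sup>2)" "expectation (\<lambda>\<omega>. (g (X k \<omega>))\<^sup>2) = (nrm g)\<^sup>2"
    using expectation_X[of "\<lambda>x. (g x)\<^sup>2" k] g by (simp_all add: L2_def nrm_square)
qed

lemma L2_X_mult:
  assumes "L2 g" "L2 h"
  shows "integrable M (\<lambda>\<omega>. g (X k \<omega>) * h (X l \<omega>))" "\<bar>expectation (\<lambda>\<omega>. g (X k \<omega>) * h (X l \<omega>))\<bar> \<le> nrm g * nrm h"
proof -
  show "integrable M (\<lambda>\<omega>. g (X k \<omega>) * h (X l \<omega>))"
    by (rule integrable_mult_square) (use assms L2_X in auto)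
  have "\<bar>expectation (\<lambda>\<omega>. g (X k \<omega>) * h (X l \<omega>))\<bar> \<le> expectation (\<lambda>\<omega>. \<bar>g (X k \<omega>) * h (X l \<omega>)\<bar>)"
    by (rule integral_abs_bound)
  also have "\<dots> \<le> sqrt (expectation (\<lambda>\<omega>. (g (X k \<omega>))\<^sup>2)) * sqrt (expectation (\<lambda>\<omega>. (h (X l \<omega>))\<^sup>2))"
    by (rule Cauchy_Schwarz_integral) (use assms L2_X in auto)
  also have "\<dots> = nrm g * nrm h" using assms nrm_nonneg by (simp add: L2_X(3))
  finally show "\<bar>expectation (\<lambda>\<omega>. g (X k \<omega>) * h (X l \<omega>))\<bar> \<le> nrm g * nrm h" .
qed

text \<open>Finite expansions approximate g in L^2, and the constant in
  \<open>hpoly_covariance_bound\<close> is the same for all of them; the error terms of order e are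
  removed by letting e tend to 0.\<close>

lemma ranked_covariance_bound:
  assumes g: "ranked g"
  shows "\<bar>expectation (\<lambda>\<omega>. g (X k \<omega>) * g (X l \<omega>))\<bar> \<le> (real CARD('d) * max_cov (l - k)) ^ q * (nrm g)\<^sup>2"
proof -
  let ?D = "(real CARD('d) * max_cov (l - k)) ^ q" and ?N = "nrm g"
  have gL: "L2 g" using g by (simp add: ranked_def)
  have D: "?D \<ge> 0" using rho0 by simp
  have bound: "\<bar>expectation (\<lambda>\<omega>. g (X k \<omega>) * g (X l \<omega>))\<bar> \<le> ?D * (?N + e)\<^sup>2 + (e * ?N + (?N + e) * e)" if e: "e > 0" for e
  proof -
    obtain A a where A: "finite A" "\<And>\<alpha>. \<alpha> \<in> A \<Longrightarrow> q \<le> msize \<alpha>" and d: "nrm (\<lambda>x. g x - hsum A a x) \<le> e"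
      using ranked_approximation[OF g e] by blast
    let ?p = "hsum A a" and ?d = "\<lambda>x. g x - hsum A a x"
    have pL: "L2 ?p" by (rule L2_hsum[OF A(1)])
    have dL: "L2 ?d" by (rule L2_diff[OF gL pL])
    have pN: "nrm ?p \<le> ?N + e"
    proof -
      have "nrm (\<lambda>x. g x + - ?d x) \<le> nrm g + nrm (\<lambda>x. - ?d x)" by (rule L2_add(2)[OF gL L2_uminus[OF dL]])
      then show ?thesis using d unfolding nrm_uminus by simp
    qed
    have "expectation (\<lambda>\<omega>. g (X k \<omega>) * g (X l \<omega>)) = expectation (\<lambda>\<omega>. ?p (X k \<omega>) * ?p (X l \<omega>) + (?d (X k \<omega>) * g (X l \<omega>) + ?p (X k \<omega>) * ?d (X l \<omega>)))"
      by (rule Bochner_Integration.integral_cong) (auto simp: algebra_simps)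
    also have "\<dots> = expectation (\<lambda>\<omega>. ?p (X k \<omega>) * ?p (X l \<omega>)) + (expectation (\<lambda>\<omega>. ?d (X k \<omega>) * g (X l \<omega>)) + expectation (\<lambda>\<omega>. ?p (X k \<omega>) * ?d (X l \<omega>)))"
      using L2_X_mult(1)[OF pL pL] L2_X_mult(1)[OF dL gL] L2_X_mult(1)[OF pL dL]
      by (subst Bochner_Integration.integral_add, simp, simp, subst Bochner_Integration.integral_add) auto
    finally have E: "\<bar>expectation (\<lambda>\<omega>. g (X k \<omega>) * g (X l \<omega>))\<bar> \<le> \<bar>expectation (\<lambda>\<omega>. ?p (X k \<omega>) * ?p (X l \<omega>))\<bar> +
       (\<bar>expectation (\<lambda>\<omega>. ?d (X k \<omega>) * g (X l \<omega>))\<bar> + \<bar>expectation (\<lambda>\<omega>. ?p (X k \<omega>) * ?d (X l \<omega>))\<bar>)" by linarith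
    have "\<bar>expectation (\<lambda>\<omega>. ?p (X k \<omega>) * ?p (X l \<omega>))\<bar> \<le> ?D * (nrm ?p)\<^sup>2"
      using hpoly_covariance_bound[where A=A and a=a and k=k and l=l, OF A]
        expectation_hpoly_square[where a=a and k=k, OF A(1)] L2_X(3)[OF pL, of k]
      by (simp add: hpoly_eq_hsum)
    also have "\<dots> \<le> ?D * (?N + e)\<^sup>2" using pN D nrm_nonneg by (intro mult_left_mono power_mono) auto
    finally have 1: "\<bar>expectation (\<lambda>\<omega>. ?p (X k \<omega>) * ?p (X l \<omega>))\<bar> \<le> ?D * (?N + e)\<^sup>2" .
    have 2: "\<bar>expectation (\<lambda>\<omega>. ?d (X k \<omega>) * g (X l \<omega>))\<bar> \<le> e * ?N"
      by (rule order_trans[OF L2_X_mult(2)[OF dL gL] mult_right_mono[OF d nrm_nonneg]])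
    have 3: "\<bar>expectation (\<lambda>\<omega>. ?p (X k \<omega>) * ?d (X l \<omega>))\<bar> \<le> (?N + e) * e"
      using e by (intro order_trans[OF L2_X_mult(2)[OF pL dL]] mult_mono pN d nrm_nonneg add_nonneg_nonneg) auto
    show ?thesis using E 1 2 3 by linarith
  qed
  have "(\<lambda>n. ?D * (?N + 1 / real (Suc n))\<^sup>2 + (1 / real (Suc n) * ?N + (?N + 1 / real (Suc n)) * (1 / real (Suc n))))
     \<longlonglongrightarrow> ?D * (?N + 0)\<^sup>2 + (0 * ?N + (?N + 0) * 0)"
    using LIMSEQ_inverse_real_of_nat by (intro tendsto_intros) (simp_all add: inverse_eq_divide)
  then have "(\<lambda>n. ?D * (?N + 1 / real (Suc n))\<^sup>2 + (1 / real (Suc n) * ?N + (?N + 1 / real (Suc n)) * (1 / real (Suc n)))) \<longlonglongrightarrow> ?D * ?N\<^sup>2"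
    by simp
  then show ?thesis by (rule LIMSEQ_le_const) (intro exI[of _ 0] allI impI bound, simp)
qed

section \<open>Normalized sums and their characteristic functions\<close>

definition psum :: "(real ^ 'd \<Rightarrow> real) \<Rightarrow> nat \<Rightarrow> 'a \<Rightarrow> real" where
  "psum g n \<omega> = (\<Sum>k\<in>{1..int n}. g (X k \<omega>)) / sqrt (real n)"

text \<open>A bound, independent of n, for the norm of the map from functions of rank at least q to
  their normalized sums: d^q times the sum of the q-th powers of the correlations, under a square
  root.\<close>

definition bnd :: real where "bnd = sqrt (real CARD('d) ^ q * C)"

lemma bnd_nonneg: "0 \<le> bnd"
  unfolding bnd_def using C_nonneg by simp

lemma psum_measurable: "L2 g \<Longrightarrow> psum g n \<in> borel_measurable M"
  unfolding psum_def[abs_def]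
  by (rule borel_measurable_divide[OF borel_measurable_sum[OF L2_X(1)] borel_measurable_const])

lemma psum_square:
  "(psum g n \<omega>)\<^sup>2 = (\<Sum>k\<in>{1..int n}. \<Sum>l\<in>{1..int n}. g (X k \<omega>) * g (X l \<omega>)) / real n"
  unfolding psum_def power_divide by (simp add: power2_eq_square sum_product)

lemma psum_integrable: "L2 g \<Longrightarrow> integrable M (\<lambda>\<omega>. (psum g n \<omega>)\<^sup>2)"
  unfolding psum_square by (intro integrable_divide Bochner_Integration.integrable_sum L2_X_mult)

lemma expectation_psum_square:
  assumes "L2 g"
  shows "expectation (\<lambda>\<omega>. (psum g n \<omega>)\<^sup>2) = (\<Sum>k\<in>{1..int n}. \<Sum>l\<in>{1..int n}. expectation (\<lambda>\<omega>. g (X k \<omega>) * g (X l \<omega>))) / real n"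
  unfolding psum_square
  by (subst integral_divide_zero, subst Bochner_Integration.integral_sum, intro Bochner_Integration.integrable_sum L2_X_mult assms,
      subst Bochner_Integration.integral_sum, intro L2_X_mult assms) simp

text \<open>Each row of the double sum of covariances is at most a multiple of \<open>C\<close>, and
  the n rows are compensated by the normalization.\<close>

lemma psum_L2_bound:
  assumes g: "ranked g" shows "sqrt (expectation (\<lambda>\<omega>. (psum g n \<omega>)\<^sup>2)) \<le> bnd * nrm g"
proof -
  have gL: "L2 g" using g by (simp add: ranked_def)
  let ?D = "real CARD('d) ^ q"
  have "(\<Sum>k\<in>{1..int n}. \<Sum>l\<in>{1..int n}. expectation (\<lambda>\<omega>. g (X k \<omega>) * g (X l \<omega>))) \<le>
     (\<Sum>k\<in>{1..int n}. \<Sum>l\<in>{1..int n}. ?D * (nrm g)\<^sup>2 * max_cov (l - k) ^ q)"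
  proof (intro sum_mono)
    fix k l
    show "expectation (\<lambda>\<omega>. g (X k \<omega>) * g (X l \<omega>)) \<le> ?D * (nrm g)\<^sup>2 * max_cov (l - k) ^ q"
      using ranked_covariance_bound[OF g, of k l] by (simp add: power_mult_distrib mult_ac)
  qed
  also have "\<dots> \<le> (\<Sum>k\<in>{1..int n}. ?D * (nrm g)\<^sup>2 * C)"
    unfolding sum_distrib_left[symmetric] by (intro mult_left_mono sum_mono sum_shift_le_C) auto
  also have "\<dots> = (?D * C * (nrm g)\<^sup>2) * real n" by simp
  finally have "expectation (\<lambda>\<omega>. (psum g n \<omega>)\<^sup>2) \<le> ?D * C * (nrm g)\<^sup>2"
    unfolding expectation_psum_square[OF gL] using C_nonneg by (cases "n = 0") (auto simp: divide_le_eq)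
  then have "sqrt (expectation (\<lambda>\<omega>. (psum g n \<omega>)\<^sup>2)) \<le> sqrt (?D * C * (nrm g)\<^sup>2)" by simp
  then show ?thesis using nrm_nonneg by (simp add: bnd_def real_sqrt_mult)
qed

lemma psum_diff: "psum (\<lambda>x. g x - h x) n \<omega> = psum g n \<omega> - psum h n \<omega>"
  by (simp add: psum_def sum_subtractf diff_divide_distrib)

text \<open>The characteristic function is compared with the Gaussian one of the same variance at
  the same n. Both depend on g in a Lipschitz way in the norm, uniformly in n, so the claim carries
  over from finite expansions without interchanging limits; convergence of the variances is a
  separate matter.\<close>

lemma char_psum_tendsto:
  assumes g: "ranked g"
  shows "(\<lambda>n. expectation (\<lambda>\<omega>. iexp (t * psum g n \<omega>)) -
     complex_of_real (exp (- (t\<^sup>2 * expectation (\<lambda>\<omega>. (psum g n \<omega>)\<^sup>2) / 2)))) \<longlonglongrightarrow> 0"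
proof -
  have gL: "L2 g" using g by (simp add: ranked_def)
  define N where "N = nrm g"
  \<comment> \<open>The first term is the Lipschitz constant of the characteristic function. The
    second is that of the Gaussian factor: two variances differ by E[(U - V)(U + V)], and U + V has
    L^2 norm at most bnd (2N + 1) because e \<le> 1.\<close>
  define Q where "Q = \<bar>t\<bar> * bnd + t\<^sup>2 * (bnd * (bnd * (2 * N + 1)))"
  have N0: "0 \<le> N" by (simp add: N_def nrm_nonneg)
  have Q0: "0 \<le> Q" unfolding Q_def using bnd_nonneg N0 by (intro add_nonneg_nonneg mult_nonneg_nonneg) auto
  let ?v = "\<lambda>h n. expectation (\<lambda>\<omega>. (psum h n \<omega>)\<^sup>2)"
  let ?\<phi> = "\<lambda>h n. expectation (\<lambda>\<omega>. iexp (t * psum h n \<omega>))"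
  let ?z = "\<lambda>h n. ?\<phi> h n - complex_of_real (exp (- (t\<^sup>2 * ?v h n / 2)))"
  have close: "norm (?z g n - ?z h n) \<le> Q * e"
    if h: "ranked h" and e: "nrm (\<lambda>x. g x - h x) \<le> e" "0 \<le> e" "e \<le> 1" for h n e
  proof -
    have hL: "L2 h" using h by (simp add: ranked_def)
    have d: "ranked (\<lambda>x. g x - h x)" by (rule ranked_diff[OF g h])
    note [measurable] = psum_measurable[OF gL] psum_measurable[OF hL]
    have ig: "integrable M (\<lambda>\<omega>. (psum g n \<omega>)\<^sup>2)" "integrable M (\<lambda>\<omega>. (psum h n \<omega>)\<^sup>2)"
      by (rule psum_integrable[OF gL], rule psum_integrable[OF hL])
    have id: "integrable M (\<lambda>\<omega>. (psum g n \<omega> - psum h n \<omega>)\<^sup>2)"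
      using psum_integrable[OF L2_diff[OF gL hL], of n] by (simp add: psum_diff)
    have dS: "sqrt (expectation (\<lambda>\<omega>. (psum g n \<omega> - psum h n \<omega>)\<^sup>2)) \<le> bnd * e"
      using psum_L2_bound[OF d, of n] mult_left_mono[OF e(1) bnd_nonneg] by (simp add: psum_diff)
    have dA: "integrable M (\<lambda>\<omega>. psum g n \<omega> - psum h n \<omega>)" "expectation (\<lambda>\<omega>. \<bar>psum g n \<omega> - psum h n \<omega>\<bar>) \<le> bnd * e"
      using abs_expectation_le_sqrt[of "\<lambda>\<omega>. psum g n \<omega> - psum h n \<omega>"] id dS by auto
    have ie: "integrable M (\<lambda>\<omega>. iexp (t * psum g n \<omega>))" "integrable M (\<lambda>\<omega>. iexp (t * psum h n \<omega>))"
      by (rule integrable_const_bound[of _ 1]; simp)+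
    have "norm (?\<phi> g n - ?\<phi> h n) = norm (expectation (\<lambda>\<omega>. iexp (t * psum g n \<omega>) - iexp (t * psum h n \<omega>)))"
      by (subst Bochner_Integration.integral_diff[OF ie]) simp
    also have "\<dots> \<le> expectation (\<lambda>\<omega>. norm (iexp (t * psum g n \<omega>) - iexp (t * psum h n \<omega>)))"
      by (rule integral_norm_bound)
    also have "\<dots> \<le> expectation (\<lambda>\<omega>. \<bar>t\<bar> * \<bar>psum g n \<omega> - psum h n \<omega>\<bar>)"
    proof (rule integral_mono)
      show "integrable M (\<lambda>\<omega>. norm (iexp (t * psum g n \<omega>) - iexp (t * psum h n \<omega>)))"
        by (intro integrable_norm Bochner_Integration.integrable_diff ie)
      show "integrable M (\<lambda>\<omega>. \<bar>t\<bar> * \<bar>psum g n \<omega> - psum h n \<omega>\<bar>)" using dA(1) by auto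
      show "norm (iexp (t * psum g n \<omega>) - iexp (t * psum h n \<omega>)) \<le> \<bar>t\<bar> * \<bar>psum g n \<omega> - psum h n \<omega>\<bar>" for \<omega>
        using norm_iexp_diff[of "t * psum g n \<omega>" "t * psum h n \<omega>"] by (simp add: right_diff_distrib[symmetric] abs_mult)
    qed
    also have "\<dots> \<le> \<bar>t\<bar> * (bnd * e)" using dA(2) by (simp add: mult_left_mono)
    finally have 1: "norm (?\<phi> g n - ?\<phi> h n) \<le> \<bar>t\<bar> * (bnd * e)" .
    have hN: "nrm h \<le> N + 1"
    proof -
      have "nrm (\<lambda>x. g x + - (g x - h x)) \<le> nrm g + nrm (\<lambda>x. - (g x - h x))"
        by (rule L2_add(2)[OF gL L2_uminus[OF L2_diff[OF gL hL]]])
      then show ?thesis using e unfolding nrm_uminus N_def by simp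
    qed
    have sS: "sqrt (expectation (\<lambda>\<omega>. (psum g n \<omega> + psum h n \<omega>)\<^sup>2)) \<le> bnd * (2 * N + 1)"
    proof -
      have "sqrt (expectation (\<lambda>\<omega>. (psum g n \<omega> + psum h n \<omega>)\<^sup>2)) \<le> sqrt (?v g n) + sqrt (?v h n)"
        by (rule sqrt_integral_add_le(2)) (use ig in auto)
      also have "\<dots> \<le> bnd * N + bnd * (N + 1)"
        unfolding N_def using psum_L2_bound[OF g, of n] psum_L2_bound[OF h, of n] mult_left_mono[OF hN bnd_nonneg]
        by (simp add: N_def)
      finally show ?thesis by (simp add: algebra_simps)
    qed
    have "?v g n - ?v h n = expectation (\<lambda>\<omega>. (psum g n \<omega> - psum h n \<omega>) * (psum g n \<omega> + psum h n \<omega>))"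
    proof -
      have "(\<lambda>\<omega>. (psum g n \<omega> - psum h n \<omega>) * (psum g n \<omega> + psum h n \<omega>)) = (\<lambda>\<omega>. (psum g n \<omega>)\<^sup>2 - (psum h n \<omega>)\<^sup>2)"
        by (auto simp: power2_eq_square algebra_simps)
      then show ?thesis using ig by simp
    qed
    also have "\<bar>\<dots>\<bar> \<le> expectation (\<lambda>\<omega>. \<bar>(psum g n \<omega> - psum h n \<omega>) * (psum g n \<omega> + psum h n \<omega>)\<bar>)"
      by (rule integral_abs_bound)
    also have "\<dots> \<le> sqrt (expectation (\<lambda>\<omega>. (psum g n \<omega> - psum h n \<omega>)\<^sup>2)) * sqrt (expectation (\<lambda>\<omega>. (psum g n \<omega> + psum h n \<omega>)\<^sup>2))"
      by (rule Cauchy_Schwarz_integral) (use id ig sqrt_integral_add_le(1)[of "psum g n" M "psum h n"] in auto)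
    also have "\<dots> \<le> (bnd * e) * (bnd * (2 * N + 1))"
      using bnd_nonneg e by (intro mult_mono dS sS) auto
    finally have v: "\<bar>?v g n - ?v h n\<bar> \<le> (bnd * e) * (bnd * (2 * N + 1))" .
    have "\<bar>exp (- (t\<^sup>2 * ?v g n / 2)) - exp (- (t\<^sup>2 * ?v h n / 2))\<bar> \<le> \<bar>t\<^sup>2 * ?v g n / 2 - t\<^sup>2 * ?v h n / 2\<bar>"
      by (rule exp_minus_lipschitz) auto
    also have "\<dots> = t\<^sup>2 / 2 * \<bar>?v g n - ?v h n\<bar>"
    proof -
      have "t\<^sup>2 * ?v g n / 2 - t\<^sup>2 * ?v h n / 2 = t\<^sup>2 / 2 * (?v g n - ?v h n)" by (simp add: right_diff_distrib)
      then show ?thesis by (simp only: abs_mult) simp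
    qed
    also have "\<dots> \<le> t\<^sup>2 * ((bnd * e) * (bnd * (2 * N + 1)))"
      by (rule mult_mono[OF _ v]) auto
    finally have 2: "\<bar>exp (- (t\<^sup>2 * ?v g n / 2)) - exp (- (t\<^sup>2 * ?v h n / 2))\<bar> \<le> t\<^sup>2 * ((bnd * e) * (bnd * (2 * N + 1)))" .
    have "norm (?z g n - ?z h n) \<le> norm (?\<phi> g n - ?\<phi> h n) + norm (complex_of_real (exp (- (t\<^sup>2 * ?v g n / 2)) - exp (- (t\<^sup>2 * ?v h n / 2))))"
    proof -
      have "?z g n - ?z h n = (?\<phi> g n - ?\<phi> h n) - complex_of_real (exp (- (t\<^sup>2 * ?v g n / 2)) - exp (- (t\<^sup>2 * ?v h n / 2)))" by simp
      then show ?thesis by (simp only: norm_triangle_ineq4)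
    qed
    also have "\<dots> \<le> \<bar>t\<bar> * (bnd * e) + t\<^sup>2 * ((bnd * e) * (bnd * (2 * N + 1)))"
      unfolding norm_of_real by (rule add_mono[OF 1 2])
    also have "\<dots> = Q * e" by (simp add: Q_def algebra_simps)
    finally show ?thesis .
  qed
  show ?thesis
  proof (rule LIMSEQ_I)
    fix \<epsilon> :: real assume \<epsilon>: "0 < \<epsilon>"
    define e where "e = min 1 (\<epsilon> / (2 * (Q + 1)))"
    have e: "0 < e" "e \<le> 1" using \<epsilon> Q0 by (auto simp: e_def)
    have Qe: "Q * e \<le> \<epsilon> / 2"
    proof -
      have "Q * e \<le> (Q + 1) * (\<epsilon> / (2 * (Q + 1)))" using Q0 \<epsilon> e by (intro mult_mono) (auto simp: e_def)
      also have "\<dots> = \<epsilon> / 2" using Q0 by (simp add: field_simps add_nonneg_eq_0_iff)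
      finally show ?thesis .
    qed
    obtain A a where A: "finite A" "\<And>\<alpha>. \<alpha> \<in> A \<Longrightarrow> q \<le> msize \<alpha>" and d: "nrm (\<lambda>x. g x - hsum A a x) \<le> e"
      using ranked_approximation[OF g e(1)] by blast
    have p: "psum (hsum A a) n \<omega> = sum_poly A a n (vec \<omega>)" for n \<omega>
      by (simp add: psum_def sum_poly_eq_hpoly[OF A] hpoly_eq_hsum)
    have "(\<lambda>n. ?z (hsum A a) n) \<longlonglongrightarrow> 0"
      using char_sum_poly_tendsto[OF A, where t=t] by (simp add: p)
    from LIMSEQ_D[OF this, of "\<epsilon> / 2"] \<epsilon> obtain n0 where n0: "\<And>n. n \<ge> n0 \<Longrightarrow> norm (?z (hsum A a) n) < \<epsilon> / 2" by auto
    have "norm (?z g n - 0) < \<epsilon>" if "n \<ge> n0" for n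
    proof -
      have "norm (?z g n) \<le> norm (?z (hsum A a) n) + norm (?z g n - ?z (hsum A a) n)" by (rule norm_triangle_sub)
      also have "\<dots> < \<epsilon> / 2 + \<epsilon> / 2"
        by (rule add_less_le_mono[OF n0[OF that] order_trans[OF close[OF ranked_hsum[OF A] d] Qe]]) (use e in auto)
      finally show ?thesis by simp
    qed
    then show "\<exists>n0. \<forall>n\<ge>n0. norm (?z g n - 0) < \<epsilon>" by blast
  qed
qed

section \<open>The limiting variance\<close>

definition lag :: "(real ^ 'd \<Rightarrow> real) \<Rightarrow> int \<Rightarrow> real" where
  "lag g j = expectation (\<lambda>\<omega>. g (X 1 \<omega>) * g (X (1 + j) \<omega>))"

lemma expectation_lag:
  assumes "L2 g" shows "expectation (\<lambda>\<omega>. g (X k \<omega>) * g (X l \<omega>)) = lag g (l - k)"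
proof -
  have [measurable]: "g \<in> borel_measurable borel" using assms by (simp add: L2_def)
  show ?thesis using expectation_pair[of "\<lambda>(x, y). g x * g y" k l] by (simp add: lag_def)
qed

lemma lag_bound: "ranked g \<Longrightarrow> \<bar>lag g j\<bar> \<le> (real CARD('d) ^ q * (nrm g)\<^sup>2) * max_cov j ^ q"
  using ranked_covariance_bound[of g 1 "1 + j"] by (simp add: lag_def power_mult_distrib mult_ac)

lemma summable_lag:
  assumes "ranked g" shows "summable (\<lambda>j. lag g (int (Suc j)))"
proof (rule summable_comparison_test[OF exI[of _ 0]])
  have "summable (\<lambda>j. max_cov (int (Suc j)) ^ q)"
  proof (rule summableI_nonneg_bounded)
    show "0 \<le> max_cov (int (Suc j)) ^ q" for j using rho0 by simp
    show "(\<Sum>j<n. max_cov (int (Suc j)) ^ q) \<le> C" for n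
    proof -
      have "(\<Sum>j<n. max_cov (int (Suc j)) ^ q) = (\<Sum>j\<in>(\<lambda>j. int (Suc j)) ` {..<n}. max_cov j ^ q)"
        by (subst sum.reindex) (auto simp: inj_on_def)
      then show ?thesis using sum_le_C[of "(\<lambda>j. int (Suc j)) ` {..<n}"] by simp
    qed
  qed
  then show "summable (\<lambda>j. (real CARD('d) ^ q * (nrm g)\<^sup>2) * max_cov (int (Suc j)) ^ q)" by (rule summable_mult)
qed (use lag_bound[OF assms] in auto)

text \<open>The second moment is a Cesaro mean of the partial sums \<open>b m\<close>, each
  consisting of the term of lag 0 and twice the first m covariances, and these converge by
  summability.\<close>

lemma psum_variance_tendsto:
  assumes g: "ranked g"
  shows "(\<lambda>n. expectation (\<lambda>\<omega>. (psum g n \<omega>)\<^sup>2)) \<longlonglongrightarrow> lag g 0 + 2 * (\<Sum>j. lag g (int (Suc j)))"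
proof -
  have gL: "L2 g" using g by (simp add: ranked_def)
  define b where "b m = lag g 0 + 2 * (\<Sum>j<m. lag g (int (Suc j)))" for m
  have lag_minus: "lag g (- j) = lag g j" for j
    using expectation_lag[OF gL, of 1 "1 + j"] expectation_lag[OF gL, of "1 + j" 1] by (simp add: mult.commute)
  \<comment> \<open>Enlarging the square of index pairs by one row and one column adds the corner,
    of lag 0, and two copies of the lags 1 to n.\<close>
  have sum: "(\<Sum>k\<in>{1..int n}. \<Sum>l\<in>{1..int n}. lag g (l - k)) = (\<Sum>m<n. b m)" for n
  proof (induction n)
    case (Suc n)
    let ?I = "{1..int n}" and ?s = "int (Suc n)"
    have I: "{1..?s} = insert ?s ?I" by auto
    have s: "?s \<notin> ?I" by simp
    have r: "(\<Sum>k\<in>?I. lag g (?s - k)) = (\<Sum>j<n. lag g (int (Suc j)))"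
      by (rule sum.reindex_bij_witness[of _ "\<lambda>j. int n - int j" "\<lambda>k. nat (int n - k)"]) (auto simp: algebra_simps)
    have r': "(\<Sum>k\<in>?I. lag g (k - ?s)) = (\<Sum>j<n. lag g (int (Suc j)))"
      unfolding r[symmetric] by (intro sum.cong refl) (metis lag_minus minus_diff_eq)
    have "(\<Sum>k\<in>{1..?s}. \<Sum>l\<in>{1..?s}. lag g (l - k)) =
      (lag g (?s - ?s) + (\<Sum>l\<in>?I. lag g (l - ?s))) + (\<Sum>k\<in>?I. lag g (?s - k) + (\<Sum>l\<in>?I. lag g (l - k)))"
      unfolding I by (simp only: sum.insert[OF _ s] finite_atLeastAtMost_int)
    also have "\<dots> = b n + (\<Sum>m<n. b m)" unfolding sum.distrib r r' Suc.IH by (simp add: b_def)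
    finally show ?case by simp
  qed simp
  have "(\<lambda>m. \<Sum>j<m. lag g (int (Suc j))) \<longlonglongrightarrow> (\<Sum>j. lag g (int (Suc j)))"
    by (rule summable_LIMSEQ[OF summable_lag[OF g]])
  then have "b \<longlonglongrightarrow> lag g 0 + 2 * (\<Sum>j. lag g (int (Suc j)))" unfolding b_def by (intro tendsto_intros)
  from Cesaro_mean[OF this] show ?thesis
    unfolding expectation_psum_square[OF gL] expectation_lag[OF gL] sum .
qed

end

text \<open>If the limit variance is 0, the limit is a point mass, whose distribution function
  jumps, and convergence in the Kolmogorov distance can fail. For d = 1, i.i.d. standard normal Z_k,
  X_k = (Z_k - Z_{k-1}) / sqrt 2 and f(x) = x, the sums telescope and the limit variance is 0, but
  S_n is a nondegenerate centered normal variable and so lies above 0 with probability 1/2 for every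
  n. The other two distances are insensitive to this.\<close>

theorem corollary2p4:
  fixes M :: "'a measure"
    and X :: "int \<Rightarrow> 'a \<Rightarrow> real ^ 'd::finite"
    and f :: "real ^ 'd \<Rightarrow> real"
    and q :: nat
    and N :: "'b measure"
    and S :: "'b \<Rightarrow> real"
  assumes "prob_space M"
    and "gaussian_process M X"
    and "centered_process M X"
    and "stationary_process M X"
    and "distr M borel (X 1) = std_normal_law_vec"
    and "f \<in> borel_measurable borel"
    and "(\<integral>\<omega>. f (X 1 \<omega>) \<partial>M) = 0"
    and "integrable M (\<lambda>\<omega>. (f (X 1 \<omega>))\<^sup>2)"
    and "has_hermite_rank M f (X 1) q"
    and "\<And>i l. (\<lambda>j. \<bar>cross_cov M X i l j\<bar> ^ q) summable_on UNIV"
    and "prob_space N"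
    and "S \<in> borel_measurable N"
    and "distr N borel S = normal_law 0 (limit_variance M f X)"
  shows "summable (\<lambda>k. lag_covar M f X (Suc k)) \<and>
         limit_variance M f X \<ge> 0 \<and>
         (limit_variance M f X > 0 \<longrightarrow>
            (\<lambda>n. d_Kol M (normalized_sum f X n) N S) \<longlonglongrightarrow> 0) \<and>
         (\<lambda>n. d_W M (normalized_sum f X n) N S) \<longlonglongrightarrow> 0 \<and>
         (\<forall>C>0. (\<lambda>n. d_C C M (normalized_sum f X n) N S) \<longlonglongrightarrow> 0)"
proof -
  interpret gaussian_sequence M X
    by (rule gaussian_sequence.intro[OF assms(1) gaussian_sequence_axioms.intro[OF assms(2-5)]])
  have q: "1 \<le> q" using assms(9) by (simp add: has_hermite_rank_def)
  interpret breuer_major_sequence M X q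
    by (rule breuer_major_sequence.intro[OF _ breuer_major_sequence_axioms.intro[OF summable_correlation_max_cov[OF q assms(10)]]])
      unfold_locales
  note [measurable] = assms(6)
  have fL: "L2 f" using expectation_X(2)[of "\<lambda>x. (f x)\<^sup>2" 1] assms(6,8) by (simp add: L2_def)
  have f: "ranked f"
    unfolding ranked_def
  proof (intro conjI allI impI fL)
    fix \<alpha> :: "'d \<Rightarrow> nat" assume "msize \<alpha> < q"
    then have "hermite_coeff M f (X 1) \<alpha> = 0" using assms(9) by (simp add: has_hermite_rank_def msize_def)
    moreover have "(\<Prod>i\<in>UNIV. fact (\<alpha> i)) \<noteq> (0::real)" by simp
    ultimately have "expectation (\<lambda>\<omega>. f (X 1 \<omega>) * hermite_vec \<alpha> (X 1 \<omega>)) = 0"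
      by (simp add: hermite_coeff_def hermite_vec_def)
    moreover have "(\<lambda>x. f x * hermite_vec \<alpha> x) \<in> borel_measurable borel"
      using L2_measurable[OF L2_hermite_vec[of \<alpha>]] by measurable
    ultimately show "(\<integral>x. f x * hermite_vec \<alpha> x \<partial>std_normal_law_vec) = 0"
      using expectation_X(1)[of "\<lambda>x. f x * hermite_vec \<alpha> x" 1] by simp
  qed
  have mean: "expectation (\<lambda>\<omega>. f (X k \<omega>)) = 0" for k
    using expectation_X(1)[of f k] expectation_X(1)[of f 1] assms(7) by simp
  have lag: "lag_covar M f X k = lag f (int k)" for k
    by (simp add: lag_covar_def covar_def mean lag_def)
  have S_eq: "normalized_sum f X n = psum f n" for n
  proof
    fix \<omega>
    have "(\<Sum>k = 1..n. f (X (int k) \<omega>)) = (\<Sum>k\<in>int ` {1..n}. f (X k \<omega>))" by (subst sum.reindex) auto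
    also have "int ` {1..n} = {1..int n}" by (simp add: image_int_atLeastAtMost)
    finally show "normalized_sum f X n \<omega> = psum f n \<omega>" by (simp add: normalized_sum_def psum_def)
  qed
  have sum: "summable (\<lambda>k. lag_covar M f X (Suc k))" unfolding lag by (rule summable_lag[OF f])
  have var: "(\<lambda>n. expectation (\<lambda>\<omega>. (psum f n \<omega>)\<^sup>2)) \<longlonglongrightarrow> limit_variance M f X"
    using psum_variance_tendsto[OF f] by (simp add: limit_variance_def lag)
  \<comment> \<open>As a limit of second moments. It has to come before the moments of S, since
    \<open>normal_law\<close> takes the square root of this number.\<close>
  have v0: "limit_variance M f X \<ge> 0" by (rule LIMSEQ_le_const[OF var]) auto
  note S = normal_law_moments[OF assms(13,12) v0]
  have "(\<lambda>n. char (distr M borel (psum f n)) t) \<longlonglongrightarrow> char (distr N borel S) t" for t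
  proof -
    have c: "char (distr M borel (psum f n)) t = expectation (\<lambda>\<omega>. iexp (t * psum f n \<omega>))" for n
      unfolding char_def using psum_measurable[OF fL, of n] by (subst integral_distr) auto
    have cS: "char (distr N borel S) t = complex_of_real (exp (- (t\<^sup>2 * limit_variance M f X / 2)))"
      unfolding char_def using assms(12) S(5)[of t] by (subst integral_distr) auto
    have "(\<lambda>n. (expectation (\<lambda>\<omega>. iexp (t * psum f n \<omega>)) -
        complex_of_real (exp (- (t\<^sup>2 * expectation (\<lambda>\<omega>. (psum f n \<omega>)\<^sup>2) / 2)))) +
        complex_of_real (exp (- (t\<^sup>2 * expectation (\<lambda>\<omega>. (psum f n \<omega>)\<^sup>2) / 2))))
      \<longlonglongrightarrow> 0 + complex_of_real (exp (- (t\<^sup>2 * limit_variance M f X / 2)))"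
      by (intro tendsto_add char_psum_tendsto[OF f] tendsto_of_real tendsto_exp tendsto_minus tendsto_divide tendsto_mult tendsto_const var) auto
    then show ?thesis unfolding c cS by simp
  qed
  note char = this
  have i1: "integrable M (\<lambda>\<omega>. f (X k \<omega>))" for k
    by (rule abs_expectation_le_sqrt(1)[OF L2_X(1)[OF fL] L2_X(2)[OF fL]])
  have mU: "expectation (\<lambda>\<omega>. psum f n \<omega>) = 0" for n
    unfolding psum_def using i1 mean by (simp add: Bochner_Integration.integral_sum)
  have mom: "(\<lambda>n. expectation (\<lambda>\<omega>. (psum f n \<omega>)\<^sup>2)) \<longlonglongrightarrow> (\<integral>x. (S x)\<^sup>2 \<partial>N)" using var S(4) by simp
  note dist = distances_tendsto_0[OF assms(1,11) psum_measurable[OF fL] assms(12) psum_integrable[OF fL] S(3) mU S(2) mom char]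
  show ?thesis unfolding S_eq
    using sum v0 dist(1,2) dist(3)[OF normal_law_cdf_lipschitz[OF assms(13,12,11)]] by blast
qed

end
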